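(* Let $\pi: N\to B$ be a smooth real vector bundle of finite rank over a smooth manifold $B$, let $P$ be a fiberwise algebraic plane field on $N$, and let $\mathcal{S}$ be a fiberwise constructible subset of $N$. Then there is an open dense set $U\subset B$ over which the sets of integrability points and of infinitesimal integrability points of $P$ in $\mathcal{S}$ are equal, that is, $$\mathcal{D}\cap\mathcal{S}\cap\pi^{-1}(U)=\mathcal{D}^\infty\cap\mathcal{S}\cap\pi^{-1}(U).$$ In addition, the projection $\pi(\mathcal{D}\cap\mathcal{S}\cap\pi^{-1}(U))$ is a closed (possibly empty) subset of $U$.
   Context: Fiberwise algebraic objects. Let $\pi:N\to B$ be a smooth vector bundle with fiber $\mathbb{R}^m$ over a manifold of dimension $n$. Over a coordinate open set $V \subset B$ on which $N$ is trivialized, $\pi^{-1}(V) \cong V \times \mathbb{R}^m$ with $V$ identified with an open subset of $\mathbb{R}^n$ (trivializations being linear in the fibers). A function (resp. vector field) on $N$ is fiberwise algebraic if, in each sufficiently small such local trivialization, it is an element of the ring $C^\infty(V)[X_1,\dots,X_m]$ (resp. has the form $(x,u)\mapsto (R(x,u),Q(x,u)) \in \mathbb{R}^n\times\mathbb{R}^m$ with all components in $C^\infty(V)[X_1,\dots,X_m]$), i.e. is polynomial in the fiber coordinate $u$ with coefficients smooth in $x$. A fiberwise algebraic plane field $P$ of dimension $d$ on $N$ is a smooth plane field (a rank-$d$ subbundle of $TN$) such that each point of $B$ has a neighborhood $V$ for which $P$ is spanned, at each point of $\pi^{-1}(V)$, by fiberwise algebraic vector fields on $\pi^{-1}(V)$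 tangent to $P$. A fiberwise algebraic set is the common zero locus in $N$ of a (possibly infinite) system of fiberwise algebraic functions. A subset $\mathcal{S}\subset N$ is fiberwise constructible if $\mathcal{S}=\mathcal{S}_1-\mathcal{S}_2$ (set difference) for two fiberwise algebraic sets $\mathcal{S}_1,\mathcal{S}_2$. Integrability domains. For a smooth plane field $P$ of dimension $d$ on $N$, a leaf of $P$ is a $d$-dimensional submanifold everywhere tangent to $P$. The integrability domain $\mathcal{D}$ of $P$ is the set of points of $N$ through which passes a (germ of a) leaf of $P$. Let $\mathcal{G}$ be the Lie subalgebra of the Lie algebra of $C^\infty$ vector fields on $N$ generated by the smooth vector fields everywhere tangent to $P$, and $G(x)=\{X(x):X\in\mathcal{G}\}$. The infinitesimal integrability domain is $\mathcal{D}^\infty=\{x\in N: G(x)=P(x)\}$. The set $\mathcal{S}$ is not assumed to be related to $P$ (e.g. $P$ need not be tangent to it). *)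

theory Defs
  imports "HOL-Analysis.Analysis" "HOL-Library.Function_Algebras"
begin

text \<open>
  The numerical spaces are those of \<^const>\<open>Euclidean_space\<close>: a point of the \<open>n\<close>-dimensional one is a
  function \<open>x :: nat \<Rightarrow> real\<close> with \<open>x i = 0\<close> for all \<open>i \<ge> n\<close>. Unlike the type
  \<open>real ^ 'n\<close> this leaves all dimensions arbitrary natural numbers, with \<open>0\<close> included.
\<close>

instantiation "fun" :: (type, real_vector) real_vector
begin

definition scaleR_fun :: "real \<Rightarrow> ('a \<Rightarrow> 'b) \<Rightarrow> 'a \<Rightarrow> 'b"
  where "scaleR_fun c f = (\<lambda>x. c *\<^sub>R f x)"

instance
  by standard (simp_all add: scaleR_fun_def fun_eq_iff algebra_simps)

end

section \<open>Smooth functions on open subsets of Euclidean space\<close>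

definition partial_deriv :: "nat \<Rightarrow> ((nat \<Rightarrow> real) \<Rightarrow> real) \<Rightarrow> (nat \<Rightarrow> real) \<Rightarrow> real"
  where "partial_deriv i f x = deriv (\<lambda>t. f (x(i := t))) (x i)"

primrec Ck_on :: "nat \<Rightarrow> nat \<Rightarrow> (nat \<Rightarrow> real) set \<Rightarrow> ((nat \<Rightarrow> real) \<Rightarrow> real) \<Rightarrow> bool"
  where
    "Ck_on n 0 W f \<longleftrightarrow> continuous_map (subtopology (Euclidean_space n) W) euclideanreal f"
  | "Ck_on n (Suc k) W f \<longleftrightarrow>
       continuous_map (subtopology (Euclidean_space n) W) euclideanreal f \<and>
       (\<forall>i<n. (\<forall>x\<in>W. (\<lambda>t. f (x(i := t))) field_differentiable (at (x i))) \<and>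
              Ck_on n k W (partial_deriv i f))"

definition Cinf_on :: "nat \<Rightarrow> (nat \<Rightarrow> real) set \<Rightarrow> ((nat \<Rightarrow> real) \<Rightarrow> real) \<Rightarrow> bool"
  where "Cinf_on n W f \<longleftrightarrow> (\<forall>k. Ck_on n k W f)"

section \<open>Smooth manifolds\<close>

text \<open>A chart is a domain together with a coordinate map, whose values outside of the domain are
  irrelevant. An atlas is always the full (maximal) one.\<close>

type_synonym 'a chart = "'a set \<times> ('a \<Rightarrow> nat \<Rightarrow> real)"

record 'a manifold =
  mtop :: "'a topology"
  mdim :: nat
  atlas :: "'a chart set"

definition chart_inv :: "'a chart \<Rightarrow> (nat \<Rightarrow> real) \<Rightarrow> 'a"
  where "chart_inv c = inv_into (fst c) (snd c)"

definition is_chart :: "nat \<Rightarrow> 'a topology \<Rightarrow> 'a chart \<Rightarrow> bool"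
  where "is_chart n X c \<longleftrightarrow>
    openin X (fst c) \<and> openin (Euclidean_space n) (snd c ` fst c) \<and>
    homeomorphic_map (subtopology X (fst c)) (subtopology (Euclidean_space n) (snd c ` fst c)) (snd c)"

definition smooth_transition :: "nat \<Rightarrow> 'a chart \<Rightarrow> 'a chart \<Rightarrow> bool"
  where "smooth_transition n c c' \<longleftrightarrow>
    (\<forall>i<n. Cinf_on n (snd c ` (fst c \<inter> fst c')) (\<lambda>x. snd c' (chart_inv c x) i))"

definition smooth_manifold :: "'a manifold \<Rightarrow> bool"
  where "smooth_manifold M \<longleftrightarrow>
    Hausdorff_space (mtop M) \<and> second_countable (mtop M) \<and>
    (\<Union>c\<in>atlas M. fst c) = topspace (mtop M) \<and>
    atlas M = {c. is_chart (mdim M) (mtop M) c \<and>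
                  (\<forall>c'\<in>atlas M. smooth_transition (mdim M) c c' \<and> smooth_transition (mdim M) c' c)}"

definition smooth_fun_on :: "'a manifold \<Rightarrow> 'a set \<Rightarrow> ('a \<Rightarrow> real) \<Rightarrow> bool"
  where "smooth_fun_on M W f \<longleftrightarrow>
    (\<forall>c\<in>atlas M. Cinf_on (mdim M) (snd c ` (fst c \<inter> W)) (f \<circ> chart_inv c))"

definition Cinf :: "'a manifold \<Rightarrow> ('a \<Rightarrow> real) set"
  where "Cinf M = {f. smooth_fun_on M (topspace (mtop M)) f}"

section \<open>Tangent vectors, vector fields and the Lie bracket\<close>

text \<open>Tangent vectors at \<open>p\<close> are the derivations at \<open>p\<close> of the algebra \<open>Cinf M\<close>. They are set to \<open>0\<close>
  on non-smooth functions so that equality of tangent vectors is equality of functionals.\<close>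

type_synonym 'a tvector = "('a \<Rightarrow> real) \<Rightarrow> real"

definition tangent_space :: "'a manifold \<Rightarrow> 'a \<Rightarrow> 'a tvector set"
  where "tangent_space M p =
    {v. (\<forall>f\<in>Cinf M. \<forall>g\<in>Cinf M. v (\<lambda>x. f x + g x) = v f + v g) \<and>
        (\<forall>f\<in>Cinf M. \<forall>a. v (\<lambda>x. a * f x) = a * v f) \<and>
        (\<forall>f\<in>Cinf M. \<forall>g\<in>Cinf M. v (\<lambda>x. f x * g x) = f p * v g + g p * v f) \<and>
        (\<forall>f. f \<notin> Cinf M \<longrightarrow> v f = 0)}"

definition coord_vector :: "'a manifold \<Rightarrow> 'a chart \<Rightarrow> nat \<Rightarrow> 'a \<Rightarrow> 'a tvector"
  where "coord_vector M c i p =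
    (\<lambda>f. if f \<in> Cinf M then partial_deriv i (f \<circ> chart_inv c) (snd c p) else 0)"

text \<open>A vector field is a map from points to tangent vectors; its values outside of the set \<open>W\<close> under
  consideration are irrelevant.\<close>

definition smooth_vector_field_on :: "'a manifold \<Rightarrow> 'a set \<Rightarrow> ('a \<Rightarrow> 'a tvector) \<Rightarrow> bool"
  where "smooth_vector_field_on M W X \<longleftrightarrow>
    (\<forall>p\<in>W. X p \<in> tangent_space M p) \<and>
    (\<forall>f\<in>Cinf M. smooth_fun_on M W (\<lambda>p. X p f))"

definition lie_bracket :: "('a \<Rightarrow> 'a tvector) \<Rightarrow> ('a \<Rightarrow> 'a tvector) \<Rightarrow> 'a \<Rightarrow> 'a tvector"
  where "lie_bracket X Y = (\<lambda>p f. X p (\<lambda>q. Y q f) - Y p (\<lambda>q. X q f))"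

inductive_set lie_subalgebra_generated :: "('a \<Rightarrow> 'a tvector) set \<Rightarrow> ('a \<Rightarrow> 'a tvector) set"
  for \<X> :: "('a \<Rightarrow> 'a tvector) set"
  where
    generator: "X \<in> \<X> \<Longrightarrow> X \<in> lie_subalgebra_generated \<X>"
  | zero: "0 \<in> lie_subalgebra_generated \<X>"
  | add: "\<lbrakk>X \<in> lie_subalgebra_generated \<X>; Y \<in> lie_subalgebra_generated \<X>\<rbrakk>
      \<Longrightarrow> X + Y \<in> lie_subalgebra_generated \<X>"
  | scale: "X \<in> lie_subalgebra_generated \<X> \<Longrightarrow> a *\<^sub>R X \<in> lie_subalgebra_generated \<X>"
  | bracket: "\<lbrakk>X \<in> lie_subalgebra_generated \<X>; Y \<in> lie_subalgebra_generated \<X>\<rbrakk>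
      \<Longrightarrow> lie_bracket X Y \<in> lie_subalgebra_generated \<X>"

section \<open>Plane fields and integrability domains\<close>

definition smooth_plane_field :: "'a manifold \<Rightarrow> nat \<Rightarrow> ('a \<Rightarrow> 'a tvector set) \<Rightarrow> bool"
  where "smooth_plane_field M d P \<longleftrightarrow>
    (\<forall>p\<in>topspace (mtop M). \<exists>W X. openin (mtop M) W \<and> p \<in> W \<and>
       (\<forall>i<d. smooth_vector_field_on M W (X i)) \<and>
       (\<forall>q\<in>W. P q = span ((\<lambda>i. X i q) ` {..<d}) \<and> dim (P q) = d))"

text \<open>\<open>c\<close> flattens \<open>L\<close>: inside \<open>c\<close>, \<open>L\<close> is given by the vanishing of all coordinates but the first \<open>d\<close>.\<close>

definition slice_chart :: "'a manifold \<Rightarrow> nat \<Rightarrow> 'a set \<Rightarrow> 'a chart \<Rightarrow> bool"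
  where "slice_chart M d L c \<longleftrightarrow> c \<in> atlas M \<and>
    snd c ` (fst c \<inter> L) = snd c ` fst c \<inter> topspace (Euclidean_space d)"

definition submanifold :: "'a manifold \<Rightarrow> nat \<Rightarrow> 'a set \<Rightarrow> bool"
  where "submanifold M d L \<longleftrightarrow>
    d \<le> mdim M \<and> (\<forall>p\<in>L. \<exists>c. slice_chart M d L c \<and> p \<in> fst c)"

text \<open>The tangent space of \<open>L\<close> at \<open>p\<close> is spanned by the first \<open>d\<close> coordinate vectors of any slice chart.\<close>

definition leaf :: "'a manifold \<Rightarrow> nat \<Rightarrow> ('a \<Rightarrow> 'a tvector set) \<Rightarrow> 'a set \<Rightarrow> bool"
  where "leaf M d P L \<longleftrightarrow> submanifold M d L \<and>
    (\<forall>p\<in>L. \<forall>c. slice_chart M d L c \<and> p \<in> fst c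
       \<longrightarrow> span ((\<lambda>i. coord_vector M c i p) ` {..<d}) = P p)"

definition integrability_domain :: "'a manifold \<Rightarrow> nat \<Rightarrow> ('a \<Rightarrow> 'a tvector set) \<Rightarrow> 'a set"
  where "integrability_domain M d P = {p. \<exists>L. leaf M d P L \<and> p \<in> L}"

definition tangent_fields :: "'a manifold \<Rightarrow> ('a \<Rightarrow> 'a tvector set) \<Rightarrow> ('a \<Rightarrow> 'a tvector) set"
  where "tangent_fields M P =
    {X. smooth_vector_field_on M (topspace (mtop M)) X \<and> (\<forall>p\<in>topspace (mtop M). X p \<in> P p)}"

definition inf_integrability_domain :: "'a manifold \<Rightarrow> ('a \<Rightarrow> 'a tvector set) \<Rightarrow> 'a set"
  where "inf_integrability_domain M P =
    {p\<in>topspace (mtop M). {X p |X. X \<in> lie_subalgebra_generated (tangent_fields M P)} = P p}"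

section \<open>Smooth vector bundles\<close>

record ('e, 'b) vbundle =
  total_space :: "'e manifold"
  base_space :: "'b manifold"
  proj :: "'e \<Rightarrow> 'b"
  fibre_dim :: nat
  fibre_add :: "'e \<Rightarrow> 'e \<Rightarrow> 'e"
  fibre_scale :: "real \<Rightarrow> 'e \<Rightarrow> 'e"

definition over :: "('e, 'b) vbundle \<Rightarrow> 'b set \<Rightarrow> 'e set"
  where "over E V = {p \<in> topspace (mtop (total_space E)). proj E p \<in> V}"

definition join :: "nat \<Rightarrow> (nat \<Rightarrow> real) \<Rightarrow> (nat \<Rightarrow> real) \<Rightarrow> nat \<Rightarrow> real"
  where "join n x u = (\<lambda>i. if i < n then x i else u (i - n))"

definition trivial_chart :: "('e, 'b) vbundle \<Rightarrow> 'b chart \<Rightarrow> ('e \<Rightarrow> nat \<Rightarrow> real) \<Rightarrow> 'e chart"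
  where "trivial_chart E c \<tau> =
    (over E (fst c), \<lambda>p. join (mdim (base_space E)) (snd c (proj E p)) (\<tau> p))"

text \<open>A local trivialization over the domain of the base chart \<open>c\<close>, with fibre coordinate \<open>\<tau>\<close>: that
  \<open>p \<mapsto> (proj E p, \<tau> p)\<close> is a diffeomorphism onto the product with the standard fibre says that its
  expression through \<open>c\<close> is a chart of the total space with a product as its image.\<close>

definition local_trivialization :: "('e, 'b) vbundle \<Rightarrow> 'b chart \<Rightarrow> ('e \<Rightarrow> nat \<Rightarrow> real) \<Rightarrow> bool"
  where "local_trivialization E c \<tau> \<longleftrightarrow>
    c \<in> atlas (base_space E) \<and> trivial_chart E c \<tau> \<in> atlas (total_space E) \<and>
    snd (trivial_chart E c \<tau>) ` over E (fst c) =
      {join (mdim (base_space E)) x u |x u. x \<in> snd c ` fst c \<and> u \<in> topspace (Euclidean_space (fibre_dim E))} \<and>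
    (\<forall>p\<in>over E (fst c). \<forall>q\<in>over E (fst c). proj E p = proj E q
       \<longrightarrow> \<tau> (fibre_add E p q) = \<tau> p + \<tau> q) \<and>
    (\<forall>p\<in>over E (fst c). \<forall>a. \<tau> (fibre_scale E a p) = a *\<^sub>R \<tau> p)"

text \<open>That each fibre is a vector space of dimension \<open>fibre_dim E\<close> need not be demanded separately: local
  trivializations map fibres bijectively onto the standard one and respect the operations.\<close>

definition smooth_vector_bundle :: "('e, 'b) vbundle \<Rightarrow> bool"
  where "smooth_vector_bundle E \<longleftrightarrow>
    smooth_manifold (base_space E) \<and> smooth_manifold (total_space E) \<and>
    mdim (total_space E) = mdim (base_space E) + fibre_dim E \<and>
    proj E ` topspace (mtop (total_space E)) \<subseteq> topspace (mtop (base_space E)) \<and>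
    (\<forall>b\<in>topspace (mtop (base_space E)). \<forall>p\<in>over E {b}. \<forall>q\<in>over E {b}. fibre_add E p q \<in> over E {b}) \<and>
    (\<forall>b\<in>topspace (mtop (base_space E)). \<forall>p\<in>over E {b}. \<forall>a. fibre_scale E a p \<in> over E {b}) \<and>
    (\<forall>b\<in>topspace (mtop (base_space E)). \<exists>c \<tau>. b \<in> fst c \<and> local_trivialization E c \<tau>)"

section \<open>Fiberwise algebraic objects\<close>

text \<open>Elements of the polynomial ring in \<open>m\<close> fibre variables over the smooth functions on \<open>W\<close>; \<open>K\<close> is
  the finite set of exponents occurring.\<close>

definition fibre_polynomial :: "nat \<Rightarrow> nat \<Rightarrow> (nat \<Rightarrow> real) set \<Rightarrow> ((nat \<Rightarrow> real) \<Rightarrow> real) \<Rightarrow> bool"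
  where "fibre_polynomial n m W g \<longleftrightarrow>
    (\<exists>(K :: (nat \<Rightarrow> nat) set) a. finite K \<and> (\<forall>\<alpha>\<in>K. Cinf_on n W (a \<alpha>)) \<and>
       (\<forall>x\<in>W. \<forall>u\<in>topspace (Euclidean_space m).
          g (join n x u) = (\<Sum>\<alpha>\<in>K. a \<alpha> x * (\<Prod>j<m. u j ^ \<alpha> j))))"

definition fiberwise_algebraic_fun_on :: "('e, 'b) vbundle \<Rightarrow> 'b set \<Rightarrow> ('e \<Rightarrow> real) \<Rightarrow> bool"
  where "fiberwise_algebraic_fun_on E V f \<longleftrightarrow>
    (\<forall>b\<in>V. \<exists>V'. openin (mtop (base_space E)) V' \<and> b \<in> V' \<and> V' \<subseteq> V \<and>
       (\<forall>c \<tau>. local_trivialization E c \<tau> \<and> fst c \<subseteq> V' \<longrightarrow>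
          fibre_polynomial (mdim (base_space E)) (fibre_dim E) (snd c ` fst c)
            (f \<circ> chart_inv (trivial_chart E c \<tau>))))"

definition fiberwise_algebraic_field_on ::
    "('e, 'b) vbundle \<Rightarrow> 'b set \<Rightarrow> ('e \<Rightarrow> 'e tvector) \<Rightarrow> bool"
  where "fiberwise_algebraic_field_on E V X \<longleftrightarrow>
    (\<forall>b\<in>V. \<exists>V'. openin (mtop (base_space E)) V' \<and> b \<in> V' \<and> V' \<subseteq> V \<and>
       (\<forall>c \<tau>. local_trivialization E c \<tau> \<and> fst c \<subseteq> V' \<longrightarrow>
          (\<exists>R. (\<forall>i<mdim (total_space E).
                  fibre_polynomial (mdim (base_space E)) (fibre_dim E) (snd c ` fst c) (R i)) \<and>
               (\<forall>p\<in>over E (fst c).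
                  X p = (\<Sum>i<mdim (total_space E). R i (snd (trivial_chart E c \<tau>) p)
                                   *\<^sub>R coord_vector (total_space E) (trivial_chart E c \<tau>) i p)))))"

definition fiberwise_algebraic_plane_field ::
    "('e, 'b) vbundle \<Rightarrow> nat \<Rightarrow> ('e \<Rightarrow> 'e tvector set) \<Rightarrow> bool"
  where "fiberwise_algebraic_plane_field E d P \<longleftrightarrow>
    smooth_plane_field (total_space E) d P \<and>
    (\<forall>b\<in>topspace (mtop (base_space E)). \<exists>V. openin (mtop (base_space E)) V \<and> b \<in> V \<and>
       (\<forall>p\<in>over E V. P p = span {X p |X. fiberwise_algebraic_field_on E V X \<and>
                                          (\<forall>q\<in>over E V. X q \<in> P q)}))"

definition fiberwise_algebraic_set :: "('e, 'b) vbundle \<Rightarrow> 'e set \<Rightarrow> bool"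
  where "fiberwise_algebraic_set E Z \<longleftrightarrow>
    (\<exists>F. (\<forall>f\<in>F. fiberwise_algebraic_fun_on E (topspace (mtop (base_space E))) f) \<and>
         Z = {p \<in> topspace (mtop (total_space E)). \<forall>f\<in>F. f p = 0})"

definition fiberwise_constructible :: "('e, 'b) vbundle \<Rightarrow> 'e set \<Rightarrow> bool"
  where "fiberwise_constructible E S \<longleftrightarrow>
    (\<exists>S1 S2. fiberwise_algebraic_set E S1 \<and> fiberwise_algebraic_set E S2 \<and> S = S1 - S2)"

end

theory Submission
  imports Defs "HOL-Computational_Algebra.Polynomial" "HOL-Computational_Algebra.Primes" "HOL-Library.Infinite_Set"
begin

text \<open>
  Brackets of fields tangent to a leaf stay tangent to it, so an integrability point is always an
  infinitesimal one. For the converse, work over a small open subset of the base. The Lie algebra generated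
  by the fibrewise algebraic fields tangent to \<open>P\<close> consists of fields with fibre polynomial coefficients;
  by division with a Groebner basis whose leading coefficients vanish nowhere, it is spanned, after
  shrinking the base, by finitely many of its members \<open>Y\<^sub>a\<close>. These form an involutive family whose span
  contains \<open>P\<close>. Hermann's theorem gives an integral surface through every point, whatever the rank; at an
  infinitesimal integrability point all \<open>Y\<^sub>a\<close> lie in \<open>P\<close>, so that this surface has dimension \<open>d\<close> and is a
  leaf. Both domains are thus cut out by the condition that the \<open>Y\<^sub>a\<close> have rank at most \<open>d\<close>, a first-order
  condition on the fibre polynomials. By quantifier elimination (Cohen-Hoermander) and further shrinking
  of the base, the integrability points in \<open>S\<close> project onto everything or onto nothing.
\<close>

section \<open>Calculus in the numerical spaces\<close>

text \<open>Two obstacles shape the proof. The rank of the \<open>Y a\<close> may jump at an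
  integrability point, so Frobenius' theorem does not apply near it; but the excess of the
  \<open>Y a\<close> over an echelon basis obeys a homogeneous linear system along that basis and
  stays zero once it is zero. Secondly, a ring of smooth functions is not Noetherian, and leading
  coefficients may vanish on arbitrary closed sets. Since only a dense set of base points is asked
  for, a coefficient that is not identically zero is made nowhere zero by passing to an open subset;
  Dickson's lemma shows that this enlarges the set of leading monomials only finitely often. As
  fibre polynomials are given locally over the base, membership in a module or an ideal is asserted
  near each base point only. Once finitely many smooth functions on the base have constant signs,
  all fibres realize the same sign patterns. The final \<open>U\<close> is the union of all open
  base sets with the desired equality that lie inside or outside the projection altogether; every
  nonempty open set contains a nonempty one of these.\<close>

abbreviation "eopen n \<equiv> openin (Euclidean_space n)"

abbreviation eucl :: "nat \<Rightarrow> (nat \<Rightarrow> real) set"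
  where "eucl n \<equiv> topspace (Euclidean_space n)"

lemma eucl_iff: "x \<in> eucl n \<longleftrightarrow> (\<forall>i\<ge>n. x i = 0)"
  by (simp add: topspace_Euclidean_space)

lemma eucl_ext: "x \<in> eucl n \<Longrightarrow> y \<in> eucl n \<Longrightarrow> (\<And>i. i < n \<Longrightarrow> x i = y i) \<Longrightarrow> x = y"
  by (metis eucl_iff ext not_le)

lemma openin_eucl: "eopen n = openin (top_of_set (eucl n))"
  by (simp add: Euclidean_space_def euclidean_product_topology)

text \<open>Open sup-norm cubes in \<open>eucl n\<close>. They bound every coordinate below
  \<open>n\<close> separately, which suits arguments that change one coordinate at a time.\<close>

definition cbx :: "nat \<Rightarrow> (nat \<Rightarrow> real) \<Rightarrow> real \<Rightarrow> (nat \<Rightarrow> real) set"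
  where "cbx n x e = {y \<in> eucl n. \<forall>i<n. \<bar>y i - x i\<bar> < e}"

lemma cbx_mono: "e \<le> e' \<Longrightarrow> cbx n x e \<subseteq> cbx n x e'"
  by (force simp: cbx_def)

lemma cbx_self: "x \<in> eucl n \<Longrightarrow> e > 0 \<Longrightarrow> x \<in> cbx n x e"
  by (simp add: cbx_def)

text \<open>A basic neighbourhood in the product topology constrains each coordinate separately. On
  \<open>eucl n\<close> all coordinates from \<open>n\<close> on are 0, so only \<open>n\<close>
  radii count and their minimum serves.\<close>

lemma openin_eucl_iff:
  "eopen n W \<longleftrightarrow> W \<subseteq> eucl n \<and> (\<forall>x\<in>W. \<exists>e>0. cbx n x e \<subseteq> W)"
proof
  assume "eopen n W"
  then obtain T where T: "open T" "W = T \<inter> eucl n"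
    unfolding openin_eucl openin_subtopology by auto
  have "\<exists>e>0. cbx n x e \<subseteq> W" if "x \<in> W" for x
  proof -
    have "x \<in> T" using that T by auto
    then obtain X where X: "x \<in> Pi\<^sub>E UNIV X" "\<And>i. open (X i)" "finite {i. X i \<noteq> UNIV}" "Pi\<^sub>E UNIV X \<subseteq> T"
      using product_topology_open_contains_basis[of "\<lambda>i. euclidean" UNIV T x] T(1)
      by (metis euclidean_product_topology open_openin topspace_euclidean)
    have "\<exists>e>0. \<forall>y. \<bar>y - x i\<bar> < e \<longrightarrow> y \<in> X i" for i
      using X(1,2) unfolding open_dist by (auto simp: dist_real_def PiE_iff)
    then obtain e where e: "\<And>i. e i > 0" "\<And>i y. \<bar>y - x i\<bar> < e i \<Longrightarrow> y \<in> X i" by metis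
    define d where "d = Min (insert 1 (e ` {..<n}))"
    have d: "d > 0" "\<And>i. i < n \<Longrightarrow> d \<le> e i" by (auto simp: d_def e(1))
    have "y \<in> W" if y: "y \<in> cbx n x d" for y
    proof -
      have "y i \<in> X i" for i
      proof (cases "i < n")
        case True
        then have "\<bar>y i - x i\<bar> < d" using y by (simp add: cbx_def)
        then show ?thesis using d(2)[OF True] e(2)[of "y i" i] by linarith
      next
        case False
        then have "y i = 0" "x i = 0" using y \<open>x \<in> W\<close> T(2) by (auto simp: cbx_def eucl_iff)
        then show ?thesis using X(1) by (metis PiE_iff UNIV_I)
      qed
      then have "y \<in> Pi\<^sub>E UNIV X" by (simp add: PiE_iff)
      then show ?thesis using X(4) T(2) y unfolding cbx_def by blast
    qed
    then show ?thesis using d by blast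
  qed
  then show "W \<subseteq> eucl n \<and> (\<forall>x\<in>W. \<exists>e>0. cbx n x e \<subseteq> W)" using T(2) by auto
next
  assume R: "W \<subseteq> eucl n \<and> (\<forall>x\<in>W. \<exists>e>0. cbx n x e \<subseteq> W)"
  then obtain e where e: "\<And>x. x \<in> W \<Longrightarrow> e x > 0" "\<And>x. x \<in> W \<Longrightarrow> cbx n x (e x) \<subseteq> W" by metis
  have op: "open {y. \<forall>i<n. \<bar>y i - x i\<bar> < d}" for x :: "nat \<Rightarrow> real" and d
  proof -
    have "open (\<Inter>i\<in>{..<n}. {y. \<bar>y i - x i\<bar> < d})"
    proof (rule open_INT[OF finite_lessThan], rule ballI, rule open_Collect_less)
      show "continuous_on UNIV (\<lambda>y. \<bar>y i - x i\<bar>)" for i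
        by (intro continuous_on_rabs continuous_on_diff continuous_on_product_coordinates continuous_on_const)
    qed (rule continuous_on_const)
    then show ?thesis by (simp add: INTER_eq Ball_def)
  qed
  have "W = (\<Union>x\<in>W. {y. \<forall>i<n. \<bar>y i - x i\<bar> < e x}) \<inter> eucl n"
  proof (intro equalityI subsetI IntI)
    fix y assume "y \<in> W"
    then show "y \<in> (\<Union>x\<in>W. {y. \<forall>i<n. \<bar>y i - x i\<bar> < e x})" using e(1) by (intro UN_I[of y]) auto
  next
    fix y assume "y \<in> (\<Union>x\<in>W. {y. \<forall>i<n. \<bar>y i - x i\<bar> < e x}) \<inter> eucl n"
    then obtain x where x: "x \<in> W" "y \<in> cbx n x (e x)" unfolding cbx_def by blast
    then show "y \<in> W" using e(2) by blast
  qed (use R in blast)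
  then show "eopen n W"
    unfolding openin_eucl openin_subtopology
    by (intro exI[of _ "\<Union>x\<in>W. {y. \<forall>i<n. \<bar>y i - x i\<bar> < e x}"]) (auto simp: open_openin[symmetric] intro!: open_UN op)
qed

lemma open_cbx: "eopen n (cbx n x e)"
  unfolding openin_eucl_iff
proof (intro conjI ballI)
  fix y assume y: "y \<in> cbx n x e"
  define d where "d = Min (insert 1 ((\<lambda>i. e - \<bar>y i - x i\<bar>) ` {..<n}))"
  have "d > 0" using y by (auto simp: d_def cbx_def)
  moreover have "cbx n y d \<subseteq> cbx n x e"
  proof
    fix w assume w: "w \<in> cbx n y d"
    have "\<bar>w i - x i\<bar> < e" if "i < n" for i
    proof -
      have "d \<le> e - \<bar>y i - x i\<bar>" using that by (auto simp: d_def)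
      moreover have "\<bar>w i - y i\<bar> < d" using w that by (auto simp: cbx_def)
      ultimately show ?thesis by linarith
    qed
    then show "w \<in> cbx n x e" using w by (auto simp: cbx_def)
  qed
  ultimately show "\<exists>d>0. cbx n y d \<subseteq> cbx n x e" by blast
qed (auto simp: cbx_def)

lemma open_sub_eucl: "eopen n W \<Longrightarrow> W \<subseteq> eucl n"
  by (simp add: openin_subset)

text \<open>Partial derivatives see only one coordinate line. Near \<open>x\<close> that line stays
  inside \<open>W\<close>, so functions that agree on the open set \<open>W\<close> can be compared
  there.\<close>

lemma eventually_upd:
  assumes "eopen n W" "x \<in> W" "i < n"
  shows "\<forall>\<^sub>F t in nhds (x i). x(i := t) \<in> W"
proof -
  obtain e where e: "e > 0" "cbx n x e \<subseteq> W" using assms unfolding openin_eucl_iff by auto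
  have "x(i := t) \<in> W" if "dist t (x i) < e" for t
    using e that assms open_sub_eucl[OF assms(1)] by (auto simp: cbx_def eucl_iff dist_real_def subset_iff)
  then show ?thesis using e(1) by (auto simp: eventually_nhds_metric)
qed

lemma continuous_on_eucl_iff:
  assumes W: "eopen n W"
  shows "continuous_on W f \<longleftrightarrow> (\<forall>x\<in>W. \<forall>e>0. \<exists>d>0. \<forall>y\<in>cbx n x d. \<bar>f y - f x\<bar> < (e::real))"
proof
  assume c: "continuous_on W f"
  show "\<forall>x\<in>W. \<forall>e>0. \<exists>d>0. \<forall>y\<in>cbx n x d. \<bar>f y - f x\<bar> < e"
  proof (intro ballI allI impI)
    fix x and e :: real assume x: "x \<in> W" "e > 0"
    have "openin (top_of_set W) (W \<inter> f -` ball (f x) e)"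
      using c by (simp add: continuous_openin_preimage_gen)
    then have "eopen n (W \<inter> f -` ball (f x) e)"
      using W unfolding openin_eucl by (meson openin_trans)
    then obtain d where "d > 0" "cbx n x d \<subseteq> W \<inter> f -` ball (f x) e"
      using x unfolding openin_eucl_iff by (metis IntI centre_in_ball vimageI)
    then show "\<exists>d>0. \<forall>y\<in>cbx n x d. \<bar>f y - f x\<bar> < e"
      by (intro exI[of _ d]) (auto simp: dist_real_def subset_iff abs_minus_commute)
  qed
next
  assume R: "\<forall>x\<in>W. \<forall>e>0. \<exists>d>0. \<forall>y\<in>cbx n x d. \<bar>f y - f x\<bar> < e"
  have "openin (top_of_set W) (W \<inter> f -` U)" if U: "open U" for U
  proof -
    have "eopen n (W \<inter> f -` U)" unfolding openin_eucl_iff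
    proof (intro conjI ballI)
      show "W \<inter> f -` U \<subseteq> eucl n" using open_sub_eucl[OF W] by auto
      fix x assume x: "x \<in> W \<inter> f -` U"
      then obtain e where e: "e > 0" "ball (f x) e \<subseteq> U" using U open_contains_ball by blast
      obtain d where d: "d > 0" "\<forall>y\<in>cbx n x d. \<bar>f y - f x\<bar> < e" using R x e by blast
      obtain d' where d': "d' > 0" "cbx n x d' \<subseteq> W" using W x unfolding openin_eucl_iff by auto
      have "cbx n x (min d d') \<subseteq> W \<inter> f -` U"
      proof
        fix y assume "y \<in> cbx n x (min d d')"
        then have "y \<in> cbx n x d" "y \<in> cbx n x d'" by (auto simp: cbx_def)
        then show "y \<in> W \<inter> f -` U" using d d' e by (auto simp: dist_real_def subset_iff abs_minus_commute)
      qed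
      then show "\<exists>e>0. cbx n x e \<subseteq> W \<inter> f -` U" using d(1) d'(1) by (intro exI[of _ "min d d'"]) auto
    qed
    then show ?thesis using W unfolding openin_eucl 
      by (meson inf_le1 openin_subset_trans open_sub_eucl[OF W])
  qed
  then show "continuous_on W f" by (simp add: continuous_on_open_gen[of f W UNIV])
qed

lemma continuous_map_eucl:
  assumes "W \<subseteq> eucl n"
  shows "continuous_map (subtopology (Euclidean_space n) W) euclideanreal f \<longleftrightarrow> continuous_on W f"
  using assms by (simp add: Euclidean_space_def euclidean_product_topology subtopology_subtopology inf.absorb2)

lemma Ck_cont: "Ck_on n k W f \<Longrightarrow> W \<subseteq> eucl n \<Longrightarrow> continuous_on W f"
  by (cases k) (auto simp: continuous_map_eucl)

lemma partial_deriv_eqI: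
  "((\<lambda>t. f (x(i := t))) has_real_derivative D) (at (x i)) \<Longrightarrow> partial_deriv i f x = D"
  by (simp add: partial_deriv_def DERIV_imp_deriv)

lemma partial_deriv_cong:
  assumes "eopen n W" "\<And>y. y \<in> W \<Longrightarrow> f y = g y" "x \<in> W" "i < n"
  shows "partial_deriv i f x = partial_deriv i g x"
  unfolding partial_deriv_def
  by (rule deriv_cong_ev[OF eventually_mono[OF eventually_upd[OF assms(1,3,4)]]]) (auto simp: assms)

lemma Ck_has:
  "Ck_on n (Suc k) W f \<Longrightarrow> x \<in> W \<Longrightarrow> i < n \<Longrightarrow>
    ((\<lambda>t. f (x(i := t))) has_real_derivative partial_deriv i f x) (at (x i))"
  by (simp add: partial_deriv_def DERIV_deriv_iff_field_differentiable)

lemma Ck_cong: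
  assumes W: "eopen n W"
  shows "Ck_on n k W f \<Longrightarrow> (\<And>x. x \<in> W \<Longrightarrow> f x = g x) \<Longrightarrow> Ck_on n k W g"
proof (induction k arbitrary: f g)
  case 0
  then show ?case using continuous_map_eucl[OF open_sub_eucl[OF W]] by (metis Ck_on.simps(1) continuous_on_eq)
next
  case (Suc k)
  have c: "continuous_on W g" using Ck_cont[OF Suc.prems(1) open_sub_eucl[OF W]] Suc.prems(2) continuous_on_eq by blast
  have "(\<lambda>t. g (x(i := t))) field_differentiable (at (x i)) \<and> Ck_on n k W (partial_deriv i g)"
    if "i < n" "x \<in> W" for i x
  proof
    have "((\<lambda>t. g (x(i := t))) has_real_derivative partial_deriv i f x) (at (x i))"
      using DERIV_cong_ev[OF refl eventually_mono[OF eventually_upd[OF W that(2,1)]] refl, of "\<lambda>t. f (x(i:=t))" "\<lambda>t. g (x(i:=t))"]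
        Ck_has[OF Suc.prems(1) that(2,1)] Suc.prems(2) by (simp del: fun_upd_apply)
    then show "(\<lambda>t. g (x(i := t))) field_differentiable (at (x i))" by (auto simp: field_differentiable_def)
    show "Ck_on n k W (partial_deriv i g)"
      by (rule Suc.IH[of "partial_deriv i f"]) (use Suc.prems that partial_deriv_cong[OF W Suc.prems(2)] in auto)
  qed
  moreover have "Ck_on n k W (partial_deriv i g)" if "i < n" for i
    by (rule Suc.IH[of "partial_deriv i f"]) (use Suc.prems that partial_deriv_cong[OF W Suc.prems(2)] in auto)
  ultimately show ?case using c by (simp add: continuous_map_eucl[OF open_sub_eucl[OF W]])
qed

text \<open>\<open>partial_deriv\<close> is a value of \<open>deriv\<close>, awkward to handle
  inside an induction on \<open>k\<close>. Here the derivatives are supplied by formulas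
  \<open>g i\<close>, and \<open>Ck_cong\<close> transfers their smoothness.\<close>

lemma CkI:
  assumes W: "eopen n W" and c: "continuous_on W f"
    and d: "\<And>i x. i < n \<Longrightarrow> x \<in> W \<Longrightarrow> ((\<lambda>t. f (x(i := t))) has_real_derivative g i x) (at (x i))"
    and g: "\<And>i. i < n \<Longrightarrow> Ck_on n k W (g i)"
  shows "Ck_on n (Suc k) W f"
proof -
  have "Ck_on n k W (partial_deriv i f)" if "i < n" for i
  proof (rule Ck_cong[OF W g[OF that]])
    fix x assume "x \<in> W"
    from partial_deriv_eqI[OF d[OF that this]] show "g i x = partial_deriv i f x" ..
  qed
  moreover have "(\<lambda>t. f (x(i := t))) field_differentiable (at (x i))" if "i < n" "x \<in> W" for i x
    using d[OF that] unfolding field_differentiable_def by blast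
  ultimately show ?thesis using c by (simp add: continuous_map_eucl[OF open_sub_eucl[OF W]])
qed

lemma Ck_Suc: "Ck_on n (Suc k) W f \<Longrightarrow> Ck_on n k W f"
  by (induction k arbitrary: f) auto

lemma Ck_le: "Ck_on n k W f \<Longrightarrow> j \<le> k \<Longrightarrow> Ck_on n j W f"
  by (induction k) (auto simp: le_Suc_eq simp del: Ck_on.simps dest: Ck_Suc)

lemma Ck_subset: "Ck_on n k W f \<Longrightarrow> V \<subseteq> W \<Longrightarrow> Ck_on n k V f"
proof (induction k arbitrary: f)
  case 0 then show ?case
    by simp (metis continuous_map_from_subtopology_mono)
next
  case (Suc k) then show ?case
    by simp (metis continuous_map_from_subtopology_mono subset_iff)
qed

lemma continuous_on_eucl_local:
  assumes W: "eopen n W"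
    and "\<And>x. x \<in> W \<Longrightarrow> \<exists>V. eopen n V \<and> x \<in> V \<and> continuous_on V f"
  shows "continuous_on W (f :: _ \<Rightarrow> real)"
  using assms continuous_on_eucl_iff by metis

lemma Ck_local:
  assumes W: "eopen n W"
    and "\<And>x. x \<in> W \<Longrightarrow> \<exists>V. eopen n V \<and> x \<in> V \<and> Ck_on n k V f"
  shows "Ck_on n k W f"
  using assms(2)
proof (induction k arbitrary: f)
  case 0
  have "continuous_on W f"
    by (rule continuous_on_eucl_local[OF W]) (metis "0" Ck_cont open_sub_eucl)
  then show ?case by (simp add: continuous_map_eucl[OF open_sub_eucl[OF W]])
next
  case (Suc k)
  have "continuous_on W f"
    by (rule continuous_on_eucl_local[OF W]) (metis Suc.prems Ck_cont open_sub_eucl)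
  moreover have "Ck_on n k W (partial_deriv i f)" if "i < n" for i
    by (rule Suc.IH) (use Suc.prems that in force)
  moreover have "(\<lambda>t. f (x(i := t))) field_differentiable (at (x i))" if "i < n" "x \<in> W" for i x
    using Suc.prems[OF that(2)] that(1) by auto
  ultimately show ?case by (simp add: continuous_map_eucl[OF open_sub_eucl[OF W]])
qed

lemma Ck_const: "eopen n W \<Longrightarrow> Ck_on n k W (\<lambda>x. c)"
proof (induction k arbitrary: c)
  case 0 then show ?case by simp
next
  case (Suc k) show ?case by (rule CkI[where g="\<lambda>i x. 0"]) (use Suc in auto)
qed

lemma Ck_coord: "eopen n W \<Longrightarrow> Ck_on n k W (\<lambda>x. x j)"
proof (cases k)
  assume W: "eopen n W"
  have c: "continuous_on W (\<lambda>x. x j)" by (rule continuous_on_subset[OF continuous_on_product_coordinates subset_UNIV])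
  { case 0 then show ?thesis using c by (simp add: continuous_map_eucl[OF open_sub_eucl[OF W]]) }
  case (Suc k')
  show ?thesis unfolding Suc
  proof (rule CkI[OF W c, where g="\<lambda>i x. if i = j then 1 else 0"])
    fix i and x :: "nat \<Rightarrow> real"
    show "((\<lambda>t. (x(i := t)) j) has_real_derivative (if i = j then 1 else 0)) (at (x i))"
      by (cases "i = j") auto
  qed (simp add: Ck_const[OF W])
qed

lemma Ck_add:
  assumes W: "eopen n W"
  shows "Ck_on n k W f \<Longrightarrow> Ck_on n k W g \<Longrightarrow> Ck_on n k W (\<lambda>x. f x + g x)"
proof (induction k arbitrary: f g)
  case 0 then show ?case by (auto intro: continuous_map_add)
next
  case (Suc k)
  show ?case
  proof (rule CkI[OF W, where g="\<lambda>i x. partial_deriv i f x + partial_deriv i g x"])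
    show "continuous_on W (\<lambda>x. f x + g x)"
      using Suc.prems Ck_cont[OF _ open_sub_eucl[OF W]] by (blast intro: continuous_intros)
    fix i assume i: "i < n"
    show "((\<lambda>t. f (x(i := t)) + g (x(i := t))) has_real_derivative
         partial_deriv i f x + partial_deriv i g x) (at (x i))" if "x \<in> W" for x
      using DERIV_add[OF Ck_has[OF Suc.prems(1) that i] Ck_has[OF Suc.prems(2) that i]] .
    show "Ck_on n k W (\<lambda>x. partial_deriv i f x + partial_deriv i g x)"
      by (intro Suc.IH) (use Suc.prems i in auto)
  qed
qed

lemma Ck_mult:
  assumes W: "eopen n W"
  shows "Ck_on n k W f \<Longrightarrow> Ck_on n k W g \<Longrightarrow> Ck_on n k W (\<lambda>x. f x * g x)"
proof (induction k arbitrary: f g)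
  case 0 then show ?case by (auto intro: continuous_map_real_mult)
next
  case (Suc k)
  show ?case
  proof (rule CkI[OF W, where g="\<lambda>i x. partial_deriv i f x * g x + partial_deriv i g x * f x"])
    show "continuous_on W (\<lambda>x. f x * g x)"
      using Suc.prems Ck_cont[OF _ open_sub_eucl[OF W]] by (blast intro: continuous_intros)
    fix i assume i: "i < n"
    show "((\<lambda>t. f (x(i := t)) * g (x(i := t))) has_real_derivative
         partial_deriv i f x * g x + partial_deriv i g x * f x) (at (x i))" if "x \<in> W" for x
      using DERIV_mult[OF Ck_has[OF Suc.prems(1) that i] Ck_has[OF Suc.prems(2) that i]] by (simp del: fun_upd_apply)
    show "Ck_on n k W (\<lambda>x. partial_deriv i f x * g x + partial_deriv i g x * f x)"
      by (intro Ck_add[OF W] Suc.IH) (use Suc.prems i Ck_Suc in auto)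
  qed
qed

lemma Ck_inverse:
  assumes W: "eopen n W" and nz: "\<And>x. x \<in> W \<Longrightarrow> f x \<noteq> 0"
  shows "Ck_on n k W f \<Longrightarrow> Ck_on n k W (\<lambda>x. inverse (f x))"
proof (induction k)
  case 0 then show ?case using nz open_sub_eucl[OF W]
    by (auto simp: continuous_map_eucl intro!: continuous_intros)
next
  case (Suc k)
  show ?case
  proof (rule CkI[OF W, where g="\<lambda>i x. (-1) * ((inverse (f x) * partial_deriv i f x) * inverse (f x))"])
    show "continuous_on W (\<lambda>x. inverse (f x))"
      using Suc.prems Ck_cont[OF _ open_sub_eucl[OF W]] nz by (blast intro: continuous_intros)
    fix i assume i: "i < n"
    show "((\<lambda>t. inverse (f (x(i := t)))) has_real_derivative
         (-1) * ((inverse (f x) * partial_deriv i f x) * inverse (f x))) (at (x i))" if "x \<in> W" for x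
      using DERIV_inverse'[OF Ck_has[OF Suc.prems that i]] nz[OF that] by (simp del: fun_upd_apply)
    show "Ck_on n k W (\<lambda>x. (-1) * ((inverse (f x) * partial_deriv i f x) * inverse (f x)))"
      by (intro Ck_const Ck_mult[OF W] Suc.IH) (use Suc.prems i Ck_Suc W in auto)
  qed
qed

section \<open>Mean values, the chain rule and symmetry of second derivatives\<close>

text \<open>The path from \<open>x\<close> to \<open>y\<close> changes one coordinate at a time.
  What matters later is that each \<open>\<xi> i\<close> is, coordinate by coordinate, no farther
  from \<open>x\<close> than \<open>y\<close> is: this makes the points converge in the chain rule
  and the remainder quadratic in \<open>box_taylor\<close>.\<close>

lemma telescope_mvt:
  assumes f: "\<And>i y. i < n \<Longrightarrow> y \<in> cbx n c e \<Longrightarrow> ((\<lambda>t. f (y(i := t))) has_real_derivative g i y) (at (y i))"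
    and x: "x \<in> cbx n c e" and y: "y \<in> cbx n c e"
  shows "\<exists>\<xi>. (\<forall>i<n. \<xi> i \<in> cbx n c e \<and> (\<forall>j. \<bar>\<xi> i j - x j\<bar> \<le> \<bar>y j - x j\<bar>)) \<and>
     f y - f x = (\<Sum>i<n. g i (\<xi> i) * (y i - x i))"
proof -
  \<comment> \<open>The point \<open>w k\<close> already has its first \<open>k\<close> coordinates
    from \<open>y\<close>; consecutive points differ in one coordinate, where the mean value theorem
    in one variable applies.\<close>
  define w where "w k = (\<lambda>j. if j < k then y j else x j)" for k :: nat
  have wk: "w k \<in> cbx n c e" for k using x y by (auto simp: w_def cbx_def eucl_iff)
  have st: "\<exists>z. z \<in> cbx n c e \<and> (\<forall>j. \<bar>z j - x j\<bar> \<le> \<bar>y j - x j\<bar>) \<and> f (w (Suc i)) - f (w i) = g i z * (y i - x i)" if i: "i < n" for i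
  proof -
    define \<phi> where "\<phi> s = f ((w i)(i := x i + s * (y i - x i)))" for s :: real
    have in_b: "(w i)(i := x i + s * (y i - x i)) \<in> cbx n c e" if s: "0 \<le> s" "s \<le> 1" for s
    proof -
      have "x i + s * (y i - x i) = (1 - s) * x i + s * y i" by algebra
      moreover have "\<bar>(1 - s) * x i + s * y i - c i\<bar> < e"
      proof -
        have "(1 - s) * x i + s * y i - c i = (1 - s) * (x i - c i) + s * (y i - c i)" by algebra
        moreover have "\<bar>x i - c i\<bar> < e" "\<bar>y i - c i\<bar> < e" using x y i by (auto simp: cbx_def)
        ultimately show ?thesis using convex_bound_lt[of "x i - c i" e "y i - c i" "1-s" s]
            convex_bound_lt[of "-(x i - c i)" e "-(y i - c i)" "1-s" s] s
          by (auto simp: abs_less_iff algebra_simps)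
      qed
      ultimately show ?thesis using wk[of i] i by (auto simp: cbx_def eucl_iff)
    qed
    have der: "(\<phi> has_real_derivative g i ((w i)(i := x i + s * (y i - x i))) * (y i - x i)) (at s)" if s: "0 \<le> s" "s \<le> 1" for s
    proof -
      let ?z = "(w i)(i := x i + s * (y i - x i))"
      have p1: "((\<lambda>t. f (?z(i := t))) has_real_derivative g i ?z) (at (x i + s * (y i - x i)))"
        using f[OF i in_b[OF s]] by simp
      have p2: "((\<lambda>s. x i + s * (y i - x i)) has_real_derivative y i - x i) (at s)"
        by (auto intro!: derivative_eq_intros)
      show ?thesis using DERIV_chain2[where g="\<lambda>s. x i + s * (y i - x i)" and x=s, OF p1 p2]
        unfolding \<phi>_def[abs_def] fun_upd_upd .
    qed
    obtain s where s: "0 < s" "s < 1" "\<phi> 1 - \<phi> 0 = (1 - 0) * (g i ((w i)(i := x i + s * (y i - x i))) * (y i - x i))"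
      using MVT2[of 0 1 \<phi> "\<lambda>s. g i ((w i)(i := x i + s * (y i - x i))) * (y i - x i)"] der by auto
    have "\<phi> 1 = f (w (Suc i))" "\<phi> 0 = f (w i)"
      by (auto simp: \<phi>_def w_def less_Suc_eq intro!: arg_cong[of _ _ f])
    moreover have "\<bar>((w i)(i := x i + s * (y i - x i))) j - x j\<bar> \<le> \<bar>y j - x j\<bar>" for j
      using s by (auto simp: w_def abs_mult mult_left_le_one_le)
    ultimately show ?thesis using s in_b[of s] by (intro exI[of _ "(w i)(i := x i + s * (y i - x i))"]) auto
  qed
  then obtain \<xi> where xi: "\<And>i. i < n \<Longrightarrow> \<xi> i \<in> cbx n c e \<and> (\<forall>j. \<bar>\<xi> i j - x j\<bar> \<le> \<bar>y j - x j\<bar>) \<and> f (w (Suc i)) - f (w i) = g i (\<xi> i) * (y i - x i)"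
    by metis
  have "f (w n) - f (w 0) = (\<Sum>i<n. f (w (Suc i)) - f (w i))" using sum_lessThan_telescope[of "\<lambda>i. f (w i)" n] by simp
  moreover have "w n = y" using x y by (intro ext) (auto simp: w_def cbx_def eucl_iff)
  moreover have "w 0 = x" by (auto simp: w_def)
  ultimately show ?thesis using xi by (intro exI[of _ \<xi>]) auto
qed

text \<open>The increment of \<open>f\<close> is written by \<open>telescope_mvt\<close> with
  partial derivatives at points that tend to \<open>\<gamma> t\<close>, so their continuity
  suffices. The derivative is taken within \<open>S\<close> because the curves to come are solutions
  on a closed interval.\<close>

lemma chain_curve:
  assumes W: "eopen n W" and f: "Ck_on n (Suc 0) W f"
    and g: "\<And>i. i < n \<Longrightarrow> ((\<lambda>s. \<gamma> s i) has_real_derivative \<gamma>' i) (at t within S)"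
    and gW: "\<gamma> t \<in> W" and ge: "\<And>s. s \<in> S \<Longrightarrow> \<gamma> s \<in> eucl n"
  shows "((\<lambda>s. f (\<gamma> s)) has_real_derivative (\<Sum>i<n. partial_deriv i f (\<gamma> t) * \<gamma>' i)) (at t within S)"
proof -
  obtain e where e: "e > 0" "cbx n (\<gamma> t) e \<subseteq> W" using W gW unfolding openin_eucl_iff by auto
  have te: "\<gamma> t \<in> eucl n" using gW open_sub_eucl[OF W] by auto
  have lim: "((\<lambda>s. \<gamma> s i) \<longlongrightarrow> \<gamma> t i) (at t within S)" if "i < n" for i
    using DERIV_continuous[OF g[OF that]] by (simp add: continuous_within)
  have near: "\<forall>\<^sub>F s in at t within S. \<gamma> s \<in> cbx n (\<gamma> t) d" if "d > 0" for d
  proof -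
    have "\<forall>\<^sub>F s in at t within S. \<forall>i\<in>{..<n}. \<bar>\<gamma> s i - \<gamma> t i\<bar> < d"
      by (intro eventually_ball_finite) (use lim tendstoD[OF lim that] in \<open>auto simp: dist_real_def\<close>)
    moreover have "\<forall>\<^sub>F s in at t within S. s \<in> S" by (simp add: eventually_at_filter)
    ultimately show ?thesis by eventually_elim (auto simp: cbx_def ge)
  qed
  define Q where "Q s \<xi> \<longleftrightarrow> (\<forall>i<n. \<xi> i \<in> cbx n (\<gamma> t) e \<and> (\<forall>j. \<bar>\<xi> i j - \<gamma> t j\<bar> \<le> \<bar>\<gamma> s j - \<gamma> t j\<bar>)) \<and>
     f (\<gamma> s) - f (\<gamma> t) = (\<Sum>i<n. partial_deriv i f (\<xi> i) * (\<gamma> s i - \<gamma> t i))" for s \<xi>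
  have "\<exists>\<xi>. Q s \<xi>" if "\<gamma> s \<in> cbx n (\<gamma> t) e" for s
    unfolding Q_def
    by (rule telescope_mvt[of n "\<gamma> t" e f "\<lambda>i. partial_deriv i f" "\<gamma> t" "\<gamma> s"])
       (use Ck_has[OF f] e te that in \<open>auto intro: cbx_self\<close>)
  then obtain \<xi> where xi0: "\<And>s. \<gamma> s \<in> cbx n (\<gamma> t) e \<Longrightarrow> Q s (\<xi> s)" by metis
  note xi = xi0[unfolded Q_def]
  have lim2: "((\<lambda>s. partial_deriv i f (\<xi> s i)) \<longlongrightarrow> partial_deriv i f (\<gamma> t)) (at t within S)" if i: "i < n" for i
  proof (rule tendstoI)
    fix r :: real assume r: "r > 0"
    have "continuous_on W (partial_deriv i f)"
      using f i by (auto intro: Ck_cont[OF _ open_sub_eucl[OF W], of 0])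
    then obtain d where d: "d > 0" "\<And>y. y \<in> cbx n (\<gamma> t) d \<Longrightarrow> \<bar>partial_deriv i f y - partial_deriv i f (\<gamma> t)\<bar> < r"
      using gW r unfolding continuous_on_eucl_iff[OF W] by metis
    have "min d e > 0" using d e by auto
    from near[OF this] show "\<forall>\<^sub>F s in at t within S. dist (partial_deriv i f (\<xi> s i)) (partial_deriv i f (\<gamma> t)) < r"
    proof eventually_elim
      case (elim s)
      then have "\<gamma> s \<in> cbx n (\<gamma> t) e" "\<forall>j<n. \<bar>\<gamma> s j - \<gamma> t j\<bar> < d" by (auto simp: cbx_def)
      then have "\<xi> s i \<in> cbx n (\<gamma> t) d" using xi[of s] i unfolding cbx_def by simp (meson le_less_trans)
      then show ?case using d(2) by (auto simp: dist_real_def)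
    qed
  qed
  have "((\<lambda>s. \<Sum>i<n. partial_deriv i f (\<xi> s i) * ((\<gamma> s i - \<gamma> t i) / (s - t))) \<longlongrightarrow>
      (\<Sum>i<n. partial_deriv i f (\<gamma> t) * \<gamma>' i)) (at t within S)"
    by (intro tendsto_sum tendsto_mult lim2) (use g in \<open>auto simp: has_field_derivative_iff\<close>)
  moreover have "\<forall>\<^sub>F s in at t within S. (\<Sum>i<n. partial_deriv i f (\<xi> s i) * ((\<gamma> s i - \<gamma> t i) / (s - t))) = (f (\<gamma> s) - f (\<gamma> t)) / (s - t)"
    using near[OF e(1)] by eventually_elim (use xi in \<open>auto simp: sum_divide_distrib\<close>)
  ultimately show ?thesis unfolding has_field_derivative_iff by (rule Lim_transform_eventually)
qed

lemma Ck_sum: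
  assumes W: "eopen n W"
  shows "(\<And>a. a \<in> A \<Longrightarrow> Ck_on n k W (f a)) \<Longrightarrow> Ck_on n k W (\<lambda>x. \<Sum>a\<in>A. f a x)"
  by (induction A rule: infinite_finite_induct) (auto intro: Ck_add[OF W] Ck_const[OF W])

lemma Ck_continuous_comp:
  assumes V: "eopen m V" and W: "eopen n W"
    and f: "continuous_on W f"
    and g: "\<And>j. j < n \<Longrightarrow> continuous_on V (\<lambda>y. G y j)"
    and GW: "\<And>y. y \<in> V \<Longrightarrow> G y \<in> W"
  shows "continuous_on V (\<lambda>y. f (G y))"
proof -
  have "continuous_on V G"
  proof (rule continuous_on_coordinatewise_then_product)
    fix j show "continuous_on V (\<lambda>y. G y j)"
    proof (cases "j < n")
      case False
      have "G y j = 0" if "y \<in> V" for y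
        using GW[OF that] open_sub_eucl[OF W] False by (auto simp: eucl_iff subset_iff)
      then show ?thesis using continuous_on_cong[of V V "\<lambda>y. G y j" "\<lambda>y. 0"] by simp
    qed (use g in auto)
  qed
  then show ?thesis using continuous_on_compose2[OF f] GW by blast
qed

lemma partial_chain:
  assumes V: "eopen m V" and W: "eopen n W"
    and f: "Ck_on n (Suc k) W f" and g: "\<And>j. j < n \<Longrightarrow> Ck_on m (Suc k') V (\<lambda>y. G y j)"
    and GW: "\<And>y. y \<in> V \<Longrightarrow> G y \<in> W" and y: "y \<in> V" and i: "i < m"
  shows "((\<lambda>t. f (G (y(i := t)))) has_real_derivative
     (\<Sum>j<n. partial_deriv j f (G y) * partial_deriv i (\<lambda>y. G y j) y)) (at (y i))"
proof -
  obtain e where e: "e > 0" "cbx m y e \<subseteq> V" using V y unfolding openin_eucl_iff by auto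
  have ye: "y \<in> eucl m" using y open_sub_eucl[OF V] by auto
  let ?S = "ball (y i) e"
  have inV: "y(i := t) \<in> V" if "t \<in> ?S" for t
    using that e ye i by (auto simp: cbx_def eucl_iff dist_real_def abs_minus_commute subset_iff)
  have "((\<lambda>s. f (G (y(i := s)))) has_real_derivative
     (\<Sum>j<n. partial_deriv j f (G (y(i := y i))) * partial_deriv i (\<lambda>y. G y j) y)) (at (y i) within ?S)"
  proof (rule chain_curve[OF W])
    show "Ck_on n (Suc 0) W f" by (rule Ck_le[OF f]) simp
    show "((\<lambda>s. G (y(i := s)) j) has_real_derivative partial_deriv i (\<lambda>y. G y j) y) (at (y i) within ?S)"
      if "j < n" for j using Ck_has[OF g[OF that] y i] has_field_derivative_at_within by blast
    show "G (y(i := y i)) \<in> W" using GW y by simp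
    show "G (y(i := s)) \<in> eucl n" if "s \<in> ?S" for s using GW inV[OF that] open_sub_eucl[OF W] by auto
  qed
  then show ?thesis using e(1) by (simp add: at_within_open[of "y i" ?S])
qed

text \<open>Each partial derivative of the composite is a sum of products in which \<open>f\<close>
  is replaced by one of its own partial derivatives, one order lower; hence the induction is for all
  \<open>f\<close> at once.\<close>

lemma Ck_comp:
  assumes V: "eopen m V" and W: "eopen n W"
    and f: "Ck_on n k W f" and g: "\<And>j. j < n \<Longrightarrow> Ck_on m k V (\<lambda>y. G y j)"
    and GW: "\<And>y. y \<in> V \<Longrightarrow> G y \<in> W"
  shows "Ck_on m k V (\<lambda>y. f (G y))"
  using f g
proof (induction k arbitrary: f)
  case 0
  then show ?case using Ck_continuous_comp[OF V W _ _ GW, of f "\<lambda>y. y"]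
    by (simp add: continuous_map_eucl[OF open_sub_eucl[OF W]] continuous_map_eucl[OF open_sub_eucl[OF V]])
next
  case (Suc k)
  show ?case
  proof (rule CkI[OF V, where g="\<lambda>i y. \<Sum>j<n. partial_deriv j f (G y) * partial_deriv i (\<lambda>y. G y j) y"])
    show "continuous_on V (\<lambda>y. f (G y))"
      by (rule Ck_continuous_comp[OF V W Ck_cont[OF Suc.prems(1) open_sub_eucl[OF W]]])
         (use Ck_cont[OF Suc.prems(2) open_sub_eucl[OF V]] GW in auto)
    fix i assume i: "i < m"
    show "((\<lambda>t. f (G (y(i := t)))) has_real_derivative
      (\<Sum>j<n. partial_deriv j f (G y) * partial_deriv i (\<lambda>y. G y j) y)) (at (y i))" if "y \<in> V" for y
      by (rule partial_chain[OF V W Suc.prems GW that i])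
    show "Ck_on m k V (\<lambda>y. \<Sum>j<n. partial_deriv j f (G y) * partial_deriv i (\<lambda>y. G y j) y)"
    proof (intro Ck_sum[OF V] Ck_mult[OF V])
      fix j assume j: "j \<in> {..<n}"
      show "Ck_on m k V (\<lambda>y. partial_deriv j f (G y))"
        by (rule Suc.IH) (use Suc.prems j Ck_Suc in auto)
      show "Ck_on m k V (partial_deriv i (\<lambda>y. G y j))" using Suc.prems(2) i j by auto
    qed
  qed
qed

text \<open>The two second-order difference quotients of a rectangle are both its mixed partial derivative at
  some point of the rectangle.\<close>

lemma Ck_symmetric:
  assumes W: "eopen n W" and f: "Ck_on n (Suc (Suc 0)) W f" and x: "x \<in> W"
    and i: "i < n" and j: "j < n"
  shows "partial_deriv i (partial_deriv j f) x = partial_deriv j (partial_deriv i f) x"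
proof (cases "i = j")
  case False
  have key: "\<exists>p q. 0 \<le> p \<and> p \<le> h \<and> 0 \<le> q \<and> q \<le> h \<and>
      f (x(i := x i + h, j := x j + h)) - f (x(i := x i + h)) - f (x(j := x j + h)) + f x
        = h * (h * partial_deriv j (partial_deriv i f) (x(i := x i + p, j := x j + q)))"
    if h: "h > 0" "\<And>p q. 0 \<le> p \<Longrightarrow> p \<le> h \<Longrightarrow> 0 \<le> q \<Longrightarrow> q \<le> h \<Longrightarrow> x(i := x i + p, j := x j + q) \<in> W"
      and i: "i < n" and j: "j < n" and ij: "i \<noteq> j" for h i j
  proof -
    have f': "Ck_on n (Suc 0) W (partial_deriv i f)" using f i by simp
    have d1: "((\<lambda>p. f (x(i := x i + p, j := x j + q))) has_real_derivative
        partial_deriv i f (x(i := x i + p, j := x j + q))) (at p)" if "0 \<le> p" "p \<le> h" "0 \<le> q" "q \<le> h" for p q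
    proof -
      let ?z = "x(i := x i + p, j := x j + q)"
      have "((\<lambda>t. f (?z(i := t))) has_real_derivative partial_deriv i f ?z) (at (x i + p))"
        using Ck_has[OF f h(2)[OF that] i] ij by simp
      then have "((\<lambda>s. f (?z(i := x i + s))) has_real_derivative partial_deriv i f ?z) (at p)"
        by (simp add: DERIV_at_within_shift add.commute DERIV_shift)
      moreover have "?z(i := x i + s) = x(i := x i + s, j := x j + q)" for s using ij by auto
      ultimately show ?thesis by simp
    qed
    have d2: "((\<lambda>q. partial_deriv i f (x(i := x i + p, j := x j + q))) has_real_derivative
        partial_deriv j (partial_deriv i f) (x(i := x i + p, j := x j + q))) (at q)" if "0 \<le> p" "p \<le> h" "0 \<le> q" "q \<le> h" for p q
    proof -
      let ?z = "x(i := x i + p, j := x j + q)"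
      have "((\<lambda>t. partial_deriv i f (?z(j := t))) has_real_derivative partial_deriv j (partial_deriv i f) ?z) (at (x j + q))"
        using Ck_has[OF f' h(2)[OF that] j] ij by simp
      then have "((\<lambda>s. partial_deriv i f (?z(j := x j + s))) has_real_derivative partial_deriv j (partial_deriv i f) ?z) (at q)"
        by (simp add: DERIV_shift add.commute)
      then show ?thesis by simp
    qed
    define \<phi> where "\<phi> p = f (x(i := x i + p, j := x j + h)) - f (x(i := x i + p, j := x j + 0))" for p
    obtain p where p: "0 < p" "p < h" "\<phi> h - \<phi> 0 = (h - 0) * (partial_deriv i f (x(i := x i + p, j := x j + h)) - partial_deriv i f (x(i := x i + p, j := x j + 0)))"
      using MVT2[of 0 h \<phi> "\<lambda>p. partial_deriv i f (x(i := x i + p, j := x j + h)) - partial_deriv i f (x(i := x i + p, j := x j + 0))"]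
      using d1 h(1) unfolding \<phi>_def by (force intro!: DERIV_diff)
    obtain q where q: "0 < q" "q < h" "partial_deriv i f (x(i := x i + p, j := x j + h)) - partial_deriv i f (x(i := x i + p, j := x j + 0)) =
       (h - 0) * partial_deriv j (partial_deriv i f) (x(i := x i + p, j := x j + q))"
      using MVT2[of 0 h "\<lambda>q. partial_deriv i f (x(i := x i + p, j := x j + q))"
         "\<lambda>q. partial_deriv j (partial_deriv i f) (x(i := x i + p, j := x j + q))"] d2 h(1) p by auto
    have "x(i := x i, j := x j + h) = x(j := x j + h)" "x(i := x i + h, j := x j) = x(i := x i + h)" "x(i := x i, j := x j) = x"
      using ij by auto
    then have "\<phi> h - \<phi> 0 = f (x(i := x i + h, j := x j + h)) - f (x(i := x i + h)) - f (x(j := x j + h)) + f x"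
      by (simp add: \<phi>_def)
    then show ?thesis using p q by (intro exI[of _ p] exI[of _ q]) auto
  qed
  obtain e where e: "e > 0" "cbx n x e \<subseteq> W" using W x unfolding openin_eucl_iff by auto
  have xe: "x \<in> eucl n" using x open_sub_eucl[OF W] by auto
  have cont: "continuous_on W (partial_deriv i' (partial_deriv j' f))" if "i' < n" "j' < n" for i' j'
    using f that by (auto intro: Ck_cont[OF _ open_sub_eucl[OF W], of 0])
  show ?thesis
  proof (rule ccontr)
    define A where "A = partial_deriv i (partial_deriv j f)"
    define B where "B = partial_deriv j (partial_deriv i f)"
    assume "partial_deriv i (partial_deriv j f) x \<noteq> partial_deriv j (partial_deriv i f) x"
    then have r: "\<bar>A x - B x\<bar> / 2 > 0" by (auto simp: A_def B_def)
    obtain d1 where d1: "d1 > 0" "\<And>y. y \<in> cbx n x d1 \<Longrightarrow> \<bar>A y - A x\<bar> < \<bar>A x - B x\<bar> / 2"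
      using cont[OF i j] x r unfolding A_def continuous_on_eucl_iff[OF W] by meson
    obtain d2 where d2: "d2 > 0" "\<And>y. y \<in> cbx n x d2 \<Longrightarrow> \<bar>B y - B x\<bar> < \<bar>A x - B x\<bar> / 2"
      using cont[OF j i] x r unfolding B_def continuous_on_eucl_iff[OF W] by meson
    \<comment> \<open>The offsets \<open>p\<close> and \<open>q\<close> range over the closed
      interval up to \<open>h\<close>, whereas the cubes are open; halving makes \<open>h\<close>
      strictly smaller than all three radii.\<close>
    define h where "h = min e (min d1 d2) / 2"
    have h: "h > 0" "h < e" "h < d1" "h < d2" using e d1 d2 by (auto simp: h_def)
    have nb: "x(a := x a + p, b := x b + q) \<in> cbx n x r" if "0 \<le> p" "p \<le> h" "0 \<le> q" "q \<le> h" "h < r" "a < n" "b < n" "a \<noteq> b" for p q r a b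
      using that xe by (auto simp: cbx_def eucl_iff)
    obtain p q where pq: "0 \<le> p" "p \<le> h" "0 \<le> q" "q \<le> h"
      "f (x(i := x i + h, j := x j + h)) - f (x(i := x i + h)) - f (x(j := x j + h)) + f x = h * (h * B (x(i := x i + p, j := x j + q)))"
      using key[OF h(1) subsetD[OF e(2) nb[OF _ _ _ _ h(2) i j False]] i j False] unfolding B_def by auto
    obtain p' q' where pq': "0 \<le> p'" "p' \<le> h" "0 \<le> q'" "q' \<le> h"
      "f (x(j := x j + h, i := x i + h)) - f (x(j := x j + h)) - f (x(i := x i + h)) + f x = h * (h * A (x(j := x j + p', i := x i + q')))"
      using key[OF h(1) subsetD[OF e(2) nb[OF _ _ _ _ h(2) j i False[symmetric]]] j i False[symmetric]] unfolding A_def by auto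
    have "x(j := x j + h, i := x i + h) = x(i := x i + h, j := x j + h)" using False by auto
    from pq'(5)[unfolded this] have "h * (h * B (x(i := x i + p, j := x j + q))) = h * (h * A (x(j := x j + p', i := x i + q')))"
      using pq(5) by linarith
    then have "B (x(i := x i + p, j := x j + q)) = A (x(j := x j + p', i := x i + q'))" using h(1) by simp
    then show False using d1(2)[OF nb[OF pq'(1-4) h(3) j i False[symmetric]]] d2(2)[OF nb[OF pq(1-4) h(4) i j False]] by argo
  qed
qed auto

lemma Cinf_cong: "eopen n W \<Longrightarrow> Cinf_on n W f \<Longrightarrow> (\<And>x. x \<in> W \<Longrightarrow> f x = g x) \<Longrightarrow> Cinf_on n W g"
  unfolding Cinf_on_def using Ck_cong by blast

lemma Cinf_subset: "Cinf_on n W f \<Longrightarrow> V \<subseteq> W \<Longrightarrow> Cinf_on n V f"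
  unfolding Cinf_on_def using Ck_subset by blast

lemma Cinf_local:
  "eopen n W \<Longrightarrow>
    (\<And>x. x \<in> W \<Longrightarrow> \<exists>V. eopen n V \<and> x \<in> V \<and> Cinf_on n V f) \<Longrightarrow> Cinf_on n W f"
  unfolding Cinf_on_def by (intro allI Ck_local) blast+

lemma Cinf_const: "eopen n W \<Longrightarrow> Cinf_on n W (\<lambda>x. c)"
  unfolding Cinf_on_def using Ck_const by blast

lemma Cinf_coord: "eopen n W \<Longrightarrow> Cinf_on n W (\<lambda>x. x j)"
  unfolding Cinf_on_def using Ck_coord by blast

lemma Cinf_add: "eopen n W \<Longrightarrow> Cinf_on n W f \<Longrightarrow> Cinf_on n W g \<Longrightarrow> Cinf_on n W (\<lambda>x. f x + g x)"
  unfolding Cinf_on_def using Ck_add by blast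

lemma Cinf_mult: "eopen n W \<Longrightarrow> Cinf_on n W f \<Longrightarrow> Cinf_on n W g \<Longrightarrow> Cinf_on n W (\<lambda>x. f x * g x)"
  unfolding Cinf_on_def using Ck_mult by blast

lemma Cinf_diff:
  assumes W: "eopen n W" and "Cinf_on n W f" "Cinf_on n W g"
  shows "Cinf_on n W (\<lambda>x. f x - g x)"
  using Cinf_add[OF W assms(2) Cinf_mult[OF W Cinf_const[OF W, of "-1"] assms(3)]] by simp

lemma Cinf_sum:
  "eopen n W \<Longrightarrow> (\<And>a. a \<in> A \<Longrightarrow> Cinf_on n W (f a)) \<Longrightarrow> Cinf_on n W (\<lambda>x. \<Sum>a\<in>A. f a x)"
  unfolding Cinf_on_def by (intro allI Ck_sum) auto

lemma Cinf_inverse: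
  "eopen n W \<Longrightarrow> (\<And>x. x \<in> W \<Longrightarrow> f x \<noteq> 0) \<Longrightarrow> Cinf_on n W f \<Longrightarrow> Cinf_on n W (\<lambda>x. inverse (f x))"
  unfolding Cinf_on_def using Ck_inverse by blast

lemma Cinf_comp:
  "eopen m V \<Longrightarrow> eopen n W \<Longrightarrow> Cinf_on n W f \<Longrightarrow>
    (\<And>j. j < n \<Longrightarrow> Cinf_on m V (\<lambda>y. G y j)) \<Longrightarrow> (\<And>y. y \<in> V \<Longrightarrow> G y \<in> W) \<Longrightarrow> Cinf_on m V (\<lambda>y. f (G y))"
  unfolding Cinf_on_def by (intro allI, rule Ck_comp[of m V n W _ f]) blast+

lemma Cinf_partial: "Cinf_on n W f \<Longrightarrow> i < n \<Longrightarrow> Cinf_on n W (partial_deriv i f)"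
  unfolding Cinf_on_def using Ck_on.simps(2) by blast

lemma Cinf_cont: "Cinf_on n W f \<Longrightarrow> W \<subseteq> eucl n \<Longrightarrow> continuous_on W f"
  unfolding Cinf_on_def using Ck_cont by blast

lemma Cinf_has:
  "Cinf_on n W f \<Longrightarrow> x \<in> W \<Longrightarrow> i < n \<Longrightarrow>
    ((\<lambda>t. f (x(i := t))) has_real_derivative partial_deriv i f x) (at (x i))"
  unfolding Cinf_on_def using Ck_has by blast

lemma Cinf_symmetric:
  "eopen n W \<Longrightarrow> Cinf_on n W f \<Longrightarrow> x \<in> W \<Longrightarrow> i < n \<Longrightarrow> j < n \<Longrightarrow>
    partial_deriv i (partial_deriv j f) x = partial_deriv j (partial_deriv i f) x"
  unfolding Cinf_on_def using Ck_symmetric by blast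

lemma Cinf_curve:
  assumes "eopen n W" "Cinf_on n W f"
    and "\<And>i. i < n \<Longrightarrow> ((\<lambda>s. \<gamma> s i) has_real_derivative \<gamma>' i) (at t within S)"
    and "\<gamma> t \<in> W" "\<And>s. s \<in> S \<Longrightarrow> \<gamma> s \<in> eucl n"
  shows "((\<lambda>s. f (\<gamma> s)) has_real_derivative (\<Sum>i<n. partial_deriv i f (\<gamma> t) * \<gamma>' i)) (at t within S)"
  using chain_curve[OF assms(1) _ assms(3-5)] assms(2) unfolding Cinf_on_def by blast

lemma Cinf_chain:
  assumes "eopen m V" "eopen n W" "Cinf_on n W f"
    and "\<And>j. j < n \<Longrightarrow> Cinf_on m V (\<lambda>y. G y j)" "\<And>y. y \<in> V \<Longrightarrow> G y \<in> W" "y \<in> V" "i < m"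
  shows "partial_deriv i (\<lambda>y. f (G y)) y = (\<Sum>j<n. partial_deriv j f (G y) * partial_deriv i (\<lambda>y. G y j) y)"
  by (rule partial_deriv_eqI, rule partial_chain[OF assms(1,2) _ _ assms(5-7), where k=0 and k'=0])
     (use assms(3,4) in \<open>auto simp: Cinf_on_def simp del: Ck_on.simps\<close>)

lemma partial_deriv_const: "partial_deriv i (\<lambda>x. c) x = 0"
  by (rule partial_deriv_eqI) simp

lemma partial_deriv_coord: "partial_deriv i (\<lambda>x. x j) x = (if i = j then 1 else 0)"
  by (rule partial_deriv_eqI) (cases "i = j"; simp)

lemma partial_deriv_add:
  "Cinf_on n W f \<Longrightarrow> Cinf_on n W g \<Longrightarrow> x \<in> W \<Longrightarrow> i < n \<Longrightarrow>
    partial_deriv i (\<lambda>x. f x + g x) x = partial_deriv i f x + partial_deriv i g x"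
  by (rule partial_deriv_eqI) (rule DERIV_add[OF Cinf_has Cinf_has])

lemma partial_deriv_mult:
  "Cinf_on n W f \<Longrightarrow> Cinf_on n W g \<Longrightarrow> x \<in> W \<Longrightarrow> i < n \<Longrightarrow>
    partial_deriv i (\<lambda>x. f x * g x) x = partial_deriv i f x * g x + partial_deriv i g x * f x"
  using DERIV_mult[OF Cinf_has[of n W f x i] Cinf_has[of n W g x i]]
  by (intro partial_deriv_eqI) (simp del: fun_upd_apply)

lemma partial_deriv_sum:
  "(\<And>a. a \<in> A \<Longrightarrow> Cinf_on n W (f a)) \<Longrightarrow> x \<in> W \<Longrightarrow> i < n \<Longrightarrow>
    partial_deriv i (\<lambda>x. \<Sum>a\<in>A. f a x) x = (\<Sum>a\<in>A. partial_deriv i (f a) x)"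
  by (rule partial_deriv_eqI, rule DERIV_sum, rule Cinf_has) auto

section \<open>Integral surfaces of involutive families\<close>

text \<open>At its maximum over the unit interval the sum \<open>S\<close> satisfies
  \<open>S \<le> c * card K * S + card K * a\<close> by the mean value inequality, and a coefficient
  of at most 1/2 can be absorbed on the left. The bound is linear in \<open>a\<close>, so
  \<open>a = 0\<close> gives uniqueness; the smallness of \<open>c\<close> is later bought by small
  parameters \<open>v\<close>.\<close>

lemma small_gronwall:
  fixes \<phi> \<phi>' :: "'k \<Rightarrow> real \<Rightarrow> real" and a c s :: real
  assumes K: "finite K"
    and der: "\<And>k s. k \<in> K \<Longrightarrow> s \<in> {0..1} \<Longrightarrow> (\<phi> k has_real_derivative \<phi>' k s) (at s within {0..1})"
    and z: "\<And>k. k \<in> K \<Longrightarrow> \<phi> k 0 = 0"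
    and b: "\<And>k s. k \<in> K \<Longrightarrow> s \<in> {0..1} \<Longrightarrow> \<bar>\<phi>' k s\<bar> \<le> c * (\<Sum>l\<in>K. \<bar>\<phi> l s\<bar>) + a"
    and c: "c \<ge> 0" "c * card K \<le> 1/2" and s: "s \<in> {0..1}"
  shows "(\<Sum>l\<in>K. \<bar>\<phi> l s\<bar>) \<le> 2 * card K * a"
proof -
  define S where "S s = (\<Sum>l\<in>K. \<bar>\<phi> l s\<bar>)" for s
  have "continuous_on {0..1} (\<phi> k)" if "k \<in> K" for k
    by (rule DERIV_continuous_on[OF der[OF that]])
  then have "continuous_on {0..1} S" unfolding S_def by (intro continuous_intros) auto
  then obtain s0 where s0: "s0 \<in> {0..1}" "\<And>s. s \<in> {0..1} \<Longrightarrow> S s \<le> S s0"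
    using continuous_attains_sup[of "{0..1::real}" S] by auto
  have "\<bar>\<phi> k s0\<bar> \<le> c * S s0 + a" if k: "k \<in> K" for k
  proof -
    have B: "\<bar>\<phi>' k s\<bar> \<le> c * S s0 + a" if "s \<in> {0..1}" for s
    proof -
      have "c * S s \<le> c * S s0" using s0(2) that c(1) by (intro mult_left_mono) auto
      then show ?thesis using b[OF k that] unfolding S_def by linarith
    qed
    have "norm (\<phi> k s0 - \<phi> k 0) \<le> (c * S s0 + a) * norm (s0 - 0)"
      by (rule field_differentiable_bound[where S="{0..1}" and f'="\<phi>' k"]) (use der[OF k] B s0 in auto)
    moreover have "(c * S s0 + a) * norm (s0 - 0) \<le> c * S s0 + a"
      using B[OF s0(1)] s0(1) by (auto intro!: mult_left_le)
    ultimately show ?thesis using z[OF k] by simp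
  qed
  then have "S s0 \<le> (\<Sum>k\<in>K. c * S s0 + a)" by (subst S_def) (rule sum_mono)
  also have "\<dots> = (c * card K) * S s0 + card K * a" by (simp add: algebra_simps)
  also have "\<dots> \<le> 1/2 * S s0 + card K * a"
    using c(2) by (intro add_right_mono mult_right_mono) (auto simp: S_def sum_nonneg)
  finally have "S s0 \<le> 2 * card K * a" by simp
  then show ?thesis using s0(2)[OF s] by (simp add: S_def)
qed

lemma lipschitz_continuous_comp:
  fixes Z :: "real \<Rightarrow> nat \<Rightarrow> real"
  assumes L: "\<And>z w. z \<in> K \<Longrightarrow> w \<in> K \<Longrightarrow> \<bar>G z - G w\<bar> \<le> L * (\<Sum>l<n. \<bar>z l - w l\<bar>)"
    and Z: "\<And>t. t \<in> I \<Longrightarrow> Z t \<in> K" "\<And>l. l < n \<Longrightarrow> continuous_on I (\<lambda>t. Z t l)"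
  shows "continuous_on I (\<lambda>t. G (Z t) :: real)"
  unfolding continuous_on
proof
  fix s assume s: "s \<in> I"
  have "((\<lambda>t. L * (\<Sum>l<n. \<bar>Z t l - Z s l\<bar>)) \<longlongrightarrow> L * (\<Sum>l<n. \<bar>Z s l - Z s l\<bar>)) (at s within I)"
    using Z(2) s by (intro tendsto_intros) (auto simp: continuous_on)
  then have "((\<lambda>t. L * (\<Sum>l<n. \<bar>Z t l - Z s l\<bar>)) \<longlongrightarrow> 0) (at s within I)" by simp
  then have "((\<lambda>t. G (Z t) - G (Z s)) \<longlongrightarrow> 0) (at s within I)"
  proof (rule Lim_null_comparison[rotated])
    show "\<forall>\<^sub>F t in at s within I. norm (G (Z t) - G (Z s)) \<le> L * (\<Sum>l<n. \<bar>Z t l - Z s l\<bar>)"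
      using L Z(1) s by (auto simp: eventually_at_filter)
  qed
  then show "((\<lambda>t. G (Z t)) \<longlongrightarrow> G (Z s)) (at s within I)" by (simp add: LIM_zero_iff)
qed

text \<open>Time is normalized to the unit interval and smallness is demanded of the field: the
  bound \<open>\<epsilon>\<close> on \<open>G\<close> keeps all iterates in \<open>K\<close>, and
  \<open>L * n \<le> 1/2\<close> halves the bound on their l1 distance at every step. Parameters
  will scale the field later and take over the part of a short time.\<close>

lemma picard:
  fixes G :: "nat \<Rightarrow> (nat \<Rightarrow> real) \<Rightarrow> real" and L \<epsilon> :: real
  assumes K_def: "K = {z \<in> eucl n. \<forall>i<n. \<bar>z i - z0 i\<bar> \<le> \<epsilon>}"
    and z0: "z0 \<in> eucl n" and eps: "\<epsilon> \<ge> 0"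
    and bd: "\<And>k z. k < n \<Longrightarrow> z \<in> K \<Longrightarrow> \<bar>G k z\<bar> \<le> \<epsilon>"
    and L: "\<And>k z w. k < n \<Longrightarrow> z \<in> K \<Longrightarrow> w \<in> K \<Longrightarrow> \<bar>G k z - G k w\<bar> \<le> L * (\<Sum>l<n. \<bar>z l - w l\<bar>)"
    and L0: "L \<ge> 0" "L * n \<le> 1/2"
  shows "\<exists>\<gamma>. \<gamma> 0 = z0 \<and> (\<forall>s\<in>{0..1::real}. \<gamma> s \<in> K \<and>
     (\<forall>k<n. ((\<lambda>s. \<gamma> s k) has_real_derivative G k (\<gamma> s)) (at s within {0..1})))"
proof -
  \<comment> \<open>The Picard iterates, starting from the constant curve; coordinates from
    \<open>n\<close> on are set to 0, which keeps every iterate in \<open>eucl n\<close>.\<close>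
  define Z :: "nat \<Rightarrow> real \<Rightarrow> nat \<Rightarrow> real" where "Z = rec_nat (\<lambda>s. z0) (\<lambda>_ w s k. if k < n then z0 k + integral {0..s} (\<lambda>t. G k (w t)) else 0)"
  have Z0: "Z 0 = (\<lambda>s. z0)" by (simp add: Z_def)
  have ZS: "Z (Suc j) s k = (if k < n then z0 k + integral {0..s} (\<lambda>t. G k (Z j t)) else 0)" for j s k
    by (simp add: Z_def)
  have Gc: "continuous_on {0..s} (\<lambda>t. G k (Z t))"
    if k: "k < n" and Z: "\<And>t. t \<in> {0..1} \<Longrightarrow> Z t \<in> K" "\<And>l. l < n \<Longrightarrow> continuous_on {0..1} (\<lambda>t. Z t l)"
      and s: "s \<in> {0..1}" for Z :: "real \<Rightarrow> nat \<Rightarrow> real" and k s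
  proof (rule continuous_on_subset[of "{0..1}"])
    show "continuous_on {0..1} (\<lambda>t. G k (Z t))"
      by (rule lipschitz_continuous_comp[where K=K and L=L and n=n, OF L[OF k] Z])
  qed (use s in auto)
  have inK: "w s \<in> K"
    if A: "\<And>t. t \<in> {0..1} \<Longrightarrow> v t \<in> K" "\<And>l. l < n \<Longrightarrow> continuous_on {0..1} (\<lambda>t. v t l)"
      "\<And>k. k < n \<Longrightarrow> w s k = z0 k + integral {0..s} (\<lambda>t. G k (v t))" "w s \<in> eucl n" "s \<in> {0..1}" for v w :: "real \<Rightarrow> nat \<Rightarrow> real" and s
  proof -
    have "\<bar>integral {0..s} (\<lambda>t. G k (v t))\<bar> \<le> \<epsilon>" if k: "k < n" for k
    proof -
      have c: "continuous_on {0..s} (\<lambda>t. G k (v t))"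
        by (rule Gc[OF k A(1,2) A(5)])
      have "norm (integral {0..s} (\<lambda>t. G k (v t))) \<le> \<epsilon> * (s - 0)"
        by (rule integral_bound[OF _ c]) (use bd[OF k] A in auto)
      also have "\<dots> \<le> \<epsilon>" using A(5) eps by (simp add: mult_left_le)
      finally show ?thesis by simp
    qed
    then show ?thesis using A by (auto simp: K_def)
  qed
  have inv: "(\<forall>s\<in>{0..1}. Z j s \<in> K) \<and> (\<forall>k<n. continuous_on {0..1} (\<lambda>s. Z j s k))" for j
  proof (induction j)
    case 0 then show ?case using z0 eps by (auto simp: Z0 K_def)
  next
    case (Suc j)
    have "Z (Suc j) s \<in> K" if "s \<in> {0..1}" for s
      by (rule inK[of "Z j" "Z (Suc j)"]) (use Suc that in \<open>auto simp: ZS eucl_iff\<close>)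
    moreover have "continuous_on {0..1} (\<lambda>s. Z (Suc j) s k)" if k: "k < n" for k
    proof -
      have "(\<lambda>t. G k (Z j t)) integrable_on {0..1}"
        by (rule integrable_continuous_real, rule Gc[OF k]) (use Suc in auto)
      then show ?thesis using k by (auto simp: ZS intro!: continuous_intros indefinite_integral_continuous_1)
    qed
    ultimately show ?case by auto
  qed
  have diff: "(\<Sum>k<n. \<bar>Z (Suc j) s k - Z j s k\<bar>) \<le> n * \<epsilon> * (1/2)^j" if s: "s \<in> {0..1}" for j s
    using s
  proof (induction j arbitrary: s)
    case 0
    have "\<bar>Z (Suc 0) s k - Z 0 s k\<bar> \<le> \<epsilon>" if "k < n" for k
      using inv[of "Suc 0"] 0 that by (auto simp: Z0 K_def)
    then have "(\<Sum>k<n. \<bar>Z (Suc 0) s k - Z 0 s k\<bar>) \<le> (\<Sum>k<n. \<epsilon>)" by (intro sum_mono) auto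
    then show ?case by simp
  next
    case (Suc j)
    have "\<bar>Z (Suc (Suc j)) s k - Z (Suc j) s k\<bar> \<le> L * (n * \<epsilon> * (1/2)^j)" if k: "k < n" for k
    proof -
      have c: "continuous_on {0..s} (\<lambda>t. G k (Z j t))" for j
        by (rule Gc[OF k _ _ Suc.prems]) (use inv[of j] in auto)
      have "Z (Suc (Suc j)) s k - Z (Suc j) s k = integral {0..s} (\<lambda>t. G k (Z (Suc j) t) - G k (Z j t))"
        using k c by (simp add: ZS Henstock_Kurzweil_Integration.integral_diff integrable_continuous_real)
      also have "norm \<dots> \<le> (L * (n * \<epsilon> * (1/2)^j)) * (s - 0)"
      proof (rule integral_bound)
        fix t assume "t \<in> {0..s}"
        then have t: "t \<in> {0..1}" using Suc.prems by auto
        have "\<bar>G k (Z (Suc j) t) - G k (Z j t)\<bar> \<le> L * (\<Sum>l<n. \<bar>Z (Suc j) t l - Z j t l\<bar>)"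
          using L[OF k] inv t by blast
        also have "\<dots> \<le> L * (n * \<epsilon> * (1/2)^j)" using Suc.IH[OF t] L0 by (intro mult_left_mono) auto
        finally show "norm (G k (Z (Suc j) t) - G k (Z j t)) \<le> L * (n * \<epsilon> * (1/2)^j)" by simp
      qed (use Suc.prems c in \<open>auto intro!: continuous_intros\<close>)
      also have "\<dots> \<le> L * (n * \<epsilon> * (1/2)^j)"
        using Suc.prems L0 eps by (auto intro!: mult_left_le)
      finally show ?thesis by simp
    qed
    then have "(\<Sum>k<n. \<bar>Z (Suc (Suc j)) s k - Z (Suc j) s k\<bar>) \<le> (\<Sum>k<n. L * (n * \<epsilon> * (1/2)^j))" by (intro sum_mono) auto
    also have "\<dots> = (L * n) * (n * \<epsilon> * (1/2)^j)" by simp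
    also have "\<dots> \<le> 1/2 * (n * \<epsilon> * (1/2)^j)" using L0 eps by (intro mult_right_mono) auto
    finally show ?case by simp
  qed
  have "\<exists>g. uniform_limit {0..1} (\<lambda>m s. Z m s k) g sequentially" if k: "k < n" for k
  proof -
    have "uniform_limit {0..1} (\<lambda>m s. \<Sum>j<m. Z (Suc j) s k - Z j s k) (\<lambda>s. \<Sum>j. Z (Suc j) s k - Z j s k) sequentially"
    proof (rule Weierstrass_m_test)
      show "norm (Z (Suc j) s k - Z j s k) \<le> n * \<epsilon> * (1/2)^j" if "s \<in> {0..1}" for j s
        using member_le_sum[of k "{..<n}" "\<lambda>k. \<bar>Z (Suc j) s k - Z j s k\<bar>"] diff[OF that, of j] k by auto
      show "summable (\<lambda>j. real n * \<epsilon> * (1 / 2) ^ j)" by (intro summable_mult summable_geometric) auto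
    qed
    then have "uniform_limit {0..1} (\<lambda>m s. Z m s k - z0 k) (\<lambda>s. \<Sum>j. Z (Suc j) s k - Z j s k) sequentially"
      unfolding sum_lessThan_telescope[of "\<lambda>j. Z j s k" for s] by (simp add: Z0)
    then have "uniform_limit {0..1} (\<lambda>m s. (Z m s k - z0 k) + z0 k) (\<lambda>s. (\<Sum>j. Z (Suc j) s k - Z j s k) + z0 k) sequentially"
      by (intro uniform_limit_add uniform_limit_const)
    then show ?thesis by auto
  qed
  then obtain g where g: "\<And>k. k < n \<Longrightarrow> uniform_limit {0..1} (\<lambda>m s. Z m s k) (g k) sequentially" by metis
  define \<gamma> where "\<gamma> s k = (if k < n then g k s else 0)" for s k
  have lim: "(\<lambda>m. Z m s k) \<longlonglongrightarrow> \<gamma> s k" if "k < n" "s \<in> {0..1}" for s k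
    using tendsto_uniform_limitI[OF g[OF that(1)] that(2)] that(1) by (simp add: \<gamma>_def)
  have gK: "\<gamma> s \<in> K" if s: "s \<in> {0..1}" for s
  proof -
    have "\<bar>\<gamma> s k - z0 k\<bar> \<le> \<epsilon>" if k: "k < n" for k
    proof (rule tendsto_upperbound)
      show "(\<lambda>m. \<bar>Z m s k - z0 k\<bar>) \<longlonglongrightarrow> \<bar>\<gamma> s k - z0 k\<bar>" by (intro tendsto_intros lim k s)
      show "\<forall>\<^sub>F m in sequentially. \<bar>Z m s k - z0 k\<bar> \<le> \<epsilon>" using inv s k by (auto simp: K_def)
    qed simp
    then show ?thesis by (auto simp: K_def \<gamma>_def eucl_iff)
  qed
  have gc: "continuous_on {0..1} (\<lambda>s. \<gamma> s k)" if k: "k < n" for k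
  proof -
    have "continuous_on {0..1} (g k)"
      by (rule uniform_limit_theorem[OF always_eventually g[OF k]]) (use inv k in auto)
    then show ?thesis using k by (simp add: \<gamma>_def)
  qed
  have gG: "continuous_on {0..1} (\<lambda>t. G k (\<gamma> t))" if k: "k < n" for k
    by (rule Gc[OF k gK gc]) auto
  have eq: "\<gamma> s k = z0 k + integral {0..s} (\<lambda>t. G k (\<gamma> t))" if s: "s \<in> {0..1}" and k: "k < n" for s k
  proof -
    \<comment> \<open>Half of \<open>e\<close> pays for replacing the limit curve by the iterate
      \<open>Z m0\<close> under the integral, the other half for the distance of
      \<open>Z (Suc m0)\<close> from its limit.\<close>
    have "\<bar>\<gamma> s k - (z0 k + integral {0..s} (\<lambda>t. G k (\<gamma> t)))\<bar> \<le> 0 + e" if e: "e > 0" for e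
    proof -
      define r where "r = e / 2"
      have r: "r > 0" using e by (simp add: r_def)
      have "\<forall>\<^sub>F m in sequentially. \<forall>l\<in>{..<n}. \<forall>t\<in>{0..1}. dist (Z m t l) (g l t) < r"
        by (intro eventually_ball_finite) (use uniform_limitD[OF g r] in auto)
      then obtain m0 where m0: "\<And>m l t. m \<ge> m0 \<Longrightarrow> l < n \<Longrightarrow> t \<in> {0..1} \<Longrightarrow> \<bar>Z m t l - \<gamma> t l\<bar> < r"
        unfolding eventually_sequentially by (force simp: dist_real_def \<gamma>_def)
      have c1: "continuous_on {0..s} (\<lambda>t. G k (Z m0 t))" by (rule Gc[OF k _ _ s]) (use inv[of m0] in auto)
      have c2: "continuous_on {0..s} (\<lambda>t. G k (\<gamma> t))" by (rule Gc[OF k gK gc s])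
      note c = c1 c2
      have "norm (integral {0..s} (\<lambda>t. G k (Z m0 t) - G k (\<gamma> t))) \<le> (L * (n * r)) * (s - 0)"
      proof (rule integral_bound)
        fix t assume "t \<in> {0..s}"
        then have t: "t \<in> {0..1}" using s by auto
        have "\<bar>G k (Z m0 t) - G k (\<gamma> t)\<bar> \<le> L * (\<Sum>l<n. \<bar>Z m0 t l - \<gamma> t l\<bar>)" using L[OF k] inv gK t by blast
        also have "\<dots> \<le> L * (\<Sum>l<n. r)" using L0 m0[OF order_refl _ t] by (intro mult_left_mono sum_mono) (auto intro: less_imp_le)
        finally show "norm (G k (Z m0 t) - G k (\<gamma> t)) \<le> L * (n * r)" by simp
      qed (use s c in \<open>auto intro!: continuous_intros\<close>)
      also have "\<dots> \<le> L * (n * r)" using s L0 r by (auto intro!: mult_left_le)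
      also have "\<dots> \<le> r" using mult_right_mono[OF L0(2), of r] r by simp
      finally have "\<bar>integral {0..s} (\<lambda>t. G k (Z m0 t)) - integral {0..s} (\<lambda>t. G k (\<gamma> t))\<bar> \<le> r"
        using c by (simp add: Henstock_Kurzweil_Integration.integral_diff integrable_continuous_real)
      moreover have "\<bar>(z0 k + integral {0..s} (\<lambda>t. G k (Z m0 t))) - \<gamma> s k\<bar> < r"
        using m0[of "Suc m0" k s] k s by (simp add: ZS)
      ultimately show ?thesis unfolding r_def by linarith
    qed
    then have "\<bar>\<gamma> s k - (z0 k + integral {0..s} (\<lambda>t. G k (\<gamma> t)))\<bar> \<le> 0" by (rule field_le_epsilon)
    then show ?thesis by simp
  qed
  have "((\<lambda>s. \<gamma> s k) has_real_derivative G k (\<gamma> s)) (at s within {0..1})" if s: "s \<in> {0..1}" and k: "k < n" for s k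
  proof -
    have "((\<lambda>s. z0 k + integral {0..s} (\<lambda>t. G k (\<gamma> t))) has_real_derivative G k (\<gamma> s)) (at s within {0..1})"
      using DERIV_add[OF DERIV_const integral_has_real_derivative[OF gG[OF k] s], of "z0 k"] by simp
    then show ?thesis
      by (rule has_field_derivative_transform_within[where d=1]) (use eq s k in auto)
  qed
  moreover have "\<gamma> 0 = z0" by (rule eucl_ext[of _ n]) (use gK[of 0] eq[of 0] z0 in \<open>auto simp: K_def\<close>)
  ultimately show ?thesis using gK by blast
qed


lemma local_bound:
  assumes B: "eopen n B" "z0 \<in> B" and F: "finite F" "\<And>f. f \<in> F \<Longrightarrow> continuous_on B f"
  shows "\<exists>e>0. \<exists>M. cbx n z0 e \<subseteq> B \<and> (\<forall>f\<in>F. \<forall>z\<in>cbx n z0 e. \<bar>f z\<bar> \<le> (M::real))"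
  using F
proof (induction F rule: finite_induct)
  case empty then show ?case using B unfolding openin_eucl_iff by auto
next
  case (insert f F)
  then obtain e M where e: "e > 0" "cbx n z0 e \<subseteq> B" "\<And>f z. f \<in> F \<Longrightarrow> z \<in> cbx n z0 e \<Longrightarrow> \<bar>f z\<bar> \<le> M"
    by (meson insertI2)
  have "continuous_on B f" using insert by auto
  then obtain d where d: "d > 0" "\<And>y. y \<in> cbx n z0 d \<Longrightarrow> \<bar>f y - f z0\<bar> < 1"
    using B(2) unfolding continuous_on_eucl_iff[OF B(1)] by (metis zero_less_one)
  have sub: "cbx n z0 (min e d) \<subseteq> cbx n z0 e" "cbx n z0 (min e d) \<subseteq> cbx n z0 d" by (auto intro!: cbx_mono)
  have "\<bar>g z\<bar> \<le> max M (\<bar>f z0\<bar> + 1)" if "g \<in> insert f F" "z \<in> cbx n z0 (min e d)" for g z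
  proof (cases "g = f")
    case True then show ?thesis using d(2)[of z] that sub by fastforce
  next
    case False then show ?thesis using e(3)[of g z] that sub by fastforce
  qed
  then show ?case using e d sub
    by (intro exI[of _ "min e d"] conjI exI[of _ "max M (\<bar>f z0\<bar> + 1)"]) auto
qed

lemma box_lipschitz:
  assumes f: "Cinf_on n (cbx n c e) f" and M: "\<And>l z. l < n \<Longrightarrow> z \<in> cbx n c e \<Longrightarrow> \<bar>partial_deriv l f z\<bar> \<le> M"
    and z: "z \<in> cbx n c e" "w \<in> cbx n c e"
  shows "\<bar>f w - f z\<bar> \<le> M * (\<Sum>l<n. \<bar>w l - z l\<bar>)"
proof -
  obtain \<xi> where xi: "\<forall>i<n. \<xi> i \<in> cbx n c e" "f w - f z = (\<Sum>i<n. partial_deriv i f (\<xi> i) * (w i - z i))"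
    using telescope_mvt[of n c e f "\<lambda>i. partial_deriv i f" z w, OF Cinf_has[OF f] z] by auto
  have "\<bar>f w - f z\<bar> \<le> (\<Sum>i<n. \<bar>partial_deriv i f (\<xi> i) * (w i - z i)\<bar>)" using xi(2) by simp
  also have "\<dots> \<le> (\<Sum>i<n. M * \<bar>w i - z i\<bar>)"
    using M xi(1) by (intro sum_mono) (auto simp: abs_mult intro!: mult_right_mono)
  finally show ?thesis by (simp add: sum_distrib_left)
qed

text \<open>Two mean value steps, first for \<open>f\<close> and then for each of its partial
  derivatives between \<open>z\<close> and \<open>\<xi> i\<close>. The constant is generous; only
  the square of the l1 distance matters.\<close>

lemma box_taylor:
  assumes f: "Cinf_on n (cbx n c e) f"
    and M: "\<And>l m z. l < n \<Longrightarrow> m < n \<Longrightarrow> z \<in> cbx n c e \<Longrightarrow> \<bar>partial_deriv m (partial_deriv l f) z\<bar> \<le> M"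
    and z: "z \<in> cbx n c e" "w \<in> cbx n c e" and M0: "M \<ge> 0"
  shows "\<bar>f w - f z - (\<Sum>l<n. partial_deriv l f z * (w l - z l))\<bar> \<le> M * (\<Sum>l<n. \<bar>w l - z l\<bar>)\<^sup>2"
proof -
  define S where "S = (\<Sum>l<n. \<bar>w l - z l\<bar>)"
  obtain \<xi> where xi: "\<And>i. i < n \<Longrightarrow> \<xi> i \<in> cbx n c e" "\<And>i j. i < n \<Longrightarrow> \<bar>\<xi> i j - z j\<bar> \<le> \<bar>w j - z j\<bar>"
    "f w - f z = (\<Sum>i<n. partial_deriv i f (\<xi> i) * (w i - z i))"
    using telescope_mvt[of n c e f "\<lambda>i. partial_deriv i f" z w, OF Cinf_has[OF f] z] by auto
  have "f w - f z - (\<Sum>l<n. partial_deriv l f z * (w l - z l)) =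
      (\<Sum>i<n. (partial_deriv i f (\<xi> i) - partial_deriv i f z) * (w i - z i))"
    unfolding xi(3) sum_subtractf[symmetric] by (simp add: algebra_simps)
  also have "\<bar>\<dots>\<bar> \<le> (\<Sum>i<n. \<bar>(partial_deriv i f (\<xi> i) - partial_deriv i f z) * (w i - z i)\<bar>)" by simp
  also have "\<dots> \<le> (\<Sum>i<n. (M * S) * \<bar>w i - z i\<bar>)"
  proof (rule sum_mono)
    fix i assume i: "i \<in> {..<n}"
    have "\<bar>partial_deriv i f (\<xi> i) - partial_deriv i f z\<bar> \<le> M * (\<Sum>l<n. \<bar>\<xi> i l - z l\<bar>)"
      by (rule box_lipschitz[OF Cinf_partial[OF f]]) (use i M z xi in auto)
    also have "\<dots> \<le> M * S" unfolding S_def using M0 xi(2) i by (intro mult_left_mono sum_mono) auto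
    finally show "\<bar>(partial_deriv i f (\<xi> i) - partial_deriv i f z) * (w i - z i)\<bar> \<le> M * S * \<bar>w i - z i\<bar>"
      by (auto simp: abs_mult intro: mult_right_mono)
  qed
  also have "\<dots> = M * S\<^sup>2" by (simp add: sum_distrib_left[symmetric] S_def power2_eq_square)
  finally show ?thesis by (simp add: S_def)
qed

text \<open>The Lie derivative of the function \<open>f\<close> along the vector field with
  components \<open>b k\<close>.\<close>

definition dirD :: "nat \<Rightarrow> (nat \<Rightarrow> (nat \<Rightarrow> real) \<Rightarrow> real) \<Rightarrow> ((nat \<Rightarrow> real) \<Rightarrow> real) \<Rightarrow> (nat \<Rightarrow> real) \<Rightarrow> real"
  where "dirD n b f z = (\<Sum>k<n. b k z * partial_deriv k f z)"

lemma sum_abs_comb: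
  fixes d :: nat and v x :: "nat \<Rightarrow> real" and \<rho> X :: real
  assumes "\<And>i. i < d \<Longrightarrow> \<bar>v i\<bar> \<le> \<rho>" "\<And>i. i < d \<Longrightarrow> \<bar>x i\<bar> \<le> (X::real)"
  shows "\<bar>\<Sum>i<d. v i * x i\<bar> \<le> d * \<rho> * X"
proof -
  have "\<bar>\<Sum>i<d. v i * x i\<bar> \<le> (\<Sum>i<d. \<bar>v i * x i\<bar>)" by simp
  also have "\<dots> \<le> (\<Sum>i<d. \<rho> * X)"
  proof (rule sum_mono)
    fix i assume "i \<in> {..<d}"
    then have "\<bar>v i\<bar> \<le> \<rho>" "\<bar>x i\<bar> \<le> X" using assms by auto
    then show "\<bar>v i * x i\<bar> \<le> \<rho> * X" unfolding abs_mult by (intro mult_mono) auto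
  qed
  finally show ?thesis by simp
qed

lemma sum_abs_comb2:
  fixes d :: nat and v x :: "nat \<Rightarrow> real" and \<rho> X :: real
  assumes "\<And>i. i < d \<Longrightarrow> \<bar>x i\<bar> \<le> (X::real)"
  shows "\<bar>\<Sum>i<d. v i * x i\<bar> \<le> (\<Sum>i<d. \<bar>v i\<bar>) * X"
proof -
  have "\<bar>\<Sum>i<d. v i * x i\<bar> \<le> (\<Sum>i<d. \<bar>v i * x i\<bar>)" by simp
  also have "\<dots> \<le> (\<Sum>i<d. \<bar>v i\<bar> * X)"
    using assms by (intro sum_mono) (auto simp: abs_mult intro!: mult_left_mono)
  finally show ?thesis by (simp add: sum_distrib_right)
qed

text \<open>The integral surface is swept out by the solutions of \<open>z' = \<Sum>i. v i * b i z\<close>. They stay in the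
  common zero set of the \<open>f a\<close>, where the \<open>b i\<close> commute; this makes the first-order variation in \<open>v\<close>
  of their end points equal to \<open>b\<close>.\<close>

lemma integral_surface_in_zero_set:
  fixes b :: "nat \<Rightarrow> nat \<Rightarrow> (nat \<Rightarrow> real) \<Rightarrow> real" and f :: "'a \<Rightarrow> (nat \<Rightarrow> real) \<Rightarrow> real"
  assumes B: "eopen n B" "z0 \<in> B"
    and b: "\<And>i k. i < d \<Longrightarrow> k < n \<Longrightarrow> Cinf_on n B (b i k)"
    and sg: "\<And>i. i < d \<Longrightarrow> \<sigma> i < n" "\<And>i j z. i < d \<Longrightarrow> j < d \<Longrightarrow> z \<in> B \<Longrightarrow> b i (\<sigma> j) z = (if i = j then 1 else 0)"
    and A: "finite A" "\<And>a. a \<in> A \<Longrightarrow> Cinf_on n B (f a)" "\<And>a. a \<in> A \<Longrightarrow> f a z0 = 0"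
    and H: "\<And>i a c. i < d \<Longrightarrow> a \<in> A \<Longrightarrow> c \<in> A \<Longrightarrow> Cinf_on n B (H i a c)"
      "\<And>i a z. i < d \<Longrightarrow> a \<in> A \<Longrightarrow> z \<in> B \<Longrightarrow> dirD n (b i) (f a) z = (\<Sum>c\<in>A. H i a c z * f c z)"
    and comm: "\<And>i j k z. z \<in> B \<Longrightarrow> (\<forall>a\<in>A. f a z = 0) \<Longrightarrow> i < d \<Longrightarrow> j < d \<Longrightarrow> k < n \<Longrightarrow>
      dirD n (b i) (b j k) z = dirD n (b j) (b i k) z"
  shows "\<exists>\<rho>>0. \<exists>F. F 0 = z0 \<and> (\<forall>k<n. Cinf_on d (cbx d 0 \<rho>) (\<lambda>v. F v k)) \<and>
    (\<forall>v\<in>cbx d 0 \<rho>. F v \<in> B \<and> (\<forall>a\<in>A. f a (F v) = 0) \<and> (\<forall>i<d. F v (\<sigma> i) = z0 (\<sigma> i) + v i) \<and>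
       (\<forall>i<d. \<forall>k<n. partial_deriv i (\<lambda>v. F v k) v = b i k (F v)))"
proof -
  \<comment> \<open>Everything that needs a common bound \<open>M\<close>: the fields and their
    derivatives of first and second order for the Lipschitz and Taylor estimates, and the
    coefficients \<open>H\<close> of the linear system that the \<open>f a\<close> satisfy.\<close>
  define \<Phi> where "\<Phi> = (\<Union>i<d. \<Union>k<n. {b i k}) \<union> (\<Union>i<d. \<Union>k<n. \<Union>l<n. {partial_deriv l (b i k)}) \<union>
    (\<Union>i<d. \<Union>k<n. \<Union>l<n. \<Union>m<n. {partial_deriv m (partial_deriv l (b i k))}) \<union> (\<Union>i<d. \<Union>a\<in>A. \<Union>c\<in>A. {H i a c})"
  have "finite \<Phi>" unfolding \<Phi>_def using A(1) by auto
  moreover have "continuous_on B g" if "g \<in> \<Phi>" for g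
    using that Cinf_cont[OF b open_sub_eucl[OF B(1)]] Cinf_cont[OF Cinf_partial[OF b] open_sub_eucl[OF B(1)]]
      Cinf_cont[OF Cinf_partial[OF Cinf_partial[OF b]] open_sub_eucl[OF B(1)]] Cinf_cont[OF H(1) open_sub_eucl[OF B(1)]]
    unfolding \<Phi>_def by blast
  ultimately obtain e M' where e: "e > 0" "cbx n z0 e \<subseteq> B" and M': "\<And>g z. g \<in> \<Phi> \<Longrightarrow> z \<in> cbx n z0 e \<Longrightarrow> \<bar>g z\<bar> \<le> M'"
    using local_bound[OF B, of \<Phi>] by blast
  define M where "M = max M' 0"
  have M0: "M \<ge> 0" by (simp add: M_def)
  have MM: "\<bar>g z\<bar> \<le> M" if "g \<in> \<Phi>" "z \<in> cbx n z0 e" for g z using M'[OF that] by (simp add: M_def)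
  have inP1: "b i k \<in> \<Phi>" if "i < d" "k < n" for i k
    unfolding \<Phi>_def by (rule UnI1, rule UnI1, rule UnI1, rule UN_I[of i], simp add: that, rule UN_I[of k]) (simp_all add: that)
  have inP2: "partial_deriv l (b i k) \<in> \<Phi>" if "i < d" "k < n" "l < n" for i k l
    unfolding \<Phi>_def by (rule UnI1, rule UnI1, rule UnI2, rule UN_I[of i], simp add: that, rule UN_I[of k], simp add: that, rule UN_I[of l]) (simp_all add: that)
  have inP3: "partial_deriv m (partial_deriv l (b i k)) \<in> \<Phi>" if "i < d" "k < n" "l < n" "m < n" for i k l m
    unfolding \<Phi>_def by (rule UnI1, rule UnI2, rule UN_I[of i], simp add: that, rule UN_I[of k], simp add: that, rule UN_I[of l], simp add: that, rule UN_I[of m]) (simp_all add: that)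
  have inP4: "H i a c \<in> \<Phi>" if "i < d" "a \<in> A" "c \<in> A" for i a c
    unfolding \<Phi>_def by (rule UnI2, rule UN_I[of i], simp add: that, rule UN_I[of a], simp add: that, rule UN_I[of c]) (simp_all add: that)
  have Mb: "\<bar>b i k z\<bar> \<le> M" "\<And>l. l < n \<Longrightarrow> \<bar>partial_deriv l (b i k) z\<bar> \<le> M"
    "\<And>l m. l < n \<Longrightarrow> m < n \<Longrightarrow> \<bar>partial_deriv m (partial_deriv l (b i k)) z\<bar> \<le> M"
    if "i < d" "k < n" "z \<in> cbx n z0 e" for i k z
    using MM[OF inP1[OF that(1,2)] that(3)] MM[OF inP2[OF that(1,2)] that(3)] MM[OF inP3[OF that(1,2)] that(3)] by simp_all
  have MH: "\<bar>H i a c z\<bar> \<le> M" if "i < d" "a \<in> A" "c \<in> A" "z \<in> cbx n z0 e" for i a c z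
    by (rule MM[OF inP4[OF that(1-3)] that(4)])
  have bQ: "Cinf_on n (cbx n z0 e) (b i k)" if "i < d" "k < n" for i k using Cinf_subset[OF b[OF that] e(2)] .
  have blip: "\<bar>b i k w - b i k z\<bar> \<le> M * (\<Sum>l<n. \<bar>w l - z l\<bar>)"
    if "i < d" "k < n" "z \<in> cbx n z0 e" "w \<in> cbx n z0 e" for i k z w
    by (rule box_lipschitz[OF bQ]) (use that Mb in auto)
  have btay: "\<bar>b i k w - b i k z - (\<Sum>l<n. partial_deriv l (b i k) z * (w l - z l))\<bar> \<le> M * (\<Sum>l<n. \<bar>w l - z l\<bar>)\<^sup>2"
    if "i < d" "k < n" "z \<in> cbx n z0 e" "w \<in> cbx n z0 e" for i k z w
    by (rule box_taylor[OF bQ]) (use that Mb M0 in auto)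
  have z0e: "z0 \<in> eucl n" using B open_sub_eucl by auto
  \<comment> \<open>\<open>C\<close> dominates \<open>d * M\<close>, \<open>d * M * n\<close> and
    \<open>d * M * card A\<close>, and is at least 1. With \<open>\<rho> * C\<close> at most 1/2 and
    \<open>e/2\<close>, the single number \<open>r = d * \<rho> * M\<close> then bounds the field by
    \<open>e/2\<close> and serves as Lipschitz constant for \<open>picard\<close> and for
    \<open>small_gronwall\<close>, over \<open>n\<close> components and over
    \<open>A\<close>.\<close>
  define C where "C = d * M * (n + card A + 1) + 1"
  have C: "C \<ge> 1" using M0 by (simp add: C_def)
  define \<rho> where "\<rho> = min 1 e / (2 * C)"
  have rho: "\<rho> > 0" using e C by (auto simp: \<rho>_def)
  have rhoC: "\<rho> * C \<le> 1/2" "\<rho> * C \<le> e/2" using C by (auto simp: \<rho>_def min_def)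
  have dM: "d * M \<le> C" "d * M * n \<le> C" "d * M * card A \<le> C"
    using M0 by (auto simp: C_def algebra_simps)
  define r where "r = d * \<rho> * M"
  have r: "r \<ge> 0" "r \<le> e/2" "r * n \<le> 1/2" "r * card A \<le> 1/2"
  proof -
    have "\<rho> * (d * M) \<le> \<rho> * C" "\<rho> * (d * M * n) \<le> \<rho> * C" "\<rho> * (d * M * card A) \<le> \<rho> * C"
      using dM rho by (auto intro!: mult_left_mono)
    moreover have "r = \<rho> * (d * M)" "r * n = \<rho> * (d * M * n)" "r * card A = \<rho> * (d * M * card A)" by (auto simp: r_def)
    ultimately show "r \<ge> 0" "r \<le> e/2" "r * n \<le> 1/2" "r * card A \<le> 1/2" using rhoC rho M0 by (simp, linarith+)
  qed
  define V where "V = cbx d 0 \<rho>"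
  have Vo: "eopen d V" unfolding V_def by (rule open_cbx)
  have vb: "\<bar>v i\<bar> \<le> \<rho>" if "v \<in> V" "i < d" for v i using that by (force simp: V_def cbx_def)
  define K where "K = {z \<in> eucl n. \<forall>i<n. \<bar>z i - z0 i\<bar> \<le> e/2}"
  have KQ: "K \<subseteq> cbx n z0 e" using e by (auto simp: K_def cbx_def)
  \<comment> \<open>The field with parameter \<open>v\<close>; its solution at time 1 will be the
    surface point \<open>F v\<close>, as for an exponential map.\<close>
  define G where "G v k z = (\<Sum>i<d. v i * b i k z)" for v :: "nat \<Rightarrow> real" and k z
  have Glip: "\<bar>G v k z - G v k w\<bar> \<le> r * (\<Sum>l<n. \<bar>z l - w l\<bar>)" if "v \<in> V" "k < n" "z \<in> cbx n z0 e" "w \<in> cbx n z0 e" for v k z w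
  proof -
    have "G v k z - G v k w = (\<Sum>i<d. v i * (b i k z - b i k w))"
      by (simp add: G_def sum_subtractf algebra_simps)
    then show ?thesis
      using sum_abs_comb[of d v \<rho> "\<lambda>i. b i k z - b i k w" "M * (\<Sum>l<n. \<bar>z l - w l\<bar>)"] vb blip that by (auto simp: r_def algebra_simps)
  qed
  have "\<exists>\<gamma>. \<gamma> 0 = z0 \<and> (\<forall>s\<in>{0..1::real}. \<gamma> s \<in> K \<and>
     (\<forall>k<n. ((\<lambda>s. \<gamma> s k) has_real_derivative G v k (\<gamma> s)) (at s within {0..1})))" if v: "v \<in> V" for v
  proof (rule picard[OF K_def z0e])
    show "\<bar>G v k z\<bar> \<le> e/2" if "k < n" "z \<in> K" for k z
    proof -
      have "z \<in> cbx n z0 e" using that KQ by blast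
      then have "\<bar>G v k z\<bar> \<le> d * \<rho> * M" unfolding G_def
        by (intro sum_abs_comb vb[OF v] Mb(1) that(1))
      then show ?thesis using r by (simp add: r_def)
    qed
    show "\<bar>G v k z - G v k w\<bar> \<le> r * (\<Sum>l<n. \<bar>z l - w l\<bar>)" if "k < n" "z \<in> K" "w \<in> K" for k z w
      using Glip[OF v that(1)] that KQ by blast
  qed (use e r in auto)
  then obtain \<gamma> where g0: "\<And>v. v \<in> V \<Longrightarrow> \<gamma> v 0 = z0" and gK: "\<And>v s. v \<in> V \<Longrightarrow> s \<in> {0..1::real} \<Longrightarrow> \<gamma> v s \<in> K"
    and gd: "\<And>v s k. v \<in> V \<Longrightarrow> s \<in> {0..1} \<Longrightarrow> k < n \<Longrightarrow> ((\<lambda>s. \<gamma> v s k) has_real_derivative G v k (\<gamma> v s)) (at s within {0..1})"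
    by metis
  have gQ: "\<gamma> v s \<in> cbx n z0 e" "\<gamma> v s \<in> B" "\<gamma> v s \<in> eucl n" if "v \<in> V" "s \<in> {0..1}" for v s
    using gK[OF that] KQ e by (auto simp: K_def)
  have comp_der: "((\<lambda>s. f (\<gamma> v s)) has_real_derivative (\<Sum>i<d. v i * dirD n (b i) f (\<gamma> v s))) (at s within {0..1})"
    if v: "v \<in> V" and f: "Cinf_on n B f" and s: "s \<in> {0..1}" for v f s
  proof -
    have "((\<lambda>s. f (\<gamma> v s)) has_real_derivative (\<Sum>k<n. partial_deriv k f (\<gamma> v s) * G v k (\<gamma> v s))) (at s within {0..1})"
      by (rule Cinf_curve[OF B(1) f]) (use gd[OF v s] gQ[OF v] s in auto)
    also have "(\<Sum>k<n. partial_deriv k f (\<gamma> v s) * G v k (\<gamma> v s)) = (\<Sum>i<d. v i * dirD n (b i) f (\<gamma> v s))"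
      unfolding G_def dirD_def sum_distrib_left by (subst sum.swap) (simp add: algebra_simps)
    finally show ?thesis .
  qed
  \<comment> \<open>In the coordinates \<open>\<sigma> i\<close> the equation reads
    \<open>z' = v i\<close>, because the fields are dual to them; \<open>small_gronwall\<close> with
    \<open>c = a = 0\<close> and a one-element index set gives uniqueness of the solution.\<close>
  have gs: "\<gamma> v s (\<sigma> i) = z0 (\<sigma> i) + s * v i" if v: "v \<in> V" and s: "s \<in> {0..1}" and i: "i < d" for v s i
  proof -
    have "(\<Sum>l\<in>{()}. \<bar>(\<lambda>_ s. \<gamma> v s (\<sigma> i) - (z0 (\<sigma> i) + s * v i)) l s\<bar>) \<le> real (2 * card {()}) * 0"
    proof (rule small_gronwall[where c=0 and \<phi>="\<lambda>_ s. \<gamma> v s (\<sigma> i) - (z0 (\<sigma> i) + s * v i)" and \<phi>'="\<lambda>_ s. G v (\<sigma> i) (\<gamma> v s) - v i"])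
      fix s :: real assume s: "s \<in> {0..1}"
      have "G v (\<sigma> i) (\<gamma> v s) = (\<Sum>j<d. if j = i then v j else 0)"
        unfolding G_def by (intro sum.cong) (use sg(2) i gQ[OF v s] in auto)
      then have Gv: "G v (\<sigma> i) (\<gamma> v s) = v i" using i by simp
      then show "\<bar>G v (\<sigma> i) (\<gamma> v s) - v i\<bar> \<le> 0 * (\<Sum>l\<in>{()}. \<bar>\<gamma> v s (\<sigma> i) - (z0 (\<sigma> i) + s * v i)\<bar>) + 0" by simp
      have "((\<lambda>s. z0 (\<sigma> i) + s * v i) has_real_derivative v i) (at s within {0..1})" by (auto intro!: derivative_eq_intros)
      then show "((\<lambda>s. \<gamma> v s (\<sigma> i) - (z0 (\<sigma> i) + s * v i)) has_real_derivative G v (\<sigma> i) (\<gamma> v s) - v i) (at s within {0..1})"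
        by (intro DERIV_diff gd[OF v s sg(1)[OF i]])
    qed (use s g0[OF v] in auto)
    then show ?thesis by simp
  qed
  \<comment> \<open>By \<open>H\<close> the functions \<open>f a\<close> solve a homogeneous linear
    system along each curve, with initial values 0. This confines the surface to the zero set and
    makes \<open>comm\<close> available at every point of the curve.\<close>
  have fz: "f a (\<gamma> v s) = 0" if v: "v \<in> V" and s: "s \<in> {0..1}" and a: "a \<in> A" for v s a
  proof -
    have "(\<Sum>a\<in>A. \<bar>f a (\<gamma> v s)\<bar>) \<le> real (2 * card A) * 0"
    proof (rule small_gronwall[where \<phi>'="\<lambda>a s. \<Sum>i<d. v i * dirD n (b i) (f a) (\<gamma> v s)" and c=r])
      fix a and s :: real assume a: "a \<in> A" and s: "s \<in> {0..1}"
      show "((\<lambda>s. f a (\<gamma> v s)) has_real_derivative (\<Sum>i<d. v i * dirD n (b i) (f a) (\<gamma> v s))) (at s within {0..1})"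
        by (rule comp_der[OF v A(2)[OF a] s])
      have "\<bar>dirD n (b i) (f a) (\<gamma> v s)\<bar> \<le> M * (\<Sum>c\<in>A. \<bar>f c (\<gamma> v s)\<bar>)" if i: "i < d" for i
      proof -
        have "\<bar>dirD n (b i) (f a) (\<gamma> v s)\<bar> \<le> (\<Sum>c\<in>A. \<bar>H i a c (\<gamma> v s) * f c (\<gamma> v s)\<bar>)"
          using H(2)[OF i a gQ(2)[OF v s]] by simp
        also have "\<dots> \<le> (\<Sum>c\<in>A. M * \<bar>f c (\<gamma> v s)\<bar>)"
          using MH[OF i a _ gQ(1)[OF v s]] by (intro sum_mono) (auto simp: abs_mult intro!: mult_right_mono)
        finally show ?thesis by (simp add: sum_distrib_left)
      qed
      then show "\<bar>\<Sum>i<d. v i * dirD n (b i) (f a) (\<gamma> v s)\<bar> \<le> r * (\<Sum>l\<in>A. \<bar>f l (\<gamma> v s)\<bar>) + 0"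
        using sum_abs_comb[of d v \<rho> "\<lambda>i. dirD n (b i) (f a) (\<gamma> v s)" "M * (\<Sum>c\<in>A. \<bar>f c (\<gamma> v s)\<bar>)"] vb[OF v]
        by (auto simp: r_def algebra_simps)
    qed (use A g0[OF v] r s in auto)
    then have "(\<Sum>a\<in>A. \<bar>f a (\<gamma> v s)\<bar>) = 0" by (simp add: sum_nonneg antisym)
    then show ?thesis using A(1) a by (simp add: sum_nonneg_eq_0_iff)
  qed
  define D where "D v w = (\<Sum>i<d. \<bar>w i - v i :: real\<bar>)" for v w
  have D0: "D v w \<ge> 0" for v w by (simp add: D_def sum_nonneg)
  have dist1: "(\<Sum>k<n. \<bar>\<gamma> w s k - \<gamma> v s k\<bar>) \<le> 2 * n * (M * D v w)" if v: "v \<in> V" and w: "w \<in> V" and s: "s \<in> {0..1}" for v w s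
  proof -
    have "(\<Sum>k\<in>{..<n}. \<bar>\<gamma> w s k - \<gamma> v s k\<bar>) \<le> 2 * card {..<n} * (M * D v w)"
    proof (rule small_gronwall[where \<phi>'="\<lambda>k s. G w k (\<gamma> w s) - G v k (\<gamma> v s)" and c=r])
      fix k and s :: real assume k: "k \<in> {..<n}" and s: "s \<in> {0..1}"
      show "((\<lambda>s. \<gamma> w s k - \<gamma> v s k) has_real_derivative G w k (\<gamma> w s) - G v k (\<gamma> v s)) (at s within {0..1})"
        using k by (intro DERIV_diff gd v w s) auto
      have "G w k (\<gamma> v s) - G v k (\<gamma> v s) = (\<Sum>i<d. (w i - v i) * b i k (\<gamma> v s))"
        by (simp add: G_def sum_subtractf algebra_simps)
      then have "\<bar>G w k (\<gamma> v s) - G v k (\<gamma> v s)\<bar> \<le> D v w * M"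
        using sum_abs_comb2[of d "\<lambda>i. b i k (\<gamma> v s)" M "\<lambda>i. w i - v i"] Mb(1) gQ(1)[OF v s] k by (auto simp: D_def)
      then show "\<bar>G w k (\<gamma> w s) - G v k (\<gamma> v s)\<bar> \<le> r * (\<Sum>l\<in>{..<n}. \<bar>\<gamma> w s l - \<gamma> v s l\<bar>) + M * D v w"
        using Glip[OF w _ gQ(1)[OF w s] gQ(1)[OF v s], of k] k by (simp add: mult.commute)
    qed (use r s g0 v w in auto)
    then show ?thesis by simp
  qed
  define \<tau> where "\<tau> = 2 * n * M"
  define C2 where "C2 = M * \<tau> + r * \<tau>\<^sup>2"
  have tau0: "\<tau> \<ge> 0" using M0 by (simp add: \<tau>_def)
  \<comment> \<open>The change of the solution from \<open>v\<close> to \<open>w\<close> at time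
    \<open>s\<close> is compared with \<open>s * (\<Sum>i<d. (w i - v i) * b i)\<close>. This
    candidate solves the linearized equation because the fields commute along the curve; the defect
    \<open>h\<close> therefore obeys a Gronwall inequality whose inhomogeneous part is quadratic in
    \<open>D v w\<close>.\<close>
  have dist2: "\<bar>\<gamma> w 1 k - \<gamma> v 1 k - (\<Sum>i<d. (w i - v i) * b i k (\<gamma> v 1))\<bar> \<le> 2 * n * (C2 * (D v w)\<^sup>2)"
    if v: "v \<in> V" and w: "w \<in> V" and k: "k < n" for v w k
  proof -
    define h where "h k s = \<gamma> w s k - \<gamma> v s k - s * (\<Sum>i<d. (w i - v i) * b i k (\<gamma> v s))" for k and s :: real
    define h' where "h' k s = G w k (\<gamma> w s) - G v k (\<gamma> v s) - ((\<Sum>i<d. (w i - v i) * b i k (\<gamma> v s))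
       + s * (\<Sum>i<d. (w i - v i) * (\<Sum>j<d. v j * dirD n (b j) (b i k) (\<gamma> v s))))" for k and s :: real
    have "(\<Sum>l\<in>{..<n}. \<bar>h l 1\<bar>) \<le> 2 * card {..<n} * (C2 * (D v w)\<^sup>2)"
    proof (rule small_gronwall[where \<phi>'=h' and c=r])
      fix k and s :: real assume "k \<in> {..<n}" and s: "s \<in> {0..1}"
      then have k: "k < n" by simp
      show "(h k has_real_derivative h' k s) (at s within {0..1})"
      proof -
        have "((\<lambda>s. \<Sum>i<d. (w i - v i) * b i k (\<gamma> v s)) has_real_derivative
           (\<Sum>i<d. (w i - v i) * (\<Sum>j<d. v j * dirD n (b j) (b i k) (\<gamma> v s)))) (at s within {0..1})"
          by (intro DERIV_sum DERIV_cmult comp_der[OF v _ s] b k) auto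
        from DERIV_mult[OF DERIV_ident this]
        have "((\<lambda>s. s * (\<Sum>i<d. (w i - v i) * b i k (\<gamma> v s))) has_real_derivative
           ((\<Sum>i<d. (w i - v i) * b i k (\<gamma> v s)) + s * (\<Sum>i<d. (w i - v i) * (\<Sum>j<d. v j * dirD n (b j) (b i k) (\<gamma> v s)))))
           (at s within {0..1})" by (simp add: algebra_simps)
        then show ?thesis unfolding h_def[abs_def] h'_def by (intro DERIV_diff gd v w s k)
      qed
      define \<Delta> where "\<Delta> l = \<gamma> w s l - \<gamma> v s l" for l
      define T where "T = (\<Sum>l<n. \<bar>\<Delta> l\<bar>)"
      define Hs where "Hs = (\<Sum>l<n. \<bar>h l s\<bar>)"
      have T: "0 \<le> T" "T \<le> \<tau> * D v w" using dist1[OF v w s] by (auto simp: T_def \<Delta>_def \<tau>_def sum_nonneg)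
      define q where "q i = b i k (\<gamma> w s) - b i k (\<gamma> v s)" for i
      define Ej where "Ej j = q j - s * (\<Sum>i<d. (w i - v i) * dirD n (b i) (b j k) (\<gamma> v s))" for j
      \<comment> \<open>Commutation lets the differentiating and the differentiated field change
        places, turning derivatives along \<open>v\<close> into derivatives along
        \<open>w - v\<close>.\<close>
      have sw: "(\<Sum>i<d. (w i - v i) * (\<Sum>j<d. v j * dirD n (b j) (b i k) (\<gamma> v s)))
           = (\<Sum>j<d. v j * (\<Sum>i<d. (w i - v i) * dirD n (b i) (b j k) (\<gamma> v s)))"
        unfolding sum_distrib_left
        by (subst sum.swap, intro sum.cong refl)
           (use comm[OF gQ(2)[OF v s] _ _ _ k] fz[OF v s] in \<open>auto simp: mult.left_commute\<close>)
      have h'eq: "h' k s = (\<Sum>i<d. (w i - v i) * q i) + (\<Sum>j<d. v j * Ej j)"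
        unfolding h'_def sw
        unfolding G_def Ej_def q_def right_diff_distrib sum_subtractf left_diff_distrib sum_distrib_left
        by (simp add: mult.left_commute)
      have q1: "\<bar>q i\<bar> \<le> M * T" if "i < d" for i
        unfolding q_def T_def \<Delta>_def by (rule blip[OF that k gQ(1)[OF v s] gQ(1)[OF w s]])
      have Ej: "\<bar>Ej j\<bar> \<le> M * T\<^sup>2 + M * Hs" if j: "j < d" for j
      proof -
        have "(\<Sum>l<n. partial_deriv l (b j k) (\<gamma> v s) * \<Delta> l) =
            (\<Sum>l<n. partial_deriv l (b j k) (\<gamma> v s) * h l s) +
            (\<Sum>l<n. partial_deriv l (b j k) (\<gamma> v s) * (s * (\<Sum>i<d. (w i - v i) * b i l (\<gamma> v s))))"
          unfolding sum.distrib[symmetric] by (intro sum.cong) (auto simp: h_def \<Delta>_def algebra_simps)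
        moreover have "(\<Sum>l<n. partial_deriv l (b j k) (\<gamma> v s) * (s * (\<Sum>i<d. (w i - v i) * b i l (\<gamma> v s)))) =
            s * (\<Sum>i<d. (w i - v i) * dirD n (b i) (b j k) (\<gamma> v s))"
          unfolding dirD_def sum_distrib_left by (subst sum.swap) (simp add: mult_ac)
        ultimately have "Ej j = (q j - (\<Sum>l<n. partial_deriv l (b j k) (\<gamma> v s) * \<Delta> l))
            + (\<Sum>l<n. partial_deriv l (b j k) (\<gamma> v s) * h l s)" by (simp add: Ej_def)
        moreover have "\<bar>q j - (\<Sum>l<n. partial_deriv l (b j k) (\<gamma> v s) * \<Delta> l)\<bar> \<le> M * T\<^sup>2"
          unfolding q_def \<Delta>_def T_def by (rule btay[OF j k gQ(1)[OF v s] gQ(1)[OF w s]])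
        moreover have "\<bar>\<Sum>l<n. partial_deriv l (b j k) (\<gamma> v s) * h l s\<bar> \<le> Hs * M"
          unfolding Hs_def using sum_abs_comb2[of n "\<lambda>l. partial_deriv l (b j k) (\<gamma> v s)" M "\<lambda>l. h l s"]
            Mb(2)[OF j k gQ(1)[OF v s]] by (simp add: mult.commute)
        ultimately show ?thesis by (simp add: mult.commute)
      qed
      have "\<bar>\<Sum>i<d. (w i - v i) * q i\<bar> \<le> D v w * (M * T)"
        unfolding D_def by (rule sum_abs_comb2) (rule q1)
      also have "\<dots> \<le> D v w * (M * (\<tau> * D v w))" using T M0 D0 by (intro mult_left_mono) auto
      finally have 1: "\<bar>\<Sum>i<d. (w i - v i) * q i\<bar> \<le> M * \<tau> * (D v w)\<^sup>2" by (simp add: power2_eq_square mult_ac)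
      have "\<bar>\<Sum>j<d. v j * Ej j\<bar> \<le> d * \<rho> * (M * T\<^sup>2 + M * Hs)" by (rule sum_abs_comb[OF vb[OF v] Ej])
      also have "\<dots> = r * T\<^sup>2 + r * Hs" by (simp add: r_def algebra_simps)
      also have "\<dots> \<le> r * (\<tau> * D v w)\<^sup>2 + r * Hs" using T r by (intro add_right_mono mult_left_mono power_mono) auto
      finally have 2: "\<bar>\<Sum>j<d. v j * Ej j\<bar> \<le> r * \<tau>\<^sup>2 * (D v w)\<^sup>2 + r * Hs" by (simp add: power_mult_distrib)
      show "\<bar>h' k s\<bar> \<le> r * (\<Sum>l\<in>{..<n}. \<bar>h l s\<bar>) + C2 * (D v w)\<^sup>2"
        using 1 2 unfolding h'eq C2_def Hs_def[symmetric] distrib_right by linarith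
    qed (use r g0 v w in \<open>auto simp: h_def\<close>)
    moreover have "\<bar>h k 1\<bar> \<le> (\<Sum>l\<in>{..<n}. \<bar>h l 1\<bar>)" using k by (intro member_le_sum) auto
    ultimately show ?thesis by (simp add: h_def)
  qed
  define F where "F v = \<gamma> v 1" for v
  have FB: "F v \<in> B" if "v \<in> V" for v using gQ(2)[OF that, of 1] by (simp add: F_def)
  have one: "D v (v(i := t)) = \<bar>t - v i\<bar>" "(\<Sum>j<d. ((v(i := t)) j - v j) * x j) = (t - v i) * x i" if i: "i < d" for v i t and x :: "nat \<Rightarrow> real"
  proof -
    have "D v (v(i := t)) = (\<Sum>j<d. if j = i then \<bar>t - v i\<bar> else 0)" unfolding D_def by (intro sum.cong) auto
    then show "D v (v(i := t)) = \<bar>t - v i\<bar>" using i by simp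
    have "(\<Sum>j<d. ((v(i := t)) j - v j) * x j) = (\<Sum>j<d. if j = i then (t - v i) * x i else 0)" by (intro sum.cong) auto
    then show "(\<Sum>j<d. ((v(i := t)) j - v j) * x j) = (t - v i) * x i" using i by simp
  qed
  have Fder: "((\<lambda>t. F (v(i := t)) k) has_real_derivative b i k (F v)) (at (v i))" if v: "v \<in> V" and i: "i < d" and k: "k < n" for v i k
  proof -
    have "((\<lambda>t. (F (v(i := t)) k - F v k) / (t - v i) - b i k (F v)) \<longlongrightarrow> 0) (at (v i))"
    proof (rule Lim_null_comparison)
      have "\<forall>\<^sub>F t in at (v i). v(i := t) \<in> V"
        using eventually_upd[OF Vo v i] by (simp add: eventually_at_filter eventually_mono)
      moreover have "\<forall>\<^sub>F t in at (v i). t \<noteq> v i" by (simp add: eventually_at_filter)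
      ultimately show "\<forall>\<^sub>F t in at (v i). norm ((F (v(i := t)) k - F v k) / (t - v i) - b i k (F v)) \<le> 2 * n * C2 * \<bar>t - v i\<bar>"
      proof eventually_elim
        case (elim t)
        have eq: "(F (v(i := t)) k - F v k) / (t - v i) - b i k (F v) = (F (v(i := t)) k - F v k - (t - v i) * b i k (F v)) / (t - v i)"
          using elim(2) by (simp add: field_simps)
        have "\<bar>F (v(i := t)) k - F v k - (t - v i) * b i k (F v)\<bar> \<le> 2 * n * (C2 * \<bar>t - v i\<bar>\<^sup>2)"
          using dist2[OF v elim(1) k] unfolding one[OF i] F_def .
        then have "\<bar>F (v(i := t)) k - F v k - (t - v i) * b i k (F v)\<bar> \<le> (2 * n * C2 * \<bar>t - v i\<bar>) * \<bar>t - v i\<bar>"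
          unfolding power2_eq_square by (simp only: mult_ac)
        then show ?case unfolding eq using elim(2) by (simp add: divide_le_eq)
      qed
      have "((\<lambda>t. 2 * n * C2 * \<bar>t - v i\<bar>) \<longlongrightarrow> 2 * n * C2 * \<bar>v i - v i\<bar>) (at (v i))"
        by (intro tendsto_intros)
      then show "((\<lambda>t. 2 * n * C2 * \<bar>t - v i\<bar>) \<longlongrightarrow> 0) (at (v i))" by simp
    qed
    then show ?thesis by (simp add: has_field_derivative_iff LIM_zero_iff)
  qed
  have Fcont: "continuous_on V (\<lambda>v. F v k)" if k: "k < n" for k
    unfolding continuous_on_eucl_iff[OF Vo]
  proof (intro ballI allI impI)
    fix v and x :: real assume v: "v \<in> V" and x: "x > 0"
    obtain d1 where d1: "d1 > 0" "cbx d v d1 \<subseteq> V" using Vo v unfolding openin_eucl_iff by auto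
    define y where "y = x / (\<tau> * d + 1)"
    have td: "\<tau> * d + 1 > 0" using tau0 by (simp add: add_nonneg_pos)
    have y: "y > 0" using x td by (simp add: y_def)
    have "\<bar>F w k - F v k\<bar> < x" if w: "w \<in> cbx d v (min d1 y)" for w
    proof -
      have wV: "w \<in> V" using w d1 by (auto simp: cbx_def)
      have "D v w \<le> (\<Sum>i<d. y)" unfolding D_def using w by (intro sum_mono) (auto simp: cbx_def intro: less_imp_le)
      then have "\<tau> * D v w \<le> \<tau> * (d * y)" using tau0 by (intro mult_left_mono) auto
      moreover have "\<bar>F w k - F v k\<bar> \<le> (\<Sum>k<n. \<bar>\<gamma> w 1 k - \<gamma> v 1 k\<bar>)"
        unfolding F_def using k by (intro member_le_sum) auto
      moreover have "(\<Sum>k<n. \<bar>\<gamma> w 1 k - \<gamma> v 1 k\<bar>) \<le> \<tau> * D v w" using dist1[OF v wV, of 1] by (simp add: \<tau>_def)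
      moreover have "\<tau> * (d * y) < x"
      proof -
        have "(\<tau> * d + 1) * y = x" using td by (simp add: y_def)
        then show ?thesis using y by (simp add: algebra_simps)
      qed
      ultimately show ?thesis by linarith
    qed
    then show "\<exists>d'>0. \<forall>w\<in>cbx d v d'. \<bar>F w k - F v k\<bar> < x" using d1 y by (intro exI[of _ "min d1 y"]) auto
  qed
  \<comment> \<open>Bootstrap: the partial derivatives of \<open>F\<close> are
    \<open>b i k (F v)\<close>, so \<open>m\<close> derivatives of \<open>F\<close> give one
    more.\<close>
  have FC: "\<forall>k<n. Ck_on d m V (\<lambda>v. F v k)" for m
  proof (induction m)
    case 0 then show ?case using Fcont by (simp add: continuous_map_eucl[OF open_sub_eucl[OF Vo]])
  next
    case (Suc m)
    show ?case
    proof (intro allI impI)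
      fix k assume k: "k < n"
      show "Ck_on d (Suc m) V (\<lambda>v. F v k)"
      proof (rule CkI[OF Vo Fcont[OF k], where g="\<lambda>i v. b i k (F v)"])
        show "((\<lambda>t. F (v(i := t)) k) has_real_derivative b i k (F v)) (at (v i))" if "i < d" "v \<in> V" for i v
          by (rule Fder[OF that(2,1) k])
        show "Ck_on d m V (\<lambda>v. b i k (F v))" if "i < d" for i
          by (rule Ck_comp[OF Vo B(1), of m "b i k"]) (use b[OF that k] Suc FB in \<open>auto simp: Cinf_on_def\<close>)
      qed
    qed
  qed
  have z_in: "(0 :: nat \<Rightarrow> real) \<in> V" using rho by (simp add: V_def cbx_def eucl_iff zero_fun_def)
  have "F 0 = z0"
  proof (rule eucl_ext[of _ n])
    fix k assume k: "k < n"
    have "(\<Sum>l\<in>{()}. \<bar>(\<lambda>_ s. \<gamma> 0 s k - z0 k) l 1\<bar>) \<le> real (2 * card {()}) * 0"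
    proof (rule small_gronwall[where c=0 and \<phi>="\<lambda>_ s. \<gamma> 0 s k - z0 k" and \<phi>'="\<lambda>_ s. 0"])
      fix s :: real assume s: "s \<in> {0..1}"
      have "G 0 k (\<gamma> 0 s) = 0" by (simp add: G_def)
      then show "((\<lambda>s. \<gamma> 0 s k - z0 k) has_real_derivative 0) (at s within {0..1})"
        using DERIV_diff[OF gd[OF z_in s k] DERIV_const, of "z0 k"] by simp
    qed (use g0[OF z_in] in auto)
    then show "F 0 k = z0 k" by (simp add: F_def)
  qed (use gQ(3)[OF z_in, of 1] z0e in \<open>auto simp: F_def\<close>)
  moreover have "partial_deriv i (\<lambda>v. F v k) v = b i k (F v)" if "v \<in> V" "i < d" "k < n" for v i k
    by (rule partial_deriv_eqI[OF Fder[OF that]])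
  moreover have "\<forall>k<n. Cinf_on d V (\<lambda>v. F v k)" using FC unfolding Cinf_on_def by blast
  moreover have "F v (\<sigma> i) = z0 (\<sigma> i) + v i" if "v \<in> V" "i < d" for v i
    using gs[OF that(1) _ that(2), of 1] by (simp add: F_def)
  moreover have "f a (F v) = 0" if "v \<in> V" "a \<in> A" for v a
    using fz[OF that(1) _ that(2), of 1] by (simp add: F_def)
  ultimately show ?thesis
    using FB rho unfolding V_def by (intro exI[of _ \<rho>] conjI exI[of _ F]) blast+
qed

section \<open>Modules of vector fields, echelon bases and Hermann's theorem\<close>

type_synonym vfield = "nat \<Rightarrow> (nat \<Rightarrow> real) \<Rightarrow> real"

definition cbracket :: "nat \<Rightarrow> vfield \<Rightarrow> vfield \<Rightarrow> vfield"
  where "cbracket n V W k z = (\<Sum>l<n. V l z * partial_deriv l (W k) z - W l z * partial_deriv l (V k) z)"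

lemma cbracket_dirD: "cbracket n V W k z = dirD n V (W k) z - dirD n W (V k) z"
  by (simp add: cbracket_def dirD_def sum_subtractf)

lemma dirD_sum_mult:
  assumes "\<And>a. a \<in> A \<Longrightarrow> Cinf_on n B (\<psi> a)" "\<And>a. a \<in> A \<Longrightarrow> Cinf_on n B (Y a)" "z \<in> B"
    and B: "eopen n B"
  shows "dirD n V (\<lambda>z. \<Sum>a\<in>A. \<psi> a z * Y a z) z = (\<Sum>a\<in>A. dirD n V (\<psi> a) z * Y a z + \<psi> a z * dirD n V (Y a) z)"
proof -
  have "V l z * partial_deriv l (\<lambda>z. \<Sum>a\<in>A. \<psi> a z * Y a z) z =
     (\<Sum>a\<in>A. V l z * partial_deriv l (\<psi> a) z * Y a z + \<psi> a z * (V l z * partial_deriv l (Y a) z))" if "l < n" for l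
  proof -
    have "partial_deriv l (\<lambda>z. \<Sum>a\<in>A. \<psi> a z * Y a z) z = (\<Sum>a\<in>A. partial_deriv l (\<lambda>z. \<psi> a z * Y a z) z)"
      by (rule partial_deriv_sum[OF Cinf_mult[OF B assms(1,2)] assms(3) that])
    also have "\<dots> = (\<Sum>a\<in>A. partial_deriv l (\<psi> a) z * Y a z + partial_deriv l (Y a) z * \<psi> a z)"
      by (intro sum.cong refl partial_deriv_mult[OF assms(1,2,3) that])
    finally show ?thesis by (simp add: sum_distrib_left algebra_simps)
  qed
  then have "dirD n V (\<lambda>z. \<Sum>a\<in>A. \<psi> a z * Y a z) z =
     (\<Sum>l<n. \<Sum>a\<in>A. V l z * partial_deriv l (\<psi> a) z * Y a z + \<psi> a z * (V l z * partial_deriv l (Y a) z))"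
    unfolding dirD_def by simp
  also have "\<dots> = (\<Sum>a\<in>A. \<Sum>l<n. V l z * partial_deriv l (\<psi> a) z * Y a z + \<psi> a z * (V l z * partial_deriv l (Y a) z))"
    by (rule sum.swap)
  finally show ?thesis by (simp add: dirD_def sum.distrib sum_distrib_left sum_distrib_right)
qed

lemma dirD_cong:
  assumes "eopen n B" "\<And>y. y \<in> B \<Longrightarrow> f y = g y" "z \<in> B" "\<And>l. l < n \<Longrightarrow> V l z = W l z"
  shows "dirD n V f z = dirD n W g z"
  unfolding dirD_def using assms partial_deriv_cong[OF assms(1,2,3)] by (intro sum.cong) auto

text \<open>The module over the smooth functions on \<open>B\<close>, not the pointwise linear span:
  where the rank drops, a smooth field with values in the span need not have smooth coefficients,
  and brackets differentiate them.\<close>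

definition in_span :: "nat \<Rightarrow> (nat \<Rightarrow> real) set \<Rightarrow> 'a set \<Rightarrow> ('a \<Rightarrow> vfield) \<Rightarrow> vfield \<Rightarrow> bool"
  where "in_span n B A Y V \<longleftrightarrow> (\<exists>\<phi>. (\<forall>a\<in>A. Cinf_on n B (\<phi> a)) \<and>
     (\<forall>k<n. \<forall>z\<in>B. V k z = (\<Sum>a\<in>A. \<phi> a z * Y a k z)))"

locale involutive =
  fixes n :: nat and B :: "(nat \<Rightarrow> real) set" and A :: "'a set" and Y :: "'a \<Rightarrow> vfield"
  assumes B: "eopen n B" and A: "finite A"
    and Y: "\<And>a k. a \<in> A \<Longrightarrow> k < n \<Longrightarrow> Cinf_on n B (Y a k)"
    and inv: "\<And>a b. a \<in> A \<Longrightarrow> b \<in> A \<Longrightarrow> in_span n B A Y (cbracket n (Y a) (Y b))"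
begin

abbreviation "md \<equiv> in_span n B A Y"

lemma md_Y: "a \<in> A \<Longrightarrow> md (Y a)"
  unfolding in_span_def
proof (intro exI[of _ "\<lambda>b z. if b = a then 1 else 0"] conjI ballI allI impI)
  fix k z assume "a \<in> A"
  have "(\<Sum>b\<in>A. (if b = a then 1 else 0) * Y b k z) = (\<Sum>b\<in>A. if b = a then Y a k z else 0)"
    by (intro sum.cong) auto
  then show "Y a k z = (\<Sum>b\<in>A. (if b = a then 1 else 0) * Y b k z)" using A \<open>a \<in> A\<close> by simp
qed (auto intro: Cinf_const[OF B])

lemma md_zero: "md (\<lambda>k z. 0)"
  unfolding in_span_def by (intro exI[of _ "\<lambda>b z. 0"]) (auto intro: Cinf_const[OF B])

lemma md_add:
  assumes "md V" "md W" shows "md (\<lambda>k z. V k z + W k z)"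
proof -
  obtain \<phi> \<psi> where "\<forall>a\<in>A. Cinf_on n B (\<phi> a)" "\<forall>k<n. \<forall>z\<in>B. V k z = (\<Sum>a\<in>A. \<phi> a z * Y a k z)"
     "\<forall>a\<in>A. Cinf_on n B (\<psi> a)" "\<forall>k<n. \<forall>z\<in>B. W k z = (\<Sum>a\<in>A. \<psi> a z * Y a k z)"
    using assms unfolding in_span_def by blast
  then show ?thesis unfolding in_span_def
    by (intro exI[of _ "\<lambda>a z. \<phi> a z + \<psi> a z"]) (auto intro: Cinf_add[OF B] simp: distrib_right sum.distrib)
qed

lemma md_mult:
  assumes "Cinf_on n B f" "md V" shows "md (\<lambda>k z. f z * V k z)"
proof -
  obtain \<phi> where "\<forall>a\<in>A. Cinf_on n B (\<phi> a)" "\<forall>k<n. \<forall>z\<in>B. V k z = (\<Sum>a\<in>A. \<phi> a z * Y a k z)"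
    using assms unfolding in_span_def by blast
  then show ?thesis unfolding in_span_def using assms(1)
    by (intro exI[of _ "\<lambda>a z. f z * \<phi> a z"]) (auto intro: Cinf_mult[OF B] simp: sum_distrib_left mult.assoc)
qed

lemma md_diff: "md V \<Longrightarrow> md W \<Longrightarrow> md (\<lambda>k z. V k z - W k z)"
  using md_add[OF _ md_mult[OF Cinf_const[OF B, of "-1"]], of V W] by simp

lemma md_sum: "(\<And>i. i \<in> I \<Longrightarrow> md (V i)) \<Longrightarrow> md (\<lambda>k z. \<Sum>i\<in>I. V i k z)"
  by (induction I rule: infinite_finite_induct) (auto intro: md_add md_zero)

lemma md_Cinf: "md V \<Longrightarrow> k < n \<Longrightarrow> Cinf_on n B (V k)"
proof -
  assume "md V" and k: "k < n"
  then obtain \<phi> where p: "\<And>a. a \<in> A \<Longrightarrow> Cinf_on n B (\<phi> a)" "\<And>z. z \<in> B \<Longrightarrow> V k z = (\<Sum>a\<in>A. \<phi> a z * Y a k z)"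
    unfolding in_span_def by blast
  have "Cinf_on n B (\<lambda>z. \<Sum>a\<in>A. \<phi> a z * Y a k z)"
    by (intro Cinf_sum[OF B] Cinf_mult[OF B] p(1) Y k)
  then show "Cinf_on n B (V k)" by (rule Cinf_cong[OF B]) (use p(2) in auto)
qed

lemma dirD_Cinf: "md V \<Longrightarrow> Cinf_on n B f \<Longrightarrow> Cinf_on n B (dirD n V f)"
  unfolding dirD_def[abs_def]
  by (intro Cinf_sum[OF B] Cinf_mult[OF B], erule md_Cinf, simp, erule Cinf_partial, simp)

lemma md_cong: "md V \<Longrightarrow> (\<And>k z. k < n \<Longrightarrow> z \<in> B \<Longrightarrow> W k z = V k z) \<Longrightarrow> md W"
  unfolding in_span_def by auto

text \<open>Leibniz' rule. Besides brackets of generators only generators themselves appear,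
  multiplied by derivatives of coefficients, and the module absorbs both.\<close>

lemma md_bracket:
  assumes V: "md V" and W: "md W" shows "md (cbracket n V W)"
proof -
  obtain \<phi> where p: "\<And>a. a \<in> A \<Longrightarrow> Cinf_on n B (\<phi> a)" "\<And>k z. k < n \<Longrightarrow> z \<in> B \<Longrightarrow> V k z = (\<Sum>a\<in>A. \<phi> a z * Y a k z)"
    using V unfolding in_span_def by blast
  obtain \<psi> where q: "\<And>a. a \<in> A \<Longrightarrow> Cinf_on n B (\<psi> a)" "\<And>k z. k < n \<Longrightarrow> z \<in> B \<Longrightarrow> W k z = (\<Sum>a\<in>A. \<psi> a z * Y a k z)"
    using W unfolding in_span_def by blast
  have lin: "dirD n U f z = (\<Sum>a\<in>A. \<theta> a z * dirD n (Y a) f z)"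
    if "\<And>k z. k < n \<Longrightarrow> z \<in> B \<Longrightarrow> U k z = (\<Sum>a\<in>A. \<theta> a z * Y a k z)" "z \<in> B" for U f z \<theta>
  proof -
    have "dirD n U f z = (\<Sum>k<n. \<Sum>a\<in>A. \<theta> a z * Y a k z * partial_deriv k f z)"
      unfolding dirD_def using that by (simp add: sum_distrib_right)
    then show ?thesis unfolding dirD_def by (subst (asm) sum.swap) (simp add: sum_distrib_left mult.assoc)
  qed
  have "cbracket n V W k z = (\<Sum>b\<in>A. dirD n V (\<psi> b) z * Y b k z) - (\<Sum>a\<in>A. dirD n W (\<phi> a) z * Y a k z)
      + (\<Sum>a\<in>A. \<Sum>b\<in>A. (\<phi> a z * \<psi> b z) * cbracket n (Y a) (Y b) k z)" if k: "k < n" and z: "z \<in> B" for k z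
  proof -
    have 1: "dirD n V (W k) z = (\<Sum>b\<in>A. dirD n V (\<psi> b) z * Y b k z) + (\<Sum>b\<in>A. \<psi> b z * dirD n V (Y b k) z)"
      using dirD_cong[OF B _ z, of "W k" "\<lambda>z. \<Sum>a\<in>A. \<psi> a z * Y a k z" V V] q(2)[OF k] dirD_sum_mult[of A n B \<psi> "\<lambda>b. Y b k" z, OF q(1) Y[OF _ k] z B]
      by (simp add: sum.distrib)
    have 2: "dirD n W (V k) z = (\<Sum>a\<in>A. dirD n W (\<phi> a) z * Y a k z) + (\<Sum>a\<in>A. \<phi> a z * dirD n W (Y a k) z)"
      using dirD_cong[OF B _ z, of "V k" "\<lambda>z. \<Sum>a\<in>A. \<phi> a z * Y a k z" W W] p(2)[OF k] dirD_sum_mult[of A n B \<phi> "\<lambda>b. Y b k" z, OF p(1) Y[OF _ k] z B]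
      by (simp add: sum.distrib)
    have linV: "dirD n V f z = (\<Sum>a\<in>A. \<phi> a z * dirD n (Y a) f z)" for f by (rule lin[OF p(2) z])
    have linW: "dirD n W f z = (\<Sum>a\<in>A. \<psi> a z * dirD n (Y a) f z)" for f by (rule lin[OF q(2) z])
    have 3: "(\<Sum>b\<in>A. \<psi> b z * dirD n V (Y b k) z) = (\<Sum>a\<in>A. \<Sum>b\<in>A. (\<phi> a z * \<psi> b z) * dirD n (Y a) (Y b k) z)"
      unfolding linV sum_distrib_left by (subst sum.swap) (simp add: mult_ac)
    have 4: "(\<Sum>a\<in>A. \<phi> a z * dirD n W (Y a k) z) = (\<Sum>a\<in>A. \<Sum>b\<in>A. (\<phi> a z * \<psi> b z) * dirD n (Y b) (Y a k) z)"
      unfolding linW sum_distrib_left by (simp add: mult_ac)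
    show ?thesis unfolding cbracket_dirD 1 2 3 4 right_diff_distrib sum_subtractf by simp
  qed
  moreover have "md (\<lambda>k z. (\<Sum>b\<in>A. dirD n V (\<psi> b) z * Y b k z) - (\<Sum>a\<in>A. dirD n W (\<phi> a) z * Y a k z)
      + (\<Sum>a\<in>A. \<Sum>b\<in>A. (\<phi> a z * \<psi> b z) * cbracket n (Y a) (Y b) k z))"
    by (intro md_add md_diff md_sum md_mult md_Y inv dirD_Cinf V W p q Cinf_mult[OF B])
  ultimately show ?thesis by (rule md_cong[rotated]) auto
qed

end

lemma (in involutive) restrict:
  assumes "B' \<subseteq> B" "eopen n B'" shows "involutive n B' A Y"
proof
  have *: "in_span n B' A Y V" if "md V" for V
    using that assms Cinf_subset unfolding in_span_def by (meson subsetD)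
  show "in_span n B' A Y (cbracket n (Y a) (Y b))" if "a \<in> A" "b \<in> A" for a b by (rule *[OF inv[OF that]])
qed (use A assms Cinf_subset[OF Y] in auto)

lemma (in involutive) md_restrict: "B' \<subseteq> B \<Longrightarrow> md V \<Longrightarrow> in_span n B' A Y V"
  using Cinf_subset unfolding in_span_def by (meson subsetD)

text \<open>A reduced echelon form with pivot columns \<open>\<sigma>\<close>, normalized on all of
  \<open>B\<close>. It bounds the rank of the family from below; away from a chosen point the rank
  may be larger.\<close>

definition echelon :: "nat \<Rightarrow> (nat \<Rightarrow> real) set \<Rightarrow> 'a set \<Rightarrow> ('a \<Rightarrow> vfield) \<Rightarrow> nat \<Rightarrow> (nat \<Rightarrow> nat) \<Rightarrow> (nat \<Rightarrow> vfield) \<Rightarrow> bool"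
  where "echelon n B A Y d \<sigma> b \<longleftrightarrow> inj_on \<sigma> {..<d} \<and> (\<forall>i<d. \<sigma> i < n \<and> in_span n B A Y (b i)) \<and>
    (\<forall>i<d. \<forall>j<d. \<forall>z\<in>B. b i (\<sigma> j) z = (if i = j then 1 else 0))"

lemma echelon_le: assumes "echelon n B A Y d \<sigma> b" shows "d \<le> n"
proof -
  have "card (\<sigma> ` {..<d}) \<le> card {..<n}" using assms by (intro card_mono) (auto simp: echelon_def)
  then show ?thesis using assms by (simp add: echelon_def card_image)
qed

text \<open>Gaussian elimination at \<open>z0\<close>: the residue of \<open>Y a\<close> modulo the
  \<open>b i\<close> has a nonzero component \<open>k0\<close> at \<open>z0\<close>, hence near it,
  and becomes a new pivot field after division by that component. The division is why
  \<open>B\<close> has to shrink.\<close>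

lemma (in involutive) echelon_step:
  assumes e: "echelon n B A Y d \<sigma> b" and z0: "z0 \<in> B" and a: "a \<in> A" "k0 < n"
    and ne: "Y a k0 z0 \<noteq> (\<Sum>i<d. Y a (\<sigma> i) z0 * b i k0 z0)"
  shows "\<exists>B' \<sigma>' b'. eopen n B' \<and> z0 \<in> B' \<and> B' \<subseteq> B \<and> echelon n B' A Y (Suc d) \<sigma>' b'"
proof -
  have s: "inj_on \<sigma> {..<d}" "\<And>i. i < d \<Longrightarrow> \<sigma> i < n" "\<And>i. i < d \<Longrightarrow> md (b i)"
    "\<And>i j z. i < d \<Longrightarrow> j < d \<Longrightarrow> z \<in> B \<Longrightarrow> b i (\<sigma> j) z = (if i = j then 1 else 0)"
    using e by (auto simp: echelon_def)
  define X where "X k z = Y a k z - (\<Sum>i<d. Y a (\<sigma> i) z * b i k z)" for k z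
  have Xm: "md X" unfolding X_def[abs_def] using a s by (intro md_diff md_Y md_sum md_mult Y) auto
  have Xs: "X (\<sigma> j) z = 0" if "j < d" "z \<in> B" for j z
  proof -
    have "(\<Sum>i<d. Y a (\<sigma> i) z * b i (\<sigma> j) z) = (\<Sum>i<d. if i = j then Y a (\<sigma> j) z else 0)"
      by (intro sum.cong) (use s(4) that in auto)
    then show ?thesis using that by (simp add: X_def)
  qed
  define B' where "B' = {z \<in> B. X k0 z \<noteq> 0}"
  have cX: "continuous_on B (X k0)" using Cinf_cont[OF md_Cinf[OF Xm a(2)] open_sub_eucl[OF B]] .
  have B': "eopen n B'"
  proof -
    have "openin (top_of_set B) (B \<inter> X k0 -` (- {0}))"
      using cX by (intro continuous_openin_preimage_gen) auto
    moreover have "B \<inter> X k0 -` (- {0}) = B'" by (auto simp: B'_def)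
    ultimately show ?thesis using B unfolding openin_eucl by (metis openin_trans)
  qed
  have z0': "z0 \<in> B'" using ne z0 by (simp add: B'_def X_def)
  have sub: "B' \<subseteq> B" by (auto simp: B'_def)
  interpret R: involutive n B' A Y by (rule restrict[OF sub B'])
  have k0: "k0 \<notin> \<sigma> ` {..<d}" using Xs[OF _ z0] z0' by (auto simp: B'_def)
  define c where "c k z = inverse (X k0 z) * X k z" for k z
  have cm: "R.md c" unfolding c_def[abs_def]
    by (intro R.md_mult Cinf_inverse[OF B'] md_restrict[OF sub Xm] Cinf_subset[OF md_Cinf[OF Xm a(2)] sub]) (auto simp: B'_def)
  \<comment> \<open>Index \<open>d\<close> receives the new pivot field; the older fields are
    cleared in column \<open>k0\<close> so as to remain dual to the enlarged
    \<open>\<sigma>'\<close>.\<close>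
  define b' where "b' i = (if i = d then c else (\<lambda>k z. b i k z - b i k0 z * c k z))" for i
  define \<sigma>' where "\<sigma>' = \<sigma>(d := k0)"
  have bm: "R.md (b' i)" if "i < Suc d" for i
  proof (cases "i = d")
    case False
    then have i: "i < d" using that by simp
    have "R.md (\<lambda>k z. b i k z - b i k0 z * c k z)"
      by (intro R.md_diff R.md_mult cm md_restrict[OF sub s(3)[OF i]] Cinf_subset[OF md_Cinf[OF s(3)[OF i] a(2)] sub])
    then show ?thesis using False by (simp add: b'_def)
  qed (simp add: b'_def cm)
  have cz: "c k0 z = 1" "j < d \<Longrightarrow> c (\<sigma> j) z = 0" if "z \<in> B'" for j z
    using that Xs[of j z] by (auto simp: c_def B'_def)
  have "echelon n B' A Y (Suc d) \<sigma>' b'"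
    unfolding echelon_def
  proof (intro conjI allI impI ballI)
    show "inj_on \<sigma>' {..<Suc d}" using s(1) k0 by (auto simp: \<sigma>'_def inj_on_def)
    show "\<sigma>' i < n" if "i < Suc d" for i using s(2)[of i] a(2) that by (auto simp: \<sigma>'_def)
    show "R.md (b' i)" if "i < Suc d" for i by (rule bm[OF that])
    show "b' i (\<sigma>' j) z = (if i = j then 1 else 0)" if "i < Suc d" "j < Suc d" "z \<in> B'" for i j z
      using that s(4)[of i j z] cz(1)[OF that(3)] cz(2)[OF that(3), of j] sub by (auto simp: b'_def \<sigma>'_def less_Suc_eq)
  qed
  then show ?thesis using B' z0' sub by blast
qed

text \<open>The length of a longest echelon form near \<open>z0\<close> is the rank at
  \<open>z0\<close>: a residue that did not vanish there could be added by
  \<open>echelon_step\<close>. Lengths are bounded by \<open>n\<close>, so a longest one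
  exists.\<close>

lemma (in involutive) echelon_max:
  assumes z0: "z0 \<in> B"
  shows "\<exists>B' d \<sigma> b. eopen n B' \<and> z0 \<in> B' \<and> B' \<subseteq> B \<and> echelon n B' A Y d \<sigma> b \<and>
    (\<forall>a\<in>A. \<forall>k<n. Y a k z0 = (\<Sum>i<d. Y a (\<sigma> i) z0 * b i k z0))"
proof -
  define Q where "Q d \<longleftrightarrow> (\<exists>B' \<sigma> b. eopen n B' \<and> z0 \<in> B' \<and> B' \<subseteq> B \<and> echelon n B' A Y d \<sigma> b)" for d
  have "Q 0" unfolding Q_def echelon_def using B z0 by auto
  moreover have "\<forall>d. Q d \<longrightarrow> d \<le> n" unfolding Q_def using echelon_le by blast
  ultimately obtain d where d: "Q d" "\<And>d'. Q d' \<Longrightarrow> d' \<le> d"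
    using Nat.ex_has_greatest_nat[of Q 0 n] by blast
  then obtain B' \<sigma> b where B': "eopen n B'" "z0 \<in> B'" "B' \<subseteq> B" "echelon n B' A Y d \<sigma> b"
    unfolding Q_def by blast
  interpret R: involutive n B' A Y by (rule restrict[OF B'(3,1)])
  have "Y a k z0 = (\<Sum>i<d. Y a (\<sigma> i) z0 * b i k z0)" if "a \<in> A" "k < n" for a k
  proof (rule ccontr)
    assume "Y a k z0 \<noteq> (\<Sum>i<d. Y a (\<sigma> i) z0 * b i k z0)"
    then have "Q (Suc d)" using R.echelon_step[OF B'(4,2) that] B'(3) unfolding Q_def by blast
    then show False using d(2) by fastforce
  qed
  then show ?thesis using B' by blast
qed

text \<open>Hermann's theorem. No constancy of the rank is needed.\<close>

theorem (in involutive) integral_surface: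
  assumes z0: "z0 \<in> B"
  shows "\<exists>d \<sigma> \<rho> F x. \<rho> > 0 \<and> F 0 = z0 \<and> inj_on \<sigma> {..<d} \<and> (\<forall>i<d. \<sigma> i < n) \<and>
    (\<forall>k<n. Cinf_on d (cbx d 0 \<rho>) (\<lambda>v. F v k)) \<and>
    (\<forall>v\<in>cbx d 0 \<rho>. F v \<in> B \<and> (\<forall>i<d. F v (\<sigma> i) = z0 (\<sigma> i) + v i) \<and>
      (\<forall>i<d. \<forall>k<n. partial_deriv i (\<lambda>v. F v k) v = (\<Sum>a\<in>A. x i a v * Y a k (F v))) \<and>
      (\<forall>a\<in>A. \<forall>k<n. Y a k (F v) = (\<Sum>i<d. Y a (\<sigma> i) (F v) * partial_deriv i (\<lambda>v. F v k) v)))"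
proof -
  obtain B' d \<sigma> b where B': "eopen n B'" "z0 \<in> B'" "B' \<subseteq> B" "echelon n B' A Y d \<sigma> b"
    and Y0: "\<forall>a\<in>A. \<forall>k<n. Y a k z0 = (\<Sum>i<d. Y a (\<sigma> i) z0 * b i k z0)"
    using echelon_max[OF z0] by blast
  interpret R: involutive n B' A Y by (rule restrict[OF B'(3,1)])
  have s: "inj_on \<sigma> {..<d}" "\<And>i. i < d \<Longrightarrow> \<sigma> i < n" "\<And>i. i < d \<Longrightarrow> R.md (b i)"
    "\<And>i j z. i < d \<Longrightarrow> j < d \<Longrightarrow> z \<in> B' \<Longrightarrow> b i (\<sigma> j) z = (if i = j then 1 else 0)"
    using B'(4) by (auto simp: echelon_def)
  \<comment> \<open>The residues of the \<open>Y a\<close> modulo the echelon fields, one function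
    for each component. They vanish at \<open>z0\<close>, and their common zero set consists of the
    points of \<open>B'\<close> where the rank is still \<open>d\<close>.\<close>
  define f where "f = (\<lambda>(a, k) z. Y a k z - (\<Sum>i<d. Y a (\<sigma> i) z * b i k z))"
  have fm: "R.md (\<lambda>k. f (a, k))" if "a \<in> A" for a
    unfolding f_def prod.case using that s by (intro R.md_diff R.md_Y R.md_sum R.md_mult R.Y) auto
  have fs: "f (a, \<sigma> j) z = 0" if "j < d" "z \<in> B'" for a j z
  proof -
    have "(\<Sum>i<d. Y a (\<sigma> i) z * b i (\<sigma> j) z) = (\<Sum>i<d. if i = j then Y a (\<sigma> j) z else 0)"
      by (intro sum.cong) (use s(4) that in auto)
    then show ?thesis using that by (simp add: f_def)
  qed
  \<comment> \<open>If \<open>V\<close> has no components in the pivot columns, the echelon parts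
    subtracted in the residues add up to \<open>\<Sum>i<d. V (\<sigma> i) * b i\<close>, which is 0;
    the coefficients of \<open>V\<close> over \<open>Y\<close> then serve unchanged over the
    residues.\<close>
  have red: "\<exists>\<theta>. (\<forall>a\<in>A. Cinf_on n B' (\<theta> a)) \<and> (\<forall>k<n. \<forall>z\<in>B'. V k z = (\<Sum>a\<in>A. \<theta> a z * f (a, k) z))"
    if V: "R.md V" and V0: "\<And>j z. j < d \<Longrightarrow> z \<in> B' \<Longrightarrow> V (\<sigma> j) z = 0" for V
  proof -
    obtain \<theta> where t: "\<forall>a\<in>A. Cinf_on n B' (\<theta> a)" "\<And>k z. k < n \<Longrightarrow> z \<in> B' \<Longrightarrow> V k z = (\<Sum>a\<in>A. \<theta> a z * Y a k z)"
      using V unfolding in_span_def by blast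
    have "V k z = (\<Sum>a\<in>A. \<theta> a z * f (a, k) z)" if k: "k < n" and z: "z \<in> B'" for k z
    proof -
      have "(\<Sum>a\<in>A. \<theta> a z * f (a, k) z) = V k z - (\<Sum>a\<in>A. \<Sum>i<d. \<theta> a z * (Y a (\<sigma> i) z * b i k z))"
        unfolding f_def prod.case right_diff_distrib sum_subtractf sum_distrib_left t(2)[OF k z] ..
      also have "(\<Sum>a\<in>A. \<Sum>i<d. \<theta> a z * (Y a (\<sigma> i) z * b i k z)) = (\<Sum>i<d. V (\<sigma> i) z * b i k z)"
        by (subst sum.swap) (use t(2)[OF s(2) z] in \<open>simp add: sum_distrib_right mult.assoc\<close>)
      also have "\<dots> = 0" using V0 z by simp
      finally show ?thesis by simp
    qed
    then show ?thesis using t(1) by blast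
  qed
  have const0: "partial_deriv l g z = 0" if "\<And>y. y \<in> B' \<Longrightarrow> g y = c" "z \<in> B'" "l < n" for l g z and c :: real
    using partial_deriv_cong[OF B'(1), of g "\<lambda>_. c" z l] that by (simp add: partial_deriv_const)
  define Q where "Q i a \<theta> \<longleftrightarrow> (\<forall>c\<in>A. Cinf_on n B' (\<theta> c)) \<and>
    (\<forall>k<n. \<forall>z\<in>B'. cbracket n (b i) (\<lambda>k. f (a, k)) k z = (\<Sum>c\<in>A. \<theta> c z * f (c, k) z))" for i a \<theta>
  \<comment> \<open>Pivot components are constant, 0 or 1 for \<open>b i\<close> and 0 for a
    residue, so those of the bracket vanish and \<open>red\<close> applies to it.\<close>
  have "\<exists>\<theta>. Q i a \<theta>" if i: "i < d" and a: "a \<in> A" for i a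
    unfolding Q_def
  proof (rule red)
    show "cbracket n (b i) (\<lambda>k. f (a, k)) (\<sigma> j) z = 0" if j: "j < d" and z: "z \<in> B'" for j z
      unfolding cbracket_def
    proof (rule sum.neutral, rule ballI)
      fix l assume "l \<in> {..<n}"
      then show "b i l z * partial_deriv l (f (a, \<sigma> j)) z - f (a, l) z * partial_deriv l (b i (\<sigma> j)) z = 0"
        using const0[of "f (a, \<sigma> j)" 0 z l] const0[of "b i (\<sigma> j)" _ z l, OF s(4)[OF i j]] fs[OF j] z by auto
    qed
  qed (intro R.md_bracket s(3) fm i a)
  then obtain \<theta> where "\<And>i a. i < d \<Longrightarrow> a \<in> A \<Longrightarrow> Q i a (\<theta> i a)" by metis
  then have th: "\<And>i a c. i < d \<Longrightarrow> a \<in> A \<Longrightarrow> c \<in> A \<Longrightarrow> Cinf_on n B' (\<theta> i a c)"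
    "\<And>i a k z. i < d \<Longrightarrow> a \<in> A \<Longrightarrow> k < n \<Longrightarrow> z \<in> B' \<Longrightarrow> cbracket n (b i) (\<lambda>k. f (a, k)) k z = (\<Sum>c\<in>A. \<theta> i a c z * f (c, k) z)"
    unfolding Q_def by blast+
  \<comment> \<open>Solving the bracket identity for the derivative of \<open>f (a, k)\<close> along
    \<open>b i\<close> leaves, besides the combination from \<open>red\<close> in the same component
    \<open>k\<close>, the terms where \<open>b i k\<close> is differentiated along the residue of
    \<open>a\<close> itself.\<close>
  define H where "H i = (\<lambda>(a, k) (c, l) z. (if l = k then \<theta> i a c z else 0) + (if c = a then partial_deriv l (b i k) z else 0))" for i
  have bC: "Cinf_on n B' (b i k)" if "i < d" "k < n" for i k by (rule R.md_Cinf[OF s(3)[OF that(1)] that(2)])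
  have "\<exists>\<rho>>0. \<exists>F. F 0 = z0 \<and> (\<forall>k<n. Cinf_on d (cbx d 0 \<rho>) (\<lambda>v. F v k)) \<and>
    (\<forall>v\<in>cbx d 0 \<rho>. F v \<in> B' \<and> (\<forall>a\<in>A \<times> {..<n}. f a (F v) = 0) \<and> (\<forall>i<d. F v (\<sigma> i) = z0 (\<sigma> i) + v i) \<and>
       (\<forall>i<d. \<forall>k<n. partial_deriv i (\<lambda>v. F v k) v = b i k (F v)))"
  proof (rule integral_surface_in_zero_set[OF B'(1,2) bC s(2) s(4), where H=H])
    show "finite (A \<times> {..<n})" using A by simp
    show "Cinf_on n B' (f a)" if "a \<in> A \<times> {..<n}" for a
      using R.md_Cinf[OF fm[of "fst a"], of "snd a"] that by auto
    show "f a z0 = 0" if "a \<in> A \<times> {..<n}" for a using that Y0 by (auto simp: f_def)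
    show "Cinf_on n B' (H i a c)" if "i < d" "a \<in> A \<times> {..<n}" "c \<in> A \<times> {..<n}" for i a c
    proof -
      obtain a' k c' l where eq: "a = (a', k)" "c = (c', l)" by fastforce
      have 1: "Cinf_on n B' (\<lambda>z. if l = k then \<theta> i a' c' z else 0)"
        using th(1)[of i a' c'] that eq Cinf_const[OF B'(1), of 0] by (cases "l = k") auto
      have 2: "Cinf_on n B' (\<lambda>z. if c' = a' then partial_deriv l (b i k) z else 0)"
        using Cinf_partial[OF bC[of i k], of l] that eq Cinf_const[OF B'(1), of 0] by (cases "c' = a'") auto
      show ?thesis using Cinf_add[OF B'(1) 1 2] by (simp add: H_def eq)
    qed
    show "dirD n (b i) (f a) z = (\<Sum>c\<in>A \<times> {..<n}. H i a c z * f c z)"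
      if i: "i < d" and a: "a \<in> A \<times> {..<n}" and z: "z \<in> B'" for i a z
    proof -
      obtain a' k where eq: "a = (a', k)" "a' \<in> A" "k < n" using a by auto
      have "(\<Sum>c\<in>A \<times> {..<n}. H i a c z * f c z) = (\<Sum>c\<in>A. \<Sum>l<n. H i a (c, l) z * f (c, l) z)"
        by (simp add: sum.cartesian_product)
      also have "\<dots> = (\<Sum>c\<in>A. \<Sum>l<n. (if l = k then \<theta> i a' c z * f (c, k) z else 0)) +
           (\<Sum>c\<in>A. \<Sum>l<n. (if c = a' then partial_deriv l (b i k) z * f (a', l) z else 0))"
        unfolding sum.distrib[symmetric] by (intro sum.cong refl) (auto simp: H_def eq distrib_right)
      also have "(\<Sum>c\<in>A. \<Sum>l<n. (if l = k then \<theta> i a' c z * f (c, k) z else 0)) = (\<Sum>c\<in>A. \<theta> i a' c z * f (c, k) z)"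
        using eq(3) by simp
      also have "(\<Sum>c\<in>A. \<Sum>l<n. (if c = a' then partial_deriv l (b i k) z * f (a', l) z else 0)) = (\<Sum>l<n. partial_deriv l (b i k) z * f (a', l) z)"
        by (subst sum.swap) (use eq(2) A in simp)
      also have "(\<Sum>c\<in>A. \<theta> i a' c z * f (c, k) z) + (\<Sum>l<n. partial_deriv l (b i k) z * f (a', l) z) = dirD n (b i) (f a) z"
        using th(2)[OF i eq(2,3) z] by (simp add: cbracket_def dirD_def eq sum_subtractf mult.commute)
      finally show ?thesis by simp
    qed
    show "dirD n (b i) (b j k) z = dirD n (b j) (b i k) z"
      if z: "z \<in> B'" and f0: "\<forall>a\<in>A \<times> {..<n}. f a z = 0" and ij: "i < d" "j < d" and k: "k < n" for i j k z
    proof -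
      \<comment> \<open>Again the pivot components are constant, so the bracket of
        \<open>b i\<close> and \<open>b j\<close> is a combination of residues and vanishes where
        they all do.\<close>
      have "\<exists>\<theta>. (\<forall>c\<in>A. Cinf_on n B' (\<theta> c)) \<and> (\<forall>k<n. \<forall>z\<in>B'. cbracket n (b i) (b j) k z = (\<Sum>c\<in>A. \<theta> c z * f (c, k) z))"
      proof (rule red)
        show "cbracket n (b i) (b j) (\<sigma> m) z = 0" if m: "m < d" and z: "z \<in> B'" for m z
          unfolding cbracket_def
        proof (rule sum.neutral, rule ballI)
          fix l assume "l \<in> {..<n}"
          then show "b i l z * partial_deriv l (b j (\<sigma> m)) z - b j l z * partial_deriv l (b i (\<sigma> m)) z = 0"
            using const0[of "b j (\<sigma> m)" _ z l, OF s(4)[OF ij(2) m]] const0[of "b i (\<sigma> m)" _ z l, OF s(4)[OF ij(1) m]] z by auto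
        qed
      qed (intro R.md_bracket s(3) ij)
      then have "cbracket n (b i) (b j) k z = 0" using f0 k z by auto
      then show ?thesis by (simp add: cbracket_dirD)
    qed
  qed
  then obtain \<rho> F where F: "\<rho> > 0" "F 0 = z0" "\<forall>k<n. Cinf_on d (cbx d 0 \<rho>) (\<lambda>v. F v k)"
    "\<And>v. v \<in> cbx d 0 \<rho> \<Longrightarrow> F v \<in> B'" "\<And>v a. v \<in> cbx d 0 \<rho> \<Longrightarrow> a \<in> A \<times> {..<n} \<Longrightarrow> f a (F v) = 0"
    "\<And>v i. v \<in> cbx d 0 \<rho> \<Longrightarrow> i < d \<Longrightarrow> F v (\<sigma> i) = z0 (\<sigma> i) + v i"
    "\<And>v i k. v \<in> cbx d 0 \<rho> \<Longrightarrow> i < d \<Longrightarrow> k < n \<Longrightarrow> partial_deriv i (\<lambda>v. F v k) v = b i k (F v)" by blast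
  have "\<forall>i. \<exists>x. i < d \<longrightarrow> (\<forall>k<n. \<forall>z\<in>B'. b i k z = (\<Sum>a\<in>A. x a z * Y a k z))"
    using s(3) unfolding in_span_def by blast
  then obtain x where x: "\<And>i k z. i < d \<Longrightarrow> k < n \<Longrightarrow> z \<in> B' \<Longrightarrow> b i k z = (\<Sum>a\<in>A. x i a z * Y a k z)" by metis
  have Yf: "Y a k (F v) = (\<Sum>i<d. Y a (\<sigma> i) (F v) * partial_deriv i (\<lambda>v. F v k) v)" if "v \<in> cbx d 0 \<rho>" "a \<in> A" "k < n" for v a k
    using F(5)[OF that(1), of "(a, k)"] F(7)[OF that(1) _ that(3)] that by (simp add: f_def)
  have "partial_deriv i (\<lambda>v. F v k) v = (\<Sum>a\<in>A. x i a (F v) * Y a k (F v))" if "v \<in> cbx d 0 \<rho>" "i < d" "k < n" for v i k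
    using F(7)[OF that] x[OF that(2,3) F(4)[OF that(1)]] by simp
  then show ?thesis
    using F(1-3,6) subsetD[OF B'(3) F(4)] s(1,2) Yf
    by (intro exI[of _ d] exI[of _ \<sigma>] exI[of _ \<rho>] exI[of _ F] exI[of _ "\<lambda>i a v. x i a (F v)"] conjI ballI allI impI) blast+
qed

section \<open>Quantifier elimination\<close>

lemma poly_sgn_eq:
  fixes p :: "real poly"
  assumes "\<And>x. min s t \<le> x \<Longrightarrow> x \<le> max s t \<Longrightarrow> poly p x \<noteq> 0"
  shows "sgn (poly p s) = sgn (poly p t)"
proof -
  have *: "sgn (poly p s) = sgn (poly p t)" if l: "s < t" "\<And>x. s \<le> x \<Longrightarrow> x \<le> t \<Longrightarrow> poly p x \<noteq> 0" for s t
  proof (rule ccontr)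
    assume n: "sgn (poly p s) \<noteq> sgn (poly p t)"
    have "poly p s \<noteq> 0" "poly p t \<noteq> 0" using l by auto
    then have "poly p s < 0 \<and> 0 < poly p t \<or> 0 < poly p s \<and> poly p t < 0" using n by (auto simp: sgn_if split: if_splits)
    then obtain x where "s < x" "x < t" "poly p x = 0"
      using poly_IVT_pos[OF l(1), of p] poly_IVT_neg[OF l(1), of p] by blast
    then show False using l(2)[of x] by simp
  qed
  show ?thesis
  proof (cases s t rule: linorder_cases)
    case less then show ?thesis by (intro *) (use assms in auto)
  next
    case greater then show ?thesis by (intro *[symmetric]) (use assms in auto)
  qed simp
qed

text \<open>The endpoints may come in either order, so that one notion serves to the left and to the
  right of a point; both of them are included.\<close>

definition free :: "real set \<Rightarrow> real \<Rightarrow> real \<Rightarrow> bool"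
  where "free A s t \<longleftrightarrow> (\<forall>x. min s t \<le> x \<and> x \<le> max s t \<longrightarrow> x \<notin> A)"

lemma free_image:
  assumes "strict_mono h" "surj h" shows "free (h ` A) (h s) (h t) \<longleftrightarrow> free A s t"
proof -
  have le: "h x \<le> h y \<longleftrightarrow> x \<le> y" for x y using assms(1) by (simp add: strict_mono_less_eq)
  have inj: "h x = h y \<longleftrightarrow> x = y" for x y using assms(1) by (simp add: strict_mono_eq)
  have "free (h ` A) (h s) (h t) \<longleftrightarrow> (\<forall>x. min (h s) (h t) \<le> h x \<and> h x \<le> max (h s) (h t) \<longrightarrow> h x \<notin> h ` A)"
    unfolding free_def using assms(2) by (metis surjE)
  also have "\<dots> \<longleftrightarrow> free A s t" unfolding free_def by (auto simp: min_def max_def le inj image_iff)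
  finally show ?thesis .
qed

text \<open>A positive derivative on a ray forces a positive leading coefficient of
  \<open>pderiv f\<close>, and with it one of \<open>f\<close>. Used beyond the last point of
  \<open>A\<close>.\<close>

lemma poly_eventually_pos:
  fixes f :: "real poly"
  assumes "\<And>t. t > a \<Longrightarrow> poly (pderiv f) t > 0"
  shows "\<exists>t>a. poly f t > 0"
proof -
  have "lead_coeff (pderiv f) > 0"
  proof (rule ccontr)
    assume n: "\<not> lead_coeff (pderiv f) > 0"
    have "pderiv f \<noteq> 0" using assms[of "a + 1"] by auto
    then have "lead_coeff (- pderiv f) > 0" using n by (simp add: degree_minus) (metis leading_coeff_0_iff linorder_neqE_linordered_idom)
    then obtain m where m: "\<forall>x\<ge>m. lead_coeff (- pderiv f) \<le> poly (- pderiv f) x" using poly_pinfty_gt_lc by blast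
    then have "poly (- pderiv f) (max m (a + 1)) > 0" using \<open>lead_coeff (- pderiv f) > 0\<close> by (meson less_le_trans max.cobounded1)
    moreover have "a < max m (a + 1)" by (simp add: less_max_iff_disj)
    ultimately show False using assms[of "max m (a + 1)"] by simp
  qed
  moreover have "degree f > 0"
  proof (rule ccontr)
    assume "\<not> degree f > 0"
    then have "pderiv f = 0" by (simp add: pderiv_eq_0_iff)
    then show False using assms[of "a + 1"] by simp
  qed
  ultimately have "lead_coeff f > 0" by (simp add: degree_pderiv coeff_pderiv zero_less_mult_iff)
  then obtain m where m: "\<forall>x\<ge>m. lead_coeff f \<le> poly f x" using poly_pinfty_gt_lc by blast
  then have "poly f (max m (a + 1)) > 0" using \<open>lead_coeff f > 0\<close> by (meson less_le_trans max.cobounded1)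
  then show ?thesis by (intro exI[of _ "max m (a + 1)"]) (simp add: less_max_iff_disj)
qed

text \<open>One step of the elimination: \<open>f\<close> and \<open>g\<close> are the same
  polynomial at two parameters, and \<open>h\<close> is the correspondence of sign diagrams found so
  far. It matches the derivatives everywhere and the polynomials themselves on \<open>A\<close>. As
  \<open>A\<close> contains the critical points of \<open>f\<close>, both are strictly monotone in
  the same sense on corresponding gaps, and only roots off \<open>A\<close> can be
  misplaced.\<close>

locale matched =
  fixes A :: "real set" and h :: "real \<Rightarrow> real" and f g :: "real poly"
  assumes A: "finite A" and h: "strict_mono h" "surj h"
    and d: "\<And>t. sgn (poly (pderiv f) t) = sgn (poly (pderiv g) (h t))"
    and dA: "\<And>t. poly (pderiv f) t = 0 \<Longrightarrow> t \<in> A"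
    and fA: "\<And>t. t \<in> A \<Longrightarrow> sgn (poly f t) = sgn (poly g (h t))"
begin

lemma hle: "h x \<le> h y \<longleftrightarrow> x \<le> y" and hlt: "h x < h y \<longleftrightarrow> x < y" and hinj: "h x = h y \<longleftrightarrow> x = y"
  using h(1) by (simp_all add: strict_mono_less_eq strict_mono_less strict_mono_eq)

lemma dsame: "free A s t \<Longrightarrow> sgn (poly (pderiv f) s) = sgn (poly (pderiv f) t)"
  by (rule poly_sgn_eq) (use dA in \<open>auto simp: free_def\<close>)

text \<open>An increasing \<open>f\<close> that turns positive before the next point
  \<open>a\<close> of \<open>A\<close> is positive at \<open>a\<close>; this sign is shared by
  \<open>g\<close>, which by continuity is positive slightly before \<open>h a\<close> too. To the
  right of all of \<open>A\<close> the conclusion comes from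
  \<open>poly_eventually_pos\<close>.\<close>

lemma right:
  assumes t: "t \<notin> A" "poly (pderiv f) t > 0" and s: "s \<ge> t" "free A t s" "poly f s > 0"
  shows "\<exists>s'\<ge>h t. free (h ` A) (h t) s' \<and> poly g s' > 0"
proof (cases "\<exists>a\<in>A. a > t")
  case True
  define a where "a = Min {a\<in>A. a > t}"
  have fin: "finite {a\<in>A. a > t}" "{a\<in>A. a > t} \<noteq> {}" using A True by auto
  have a: "a \<in> A" "a > t" using Min_in[OF fin] by (auto simp: a_def)
  have amin: "b \<ge> a" if "b \<in> A" "b > t" for b using that fin by (auto simp: a_def)
  have sa: "s < a" 
  proof (rule ccontr)
    assume "\<not> s < a"
    then show False using s(1,2) a unfolding free_def by (metis less_imp_le max.absorb2 min.absorb1 not_less)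
  qed
  have fr: "free A t x" if "t \<le> x" "x < a" for x using that amin t unfolding free_def by (force simp: min_def max_def)
  obtain x where x: "s < x" "x < a" "poly f a - poly f s = (a - s) * poly (pderiv f) x" using poly_MVT[OF sa] by blast
  have "poly (pderiv f) x > 0" using dsame[OF fr[of x]] x s t by (simp add: sgn_1_pos[symmetric])
  then have "(a - s) * poly (pderiv f) x > 0" using sa by simp
  then have "poly f a > 0" using x s by linarith
  then have ga: "poly g (h a) > 0" using fA[OF a(1)] by (metis sgn_greater)
  have "isCont (poly g) (h a)" by simp
  then obtain e where e: "e > 0" "\<And>y. \<bar>y - h a\<bar> < e \<Longrightarrow> \<bar>poly g y - poly g (h a)\<bar> < poly g (h a)"
    using ga unfolding continuous_at_eps_delta by (metis dist_real_def)
  \<comment> \<open>Slightly before \<open>h a\<close>, where \<open>g\<close> is still positive,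
    yet not before \<open>h t\<close>.\<close>
  define s' where "s' = max (h t) (h a - e / 2)"
  have hta: "h t < h a" using a hlt by simp
  have "\<bar>s' - h a\<bar> < e" using e hta by (auto simp: s'_def max_def)
  then have "poly g s' > 0" using e(2)[of s'] by linarith
  moreover have "free (h ` A) (h t) s'"
  proof -
    obtain w where w: "s' = h w" using h(2) by (metis surjE)
    have "h w < h a" "h t \<le> h w" using e hta by (auto simp: w[symmetric] s'_def max_def)
    then show ?thesis unfolding w free_image[OF h] using fr[of w] hlt hle by simp
  qed
  ultimately show ?thesis by (intro exI[of _ s']) (auto simp: s'_def)
next
  case False
  then have fr: "free A t x" if "t \<le> x" for x using that t(1) by (force simp: free_def min_def max_def)
  have "poly (pderiv g) y > 0" if "y > h t" for y
  proof -
    obtain w where w: "y = h w" using h(2) by (metis surjE)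
    have "t \<le> w" using that w hlt[of t w] by simp
    from dsame[OF fr[OF this]] show ?thesis using t(2) d[of w] w by (metis sgn_greater)
  qed
  then obtain y where y: "y > h t" "poly g y > 0" using poly_eventually_pos by blast
  obtain w where w: "y = h w" using h(2) by (metis surjE)
  have "free (h ` A) (h t) y" unfolding w free_image[OF h] using fr[of w] y w hlt by (simp add: less_imp_le)
  then show ?thesis using y by (intro exI[of _ y]) auto
qed

text \<open>Both graphs are rotated by a half turn, \<open>f\<close> becoming
  \<open>- f (- t)\<close>. The sign of the derivative is kept while left and right, negative and
  positive change places, so each one-sided statement is proved once.\<close>

lemma mirror: "matched (uminus ` A) (\<lambda>t. - h (- t)) (- pcompose f [:0, -1:]) (- pcompose g [:0, -1:])"
proof
  have pd: "pderiv (- pcompose f [:0, -1:]) = pcompose (pderiv f) [:0, -1:]" for f :: "real poly"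
    by (simp add: pderiv_pcompose pderiv_minus pderiv_pCons)
  show "strict_mono (\<lambda>t. - h (- t))" using h(1) by (auto simp: strict_mono_def)
  show "surj (\<lambda>t. - h (- t))"
    unfolding surj_def
  proof
    fix y obtain w where "- y = h w" using h(2) by (metis surjE)
    then show "\<exists>x. y = - h (- x)" by (intro exI[of _ "- w"]) simp
  qed
  show "sgn (poly (pderiv (- pcompose f [:0, -1:])) t) = sgn (poly (pderiv (- pcompose g [:0, -1:])) (- h (- t)))" for t
    unfolding pd using d[of "- t"] by (simp add: poly_pcompose)
  show "poly (pderiv (- pcompose f [:0, -1:])) t = 0 \<Longrightarrow> t \<in> uminus ` A" for t
    unfolding pd using dA[of "- t"] by (auto simp: poly_pcompose image_iff) (metis minus_minus)
  show "sgn (poly (- pcompose f [:0, -1:]) t) = sgn (poly (- pcompose g [:0, -1:]) (- h (- t)))" if "t \<in> uminus ` A" for t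
    using that fA[of "- t"] by (auto simp: poly_pcompose sgn_minus)
qed (use A in auto)

lemma left:
  assumes t: "t \<notin> A" "poly (pderiv f) t > 0" and s: "s \<le> t" "free A t s" "poly f s < 0"
  shows "\<exists>s'\<le>h t. free (h ` A) (h t) s' \<and> poly g s' < 0"
proof -
  interpret m: matched "uminus ` A" "\<lambda>t. - h (- t)" "- pcompose f [:0, -1:]" "- pcompose g [:0, -1:]" by (rule mirror)
  have fr: "free (uminus ` B) (- x) (- y) \<longleftrightarrow> free B x y" for B x y
  proof -
    have "free (uminus ` B) (- x) (- y) \<longleftrightarrow> (\<forall>z. min (- x) (- y) \<le> - z \<and> - z \<le> max (- x) (- y) \<longrightarrow> - z \<notin> uminus ` B)"
      unfolding free_def by (metis minus_minus)
    then show ?thesis unfolding free_def by (auto simp: min_def max_def image_iff)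
  qed
  have pd: "poly (pderiv (- pcompose f [:0, -1:])) (- t) = poly (pderiv f) t"
    by (simp add: pderiv_pcompose pderiv_minus pderiv_pCons poly_pcompose)
  have im: "(\<lambda>t. - h (- t)) ` uminus ` A = uminus ` (h ` A)" by (auto simp: image_image)
  have "\<exists>s'\<ge>- h (- (- t)). free ((\<lambda>t. - h (- t)) ` uminus ` A) (- h (- (- t))) s' \<and> poly (- pcompose g [:0, -1:]) s' > 0"
    by (rule m.right[of "- t" "- s"]) (use t s fr pd in \<open>auto simp: poly_pcompose\<close>)
  then obtain s' where "s' \<ge> - h t" "free (uminus ` (h ` A)) (- h t) (- (- s'))" "poly g (- s') < 0"
    unfolding im by (auto simp: poly_pcompose)
  then show ?thesis unfolding fr by (intro exI[of _ "- s'"]) auto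
qed

lemma pos_inc:
  assumes "free A s t" "s < t" "poly (pderiv f) s > 0" shows "poly f s < poly f t"
proof -
  obtain x where x: "s < x" "x < t" "poly f t - poly f s = (t - s) * poly (pderiv f) x" using poly_MVT[OF assms(2)] by blast
  have "free A s x" using assms(1) x by (auto simp: free_def min_def max_def split: if_splits)
  then have "poly (pderiv f) x > 0" using dsame assms(3) by (metis sgn_greater)
  then have "(t - s) * poly (pderiv f) x > 0" using assms(2) by simp
  then show ?thesis using x by linarith
qed

lemma nbhd: assumes "t \<notin> A" shows "\<exists>e>0. free A (t - e) (t + e)"
proof -
  define e where "e = Min (insert 1 ((\<lambda>a. \<bar>a - t\<bar>) ` A)) / 2"
  have "Min (insert 1 ((\<lambda>a. \<bar>a - t\<bar>) ` A)) > 0" using A assms by auto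
  moreover have "Min (insert 1 ((\<lambda>a. \<bar>a - t\<bar>) ` A)) \<le> \<bar>a - t\<bar>" if "a \<in> A" for a using A that by auto
  ultimately have e: "e > 0" "\<And>a. a \<in> A \<Longrightarrow> \<bar>a - t\<bar> > e" by (auto simp: e_def) force
  then have "free A (t - e) (t + e)" unfolding free_def by (force simp: min_def max_def)
  then show ?thesis using e by blast
qed

lemma near_root:
  assumes "t \<notin> A" "poly (pderiv f) t > 0"
  shows "poly f t \<le> 0 \<Longrightarrow> \<exists>s\<le>t. free A t s \<and> poly f s < 0"
    and "poly f t \<ge> 0 \<Longrightarrow> \<exists>s\<ge>t. free A t s \<and> poly f s > 0"
proof -
  obtain e where e: "e > 0" "free A (t - e) (t + e)" using nbhd[OF assms(1)] by blast
  have f1: "free A (t - e) t" "free A t (t + e)" "free A t (t - e)" using e by (auto simp: free_def)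
  have "poly (pderiv f) (t - e) > 0" using dsame[OF f1(1)] assms(2) by (metis sgn_greater)
  then have "poly f (t - e) < poly f t" "poly f t < poly f (t + e)"
    using pos_inc[OF f1(1)] pos_inc[OF f1(2)] assms(2) e by auto
  note lt = this
  show "\<exists>s\<le>t. free A t s \<and> poly f s < 0" if "poly f t \<le> 0"
    using e f1 lt that by (intro exI[of _ "t - e"]) auto
  show "\<exists>s\<ge>t. free A t s \<and> poly f s > 0" if "poly f t \<ge> 0"
    using e f1 lt that by (intro exI[of _ "t + e"]) auto
qed

text \<open>The situation is symmetric in \<open>f\<close> and \<open>g\<close>; a wrong sign of
  \<open>g\<close> can thus be pulled back to \<open>f\<close>.\<close>

lemma inverse: "matched (h ` A) (inv h) g f"
proof
  have hi: "h (inv h y) = y" for y using h(2) by (simp add: surj_f_inv_f)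
  show "strict_mono (inv h)" using hi hlt unfolding strict_mono_def by metis
  show "surj (inv h)" using h(1) by (meson inj_imp_surj_inv strict_mono_imp_inj_on)
  show "sgn (poly (pderiv g) t) = sgn (poly (pderiv f) (inv h t))" for t using d[of "inv h t"] hi by simp
  show "t \<in> h ` A" if "poly (pderiv g) t = 0" for t
    using d[of "inv h t"] dA[of "inv h t"] that hi by (metis imageI sgn_0 sgn_0_0)
  show "sgn (poly g t) = sgn (poly f (inv h t))" if tA: "t \<in> h ` A" for t
  proof -
    obtain a where a: "a \<in> A" "t = h a" using tA by blast
    then have "inv h t = a" using h(1) by (simp add: strict_mono_imp_inj_on)
    then show ?thesis using fA[OF a(1)] a by simp
  qed
qed (use A in auto)

lemma negate: "matched A h (- f) (- g)"
  by standard (use A h d dA fA in \<open>auto simp: pderiv_minus sgn_minus\<close>)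

text \<open>Values of both signs near \<open>b\<close> are carried over by \<open>left\<close> and
  \<open>right\<close>, and the intermediate value theorem gives a root. It need not be
  \<open>h b\<close>; it only lies in the same gap of the image of \<open>A\<close>, and
  \<open>adjust\<close> moves \<open>h\<close> accordingly.\<close>

lemma root_exists_pos:
  assumes b: "b \<notin> A" "poly f b = 0" and p: "poly (pderiv f) b > 0"
  shows "\<exists>b'. poly g b' = 0 \<and> free (h ` A) (h b) b'"
proof -
  obtain s1 s2 where "s1 \<le> b" "free A b s1" "poly f s1 < 0" "s2 \<ge> b" "free A b s2" "poly f s2 > 0"
    using near_root[OF b(1) p] b(2) by auto
  then obtain r1 r2 where r: "r1 \<le> h b" "free (h ` A) (h b) r1" "poly g r1 < 0" "r2 \<ge> h b" "free (h ` A) (h b) r2" "poly g r2 > 0"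
    using left[OF b(1) p] right[OF b(1) p] by metis
  then have "r1 < r2" by (cases "r1 = r2") auto
  then obtain b' where "r1 < b'" "b' < r2" "poly g b' = 0" using poly_IVT_pos r by blast
  moreover have "free (h ` A) (h b) b'"
    using r \<open>r1 < b'\<close> \<open>b' < r2\<close> unfolding free_def by (cases "b' \<le> h b") (auto simp: min_def max_def split: if_splits)
  ultimately show ?thesis by blast
qed

lemma root_exists:
  assumes b: "b \<notin> A" "poly f b = 0"
  shows "\<exists>b'. poly g b' = 0 \<and> free (h ` A) (h b) b'"
proof -
  have "poly (pderiv f) b \<noteq> 0" using dA b by blast
  then consider "poly (pderiv f) b > 0" | "poly (pderiv f) b < 0" by linarith
  then show ?thesis
  proof cases
    case 1 then show ?thesis using root_exists_pos[OF b] by blast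
  next
    case 2
    interpret m: matched A h "- f" "- g" by (rule negate)
    show ?thesis using m.root_exists_pos[of b] b 2 by (simp add: pderiv_minus)
  qed
qed

text \<open>Were \<open>g (h t)\<close> not positive, \<open>left\<close> for the inverse
  correspondence would give a negative value of \<open>f\<close> before \<open>t\<close> in the same
  gap, hence a root \<open>b\<close> of \<open>f\<close> in between. By \<open>roots\<close> its
  image is a root of \<open>g\<close>, from which \<open>g\<close> increases up to
  \<open>h t\<close>.\<close>

lemma pos_pos:
  assumes roots: "\<And>b. b \<notin> A \<Longrightarrow> poly f b = 0 \<Longrightarrow> poly g (h b) = 0"
    and t: "t \<notin> A" "poly (pderiv f) t > 0" "poly f t > 0"
  shows "poly g (h t) > 0"
proof (rule ccontr)
  assume n: "\<not> poly g (h t) > 0"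
  interpret i: matched "h ` A" "inv h" g f by (rule inverse)
  have ht: "h t \<notin> h ` A" using t(1) hinj by auto
  have gd: "poly (pderiv g) (h t) > 0" using d[of t] t(2) by (metis sgn_greater)
  obtain r where r: "r \<le> h t" "free (h ` A) (h t) r" "poly g r < 0" using i.near_root(1)[OF ht gd] n by auto
  have ii: "inv h (h t) = t" using h(1) by (simp add: strict_mono_imp_inj_on)
  have ia: "inv h ` h ` A = A" using h(1) by (simp add: image_image strict_mono_imp_inj_on)
  obtain s where s: "s \<le> t" "free A t s" "poly f s < 0" using i.left[OF ht gd r] unfolding ii ia by blast
  then have "s < t" using t(3) by (cases "s = t") auto
  then obtain b where b: "s < b" "b < t" "poly f b = 0" using poly_IVT_pos s t(3) by blast
  have bA: "b \<notin> A" "free A b t" using s b by (auto simp: free_def min_def max_def split: if_splits)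
  have "poly g (h b) = 0" by (rule roots[OF bA(1) b(3)])
  moreover have "poly g (h b) < poly g (h t)"
  proof (rule i.pos_inc)
    show "free (h ` A) (h b) (h t)" using free_image[OF h] bA by simp
    show "h b < h t" using hlt b by simp
    have "poly (pderiv f) b > 0" using dsame[OF bA(2)] t(2) by (metis sgn_greater)
    then show "poly (pderiv g) (h b) > 0" using d[of b] by (metis sgn_greater)
  qed
  ultimately show False using n by simp
qed

lemma neg_neg:
  assumes roots: "\<And>b. b \<notin> A \<Longrightarrow> poly f b = 0 \<Longrightarrow> poly g (h b) = 0"
    and t: "t \<notin> A" "poly (pderiv f) t > 0" "poly f t < 0"
  shows "poly g (h t) < 0"
proof -
  interpret m: matched "uminus ` A" "\<lambda>t. - h (- t)" "- pcompose f [:0, -1:]" "- pcompose g [:0, -1:]" by (rule mirror)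
  have "poly (- pcompose g [:0, -1:]) (- h (- (- t))) > 0"
    by (rule m.pos_pos) (use roots t in \<open>auto simp: poly_pcompose image_iff pderiv_pcompose pderiv_minus pderiv_pCons\<close>, metis minus_minus)
  then show ?thesis by (simp add: poly_pcompose)
qed

lemma all_signs:
  assumes roots: "\<And>b. b \<notin> A \<Longrightarrow> poly f b = 0 \<Longrightarrow> poly g (h b) = 0"
  shows "sgn (poly f t) = sgn (poly g (h t))"
proof (cases "t \<in> A \<or> poly f t = 0")
  case True then show ?thesis using fA[of t] roots[of t] by (cases "t \<in> A") auto
next
  case False
  interpret m: matched A h "- f" "- g" by (rule negate)
  have "poly (pderiv f) t \<noteq> 0" using dA False by blast
  then consider "poly (pderiv f) t > 0" | "poly (pderiv f) t < 0" by linarith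
  then show ?thesis
  proof cases
    case 1 show ?thesis using pos_pos[OF roots, of t] neg_neg[OF roots, of t] 1 False by (auto simp: sgn_if)
  next
    case 2 show ?thesis using m.pos_pos[of t] m.neg_neg[of t] 2 False roots by (auto simp: sgn_if pderiv_minus)
  qed
qed

end

text \<open>Piecewise linear, and broken inside the interval only at \<open>s\<close>; exchanging
  \<open>s\<close> and \<open>s'\<close> gives the inverse map, whence surjectivity.\<close>

lemma move_point:
  fixes L R s s' :: real
  assumes "L < s" "s < R" "L < s'" "s' < R"
  shows "\<exists>\<phi>. strict_mono \<phi> \<and> surj \<phi> \<and> \<phi> s = s' \<and> (\<forall>t. t \<le> L \<or> t \<ge> R \<longrightarrow> \<phi> t = t) \<and> (\<forall>t. L < t \<and> t < R \<longrightarrow> L < \<phi> t \<and> \<phi> t < R)"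
proof -
  define \<phi> where "\<phi> s s' t = (if t \<le> L \<or> t \<ge> R then t else if t \<le> s then L + (t - L) * ((s' - L) / (s - L)) else R - (R - t) * ((R - s') / (R - s)))" for s s' t
  have in1: "L < \<phi> s s' t \<and> \<phi> s s' t \<le> s'" if "L < t" "t \<le> s" "L < s" "s < R" "L < s'" "s' < R" for s s' t
  proof -
    have "(t - L) * ((s' - L) / (s - L)) > 0" using that by simp
    moreover have "(t - L) * ((s' - L) / (s - L)) \<le> (s - L) * ((s' - L) / (s - L))" using that by (intro mult_right_mono) auto
    moreover have "(s - L) * ((s' - L) / (s - L)) = s' - L" using that by simp
    ultimately show ?thesis using that by (simp add: \<phi>_def)
  qed
  have in2: "s' < \<phi> s s' t \<and> \<phi> s s' t < R" if "s < t" "t < R" "L < s" "s < R" "L < s'" "s' < R" for s s' t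
  proof -
    have "(R - t) * ((R - s') / (R - s)) > 0" using that by simp
    moreover have "(R - t) * ((R - s') / (R - s)) < (R - s) * ((R - s') / (R - s))" using that by (intro mult_strict_right_mono) auto
    moreover have "(R - s) * ((R - s') / (R - s)) = R - s'" using that by simp
    ultimately show ?thesis using that by (simp add: \<phi>_def)
  qed
  have rng: "L < \<phi> s s' t \<and> \<phi> s s' t < R" if "L < t" "t < R" for t
    using in1[of t s s'] in2[of s t s'] assms that by (cases "t \<le> s") auto
  have fixd: "\<phi> s s' t = t" if "t \<le> L \<or> t \<ge> R" for t using that by (auto simp: \<phi>_def)
  have mono: "\<phi> s s' t < \<phi> s s' u" if "t < u" for t u
  proof -
    consider "t \<le> L \<or> u \<ge> R" | "L < t" "u \<le> s" | "L < t" "t \<le> s" "s < u" "u < R" | "s < t" "u < R" using that by linarith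
    then show ?thesis
    proof cases
      case 1
      then show ?thesis using rng[of t] rng[of u] fixd[of t] fixd[of u] that assms
        by (cases "t \<le> L \<or> t \<ge> R"; cases "u \<le> L \<or> u \<ge> R") auto
    next
      case 2
      have "(t - L) * ((s' - L) / (s - L)) < (u - L) * ((s' - L) / (s - L))"
        using that assms by (intro mult_strict_right_mono) auto
      then show ?thesis using 2 that assms by (simp add: \<phi>_def)
    next
      case 3 then show ?thesis using in1[of t s s'] in2[of s u s'] assms by linarith
    next
      case 4
      have "(R - u) * ((R - s') / (R - s)) < (R - t) * ((R - s') / (R - s))"
        using that assms by (intro mult_strict_right_mono) auto
      then show ?thesis using 4 that assms by (simp add: \<phi>_def)
    qed
  qed
  have inv: "\<phi> s s' (\<phi> s' s y) = y" for y
  proof -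
    consider "y \<le> L \<or> y \<ge> R" | "L < y" "y \<le> s'" | "s' < y" "y < R" by linarith
    then show ?thesis
    proof cases
      case 1 then show ?thesis by (simp add: \<phi>_def)
    next
      case 2
      then have "\<phi> s' s y = L + (y - L) * ((s - L) / (s' - L))" using assms by (simp add: \<phi>_def)
      moreover have "L < \<phi> s' s y \<and> \<phi> s' s y \<le> s" using in1[of y s' s] 2 assms by simp
      ultimately show ?thesis using assms by (simp add: \<phi>_def[of s s'])
    next
      case 3
      then have "\<phi> s' s y = R - (R - y) * ((R - s) / (R - s'))" using assms by (simp add: \<phi>_def)
      moreover have "s < \<phi> s' s y \<and> \<phi> s' s y < R" using in2[of s' y s] 3 assms by simp
      ultimately show ?thesis using assms by (simp add: \<phi>_def[of s s'])
    qed
  qed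
  have "strict_mono (\<phi> s s')" using mono by (simp add: strict_mono_def)
  moreover have "surj (\<phi> s s')" using inv by (metis surjI)
  moreover have "\<phi> s s' s = s'" using assms by (simp add: \<phi>_def)
  ultimately show ?thesis using rng fixd by (intro exI[of _ "\<phi> s s'"]) blast
qed


text \<open>Roots of \<open>f\<close> off \<open>A\<close> are aligned one after another, by
  composing \<open>h\<close> with a map supported in a gap of the image of \<open>A\<close>. The
  nonzero members of the pairs in \<open>M\<close> have their zeros in \<open>A\<close>, so the
  signs of their partners are constant on the gap and survive.\<close>

lemma (in matched) adjust:
  assumes B0: "finite B0"
    and M: "\<And>u v t. (u, v) \<in> M \<Longrightarrow> sgn (poly u t) = sgn (poly v (h t))"
    and MA: "\<And>u v t. (u, v) \<in> M \<Longrightarrow> u \<noteq> 0 \<Longrightarrow> poly u t = 0 \<Longrightarrow> t \<in> A"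
    and fr: "\<And>b. b \<in> B0 \<Longrightarrow> b \<notin> A \<and> poly f b = 0"
  shows "\<exists>h'. matched A h' f g \<and> (\<forall>u v t. (u, v) \<in> M \<longrightarrow> sgn (poly u t) = sgn (poly v (h' t))) \<and> (\<forall>b\<in>B0. poly g (h' b) = 0)"
  using B0 fr
proof (induction B0 rule: finite_induct)
  case empty
  then show ?case using M matched_axioms by (intro exI[of _ h]) auto
next
  case (insert b B0)
  then obtain h' where h': "matched A h' f g" "\<And>u v t. (u, v) \<in> M \<Longrightarrow> sgn (poly u t) = sgn (poly v (h' t))"
    "\<And>b. b \<in> B0 \<Longrightarrow> poly g (h' b) = 0" by auto
  interpret m: matched A h' f g by (rule h'(1))
  have b: "b \<notin> A" "poly f b = 0" using insert.prems by auto
  obtain b' where b': "poly g b' = 0" "free (h' ` A) (h' b) b'" using m.root_exists[OF b] by blast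
  have nA: "h' b \<notin> h' ` A" "b' \<notin> h' ` A" using b' by (auto simp: free_def min_def max_def)
  interpret i: matched "h' ` A" "inv h'" g f by (rule m.inverse)
  obtain e1 where e1: "e1 > 0" "free (h' ` A) (h' b - e1) (h' b + e1)" using i.nbhd[OF nA(1)] by blast
  obtain e2 where e2: "e2 > 0" "free (h' ` A) (b' - e2) (b' + e2)" using i.nbhd[OF nA(2)] by blast
  \<comment> \<open>The interval is enlarged by \<open>e\<close> on both sides because
    \<open>move_point\<close> fixes its ends, while \<open>h' b\<close> and \<open>b'\<close> must
    lie strictly inside.\<close>
  define e where "e = min e1 e2"
  define L where "L = min (h' b) b' - e"
  define R where "R = max (h' b) b' + e"
  have LR: "L < h' b" "h' b < R" "L < b'" "b' < R" using e1 e2 by (auto simp: L_def R_def e_def)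
  have frLR: "x \<notin> h' ` A" if xx: "L \<le> x" "x \<le> R" for x
  proof -
    have "min (h' b) b' \<le> x \<and> x \<le> max (h' b) b' \<or> h' b - e1 \<le> x \<and> x \<le> h' b + e1 \<or> b' - e2 \<le> x \<and> x \<le> b' + e2"
      using xx e1(1) e2(1) unfolding L_def R_def e_def min_def max_def by (auto split: if_splits)
    then consider "min (h' b) b' \<le> x \<and> x \<le> max (h' b) b'" | "h' b - e1 \<le> x \<and> x \<le> h' b + e1" | "b' - e2 \<le> x \<and> x \<le> b' + e2"
      by blast
    then show ?thesis using b'(2) e1 e2 unfolding free_def by cases (auto simp: min_def max_def)
  qed
  obtain \<phi> where p: "strict_mono \<phi>" "surj \<phi>" "\<phi> (h' b) = b'" "\<And>t. t \<le> L \<or> t \<ge> R \<Longrightarrow> \<phi> t = t"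
    "\<And>t. L < t \<Longrightarrow> t < R \<Longrightarrow> L < \<phi> t \<and> \<phi> t < R"
    using move_point[OF LR] by metis
  have same: "sgn (poly w (\<phi> t)) = sgn (poly w t)" if "\<And>x. poly w x = 0 \<Longrightarrow> x \<in> h' ` A" for w t
  proof (cases "L < t \<and> t < R")
    case True
    show ?thesis
    proof (rule poly_sgn_eq)
      fix x assume "min (\<phi> t) t \<le> x" "x \<le> max (\<phi> t) t"
      then have "L \<le> x" "x \<le> R" using True p(5)[of t] by (auto simp: min_def max_def split: if_splits)
      then show "poly w x \<noteq> 0" using frLR that by blast
    qed
  next
    case False then show ?thesis using p(4)[of t] by (simp add: not_less)
  qed
  \<comment> \<open>If \<open>u\<close> is the zero polynomial, its roots are not confined to
    \<open>A\<close>; but then \<open>v\<close> vanishes on the range of \<open>h'\<close>, which is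
    everything.\<close>
  have Ms: "sgn (poly u t) = sgn (poly v (\<phi> (h' t)))" if uv: "(u, v) \<in> M" for u v t
  proof (cases "u = 0")
    case True
    have "poly v y = 0" for y
    proof -
      obtain x where "y = h' x" using m.h(2) by (metis surjE)
      then show ?thesis using h'(2)[OF uv, of x] True by (metis poly_0 sgn_0 sgn_0_0)
    qed
    then show ?thesis using True by simp
  next
    case False
    have "x \<in> h' ` A" if "poly v x = 0" for x
    proof -
      obtain y where y: "x = h' y" using m.h(2) by (metis surjE)
      then have "poly u y = 0" using h'(2)[OF uv, of y] that by (metis sgn_0 sgn_0_0)
      then show ?thesis using MA[OF uv False] y by blast
    qed
    then show ?thesis using same[of v "h' t"] h'(2)[OF uv, of t] by simp
  qed
  have gd: "x \<in> h' ` A" if "poly (pderiv g) x = 0" for x by (rule i.dA[OF that])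
  have fixA: "\<phi> (h' a) = h' a" if "a \<in> A" for a
    using p(4)[of "h' a"] frLR[of "h' a"] that by force
  have new: "matched A (\<lambda>t. \<phi> (h' t)) f g"
  proof
    show "strict_mono (\<lambda>t. \<phi> (h' t))" using p(1) m.h(1) by (simp add: strict_mono_def)
    show "surj (\<lambda>t. \<phi> (h' t))" using comp_surj[OF m.h(2) p(2)] by (simp add: comp_def)
    show "sgn (poly (pderiv f) t) = sgn (poly (pderiv g) (\<phi> (h' t)))" for t
      using same[of "pderiv g" "h' t", OF gd] m.d[of t] by simp
    show "sgn (poly f t) = sgn (poly g (\<phi> (h' t)))" if "t \<in> A" for t using m.fA[OF that] fixA[OF that] by simp
  qed (use A dA in auto)
  have "poly g (\<phi> (h' c)) = 0" if c: "c \<in> insert b B0" for c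
  proof (cases "c = b")
    case True then show ?thesis using p(3) b'(1) by simp
  next
    case False
    then have cB: "c \<in> B0" using c by simp
    have cA: "c \<notin> A" "poly f c = 0" using insert.prems cB by auto
    \<comment> \<open>A previously aligned root whose image lies in the moved interval would share
      with \<open>b\<close> a gap of \<open>A\<close>; by Rolle's theorem a critical point of
      \<open>f\<close> would lie between them, but \<open>A\<close> contains all of those.\<close>
    have "\<phi> (h' c) = h' c"
    proof (rule p(4), rule ccontr)
      assume "\<not> (h' c \<le> L \<or> R \<le> h' c)"
      then have "free (h' ` A) (h' c) (h' b)" unfolding free_def using frLR LR by (auto simp: min_def max_def split: if_splits)
      then have fcb: "free A c b" using free_image[OF m.h] by simp
      have "\<exists>x. min c b < x \<and> x < max c b \<and> poly (pderiv f) x = 0"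
      proof -
        have "min c b < max c b" using False by (auto simp: min_def max_def)
        from poly_MVT[OF this, of f] obtain x where "min c b < x" "x < max c b" "poly f (max c b) - poly f (min c b) = (max c b - min c b) * poly (pderiv f) x" by blast
        moreover have "poly f (max c b) = 0" "poly f (min c b) = 0" using cA b by (auto simp: min_def max_def)
        ultimately show ?thesis by auto
      qed
      then show False using dA fcb unfolding free_def by (metis less_imp_le)
    qed
    then show ?thesis using h'(3)[OF cB] by simp
  qed
  then show ?case using new Ms by (intro exI[of _ "\<lambda>t. \<phi> (h' t)"]) blast
qed

lemma (in matched) match_all:
  assumes M: "\<And>u v t. (u, v) \<in> M \<Longrightarrow> sgn (poly u t) = sgn (poly v (h t))"
    and MA: "\<And>u v t. (u, v) \<in> M \<Longrightarrow> u \<noteq> 0 \<Longrightarrow> poly u t = 0 \<Longrightarrow> t \<in> A" and f: "f \<noteq> 0"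
  shows "\<exists>h'. strict_mono h' \<and> surj h' \<and> (\<forall>u v t. (u, v) \<in> insert (f, g) M \<longrightarrow> sgn (poly u t) = sgn (poly v (h' t)))"
proof -
  have fin: "finite {b. b \<notin> A \<and> poly f b = 0}" by (rule finite_subset[OF _ poly_roots_finite[OF f]]) auto
  have "\<exists>h'. matched A h' f g \<and> (\<forall>u v t. (u, v) \<in> M \<longrightarrow> sgn (poly u t) = sgn (poly v (h' t))) \<and>
      (\<forall>b\<in>{b. b \<notin> A \<and> poly f b = 0}. poly g (h' b) = 0)"
    by (rule adjust[OF fin M MA]) auto
  then obtain h' where h': "matched A h' f g" "\<And>u v t. (u, v) \<in> M \<Longrightarrow> sgn (poly u t) = sgn (poly v (h' t))"
    "\<And>b. b \<notin> A \<Longrightarrow> poly f b = 0 \<Longrightarrow> poly g (h' b) = 0"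
    by blast
  interpret m: matched A h' f g by (rule h'(1))
  have "sgn (poly f t) = sgn (poly g (h' t))" for t by (rule m.all_signs[OF h'(3)])
  then show ?thesis using h'(2) m.h by (intro exI[of _ h']) auto
qed

section \<open>Sign diagrams of polynomials with parameters\<close>

definition fring :: "('a \<Rightarrow> real) set \<Rightarrow> bool"
  where "fring R \<longleftrightarrow> (\<forall>c. (\<lambda>x. c) \<in> R) \<and> (\<forall>f\<in>R. \<forall>g\<in>R. (\<lambda>x. f x + g x) \<in> R \<and> (\<lambda>x. f x * g x) \<in> R)"

text \<open>The degree bound is uniform in the parameter while the true degree may drop.
  Coefficients are again members of the ring of functions, which is what allows the elimination to
  be iterated.\<close>

definition ppoly :: "('a \<Rightarrow> real) set \<Rightarrow> nat \<Rightarrow> ('a \<Rightarrow> real poly) set"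
  where "ppoly R D = {p. (\<forall>i. (\<lambda>x. coeff (p x) i) \<in> R) \<and> (\<forall>x. degree (p x) \<le> D)}"

definition same_signs :: "('a \<Rightarrow> real) set \<Rightarrow> 'a \<Rightarrow> 'a \<Rightarrow> bool"
  where "same_signs C x y \<longleftrightarrow> (\<forall>c\<in>C. sgn (c x) = sgn (c y))"

text \<open>Equality of sign diagrams: along the line the sign vectors of the family occur in the
  same order at both parameters, on matching points and intervals.\<close>

definition sim :: "('a \<Rightarrow> real poly) set \<Rightarrow> 'a \<Rightarrow> 'a \<Rightarrow> bool"
  where "sim P x y \<longleftrightarrow> (\<exists>h. strict_mono h \<and> surj h \<and> (\<forall>p\<in>P. \<forall>t. sgn (poly (p x) t) = sgn (poly (p y) (h t))))"

context
  fixes R :: "('a \<Rightarrow> real) set"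
  assumes R: "fring R"
begin

lemma Rc: "(\<lambda>x. c) \<in> R" and Radd: "f \<in> R \<Longrightarrow> g \<in> R \<Longrightarrow> (\<lambda>x. f x + g x) \<in> R"
  and Rmul: "f \<in> R \<Longrightarrow> g \<in> R \<Longrightarrow> (\<lambda>x. f x * g x) \<in> R"
  using R by (auto simp: fring_def)

lemma Rdiff: "f \<in> R \<Longrightarrow> g \<in> R \<Longrightarrow> (\<lambda>x. f x - g x) \<in> R"
  using Radd[OF _ Rmul[OF Rc[of "-1"]], of f g] by simp

lemma ppoly_mono: "D \<le> D' \<Longrightarrow> ppoly R D \<subseteq> ppoly R D'" by (auto simp: ppoly_def intro: le_trans)

text \<open>Cutting off makes the degree bound true at all parameters and changes nothing where the
  higher coefficients vanish; the polynomial is used at such parameters only.\<close>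

lemma ppoly_cutoff:
  assumes "\<And>i. (\<lambda>x. coeff (p x) i) \<in> R" shows "(\<lambda>x. poly_cutoff (Suc D) (p x)) \<in> ppoly R D"
  unfolding ppoly_def
proof (intro CollectI conjI allI)
  fix i show "(\<lambda>x. coeff (poly_cutoff (Suc D) (p x)) i) \<in> R"
    using assms Rc[of 0] by (cases "i < Suc D") (simp_all add: coeff_poly_cutoff)
  show "degree (poly_cutoff (Suc D) (p x)) \<le> D" for x by (rule degree_le) (simp add: coeff_poly_cutoff)
qed

lemma cutoff_id: "degree p \<le> D \<Longrightarrow> poly_cutoff (Suc D) p = p"
  by (rule poly_eqI) (auto simp: coeff_poly_cutoff coeff_eq_0)

lemma ppoly_pderiv: assumes "p \<in> ppoly R (Suc D)" shows "(\<lambda>x. pderiv (p x)) \<in> ppoly R D"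
proof -
  have "(\<lambda>x. coeff (pderiv (p x)) i) \<in> R" for i
    using Rmul[OF Rc, of "\<lambda>x. coeff (p x) (Suc i)" "of_nat (Suc i)"] assms by (simp add: coeff_pderiv ppoly_def)
  moreover have "degree (pderiv (p x)) \<le> D" for x using assms by (simp add: ppoly_def degree_pderiv le_diff_conv)
  ultimately show ?thesis by (simp add: ppoly_def)
qed

text \<open>The multiplier \<open>s\<close> must be positive because pseudo-division is used to compare signs.\<close>

lemma pseudo_rem:
  assumes "p \<in> ppoly R E" "q \<in> ppoly R D"
  shows "\<exists>r\<in>ppoly R k. \<forall>x. degree (q x) = Suc k \<longrightarrow> (\<exists>s>0. \<exists>h. smult s (p x) = h * q x + r x)"
  using assms(1)
proof (induction E arbitrary: p rule: less_induct)
  case (less E)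
  show ?case
  proof (cases "E \<le> k")
    case True
    then have "p \<in> ppoly R k" using less.prems ppoly_mono by blast
    then show ?thesis by (intro bexI[of _ p] allI impI exI[of _ 1] conjI exI[of _ 0]) auto
  next
    case False
    then obtain E' where E': "E = Suc E'" "k \<le> E'" by (cases E) auto
    have pc: "(\<lambda>x. coeff (p x) i) \<in> R" and qc: "(\<lambda>x. coeff (q x) i) \<in> R" for i
      using less.prems assms(2) by (auto simp: ppoly_def)
    \<comment> \<open>The usual elimination of the top coefficient, multiplied once more by the
      leading coefficient of \<open>q\<close> so that \<open>p\<close> is scaled by a square. It is
      written with ring operations and so defined at every parameter; the degree is known to drop
      where \<open>q\<close> has degree \<open>Suc k\<close>.\<close>
    define p1 where "p1 x = smult ((coeff (q x) (Suc k))\<^sup>2) (p x) - smult (coeff (q x) (Suc k) * coeff (p x) E) (monom 1 (E - Suc k) * q x)" for x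
    define p2 where "p2 x = poly_cutoff (Suc E') (p1 x)" for x
    have "(\<lambda>x. coeff (p1 x) i) \<in> R" for i
    proof -
      have m: "(\<lambda>x. coeff (monom 1 (E - Suc k) * q x) i) \<in> R"
        using qc Rc[of 0] by (cases "E - Suc k \<le> i") (simp_all add: coeff_monom_mult)
      show ?thesis unfolding p1_def coeff_diff coeff_smult power2_eq_square by (intro Rdiff Rmul pc qc m)
    qed
    then have p2: "p2 \<in> ppoly R E'" unfolding p2_def[abs_def] by (rule ppoly_cutoff)
    obtain r where r: "r \<in> ppoly R k" "\<And>x. degree (q x) = Suc k \<Longrightarrow> (\<exists>s>0. \<exists>h. smult s (p2 x) = h * q x + r x)"
      using less.IH[of E' p2] p2 E' by auto
    have "\<exists>s>0. \<exists>h. smult s (p x) = h * q x + r x" if dq: "degree (q x) = Suc k" for x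
    proof -
      let ?l = "coeff (q x) (Suc k)"
      have l: "?l \<noteq> 0" using dq by (metis leading_coeff_0_iff degree_0 nat.distinct(1))
      have "degree (p1 x) \<le> E'"
      proof (rule degree_le, intro allI impI)
        fix i assume i: "E' < i"
        show "coeff (p1 x) i = 0"
        proof (cases "i = E")
          case True
          then show ?thesis using E' by (simp add: p1_def coeff_monom_mult power2_eq_square)
        next
          case False
          then have "E < i" using i E' by simp
          then have "coeff (p x) i = 0" using less.prems by (intro coeff_eq_0) (auto simp: ppoly_def intro: le_less_trans)
          moreover have "coeff (q x) (i - (E - Suc k)) = 0" using dq \<open>E < i\<close> E' by (intro coeff_eq_0) auto
          ultimately show ?thesis by (simp add: p1_def coeff_monom_mult)
        qed
      qed
      then have p21: "p2 x = p1 x" by (simp add: p2_def cutoff_id)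
      obtain s h where s: "s > 0" "smult s (p2 x) = h * q x + r x" using r(2)[OF dq] by blast
      have "smult (s * ?l\<^sup>2) (p x) = (h + smult s (smult (?l * coeff (p x) E) (monom 1 (E - Suc k)))) * q x + r x"
        using s(2) unfolding p21 p1_def by (simp add: algebra_simps smult_diff_right)
      moreover have "s * ?l\<^sup>2 > 0" using s(1) l by simp
      ultimately show ?thesis by blast
    qed
    then show ?thesis using r(1) by blast
  qed
qed

lemma sim_const: "\<exists>C\<subseteq>R. finite C \<and> (\<forall>x y. same_signs C x y \<longrightarrow> sim P x y)" if P: "finite P" "P \<subseteq> ppoly R 0"
proof (intro exI[of _ "(\<lambda>p x. coeff (p x) 0) ` P"] conjI allI impI)
  fix x y assume s: "same_signs ((\<lambda>p x. coeff (p x) 0) ` P) x y"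
  have "sgn (poly (p x) t) = sgn (poly (p y) t)" if p: "p \<in> P" for p t
  proof -
    have "degree (p z) = 0" for z using p P by (auto simp: ppoly_def)
    then have "poly (p z) t = coeff (p z) 0" for z using degree_eq_zeroE[of "p z"] by (metis coeff_pCons_0 poly_pCons poly_0 mult_zero_right add.right_neutral)
    then show ?thesis using s p by (simp add: same_signs_def)
  qed
  then show "sim P x y" unfolding sim_def by (intro exI[of _ id]) (auto simp: strict_mono_def)
qed (use P in \<open>auto simp: ppoly_def\<close>)

text \<open>Cohen-Hoermander: above the zeros of the other members, the sign of \<open>p\<close> is that of a remainder.\<close>

lemma sim_insert:
  assumes p: "p \<in> ppoly R (Suc D)" and P: "finite P" "P \<subseteq> ppoly R (Suc D)"
  shows "\<exists>P'\<subseteq>ppoly R D. \<exists>C\<subseteq>R. finite P' \<and> finite C \<and>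
     (\<forall>x y. same_signs C x y \<longrightarrow> sim (P \<union> P') x y \<longrightarrow> sim (insert p P) x y)"
proof -
  define p' where "p' x = pderiv (p x)" for x
  have p': "p' \<in> ppoly R D" unfolding p'_def[abs_def] by (rule ppoly_pderiv[OF p])
  \<comment> \<open>The derivative joins the divisors: its zeros are the critical points at which
    the sign of \<open>p\<close> has to be known.\<close>
  define Q where "Q = insert p' P"
  have Q: "finite Q" "Q \<subseteq> ppoly R (Suc D)" using P p' ppoly_mono[of D "Suc D"] by (auto simp: Q_def)
  have "\<exists>r\<in>ppoly R k. \<forall>x. degree (q x) = Suc k \<longrightarrow> (\<exists>s>0. \<exists>h. smult s (p x) = h * q x + r x)" if "q \<in> Q" for q k
    by (rule pseudo_rem[OF p]) (use that Q in auto)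
  then obtain r where r: "\<And>q k. q \<in> Q \<Longrightarrow> r q k \<in> ppoly R k"
    "\<And>q k x. q \<in> Q \<Longrightarrow> degree (q x) = Suc k \<Longrightarrow> \<exists>s>0. \<exists>h. smult s (p x) = h * q x + r q k x" by metis
  \<comment> \<open>Stands in for \<open>p\<close> at the parameters where its coefficient at
    \<open>Suc D\<close> vanishes; there both are equal.\<close>
  define p0 where "p0 x = poly_cutoff (Suc D) (p x)" for x
  have p0: "p0 \<in> ppoly R D" unfolding p0_def[abs_def] by (rule ppoly_cutoff) (use p in \<open>auto simp: ppoly_def\<close>)
  define P' where "P' = insert p0 (insert p' ((\<lambda>(q, k). r q k) ` (Q \<times> {..D})))"
  have P': "finite P'" "P' \<subseteq> ppoly R D"
  proof -
    have "r q k \<in> ppoly R D" if "q \<in> Q" "k \<le> D" for q k using r(1)[OF that(1)] ppoly_mono[OF that(2)] by blast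
    then show "finite P'" "P' \<subseteq> ppoly R D" using Q(1) p0 p' by (auto simp: P'_def)
  qed
  \<comment> \<open>The signs of all coefficients decide which of them vanish, hence the degrees; so
    the same remainder \<open>r q k\<close> is the right one at both parameters.\<close>
  define C where "C = (\<lambda>(q, i) x. coeff (q x) i) ` (insert p Q \<times> {..Suc D})"
  have C: "finite C" "C \<subseteq> R" using Q p by (auto simp: C_def ppoly_def)
  have "sim (insert p P) x y" if s: "same_signs C x y" and sm: "sim (P \<union> P') x y" for x y
  proof -
    obtain h where h: "strict_mono h" "surj h" "\<And>q t. q \<in> P \<union> P' \<Longrightarrow> sgn (poly (q x) t) = sgn (poly (q y) (h t))"
      using sm unfolding sim_def by blast
    have cs: "sgn (coeff (q x) i) = sgn (coeff (q y) i)" if "q \<in> insert p Q" for q i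
    proof (cases "i \<le> Suc D")
      case True then show ?thesis using s that by (force simp: same_signs_def C_def)
    next
      case False
      then have "coeff (q z) i = 0" for z using that p Q by (intro coeff_eq_0) (auto simp: ppoly_def not_le intro: le_less_trans)
      then show ?thesis by simp
    qed
    have cz: "coeff (q x) i = 0 \<longleftrightarrow> coeff (q y) i = 0" if "q \<in> insert p Q" for q i
      using cs[OF that] by (metis sgn_0_0)
    have deg: "degree (q x) = degree (q y)" if "q \<in> insert p Q" for q
      using cz[OF that] by (metis degree_le le_antisym le_degree not_le)
    show ?thesis
    proof (cases "coeff (p x) (Suc D) = 0")
      case True
      have "p0 z = p z" if "coeff (p z) (Suc D) = 0" for z
      proof -
        have "degree (p z) \<le> Suc D" using p by (simp add: ppoly_def)
        then have "degree (p z) \<le> D" using that by (metis degree_0 eq_zero_or_degree_less le_SucE le_less_Suc_eq less_Suc_eq_le zero_le)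
        then show ?thesis by (simp add: p0_def cutoff_id)
      qed
      then have "p0 x = p x" "p0 y = p y" using True cz[of p "Suc D"] by auto
      then have "sgn (poly (q x) t) = sgn (poly (q y) (h t))" if "q \<in> insert p P" for q t
        using that h(3)[of p0 t] h(3)[of q t] by (auto simp: P'_def)
      then show ?thesis using h unfolding sim_def by blast
    next
      case False
      \<comment> \<open>Zeros at \<open>x\<close> of the nonzero members of \<open>Q\<close>:
        finitely many, and among them the critical points of \<open>p x\<close>, as
        \<open>p' x\<close> is not zero.\<close>
      define A where "A = {t. \<exists>q\<in>Q. q x \<noteq> 0 \<and> poly (q x) t = 0}"
      have px: "p x \<noteq> 0" using False by auto
      have "degree (p x) > 0" using False by (metis coeff_eq_0 gr0I zero_less_Suc)
      then have p'x: "p' x \<noteq> 0" by (simp add: p'_def pderiv_eq_0_iff)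
      have fA: "finite A"
      proof -
        have "A = (\<Union>q\<in>{q\<in>Q. q x \<noteq> 0}. {t. poly (q x) t = 0})" by (auto simp: A_def)
        moreover have "finite (\<Union>q\<in>{q\<in>Q. q x \<noteq> 0}. {t. poly (q x) t = 0})"
          using Q(1) by (intro finite_UN_I poly_roots_finite) auto
        ultimately show ?thesis by simp
      qed
      have hQ: "sgn (poly (q x) t) = sgn (poly (q y) (h t))" if "q \<in> Q" for q t
        using h(3)[of q t] that by (auto simp: Q_def P'_def)
      have m: "matched A h (p x) (p y)"
      proof
        show "sgn (poly (pderiv (p x)) t) = sgn (poly (pderiv (p y)) (h t))" for t
          using hQ[of p' t] by (simp add: Q_def p'_def)
        show "t \<in> A" if "poly (pderiv (p x)) t = 0" for t
          using that p'x by (auto simp: A_def Q_def p'_def)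
        fix t assume "t \<in> A"
        then obtain q where q: "q \<in> Q" "q x \<noteq> 0" "poly (q x) t = 0" by (auto simp: A_def)
        have "degree (q x) > 0"
        proof (rule ccontr)
          assume "\<not> degree (q x) > 0"
          then obtain c where "q x = [:c:]" using degree_eq_zeroE by blast
          then show False using q by simp
        qed
        then obtain k where k: "degree (q x) = Suc k" by (metis Suc_pred)
        then have ky: "degree (q y) = Suc k" using deg[of q] q by simp
        have "degree (q x) \<le> Suc D" using q(1) Q(2) by (auto simp: ppoly_def)
        then have kD: "k \<le> D" using k by simp
        have sr: "sgn (poly (p z) u) = sgn (poly (r q k z) u)" if dz: "degree (q z) = Suc k" and u: "poly (q z) u = 0" for z u
        proof -
          obtain s w where sw: "s > 0" "smult s (p z) = w * q z + r q k z" using r(2)[OF q(1) dz] by blast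
          have "s * poly (p z) u = poly (r q k z) u" using arg_cong[OF sw(2), of "\<lambda>p. poly p u"] u by simp
          then have "sgn (poly (r q k z) u) = sgn s * sgn (poly (p z) u)" by (metis sgn_mult)
          then show ?thesis using sw(1) by simp
        qed
        have qy: "poly (q y) (h t) = 0" using hQ[OF q(1), of t] q(3) by (metis sgn_0 sgn_0_0)
        have "r q k \<in> P'" using q(1) kD by (auto simp: P'_def)
        then have "sgn (poly (r q k x) t) = sgn (poly (r q k y) (h t))" using h(3) by blast
        then show "sgn (poly (p x) t) = sgn (poly (p y) (h t))" using sr[OF k q(3)] sr[OF ky qy] by simp
      qed (use fA h in auto)
      interpret matched A h "p x" "p y" by (rule m)
      obtain h' where h': "strict_mono h'" "surj h'"
        "\<And>u v t. (u, v) \<in> insert (p x, p y) ((\<lambda>q. (q x, q y)) ` P) \<Longrightarrow> sgn (poly u t) = sgn (poly v (h' t))"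
      proof -
        have "\<exists>h'. strict_mono h' \<and> surj h' \<and> (\<forall>u v t. (u, v) \<in> insert (p x, p y) ((\<lambda>q. (q x, q y)) ` P) \<longrightarrow> sgn (poly u t) = sgn (poly v (h' t)))"
          by (rule match_all) (use hQ px in \<open>auto simp: A_def Q_def\<close>)
        then show ?thesis using that by blast
      qed
      then show ?thesis unfolding sim_def by (intro exI[of _ h'] conjI ballI allI) auto
    qed
  qed
  then show ?thesis using P' C by blast
qed

text \<open>Two nested inductions, on the degree bound and on the number of members that may reach
  it. \<open>sim_insert\<close> trades one member with bound \<open>Suc D\<close> for finitely many
  with bound \<open>D\<close>, which join \<open>P\<close> while \<open>Q\<close> becomes
  smaller.\<close>

lemma sim_exists:
  "finite P \<Longrightarrow> P \<subseteq> ppoly R D \<Longrightarrow> \<exists>C\<subseteq>R. finite C \<and> (\<forall>x y. same_signs C x y \<longrightarrow> sim P x y)"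
proof (induction D arbitrary: P)
  case 0 then show ?case using sim_const by blast
next
  case (Suc D)
  have "\<exists>C\<subseteq>R. finite C \<and> (\<forall>x y. same_signs C x y \<longrightarrow> sim (Q \<union> P) x y)"
    if "finite Q" "Q \<subseteq> ppoly R (Suc D)" "finite P" "P \<subseteq> ppoly R D" for Q P
    using that
  proof (induction Q arbitrary: P rule: finite_induct)
    case empty then show ?case using Suc.IH[of P] by simp
  next
    case (insert p Q)
    have sub: "Q \<union> P \<subseteq> ppoly R (Suc D)" using insert.prems ppoly_mono[of D "Suc D"] by auto
    obtain P' C1 where P': "P' \<subseteq> ppoly R D" "finite P'" and C1: "C1 \<subseteq> R" "finite C1"
      and s1: "\<And>x y. same_signs C1 x y \<Longrightarrow> sim (Q \<union> P \<union> P') x y \<Longrightarrow> sim (insert p (Q \<union> P)) x y"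
      using sim_insert[of p D "Q \<union> P"] insert.prems insert.hyps sub by (auto 4 4)
    obtain C2 where C2: "C2 \<subseteq> R" "finite C2" "\<And>x y. same_signs C2 x y \<Longrightarrow> sim (Q \<union> (P \<union> P')) x y"
      using insert.IH[of "P \<union> P'"] insert.prems P' by auto
    have "sim (insert p Q \<union> P) x y" if "same_signs (C1 \<union> C2) x y" for x y
      using s1[of x y] C2(3)[of x y] that by (simp add: same_signs_def Un_assoc)
    then show ?case using C1 C2 by (intro exI[of _ "C1 \<union> C2"]) auto
  qed
  from this[OF Suc.prems, of "{}"] show ?case by simp
qed

end

section \<open>Polynomials in the fibre variables\<close>

text \<open>The bundle projection in coordinates; filling up with 0 places the result in
  \<open>eucl n\<close>.\<close>

definition trunc :: "nat \<Rightarrow> (nat \<Rightarrow> real) \<Rightarrow> nat \<Rightarrow> real"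
  where "trunc n z = (\<lambda>i. if i < n then z i else 0)"

lemma trunc_eucl [simp]: "trunc n z \<in> eucl n" by (simp add: trunc_def eucl_iff)
lemma trunc_id: "x \<in> eucl n \<Longrightarrow> trunc n x = x" by (auto simp: trunc_def eucl_iff)
lemma trunc_cong: "(\<And>i. i < n \<Longrightarrow> z i = w i) \<Longrightarrow> trunc n z = trunc n w" by (auto simp: trunc_def)
lemma trunc_trunc: "n \<le> m \<Longrightarrow> trunc n (trunc m z) = trunc n z" by (auto simp: trunc_def)

text \<open>Functions on all of \<open>nat \<Rightarrow> real\<close>, with base coordinates below
  \<open>n\<close> and fibre variables at the next \<open>q\<close> places. As the domain is the
  whole type, the same function remains a fibre polynomial when auxiliary variables are
  appended.\<close>

inductive_set FP :: "nat \<Rightarrow> nat \<Rightarrow> (nat \<Rightarrow> real) set \<Rightarrow> ((nat \<Rightarrow> real) \<Rightarrow> real) set" for n q W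
  where
    coef: "Cinf_on n W a \<Longrightarrow> (\<lambda>z. a (trunc n z)) \<in> FP n q W"
  | var: "j < q \<Longrightarrow> (\<lambda>z. z (n + j)) \<in> FP n q W"
  | add: "f \<in> FP n q W \<Longrightarrow> g \<in> FP n q W \<Longrightarrow> (\<lambda>z. f z + g z) \<in> FP n q W"
  | mult: "f \<in> FP n q W \<Longrightarrow> g \<in> FP n q W \<Longrightarrow> (\<lambda>z. f z * g z) \<in> FP n q W"

lemma FP_dep: "f \<in> FP n q W \<Longrightarrow> (\<And>i. i < n + q \<Longrightarrow> z i = w i) \<Longrightarrow> f z = f w"
proof (induction rule: FP.induct)
  case (coef a)
  then have "trunc n z = trunc n w" by (intro trunc_cong) auto
  then show ?case by simp
qed auto

lemma FP_const: "eopen n W \<Longrightarrow> (\<lambda>z. c) \<in> FP n q W"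
  using FP.coef[OF Cinf_const] by simp

lemma FP_fring: "eopen n W \<Longrightarrow> fring (FP n q W)"
  by (auto simp: fring_def intro: FP_const FP.add FP.mult)

lemma FP_subset: "f \<in> FP n q W \<Longrightarrow> V \<subseteq> W \<Longrightarrow> f \<in> FP n q V"
  by (induction rule: FP.induct) (auto intro: FP.intros Cinf_subset)

lemma FP_mono: "f \<in> FP n q W \<Longrightarrow> q \<le> q' \<Longrightarrow> f \<in> FP n q' W"
  by (induction rule: FP.induct) (auto intro: FP.intros)

lemma FP_sum: "eopen n W \<Longrightarrow> (\<And>i. i \<in> I \<Longrightarrow> f i \<in> FP n q W) \<Longrightarrow> (\<lambda>z. \<Sum>i\<in>I. f i z) \<in> FP n q W"
  by (induction I rule: infinite_finite_induct) (auto intro: FP_const FP.add)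

lemma FP_prod: "eopen n W \<Longrightarrow> (\<And>i. i \<in> I \<Longrightarrow> f i \<in> FP n q W) \<Longrightarrow> (\<lambda>z. \<Prod>i\<in>I. f i z) \<in> FP n q W"
  by (induction I rule: infinite_finite_induct) (auto intro: FP_const FP.mult)

lemma FP_power: "eopen n W \<Longrightarrow> f \<in> FP n q W \<Longrightarrow> (\<lambda>z. f z ^ k) \<in> FP n q W"
  by (induction k) (auto intro: FP_const FP.mult)

lemma FP_diff: "eopen n W \<Longrightarrow> f \<in> FP n q W \<Longrightarrow> g \<in> FP n q W \<Longrightarrow> (\<lambda>z. f z - g z) \<in> FP n q W"
proof -
  assume W: "eopen n W" and fg: "f \<in> FP n q W" "g \<in> FP n q W"
  have "(\<lambda>z. f z + (-1) * g z) \<in> FP n q W" by (intro FP.add FP.mult FP_const W fg)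
  then show ?thesis by simp
qed

lemma FP_0:
  assumes W: "eopen n W"
  shows "f \<in> FP n 0 W \<Longrightarrow> \<exists>a. Cinf_on n W a \<and> (\<forall>z. f z = a (trunc n z))"
proof (induction rule: FP.induct)
  case (add f g)
  then obtain a b where "Cinf_on n W a" "\<forall>z. f z = a (trunc n z)" "Cinf_on n W b" "\<forall>z. g z = b (trunc n z)" by blast
  then show ?case by (intro exI[of _ "\<lambda>x. a x + b x"]) (auto intro: Cinf_add[OF W])
next
  case (mult f g)
  then obtain a b where "Cinf_on n W a" "\<forall>z. f z = a (trunc n z)" "Cinf_on n W b" "\<forall>z. g z = b (trunc n z)" by blast
  then show ?case by (intro exI[of _ "\<lambda>x. a x * b x"]) (auto intro: Cinf_mult[OF W])
qed auto

text \<open>The recursive view: a polynomial in the last variable whose coefficients are fibre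
  polynomials in the others. The degree is bounded independently of the point, as
  \<open>ppoly\<close> demands.\<close>

lemma FP_last:
  assumes W: "eopen n W"
  shows "f \<in> FP n (Suc q) W \<Longrightarrow> \<exists>D. \<exists>p\<in>ppoly (FP n q W) D. \<forall>z. f z = poly (p z) (z (n + q))"
proof (induction rule: FP.induct)
  have cst: "\<exists>D. \<exists>p\<in>ppoly (FP n q W) D. \<forall>z. f z = poly (p z) (z (n + q))" if f: "f \<in> FP n q W" for f
  proof (intro exI[of _ 0] bexI[of _ "\<lambda>z. [:f z:]"] allI)
    have "(\<lambda>x. coeff [:f x:] i) \<in> FP n q W" for i using f FP_const[OF W, of 0 q] by (cases i) auto
    then show "(\<lambda>z. [:f z:]) \<in> ppoly (FP n q W) 0" by (simp add: ppoly_def)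
  qed simp
  { case (coef a) then show ?case by (intro cst FP.coef) }
  { case (var j)
    show ?case
    proof (cases "j = q")
      case True
      have "(\<lambda>x. coeff [:0, 1:: real:] i) \<in> FP n q W" for i by (rule FP_const[OF W])
      then show ?thesis using True by (intro exI[of _ 1] bexI[of _ "\<lambda>z. [:0, 1:]"]) (auto simp: ppoly_def)
    next
      case False then show ?thesis using var by (intro cst FP.var) auto
    qed }
  { case (add f g)
    then obtain D p D' p' where p: "p \<in> ppoly (FP n q W) D" "\<forall>z. f z = poly (p z) (z (n + q))"
      "p' \<in> ppoly (FP n q W) D'" "\<forall>z. g z = poly (p' z) (z (n + q))" by blast
    then have "(\<lambda>z. p z + p' z) \<in> ppoly (FP n q W) (max D D')"
      by (auto simp: ppoly_def intro!: FP.add degree_add_le intro: le_trans)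
    then show ?case using p by (intro exI[of _ "max D D'"] bexI[of _ "\<lambda>z. p z + p' z"]) auto }
  { case (mult f g)
    then obtain D p D' p' where p: "p \<in> ppoly (FP n q W) D" "\<forall>z. f z = poly (p z) (z (n + q))"
      "p' \<in> ppoly (FP n q W) D'" "\<forall>z. g z = poly (p' z) (z (n + q))" by blast
    have "degree (p z * p' z) \<le> D + D'" for z
    proof -
      have "degree (p z) \<le> D" "degree (p' z) \<le> D'" using p(1,3) by (auto simp: ppoly_def)
      then show ?thesis using degree_mult_le[of "p z" "p' z"] by linarith
    qed
    moreover have "(\<lambda>z. coeff (p z * p' z) i) \<in> FP n q W" for i
      unfolding coeff_mult using p by (intro FP_sum[OF W] FP.mult) (auto simp: ppoly_def)
    ultimately have "(\<lambda>z. p z * p' z) \<in> ppoly (FP n q W) (D + D')" by (simp add: ppoly_def)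
    then show ?case using p by (intro exI[of _ "D + D'"] bexI[of _ "\<lambda>z. p z * p' z"]) auto }
qed

text \<open>Variables are eliminated from the last to the first. The isomorphism \<open>h\<close> of
  sign diagrams sends the last coordinate of \<open>z\<close> to the one chosen for
  \<open>w'\<close>; so every sign vector over one base point occurs over any other at which the
  base functions in \<open>C\<close> have the same signs.\<close>

lemma FP_signs:
  assumes W: "eopen n W"
  shows "finite G \<Longrightarrow> G \<subseteq> FP n q W \<Longrightarrow> \<exists>C\<subseteq>FP n 0 W. finite C \<and> (\<forall>z w. same_signs C z w \<longrightarrow>
     (\<exists>w'. (\<forall>i<n. w' i = w i) \<and> same_signs G z w' ))"
proof (induction q arbitrary: G)
  case 0
  show ?case by (intro exI[of _ G] conjI allI impI exI) (use 0 in auto)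
next
  case (Suc q)
  have "\<exists>D p. p \<in> ppoly (FP n q W) D \<and> (\<forall>z. g z = poly (p z) (z (n + q)))" if "g \<in> G" for g
    using FP_last[OF W, of g q] Suc.prems(2) that by blast
  then obtain D p where p: "\<And>g. g \<in> G \<Longrightarrow> p g \<in> ppoly (FP n q W) (D g)" "\<And>g z. g \<in> G \<Longrightarrow> g z = poly (p g z) (z (n + q))"
    by metis
  have "p g \<in> ppoly (FP n q W) (Max (D ` G))" if "g \<in> G" for g
    using p(1)[OF that] ppoly_mono[OF FP_fring[OF W], of "D g" "Max (D ` G)" q] Suc.prems(1) that by auto
  then obtain C1 where C1: "C1 \<subseteq> FP n q W" "finite C1" "\<And>x y. same_signs C1 x y \<Longrightarrow> sim (p ` G) x y"
    using sim_exists[OF FP_fring[OF W], of "p ` G" q "Max (D ` G)"] Suc.prems(1) by blast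
  obtain C where C: "C \<subseteq> FP n 0 W" "finite C"
    "\<And>z w. same_signs C z w \<Longrightarrow> \<exists>w'. (\<forall>i<n. w' i = w i) \<and> same_signs C1 z w'"
    using Suc.IH[OF C1(2,1)] by blast
  have "\<exists>w'. (\<forall>i<n. w' i = w i) \<and> same_signs G z w'" if zw: "same_signs C z w" for z w
  proof -
    obtain u where u: "\<forall>i<n. u i = w i" "same_signs C1 z u" using C(3)[OF zw] by blast
    obtain h where h: "\<And>g t. g \<in> G \<Longrightarrow> sgn (poly (p g z) t) = sgn (poly (p g u) (h t))"
      using C1(3)[OF u(2)] unfolding sim_def by blast
    \<comment> \<open>Changing the last variable leaves the coefficients of \<open>p g\<close> as
      they are, since these involve only the variables before it.\<close>
    define w' where "w' = u(n + q := h (z (n + q)))"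
    have "sgn (g z) = sgn (g w')" if g: "g \<in> G" for g
    proof -
      have "p g w' = p g u"
      proof (rule poly_eqI)
        fix i
        have "(\<lambda>x. coeff (p g x) i) \<in> FP n q W" using p(1)[OF g] by (simp add: ppoly_def)
        from FP_dep[OF this, of w' u] show "coeff (p g w') i = coeff (p g u) i" by (simp add: w'_def)
      qed
      then show ?thesis using h[OF g, of "z (n + q)"] p(2)[OF g, of z] p(2)[OF g, of w'] by (simp add: w'_def)
    qed
    moreover have "\<forall>i<n. w' i = w i" using u by (simp add: w'_def)
    ultimately show ?thesis unfolding same_signs_def by blast
  qed
  then show ?case using C by blast
qed

lemma open_sign:
  assumes W: "eopen n W" and a: "continuous_on W a" and U: "open U"
  shows "eopen n {x\<in>W. a x \<in> (U :: real set)}"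
proof -
  have "openin (top_of_set W) (W \<inter> a -` U)" using a U by (intro continuous_openin_preimage_gen) auto
  moreover have "W \<inter> a -` U = {x\<in>W. a x \<in> U}" by auto
  ultimately show ?thesis using W unfolding openin_eucl by (metis openin_trans)
qed

text \<open>A function that is positive or negative somewhere keeps this sign on a smaller open set;
  otherwise it is identically zero and its sign is constant already. Treating the next function only
  shrinks the set, so signs once made constant stay so.\<close>

lemma constant_signs:
  assumes "eopen n W" "W \<noteq> {}" "finite C" "\<And>a. a \<in> C \<Longrightarrow> Cinf_on n W a"
  shows "\<exists>V\<subseteq>W. eopen n V \<and> V \<noteq> {} \<and> (\<forall>a\<in>C. \<forall>x\<in>V. \<forall>y\<in>V. sgn (a x) = sgn (a y))"
  using assms(3,4)
proof (induction C rule: finite_induct)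
  case empty then show ?case using assms by auto
next
  case (insert a C)
  then obtain V where V: "V \<subseteq> W" "eopen n V" "V \<noteq> {}" "\<forall>a\<in>C. \<forall>x\<in>V. \<forall>y\<in>V. sgn (a x) = sgn (a y)" by auto
  have c: "continuous_on V a"
    using insert.prems[of a] V(1) Cinf_cont[OF _ open_sub_eucl[OF assms(1)]] continuous_on_subset by blast
  consider "\<exists>x\<in>V. a x > 0" | "\<exists>x\<in>V. a x < 0" | "\<forall>x\<in>V. a x = 0" by fastforce
  then show ?case
  proof cases
    case 1
    then show ?thesis using V open_sign[OF V(2) c, of "{0<..}"]
      by (intro exI[of _ "{x\<in>V. a x \<in> {0<..}}"]) auto
  next
    case 2
    then show ?thesis using V open_sign[OF V(2) c, of "{..<0}"]
      by (intro exI[of _ "{x\<in>V. a x \<in> {..<0}}"]) auto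
  next
    case 3
    then have "\<forall>b\<in>insert a C. \<forall>x\<in>V. \<forall>y\<in>V. sgn (b x) = sgn (b y)" 
    proof (intro ballI)
      fix b x y assume "b \<in> insert a C" "x \<in> V" "y \<in> V"
      then show "sgn (b x) = sgn (b y)" using 3 V(4) by (cases "b = a") (simp, blast)
    qed
    then show ?thesis using V by blast
  qed
qed

lemma generic_signs:
  assumes W: "eopen n W" "W \<noteq> {}" and G: "finite G" "G \<subseteq> FP n q W"
  shows "\<exists>V\<subseteq>W. eopen n V \<and> V \<noteq> {} \<and>
    (\<forall>z w. trunc n z \<in> V \<longrightarrow> trunc n w \<in> V \<longrightarrow> (\<exists>w'. trunc n w' = trunc n w \<and> same_signs G z w'))"
proof -
  obtain C where C: "C \<subseteq> FP n 0 W" "finite C"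
    "\<And>z w. same_signs C z w \<Longrightarrow> \<exists>w'. (\<forall>i<n. w' i = w i) \<and> same_signs G z w'"
    using FP_signs[OF W(1) G] by blast
  obtain a where a: "\<And>c. c \<in> C \<Longrightarrow> Cinf_on n W (a c)" "\<And>c z. c \<in> C \<Longrightarrow> c z = a c (trunc n z)"
    using FP_0[OF W(1)] C(1) by (metis subsetD)
  obtain V where V: "V \<subseteq> W" "eopen n V" "V \<noteq> {}" "\<forall>b\<in>a ` C. \<forall>x\<in>V. \<forall>y\<in>V. sgn (b x) = sgn (b y)"
  proof -
    have "finite (a ` C)" "\<And>b. b \<in> a ` C \<Longrightarrow> Cinf_on n W b" using C(2) a(1) by auto
    from constant_signs[OF W this] show ?thesis using that by blast
  qed
  have "\<exists>w'. trunc n w' = trunc n w \<and> same_signs G z w'" if "trunc n z \<in> V" "trunc n w \<in> V" for z w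
  proof -
    have "same_signs C z w" unfolding same_signs_def
    proof
      fix c assume c: "c \<in> C"
      show "sgn (c z) = sgn (c w)" unfolding a(2)[OF c, of z] a(2)[OF c, of w] using V(4) that c by blast
    qed
    then obtain w' where "\<forall>i<n. w' i = w i" "same_signs G z w'" using C(3) by blast
    then show ?thesis using trunc_cong[of n w' w] by blast
  qed
  then show ?thesis using V by blast
qed

section \<open>Dickson's lemma for coded monomials\<close>

text \<open>A monotone subsequence exists by \<open>seq_monosub\<close>; a decreasing sequence of
  naturals is constant once it has reached its minimum, hence weakly increasing from there.\<close>

lemma mono_subseq_nat: "\<exists>r :: nat \<Rightarrow> nat. strict_mono r \<and> mono (\<lambda>i. s (r i) :: nat)"
proof -
  obtain r where r: "strict_mono r" "monoseq (\<lambda>i. s (r i))" using seq_monosub[of s] by (auto simp: comp_def)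
  show ?thesis
  proof (cases "mono (\<lambda>i. s (r i))")
    case False
    then have dec: "\<forall>m. \<forall>i\<ge>m. s (r i) \<le> s (r m)" using r(2) by (auto simp: monoseq_def mono_def)
    obtain m where m: "\<And>i. s (r m) \<le> s (r i)" using ex_has_least_nat[of "\<lambda>_. True" 0 "\<lambda>i. s (r i)"] by auto
    have "s (r (i + m)) = s (r m)" for i using m[of "i + m"] dec by (metis le_add2 le_antisym)
    moreover have "strict_mono (\<lambda>i. r (i + m))" using r(1) by (simp add: strict_mono_def)
    ultimately show ?thesis by (intro exI[of _ "\<lambda>i. r (i + m)"]) (simp add: mono_def)
  qed (use r in blast)
qed

lemma dickson_seq: fixes q :: nat and v :: "nat \<Rightarrow> nat \<Rightarrow> nat" shows "\<exists>r :: nat \<Rightarrow> nat. strict_mono r \<and> (\<forall>l<q. mono (\<lambda>i. v (r i) l :: nat))"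
proof (induction q)
  case 0 show ?case by (intro exI[of _ id]) (simp add: strict_mono_def)
next
  case (Suc q)
  then obtain r :: "nat \<Rightarrow> nat" where r: "strict_mono r" "\<forall>l<q. mono (\<lambda>i. v (r i) l)" by blast
  obtain s :: "nat \<Rightarrow> nat" where s: "strict_mono s" "mono (\<lambda>i. v (r (s i)) q)" using mono_subseq_nat[of "\<lambda>i. v (r i) q"] by blast
  have "mono (\<lambda>i. v (r (s i)) l)" if "l < Suc q" for l
  proof (cases "l = q")
    case False
    then have "mono (\<lambda>i. v (r i) l)" using r that by auto
    then show ?thesis using strict_mono_mono[OF s(1)] unfolding mono_def by blast
  qed (use s in simp)
  moreover have "strict_mono (\<lambda>i. r (s i))" using r(1) s(1) by (simp add: strict_mono_def)
  ultimately show ?case by (intro exI[of _ "\<lambda>i. r (s i)"]) auto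
qed

definition pr :: "nat \<Rightarrow> nat" where "pr = enumerate {p. prime p}"

lemma pr_prime: "prime (pr j)" using enumerate_in_set[OF primes_infinite, of j] by (simp add: pr_def)
lemma pr_inj: "pr i = pr j \<longleftrightarrow> i = j"
  unfolding pr_def using strict_mono_enumerate[OF primes_infinite] by (simp add: strict_mono_eq)

text \<open>A monomial in \<open>q\<close> variables is coded by the number whose prime factorization has its exponents.
  Divisibility of monomials becomes divisibility, and the order of the naturals is a monomial order.\<close>

definition mcodes :: "nat \<Rightarrow> nat set" where "mcodes q = {k. k > 0 \<and> (\<forall>p. prime p \<longrightarrow> p dvd k \<longrightarrow> p \<in> pr ` {..<q})}"

definition mon :: "nat \<Rightarrow> nat \<Rightarrow> nat \<Rightarrow> (nat \<Rightarrow> real) \<Rightarrow> real"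
  where "mon n q k z = (\<Prod>j<q. z (n + j) ^ multiplicity (pr j) k)"

lemma mcodes_dvd: "k \<in> mcodes q \<Longrightarrow> l dvd k \<Longrightarrow> l \<in> mcodes q"
  by (auto simp: mcodes_def intro: dvd_trans dest: dvd_pos_nat)

lemma mcodes_mult: "k \<in> mcodes q \<Longrightarrow> l \<in> mcodes q \<Longrightarrow> k * l \<in> mcodes q"
  by (auto simp: mcodes_def prime_dvd_mult_iff)

lemma mon_mult: "k \<in> mcodes q \<Longrightarrow> l \<in> mcodes q \<Longrightarrow> mon n q (k * l) z = mon n q k z * mon n q l z"
  by (simp add: mon_def mcodes_def prime_elem_multiplicity_mult_distrib pr_prime power_add prod.distrib)

lemma mon_FP: "eopen n W \<Longrightarrow> mon n q k \<in> FP n q W"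
  unfolding mon_def[abs_def] by (intro FP_prod FP_power FP.var) auto

lemma mon_1: "mon n q (Suc 0) z = 1" "Suc 0 \<in> mcodes q"
  by (auto simp: mon_def mcodes_def)

lemma mon_var: assumes "j < q" shows "mon n q (pr j) z = z (n + j)" "pr j \<in> mcodes q"
proof -
  have "mon n q (pr j) z = (\<Prod>i<q. if i = j then z (n + j) else 1)"
    unfolding mon_def
  proof (intro prod.cong refl)
    fix i
    show "z (n + i) ^ multiplicity (pr i) (pr j) = (if i = j then z (n + j) else 1)"
      using pr_prime[of i] pr_prime[of j] pr_inj[of i j]
      by (auto simp: prime_multiplicity_other not_dvd_imp_multiplicity_0 primes_dvd_imp_eq)
  qed
  then show "mon n q (pr j) z = z (n + j)" using assms by simp
  show "pr j \<in> mcodes q" 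
    using assms prime_gt_0_nat[OF pr_prime[of j]] primes_dvd_imp_eq[OF _ pr_prime[of j]] unfolding mcodes_def by blast
qed

lemma dickson: fixes ks :: "nat \<Rightarrow> nat" assumes "\<And>i. ks i \<in> mcodes q" shows "\<exists>i j. i < j \<and> ks i dvd ks j"
proof -
  obtain r :: "nat \<Rightarrow> nat" where r: "strict_mono r" "\<And>l. l < q \<Longrightarrow> mono (\<lambda>i. multiplicity (pr l) (ks (r i)))"
    using dickson_seq[of q "\<lambda>i l. multiplicity (pr l) (ks i)"] by blast
  have "ks (r 0) dvd ks (r 1)"
  proof (rule multiplicity_le_imp_dvd)
    show "ks (r 0) \<noteq> 0" using assms by (simp add: mcodes_def)
    fix p :: nat assume p: "prime p"
    show "multiplicity p (ks (r 0)) \<le> multiplicity p (ks (r 1))"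
    proof (cases "p dvd ks (r 0)")
      case True
      then obtain l where "l < q" "p = pr l" using assms[of "r 0"] p by (auto simp: mcodes_def)
      then show ?thesis using r(2)[of l] by (simp add: mono_def)
    qed (simp add: not_dvd_imp_multiplicity_0)
  qed
  moreover have "r 0 < r 1" using r(1) by (simp add: strict_mono_def)
  ultimately show ?thesis by blast
qed

text \<open>\<open>B\<close> consists of the elements minimal for divisibility. Enumerated
  increasingly, an infinite set of them would contain a pair with one dividing the other by
  \<open>dickson\<close>, against minimality.\<close>

lemma dickson_basis:
  assumes L: "L \<subseteq> mcodes q" shows "\<exists>B\<subseteq>L. finite B \<and> (\<forall>k\<in>L. \<exists>b\<in>B. b dvd k)"
proof -
  define B where "B = {k\<in>L. \<forall>l\<in>L. l dvd k \<longrightarrow> l = k}"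
  have "finite B"
  proof (rule ccontr)
    assume inf: "infinite B"
    have inB: "enumerate B i \<in> B" for i by (rule enumerate_in_set[OF inf])
    then obtain i j where ij: "i < j" "enumerate B i dvd enumerate B j"
      using dickson[of "enumerate B" q] L by (metis (no_types, lifting) B_def mem_Collect_eq subsetD)
    then have "enumerate B i = enumerate B j" using inB[of i] inB[of j] by (auto simp: B_def)
    then show False using ij(1) strict_mono_enumerate[OF inf] by (simp add: strict_mono_eq)
  qed
  moreover have "\<exists>b\<in>B. b dvd k" if "k \<in> L" for k
    using that
  proof (induction k rule: less_induct)
    case (less k)
    show ?case
    proof (cases "k \<in> B")
      case True then show ?thesis by (intro bexI[of _ k]) auto
    next
      case False
      then obtain l where l: "l \<in> L" "l dvd k" "l \<noteq> k" using less.prems by (auto simp: B_def)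
      have "k > 0" using less.prems L by (auto simp: mcodes_def)
      then have "l < k" using dvd_imp_le[OF l(2)] l(3) by simp
      then show ?thesis using less.IH l by (meson dvd_trans)
    qed
  qed
  moreover have "B \<subseteq> L" by (auto simp: B_def)
  ultimately show ?thesis by blast
qed

section \<open>Ideals of fibre polynomials and their leading terms\<close>

context
  fixes n q :: nat
begin

text \<open>\<open>K\<close> bounds the codes that occur, so \<open>a K\<close> is the coefficient
  at the leading place, though it may vanish. The function is prescribed over \<open>W\<close> only,
  the set on which the coefficients are smooth.\<close>

definition rep :: "(nat \<Rightarrow> real) set \<Rightarrow> nat \<Rightarrow> (nat \<Rightarrow> (nat \<Rightarrow> real) \<Rightarrow> real) \<Rightarrow> ((nat \<Rightarrow> real) \<Rightarrow> real) \<Rightarrow> bool"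
  where "rep W K a f \<longleftrightarrow> (\<forall>k. Cinf_on n W (a k)) \<and>
    (\<forall>z. trunc n z \<in> W \<longrightarrow> f z = (\<Sum>k\<in>mcodes q \<inter> {..K}. a k (trunc n z) * mon n q k z))"

lemma rep_subset: "rep W K a f \<Longrightarrow> V \<subseteq> W \<Longrightarrow> rep V K a f"
  unfolding rep_def using Cinf_subset by blast

lemma rep_extend:
  assumes W: "eopen n W" and f: "rep W K a f" and K: "K \<le> K'"
  shows "rep W K' (\<lambda>k. if k \<le> K then a k else (\<lambda>x. 0)) f"
proof -
  have "(\<Sum>k\<in>mcodes q \<inter> {..K'}. (if k \<le> K then a k else (\<lambda>x. 0)) x * mon n q k z) = (\<Sum>k\<in>mcodes q \<inter> {..K}. a k x * mon n q k z)" for x z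
    by (rule sum.mono_neutral_cong_right) (use K in auto)
  then show ?thesis using f Cinf_const[OF W, of 0] unfolding rep_def by auto
qed

lemma rep_add: "eopen n W \<Longrightarrow> rep W K a f \<Longrightarrow> rep W K b g \<Longrightarrow> rep W K (\<lambda>k x. a k x + b k x) (\<lambda>z. f z + g z)"
  unfolding rep_def by (auto intro: Cinf_add simp: distrib_right sum.distrib)

text \<open>Multiplying by a monomial multiplies codes by \<open>l\<close>, so the leading place
  moves from \<open>K\<close> to exactly \<open>l * K\<close>: this is the compatibility of the
  order of the naturals with products that division relies on.\<close>

lemma rep_monmult:
  assumes W: "eopen n W" and f: "rep W K a f" and l: "l \<in> mcodes q" and c: "Cinf_on n W c"
  shows "rep W (l * K) (\<lambda>k x. if l dvd k then c x * a (k div l) x else 0) (\<lambda>z. (c (trunc n z) * mon n q l z) * f z)"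
  unfolding rep_def
proof (intro conjI allI impI)
  have l0: "l > 0" using l by (simp add: mcodes_def)
  fix k show "Cinf_on n W (\<lambda>x. if l dvd k then c x * a (k div l) x else 0)"
    using f c Cinf_const[OF W] unfolding rep_def by (cases "l dvd k") (auto intro: Cinf_mult[OF W])
  fix z assume z: "trunc n z \<in> W"
  let ?x = "trunc n z"
  have "(\<Sum>k\<in>mcodes q \<inter> {..l * K}. (if l dvd k then c ?x * a (k div l) ?x else 0) * mon n q k z) =
      (\<Sum>k\<in>{k\<in>mcodes q \<inter> {..l * K}. l dvd k}. (c ?x * a (k div l) ?x) * mon n q k z)"
    by (rule sum.mono_neutral_cong_right) auto
  also have "\<dots> = (\<Sum>k\<in>mcodes q \<inter> {..K}. (c ?x * a k ?x) * mon n q (l * k) z)"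
  proof (rule sum.reindex_bij_witness[of _ "\<lambda>k. l * k" "\<lambda>k. k div l"])
    fix k assume k: "k \<in> {k\<in>mcodes q \<inter> {..l * K}. l dvd k}"
    then obtain j where j: "k = l * j" by blast
    then show "l * (k div l) = k" using l0 by simp
    show "k div l \<in> mcodes q \<inter> {..K}" using k j l0 mcodes_dvd[of k q j] by auto
    show "(c ?x * a (k div l) ?x) * mon n q (l * (k div l)) z = c ?x * a (k div l) ?x * mon n q k z" using j l0 by simp
  next
    fix k assume "k \<in> mcodes q \<inter> {..K}"
    then show "(l * k) div l = k" "l * k \<in> {k\<in>mcodes q \<inter> {..l * K}. l dvd k}" using l0 mcodes_mult[OF l] by auto
  qed
  also have "\<dots> = (\<Sum>k\<in>mcodes q \<inter> {..K}. (c ?x * mon n q l z) * (a k ?x * mon n q k z))"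
    by (intro sum.cong refl, subst mon_mult[OF l]) (auto simp: mult_ac)
  also have "\<dots> = (c ?x * mon n q l z) * f z" using f z unfolding rep_def by (simp add: sum_distrib_left)
  finally show "(c ?x * mon n q l z) * f z = (\<Sum>k\<in>mcodes q \<inter> {..l * K}. (if l dvd k then c ?x * a (k div l) ?x else 0) * mon n q k z)" by simp
qed

definition pols :: "(nat \<Rightarrow> real) set \<Rightarrow> ((nat \<Rightarrow> real) \<Rightarrow> real) set"
  where "pols W = {f. \<exists>K a. rep W K a f}"

lemma pols_add: assumes W: "eopen n W" and "f \<in> pols W" "g \<in> pols W" shows "(\<lambda>z. f z + g z) \<in> pols W"
proof -
  obtain K a K' b where "rep W K a f" "rep W K' b g" using assms by (auto simp: pols_def)
  from rep_add[OF W rep_extend[OF W this(1), of "max K K'"] rep_extend[OF W this(2), of "max K K'"]]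
  show ?thesis unfolding pols_def by (auto intro!: exI)
qed

lemma pols_sum:
  assumes W: "eopen n W" shows "(\<And>i. i \<in> I \<Longrightarrow> f i \<in> pols W) \<Longrightarrow> (\<lambda>z. \<Sum>i\<in>I. f i z) \<in> pols W"
proof (induction I rule: infinite_finite_induct)
  have "rep W 0 (\<lambda>k x. 0) (\<lambda>z. 0)" by (simp add: rep_def Cinf_const[OF W])
  then have z: "(\<lambda>z. 0) \<in> pols W" by (auto simp: pols_def)
  { case (infinite A) then show ?case using z by simp }
  { case empty then show ?case using z by simp }
  { case (insert x F) then show ?case using pols_add[OF W] by simp }
qed

lemma pols_cong: "f \<in> pols W \<Longrightarrow> (\<And>z. trunc n z \<in> W \<Longrightarrow> g z = f z) \<Longrightarrow> g \<in> pols W"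
  unfolding pols_def rep_def by auto

lemma FP_pols:
  assumes W: "eopen n W" shows "f \<in> FP n q W \<Longrightarrow> f \<in> pols W"
proof (induction rule: FP.induct)
  have one: "rep W 1 (\<lambda>k x. if k = 1 then 1 else 0) (\<lambda>z. 1)"
  proof -
    have "(\<Sum>k\<in>mcodes q \<inter> {..1}. (if k = 1 then 1 else 0) * mon n q k z) = (\<Sum>k\<in>{1}. mon n q k z)" for z
      by (rule sum.mono_neutral_cong_right) (auto simp: mon_1)
    then show ?thesis by (simp add: rep_def Cinf_const[OF W] mon_1)
  qed
  { case (coef a)
    from rep_monmult[OF W one mon_1(2) coef] show ?case by (auto simp: mon_1 pols_def) }
  { case (var j)
    from rep_monmult[OF W one mon_var(2)[OF var] Cinf_const[OF W, of 1]] show ?case by (auto simp: mon_var[OF var] pols_def) }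
  { case (add f g) then show ?case using pols_add[OF W] by simp }
  { case (mult f g)
    then obtain K a where a: "rep W K a f" by (auto simp: pols_def)
    obtain K' b where b: "rep W K' b g" using mult by (auto simp: pols_def)
    have "(\<lambda>z. \<Sum>k\<in>mcodes q \<inter> {..K}. (a k (trunc n z) * mon n q k z) * g z) \<in> pols W"
    proof (rule pols_sum[OF W])
      fix k assume "k \<in> mcodes q \<inter> {..K}"
      then show "(\<lambda>z. (a k (trunc n z) * mon n q k z) * g z) \<in> pols W"
        using rep_monmult[OF W b, of k "a k"] a unfolding pols_def rep_def[of W K] by blast
    qed
    then show ?case by (rule pols_cong) (use a in \<open>auto simp: rep_def sum_distrib_right\<close>) }
qed

text \<open>Each member uses finitely many generators, although \<open>F\<close> may be infinite,
  and the identity is required over \<open>W\<close> only; so membership persists when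
  \<open>W\<close> shrinks.\<close>

definition ideal_on :: "((nat \<Rightarrow> real) \<Rightarrow> real) set \<Rightarrow> (nat \<Rightarrow> real) set \<Rightarrow> ((nat \<Rightarrow> real) \<Rightarrow> real) set"
  where "ideal_on F W = {f. \<exists>G h. finite G \<and> G \<subseteq> F \<and> (\<forall>g\<in>G. h g \<in> FP n q W) \<and>
     (\<forall>z. trunc n z \<in> W \<longrightarrow> f z = (\<Sum>g\<in>G. h g z * g z))}"

lemma ideal_subset: "f \<in> ideal_on F W \<Longrightarrow> V \<subseteq> W \<Longrightarrow> f \<in> ideal_on F V"
proof -
  assume f: "f \<in> ideal_on F W" and V: "V \<subseteq> W"
  then obtain G h where "finite G" "G \<subseteq> F" "\<And>g. g \<in> G \<Longrightarrow> h g \<in> FP n q W" "\<And>z. trunc n z \<in> W \<Longrightarrow> f z = (\<Sum>g\<in>G. h g z * g z)"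
    unfolding ideal_on_def by blast
  then show ?thesis unfolding ideal_on_def using FP_subset[OF _ V] V
    by (intro CollectI exI[of _ G] exI[of _ h]) auto
qed

lemma ideal_add:
  assumes W: "eopen n W" and f: "f1 \<in> ideal_on F W" "f2 \<in> ideal_on F W"
  shows "(\<lambda>z. f1 z + f2 z) \<in> ideal_on F W"
proof -
  obtain G1 h1 where 1: "finite G1" "G1 \<subseteq> F" "\<forall>g\<in>G1. h1 g \<in> FP n q W" "\<And>z. trunc n z \<in> W \<Longrightarrow> f1 z = (\<Sum>g\<in>G1. h1 g z * g z)"
    using f(1) unfolding ideal_on_def by blast
  obtain G2 h2 where 2: "finite G2" "G2 \<subseteq> F" "\<forall>g\<in>G2. h2 g \<in> FP n q W" "\<And>z. trunc n z \<in> W \<Longrightarrow> f2 z = (\<Sum>g\<in>G2. h2 g z * g z)"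
    using f(2) unfolding ideal_on_def by blast
  define k1 where "k1 g = (if g \<in> G1 then h1 g else (\<lambda>z. 0))" for g
  define k2 where "k2 g = (if g \<in> G2 then h2 g else (\<lambda>z. 0))" for g
  have k: "k1 g \<in> FP n q W" "k2 g \<in> FP n q W" for g using 1 2 FP_const[OF W] by (auto simp: k1_def k2_def)
  have "f1 z + f2 z = (\<Sum>g\<in>G1 \<union> G2. (k1 g z + k2 g z) * g z)" if "trunc n z \<in> W" for z
  proof -
    have "(\<Sum>g\<in>G1 \<union> G2. k1 g z * g z) = f1 z" unfolding 1(4)[OF that]
      by (rule sum.mono_neutral_cong_right) (use 1 2 in \<open>auto simp: k1_def\<close>)
    moreover have "(\<Sum>g\<in>G1 \<union> G2. k2 g z * g z) = f2 z" unfolding 2(4)[OF that]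
      by (rule sum.mono_neutral_cong_right) (use 1 2 in \<open>auto simp: k2_def\<close>)
    ultimately show ?thesis by (simp add: distrib_right sum.distrib)
  qed
  then show ?thesis unfolding ideal_on_def using 1 2 k
    by (intro CollectI exI[of _ "G1 \<union> G2"] exI[of _ "\<lambda>g z. k1 g z + k2 g z"]) (auto intro: FP.add)
qed

lemma ideal_mult:
  assumes f: "f \<in> ideal_on F W" and u: "u \<in> FP n q W" shows "(\<lambda>z. u z * f z) \<in> ideal_on F W"
proof -
  obtain G h where "finite G" "G \<subseteq> F" "\<forall>g\<in>G. h g \<in> FP n q W" "\<And>z. trunc n z \<in> W \<Longrightarrow> f z = (\<Sum>g\<in>G. h g z * g z)"
    using f unfolding ideal_on_def by blast
  then show ?thesis unfolding ideal_on_def using u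
    by (intro CollectI exI[of _ G] exI[of _ "\<lambda>g z. u z * h g z"]) (auto intro: FP.mult simp: sum_distrib_left mult.assoc)
qed

lemma ideal_mono: "f \<in> ideal_on F W \<Longrightarrow> F \<subseteq> F' \<Longrightarrow> f \<in> ideal_on F' W"
  unfolding ideal_on_def mem_Collect_eq by (elim exE conjE) (intro exI conjI, assumption, erule order_trans, assumption+)

lemma ideal_cong: "f \<in> ideal_on F W \<Longrightarrow> (\<And>z. trunc n z \<in> W \<Longrightarrow> g z = f z) \<Longrightarrow> g \<in> ideal_on F W"
  unfolding ideal_on_def by auto

text \<open>Codes of leading monomials whose coefficient vanishes nowhere on \<open>W\<close>. By
  members of this kind one can divide as over a field; shrinking \<open>W\<close> can only add
  codes.\<close>

definition leads :: "((nat \<Rightarrow> real) \<Rightarrow> real) set \<Rightarrow> (nat \<Rightarrow> real) set \<Rightarrow> nat set"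
  where "leads F W = {k \<in> mcodes q. \<exists>f\<in>ideal_on F W. \<exists>a. rep W k a f \<and> (\<forall>x\<in>W. a k x \<noteq> 0)}"

lemma leads_mono: "V \<subseteq> W \<Longrightarrow> leads F W \<subseteq> leads F V"
proof
  fix k assume V: "V \<subseteq> W" and "k \<in> leads F W"
  then obtain f a where "k \<in> mcodes q" "f \<in> ideal_on F W" "rep W k a f" "\<forall>x\<in>W. a k x \<noteq> 0" by (auto simp: leads_def)
  then show "k \<in> leads F V" unfolding leads_def
    using V ideal_subset[OF _ V] rep_subset[OF _ V] by (intro CollectI conjI bexI[of _ f] exI[of _ a]) auto
qed

lemma leads_mult:
  assumes W: "eopen n W" and k: "k \<in> leads F W" and l: "l \<in> mcodes q"
  shows "l * k \<in> leads F W"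
proof -
  obtain f a where f: "f \<in> ideal_on F W" "rep W k a f" "\<forall>x\<in>W. a k x \<noteq> 0" "k \<in> mcodes q" using k by (auto simp: leads_def)
  have u: "(\<lambda>z. 1 * mon n q l z) \<in> FP n q W" using mon_FP[OF W] by simp
  have "(\<lambda>z. (1 * mon n q l z) * f z) \<in> ideal_on F W" by (rule ideal_mult[OF f(1) u])
  moreover note rep_monmult[OF W f(2) l Cinf_const[OF W, of 1]]
  moreover have "l > 0" using l by (simp add: mcodes_def)
  ultimately show ?thesis unfolding leads_def using f(3,4) mcodes_mult[OF l f(4)]
    by (intro CollectI conjI bexI[of _ "\<lambda>z. (1 * mon n q l z) * f z"]
      exI[of _ "\<lambda>k' x. if l dvd k' then 1 * a (k' div l) x else 0"]) auto
qed

text \<open>Otherwise an infinite descending chain of open sets would acquire a new code at each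
  step. By Dickson's lemma an earlier code \<open>k i\<close> divides a later one
  \<open>k j\<close>; as a multiple of a code already present, \<open>k j\<close> could not have
  been new.\<close>

lemma leads_stable:
  assumes O: "eopen n W0" "W0 \<noteq> {}"
  shows "\<exists>W\<subseteq>W0. eopen n W \<and> W \<noteq> {} \<and>
    (\<forall>V\<subseteq>W. eopen n V \<longrightarrow> V \<noteq> {} \<longrightarrow> leads F V = leads F W)"
proof (rule ccontr)
  define ok where "ok W \<longleftrightarrow> W \<subseteq> W0 \<and> eopen n W \<and> W \<noteq> {}" for W
  assume "\<not> ?thesis"
  then have step: "\<exists>V\<subseteq>W. ok V \<and> leads F V \<noteq> leads F W" if "ok W" for W
    using that unfolding ok_def by (meson order_trans)
  have "\<exists>w. \<forall>i. ok (w i) \<and> (w (Suc i) \<subseteq> w i \<and> leads F (w (Suc i)) \<noteq> leads F (w i))"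
  proof (rule dependent_nat_choice)
    show "\<exists>W. ok W" using O by (auto simp: ok_def)
    show "\<exists>V. ok V \<and> V \<subseteq> W \<and> leads F V \<noteq> leads F W" if "ok W" for W i using step[OF that] by blast
  qed
  then obtain w where w: "\<And>i. ok (w i)" "\<And>i. w (Suc i) \<subseteq> w i" "\<And>i. leads F (w (Suc i)) \<noteq> leads F (w i)" by blast
  have "\<exists>k. k \<in> leads F (w (Suc i)) - leads F (w i)" for i using leads_mono[OF w(2)] w(3) by blast
  then obtain k where k: "\<And>i. k i \<in> leads F (w (Suc i))" "\<And>i. k i \<notin> leads F (w i)" by (metis DiffE)
  have kQ: "k i \<in> mcodes q" for i using k(1)[of i] by (auto simp: leads_def)
  obtain i j where ij: "i < j" "k i dvd k j" using dickson[OF kQ] by blast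
  have "w j \<subseteq> w (Suc i)" using lift_Suc_antimono_le[of w "Suc i" j, OF w(2)] ij(1) by simp
  then have "k i \<in> leads F (w j)" using leads_mono k(1) by blast
  moreover obtain l where "k j = k i * l" using ij(2) by blast
  moreover have "l \<in> mcodes q" using mcodes_dvd[OF kQ[of j], of l] calculation by simp
  ultimately have "k j \<in> leads F (w j)" using leads_mult[of "w j" "k i" F l] w(1)[of j] by (simp add: ok_def mult.commute)
  then show False using k(2) by blast
qed

text \<open>Division by a Groebner basis whose leading coefficients do not vanish on \<open>W\<close>.\<close>

theorem generically_noetherian:
  assumes O: "eopen n W0" "W0 \<noteq> {}"
    and F: "\<And>f x. f \<in> F \<Longrightarrow> x \<in> W0 \<Longrightarrow> \<exists>V. eopen n V \<and> x \<in> V \<and> f \<in> pols V"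
  shows "\<exists>W F0. W \<subseteq> W0 \<and> eopen n W \<and> W \<noteq> {} \<and> finite F0 \<and> F0 \<subseteq> F \<and>
    (\<forall>f\<in>F. \<forall>x\<in>W. \<exists>V\<subseteq>W. eopen n V \<and> x \<in> V \<and> f \<in> ideal_on F0 V)"
proof -
  obtain W where W: "W \<subseteq> W0" "eopen n W" "W \<noteq> {}"
    and st: "\<And>V. V \<subseteq> W \<Longrightarrow> eopen n V \<Longrightarrow> V \<noteq> {} \<Longrightarrow> leads F V = leads F W"
    using leads_stable[OF O, of F] by blast
  obtain B where B: "B \<subseteq> leads F W" "finite B" "\<And>k. k \<in> leads F W \<Longrightarrow> \<exists>b\<in>B. b dvd k"
  proof -
    have "leads F W \<subseteq> mcodes q" by (auto simp: leads_def)
    from dickson_basis[OF this] show ?thesis using that by blast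
  qed
  define gens where "gens b f a G \<longleftrightarrow> rep W b a f \<and> (\<forall>x\<in>W. a b x \<noteq> 0) \<and> f \<in> ideal_on F W \<and> finite G \<and> G \<subseteq> F \<and> f \<in> ideal_on G W" for b f a G
  have "\<exists>f a G. gens b f a G" if "b \<in> B" for b
  proof -
    obtain f a where f: "f \<in> ideal_on F W" "rep W b a f" "\<forall>x\<in>W. a b x \<noteq> 0" 
    proof -
      have "b \<in> leads F W" using \<open>b \<in> B\<close> B(1) by blast
      then show ?thesis using that unfolding leads_def by blast
    qed
    obtain G h where G: "finite G" "G \<subseteq> F" "\<forall>g\<in>G. h g \<in> FP n q W" "\<And>z. trunc n z \<in> W \<Longrightarrow> f z = (\<Sum>g\<in>G. h g z * g z)"
      using f(1) unfolding ideal_on_def by blast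
    then have "f \<in> ideal_on G W" unfolding ideal_on_def by (intro CollectI exI[of _ G] exI[of _ h]) auto
    then show ?thesis unfolding gens_def using f G(1,2) by blast
  qed
  then obtain fb ab G where "\<And>b. b \<in> B \<Longrightarrow> gens b (fb b) (ab b) (G b)" by metis
  then have fb: "\<And>b. b \<in> B \<Longrightarrow> rep W b (ab b) (fb b)" "\<And>b x. b \<in> B \<Longrightarrow> x \<in> W \<Longrightarrow> ab b b x \<noteq> 0"
    "\<And>b. b \<in> B \<Longrightarrow> fb b \<in> ideal_on F W" "\<And>b. b \<in> B \<Longrightarrow> finite (G b)" "\<And>b. b \<in> B \<Longrightarrow> G b \<subseteq> F" "\<And>b. b \<in> B \<Longrightarrow> fb b \<in> ideal_on (G b) W"
    unfolding gens_def by blast+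
  \<comment> \<open>Each Groebner element is itself a combination of finitely many members of
    \<open>F\<close>. These members are collected, because a finite part of \<open>F\<close> is
    wanted and not just a finite set of elements of the ideal.\<close>
  define F0 where "F0 = (\<Union>b\<in>B. G b)"
  have F0: "finite F0" "F0 \<subseteq> F" using B(2) fb(4,5) by (auto simp: F0_def)
  have fb0: "fb b \<in> ideal_on F0 W" if "b \<in> B" for b by (rule ideal_mono[OF fb(6)[OF that]]) (use that in \<open>auto simp: F0_def\<close>)
  \<comment> \<open>Induction on the bound \<open>K\<close> of the codes, each step removing the
    leading term. It is carried out over any open \<open>V\<close> inside \<open>W\<close>, because
    members of \<open>F\<close> are given as polynomials only locally.\<close>
  have div: "f \<in> ideal_on F0 V" if V: "V \<subseteq> W" "eopen n V" and "f \<in> ideal_on F V" "rep V K a f" for V K a f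
    using that(3,4)
  proof (induction K arbitrary: f a)
    case 0
    have "f z = 0" if "trunc n z \<in> V" for z
    proof -
      have "mcodes q \<inter> {..0} = {}" by (auto simp: mcodes_def)
      then show ?thesis using 0 that unfolding rep_def by simp
    qed
    then show ?case by (auto simp: ideal_on_def intro!: exI[of _ "{}"])
  next
    case (Suc K)
    have drop: "rep V K a' g" if r: "rep V (Suc K) a' g" and z: "Suc K \<notin> mcodes q \<or> (\<forall>x\<in>V. a' (Suc K) x = 0)" for a' g
    proof -
      have "(\<Sum>k\<in>mcodes q \<inter> {..Suc K}. a' k x * mon n q k z) = (\<Sum>k\<in>mcodes q \<inter> {..K}. a' k x * mon n q k z)" if "x \<in> V" for x z
        by (rule sum.mono_neutral_right) (use z that in \<open>auto simp: le_Suc_eq\<close>)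
      then show ?thesis using r unfolding rep_def by auto
    qed
    have aC: "Cinf_on n V (a (Suc K))" using Suc.prems(2) by (simp add: rep_def)
    show ?case
    proof (cases "Suc K \<in> leads F W")
      case True
      obtain b where b: "b \<in> B" "b dvd Suc K" using B(3)[OF True] by blast
      then obtain l where l: "Suc K = l * b" by (metis dvd_def mult.commute)
      have lQ: "l \<in> mcodes q" using True l mcodes_dvd[of "Suc K" q l] by (auto simp: leads_def)
      have l0: "l > 0" using lQ by (simp add: mcodes_def)
      have fbV: "rep V b (ab b) (fb b)" by (rule rep_subset[OF fb(1)[OF b(1)] V(1)])
      define c where "c x = (-1) * (a (Suc K) x * inverse (ab b b x))" for x
      have abC: "Cinf_on n V (ab b b)" using fbV by (simp add: rep_def)
      have cC: "Cinf_on n V c" unfolding c_def[abs_def]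
        using fb(2)[OF b(1)] V(1) by (intro Cinf_mult[OF V(2)] Cinf_const[OF V(2)] aC Cinf_inverse[OF V(2)] abC) auto
      define g where "g z = f z + (c (trunc n z) * mon n q l z) * fb b z" for z
      note rm = rep_monmult[OF V(2) fbV lQ cC, folded l]
      have "rep V K (\<lambda>k x. a k x + (if l dvd k then c x * ab b (k div l) x else 0)) g"
        unfolding g_def[abs_def]
      proof (rule drop[OF rep_add[OF V(2) Suc.prems(2) rm]], rule disjI2, rule ballI)
        fix x assume x: "x \<in> V"
        have "Suc K div l = b" "l dvd Suc K" using l l0 by auto
        then show "a (Suc K) x + (if l dvd Suc K then c x * ab b (Suc K div l) x else 0) = 0"
          using fb(2)[OF b(1), of x] x V(1) by (auto simp: c_def)
      qed
      moreover have u: "(\<lambda>z. c (trunc n z) * mon n q l z) \<in> FP n q V" by (intro FP.mult FP.coef cC mon_FP V(2))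
      have "g \<in> ideal_on F V" unfolding g_def[abs_def]
        by (intro ideal_add[OF V(2) Suc.prems(1)] ideal_mult[OF ideal_subset[OF fb(3)[OF b(1)] V(1)] u])
      ultimately have "g \<in> ideal_on F0 V" using Suc.IH by blast
      moreover have u': "(\<lambda>z. (-1) * (c (trunc n z) * mon n q l z)) \<in> FP n q V" by (intro FP.mult FP_const V(2) FP.coef cC mon_FP)
      have "(\<lambda>z. ((-1) * (c (trunc n z) * mon n q l z)) * fb b z) \<in> ideal_on F0 V"
        by (rule ideal_mult[OF ideal_subset[OF fb0[OF b(1)] V(1)] u'])
      ultimately have "(\<lambda>z. g z + ((-1) * (c (trunc n z) * mon n q l z)) * fb b z) \<in> ideal_on F0 V" by (rule ideal_add[OF V(2)])
      then show ?thesis by (rule ideal_cong) (simp add: g_def)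
    next
      case False
      \<comment> \<open>If \<open>Suc K\<close> codes a monomial whose coefficient is nonzero
        somewhere, then it is a lead on the open set where the coefficient does not vanish; by the
        stability \<open>st\<close> it would be one on \<open>W\<close> already.\<close>
      have "Suc K \<notin> mcodes q \<or> (\<forall>x\<in>V. a (Suc K) x = 0)"
      proof (rule ccontr)
        assume n: "\<not> ?thesis"
        define V' where "V' = {x\<in>V. a (Suc K) x \<in> - {0}}"
        have V': "eopen n V'" unfolding V'_def
          by (rule open_sign[OF V(2) Cinf_cont[OF aC open_sub_eucl[OF V(2)]]]) auto
        have sub: "V' \<subseteq> V" "V' \<noteq> {}" using n by (auto simp: V'_def)
        have "Suc K \<in> leads F V'" unfolding leads_def
          using n ideal_subset[OF Suc.prems(1) sub(1)] rep_subset[OF Suc.prems(2) sub(1)]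
          by (auto simp: V'_def intro!: bexI[of _ f] exI[of _ a])
        then show False using st[OF order_trans[OF sub(1) V(1)] V' sub(2)] False by simp
      qed
      from drop[OF Suc.prems(2) this] show ?thesis using Suc.IH Suc.prems(1) by blast
    qed
  qed
  have "\<exists>V\<subseteq>W. eopen n V \<and> x \<in> V \<and> f \<in> ideal_on F0 V" if f: "f \<in> F" and x: "x \<in> W" for f x
  proof -
    obtain V where V: "eopen n V" "x \<in> V" "f \<in> pols V" using F[OF f] x W(1) by blast
    then obtain K a where ra: "rep V K a f" by (auto simp: pols_def)
    have VW: "eopen n (V \<inter> W)" using V(1) W(2) by (rule openin_Int)
    have "f \<in> ideal_on F (V \<inter> W)" unfolding ideal_on_def
      using f FP_const[OF VW, of 1] by (intro CollectI exI[of _ "{f}"] exI[of _ "\<lambda>g z. 1"]) auto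
    then have "f \<in> ideal_on F0 (V \<inter> W)"
      using div[of "V \<inter> W" f K a] VW rep_subset[OF ra, of "V \<inter> W"] by auto
    then show ?thesis using VW V(2) x by (intro exI[of _ "V \<inter> W"]) auto
  qed
  then show ?thesis using W F0 by blast
qed

end

lemma continuous_on_eucl_map:
  assumes GW: "\<And>y. y \<in> V \<Longrightarrow> G y \<in> eucl n" and g: "\<And>j. j < n \<Longrightarrow> continuous_on V (\<lambda>y. G y j)"
  shows "continuous_on V G"
proof (rule continuous_on_coordinatewise_then_product)
  fix j show "continuous_on V (\<lambda>y. G y j)"
  proof (cases "j < n")
    case False
    have "G y j = 0" if "y \<in> V" for y using GW[OF that] False by (auto simp: eucl_iff)
    then show ?thesis using continuous_on_cong[of V V "\<lambda>y. G y j" "\<lambda>y. 0"] by simp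
  qed (use g in auto)
qed

lemma open_vimage_eucl:
  assumes V: "eopen m V" and U: "eopen n U"
    and G: "\<And>y. y \<in> V \<Longrightarrow> G y \<in> eucl n" "\<And>j. j < n \<Longrightarrow> Cinf_on m V (\<lambda>y. G y j)"
  shows "eopen m {y\<in>V. G y \<in> U}"
proof -
  obtain T where T: "open T" "U = eucl n \<inter> T" using U unfolding openin_eucl by (auto simp: openin_open)
  have "continuous_on V G" by (rule continuous_on_eucl_map[OF G(1)]) (use G(2) Cinf_cont[OF _ open_sub_eucl[OF V]] in auto)
  then have "openin (top_of_set V) (V \<inter> G -` T)" using T(1) by (intro continuous_openin_preimage_gen) auto
  moreover have "V \<inter> G -` T = {y\<in>V. G y \<in> U}" using G(1) T(2) by auto
  ultimately show ?thesis using V unfolding openin_eucl by (metis openin_trans)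
qed

section \<open>Bump functions\<close>

text \<open>The functions \<open>p (1 / x) * exp (- (1 / x))\<close>, continued by 0. The polynomial
  factor makes the family closed under differentiation, so smoothness follows by induction on the
  order for all \<open>p\<close> at once; \<open>p = 1\<close> gives the bump functions.\<close>

definition flat :: "real poly \<Rightarrow> real \<Rightarrow> real"
  where "flat p x = (if x \<le> 0 then 0 else poly p (1 / x) * exp (- (1 / x)))"

lemma poly_exp_tendsto: "((\<lambda>y::real. poly p y * exp (- y)) \<longlongrightarrow> 0) at_top"
proof -
  have "((\<lambda>y::real. \<Sum>i\<le>degree p. coeff p i * (y ^ i / exp y)) \<longlongrightarrow> (\<Sum>i\<le>degree p. coeff p i * 0)) at_top"
    by (intro tendsto_sum tendsto_mult tendsto_const tendsto_power_div_exp_0)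
  then show ?thesis by (simp add: poly_altdef sum_distrib_right exp_minus divide_inverse mult.assoc)
qed

text \<open>In terms of \<open>y = 1 / x\<close> the derivative is
  \<open>y^2 * (p - p') * exp (- y)\<close>, the two \<open>pCons 0\<close> supplying the square. At
  0 the difference quotient from the right is \<open>y * p * exp (- y)\<close>, which tends to
  0.\<close>

lemma flat_deriv: "(flat p has_real_derivative flat (pCons 0 (pCons 0 (p - pderiv p))) x) (at x)"
proof (cases x "0::real" rule: linorder_cases)
  case less
  have "((\<lambda>x. 0) has_real_derivative 0) (at x)" by simp
  then have "(flat p has_real_derivative 0) (at x)"
    by (rule has_field_derivative_transform_within_open[of _ _ _ "{..<0}"]) (use less in \<open>auto simp: flat_def\<close>)
  then show ?thesis using less by (simp add: flat_def)
next
  case greater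
  have "((\<lambda>x. poly p (1 / x) * exp (- (1 / x))) has_real_derivative flat (pCons 0 (pCons 0 (p - pderiv p))) x) (at x)"
    using greater
    by (auto simp: flat_def field_simps power2_eq_square intro!: derivative_eq_intros DERIV_chain2[OF poly_DERIV])
  then show ?thesis
    by (rule has_field_derivative_transform_within_open[of _ _ _ "{0<..}"]) (use greater in \<open>auto simp: flat_def\<close>)
next
  case equal
  have "((\<lambda>h. flat p h / h) \<longlongrightarrow> 0) (at_right 0)"
  proof -
    have "((\<lambda>y. poly (pCons 0 p) y * exp (- y)) \<longlongrightarrow> 0) at_top" by (rule poly_exp_tendsto)
    then have "((\<lambda>h. poly (pCons 0 p) (inverse h) * exp (- inverse h)) \<longlongrightarrow> 0) (at_right 0)"
      by (rule filterlim_compose[OF _ filterlim_inverse_at_top_right])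
    moreover have "\<forall>\<^sub>F h in at_right 0. poly (pCons 0 p) (inverse h) * exp (- inverse h) = flat p h / h"
      by (auto simp: eventually_at_filter flat_def field_simps)
    ultimately show ?thesis by (rule Lim_transform_eventually)
  qed
  moreover have "((\<lambda>h. flat p h / h) \<longlongrightarrow> 0) (at_left 0)"
    by (rule Lim_transform_eventually[OF tendsto_const]) (auto simp: eventually_at_filter flat_def)
  ultimately have "((\<lambda>h. flat p h / h) \<longlongrightarrow> 0) (at 0)" by (simp add: filterlim_split_at)
  then show ?thesis using equal by (simp add: has_field_derivative_iff flat_def)
qed

lemma flat_Cinf:
  assumes W: "eopen n W" and g: "Cinf_on n W g"
  shows "Cinf_on n W (\<lambda>z. flat p (g z))"
proof -
  have "Ck_on n k W (\<lambda>z. flat p (g z))" for k p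
  proof (induction k arbitrary: p)
    have c: "continuous_on W (\<lambda>z. flat p (g z))" for p
    proof -
      have "continuous_on UNIV (flat p)" using flat_deriv[of p] by (meson DERIV_isCont continuous_at_imp_continuous_on)
      then show ?thesis using continuous_on_compose2[of UNIV "flat p" W g] Cinf_cont[OF g open_sub_eucl[OF W]] by auto
    qed
    { case 0 show ?case using c by (simp add: continuous_map_eucl[OF open_sub_eucl[OF W]]) }
    { case (Suc k)
      show ?case
      proof (rule CkI[OF W c, where g="\<lambda>i z. flat (pCons 0 (pCons 0 (p - pderiv p))) (g z) * partial_deriv i g z"])
        fix i assume i: "i < n"
        show "((\<lambda>t. flat p (g (z(i := t)))) has_real_derivative flat (pCons 0 (pCons 0 (p - pderiv p))) (g z) * partial_deriv i g z) (at (z i))"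
          if "z \<in> W" for z
          using DERIV_chain2[where f="flat p" and g="\<lambda>t. g (z(i := t))" and x="z i", OF _ Cinf_has[OF g that i]] flat_deriv by (simp del: fun_upd_apply)
        show "Ck_on n k W (\<lambda>z. flat (pCons 0 (pCons 0 (p - pderiv p))) (g z) * partial_deriv i g z)"
          using Suc Cinf_partial[OF g i] by (intro Ck_mult[OF W]) (auto simp: Cinf_on_def)
      qed }
  qed
  then show ?thesis by (simp add: Cinf_on_def)
qed

lemma eucl_bump:
  assumes c: "c \<in> eucl n" and e: "e > 0"
  shows "\<exists>\<beta> e'. e' > 0 \<and> Cinf_on n (eucl n) \<beta> \<and> (\<forall>z\<in>cbx n c e'. \<beta> z = 1) \<and> (\<forall>z\<in>eucl n. z \<notin> cbx n c e \<longrightarrow> \<beta> z = 0)"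
proof -
  have o: "eopen n (eucl n)" by simp
  define r where "r z = (\<Sum>i<n. (z i - c i) * (z i - c i))" for z :: "nat \<Rightarrow> real"
  \<comment> \<open>Then \<open>2 * s = e^2\<close>. The quotient \<open>\<beta>\<close> below is 1
    for \<open>r z \<le> s\<close> and 0 for \<open>r z \<ge> 2 * s\<close>, and outside the cube a
    single coordinate already gives \<open>r z \<ge> e^2\<close>.\<close>
  define s where "s = e\<^sup>2 / 2"
  have s: "s > 0" using e by (simp add: s_def)
  have rC: "Cinf_on n (eucl n) r" unfolding r_def[abs_def]
    by (intro Cinf_sum[OF o] Cinf_mult[OF o] Cinf_diff[OF o] Cinf_coord[OF o] Cinf_const[OF o])
  define F where "F = flat 1"
  have Fpos: "F x \<ge> 0" "x > 0 \<Longrightarrow> F x > 0" "x \<le> 0 \<Longrightarrow> F x = 0" for x by (auto simp: F_def flat_def)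
  define \<beta> where "\<beta> z = F (2 * s - r z) * inverse (F (2 * s - r z) + F (r z - s))" for z
  have ne: "F (2 * s - r z) + F (r z - s) \<noteq> 0" for z
  proof (cases "r z < 2 * s")
    case True then show ?thesis using Fpos(2)[of "2 * s - r z"] Fpos(1)[of "r z - s"] by auto
  next
    case False then show ?thesis using Fpos(1)[of "2 * s - r z"] Fpos(2)[of "r z - s"] s by auto
  qed
  have "Cinf_on n (eucl n) \<beta>" unfolding \<beta>_def[abs_def] F_def
    by (intro Cinf_mult[OF o] Cinf_inverse[OF o] Cinf_add[OF o] flat_Cinf[OF o] Cinf_diff[OF o] Cinf_const[OF o] rC)
       (use ne in \<open>simp add: F_def\<close>)
  moreover have "\<beta> z = 0" if z: "z \<in> eucl n" "z \<notin> cbx n c e" for z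
  proof -
    obtain i where i: "i < n" "\<bar>z i - c i\<bar> \<ge> e" using z by (auto simp: cbx_def not_less)
    have "e\<^sup>2 \<le> (z i - c i) * (z i - c i)"
      using i(2) e by (metis abs_of_pos abs_le_square_iff power2_eq_square)
    also have "\<dots> \<le> r z" unfolding r_def using i(1) by (intro member_le_sum) auto
    finally have "F (2 * s - r z) = 0" by (intro Fpos(3)) (simp add: s_def)
    then show ?thesis by (simp add: \<beta>_def)
  qed
  \<comment> \<open>As coordinate differences are below 1, their squares are at most
    \<open>s / (n + 1)\<close>, and \<open>n\<close> of these stay below \<open>s\<close>; with
    \<open>n + 1\<close> the radius is positive for \<open>n = 0\<close> as well.\<close>
  moreover have "\<beta> z = 1" if z: "z \<in> cbx n c (min 1 (s / (n + 1)))" for z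
  proof -
    have "(z i - c i) * (z i - c i) \<le> s / (n + 1)" if "i < n" for i
    proof -
      have "\<bar>z i - c i\<bar> < 1" "\<bar>z i - c i\<bar> < s / (n + 1)" using z that by (auto simp: cbx_def)
      then have "\<bar>z i - c i\<bar> * \<bar>z i - c i\<bar> \<le> 1 * (s / (n + 1))" by (intro mult_mono) auto
      then show ?thesis by simp
    qed
    then have "r z \<le> (\<Sum>i<n. s / (n + 1))" unfolding r_def by (intro sum_mono) auto
    also have "\<dots> \<le> s" using s by (simp add: field_simps)
    finally have rs: "r z \<le> s" .
    then have "F (r z - s) = 0" by (intro Fpos(3)) simp
    moreover have "F (2 * s - r z) > 0" using rs s by (intro Fpos(2)) simp
    ultimately show ?thesis by (simp add: \<beta>_def)
  qed
  moreover have "min 1 (s / (n + 1)) > 0" using s by simp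
  ultimately show ?thesis by blast
qed

section \<open>Charts\<close>

lemma is_chart_inj: "is_chart n X c \<Longrightarrow> inj_on (snd c) (fst c)"
  unfolding is_chart_def by (metis homeomorphic_imp_injective_map inf.absorb2 openin_subset topspace_subtopology)

lemma chart_inv_snd: "is_chart n X c \<Longrightarrow> p \<in> fst c \<Longrightarrow> chart_inv c (snd c p) = p"
  unfolding chart_inv_def by (rule inv_into_f_f[OF is_chart_inj])

lemma snd_chart_inv: "z \<in> snd c ` fst c \<Longrightarrow> snd c (chart_inv c z) = z"
  and chart_inv_in: "z \<in> snd c ` fst c \<Longrightarrow> chart_inv c z \<in> fst c"
  unfolding chart_inv_def by (auto intro: f_inv_into_f inv_into_into)

lemma chart_open_image:
  assumes c: "is_chart n X c" and U: "openin X U"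
  shows "eopen n (snd c ` (fst c \<inter> U))"
proof -
  have "openin (subtopology X (fst c)) (fst c \<inter> U)" using U by (metis inf_commute openin_subtopology)
  then have "openin (subtopology (Euclidean_space n) (snd c ` fst c)) (snd c ` (fst c \<inter> U))"
    using c unfolding is_chart_def by (metis homeomorphic_imp_open_map open_map_def)
  then show ?thesis using c unfolding is_chart_def by (meson openin_trans_full)
qed

lemma chart_open_vimage:
  assumes c: "is_chart n X c" and V: "eopen n V"
  shows "openin X {p\<in>fst c. snd c p \<in> V}"
proof -
  have sub: "topspace (subtopology X (fst c)) = fst c" using c by (simp add: is_chart_def inf.absorb2 openin_subset)
  have cont: "continuous_map (subtopology X (fst c)) (subtopology (Euclidean_space n) (snd c ` fst c)) (snd c)"
    using c unfolding is_chart_def by (metis homeomorphic_imp_continuous_map)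
  have "openin (subtopology (Euclidean_space n) (snd c ` fst c)) (V \<inter> snd c ` fst c)"
    using V by (auto simp: openin_subtopology)
  then have "openin (subtopology X (fst c)) {p \<in> topspace (subtopology X (fst c)). snd c p \<in> V \<inter> snd c ` fst c}"
    using cont openin_continuous_map_preimage by blast
  moreover have "{p \<in> topspace (subtopology X (fst c)). snd c p \<in> V \<inter> snd c ` fst c} = {p\<in>fst c. snd c p \<in> V}" using sub by auto
  ultimately show ?thesis using c unfolding is_chart_def by (metis openin_trans_full)
qed

text \<open>Closed cubes in a chart become compact sets of the manifold, and these are closed
  because it is Hausdorff; supports of bump functions arise in this way.\<close>

lemma chart_compact:
  assumes c: "is_chart n X c" and K: "compactin (Euclidean_space n) K" "K \<subseteq> snd c ` fst c"
  shows "compactin X {p\<in>fst c. snd c p \<in> K}"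
proof -
  obtain g where g: "homeomorphic_maps (subtopology X (fst c)) (subtopology (Euclidean_space n) (snd c ` fst c)) (snd c) g"
    using c unfolding is_chart_def homeomorphic_map_maps by blast
  have sub: "topspace (subtopology X (fst c)) = fst c" using c by (simp add: is_chart_def inf.absorb2 openin_subset)
  have "compactin (subtopology (Euclidean_space n) (snd c ` fst c)) K" using K by (simp add: compactin_subtopology)
  then have "compactin (subtopology X (fst c)) (g ` K)"
    using g image_compactin unfolding homeomorphic_maps_def by blast
  moreover have "g ` K = {p\<in>fst c. snd c p \<in> K}"
  proof -
    have gs: "g (snd c p) = p" if "p \<in> fst c" for p using g that unfolding homeomorphic_maps_def sub by blast
    show ?thesis
    proof (intro equalityI subsetI)
      fix p assume "p \<in> g ` K"
      then obtain q where "q \<in> fst c" "snd c q \<in> K" "p = g (snd c q)" using K(2) by auto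
      then show "p \<in> {p\<in>fst c. snd c p \<in> K}" using gs by simp
    next
      fix p assume "p \<in> {p\<in>fst c. snd c p \<in> K}"
      then show "p \<in> g ` K" using gs[of p] by (metis (mono_tags, lifting) image_eqI mem_Collect_eq)
    qed
  qed
  ultimately show ?thesis by (simp add: compactin_subtopology)
qed

lemma compactin_closed_box:
  "compactin (Euclidean_space n) {z\<in>eucl n. \<forall>i<n. \<bar>z i - c i\<bar> \<le> e}"
proof -
  have eq: "{z\<in>eucl n. \<forall>i<n. \<bar>z i - c i\<bar> \<le> e} = Pi\<^sub>E UNIV (\<lambda>i. if i < n then {c i - e..c i + e} else {0})"
  proof (rule set_eqI)
    fix x
    have "x \<in> {z\<in>eucl n. \<forall>i<n. \<bar>z i - c i\<bar> \<le> e} \<longleftrightarrow> (\<forall>i. if i < n then \<bar>x i - c i\<bar> \<le> e else x i = 0)"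
      by (auto simp: eucl_iff not_less[symmetric])
    also have "\<dots> \<longleftrightarrow> (\<forall>i. x i \<in> (if i < n then {c i - e..c i + e} else {0}))"
      by (intro all_cong1) (auto simp: abs_le_iff)
    finally show "x \<in> {z\<in>eucl n. \<forall>i<n. \<bar>z i - c i\<bar> \<le> e} \<longleftrightarrow> x \<in> Pi\<^sub>E UNIV (\<lambda>i. if i < n then {c i - e..c i + e} else {0})"
      by (simp add: PiE_iff)
  qed
  have "compactin (product_topology (\<lambda>i. euclideanreal) UNIV) (Pi\<^sub>E UNIV (\<lambda>i. if i < n then {c i - e..c i + e} else {0}))"
    unfolding compactin_PiE by auto
  then show ?thesis unfolding Euclidean_space_def compactin_subtopology eq[symmetric] by (auto simp: eucl_iff)
qed

section \<open>Tangent vectors in coordinates and bump functions on manifolds\<close>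

lemma tv_sum: "(\<Sum>i\<in>A. c i *\<^sub>R (v i :: 'b \<Rightarrow> real)) f = (\<Sum>i\<in>A. c i * v i f)"
  by (induction A rule: infinite_finite_induct) (auto simp: scaleR_fun_def)

definition cvec :: "'a manifold \<Rightarrow> 'a chart \<Rightarrow> (nat \<Rightarrow> real) \<Rightarrow> 'a \<Rightarrow> 'a tvector"
  where "cvec M k \<xi> p = (\<Sum>i<mdim M. \<xi> i *\<^sub>R coord_vector M k i p)"

lemma cvec_apply: "cvec M k \<xi> p f = (if f \<in> Cinf M then \<Sum>i<mdim M. \<xi> i * partial_deriv i (f \<circ> chart_inv k) (snd k p) else 0)"
  unfolding cvec_def tv_sum by (simp add: coord_vector_def)

lemma cvec_zero: "cvec M k (\<lambda>i. 0) p = 0"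
  by (rule ext) (simp add: cvec_apply)
lemma cvec_add: "cvec M k (\<lambda>i. \<xi> i + \<eta> i) p = cvec M k \<xi> p + cvec M k \<eta> p"
  by (rule ext) (simp add: cvec_apply distrib_right sum.distrib)
lemma cvec_scale: "cvec M k (\<lambda>i. a * \<xi> i) p = a *\<^sub>R cvec M k \<xi> p"
  by (rule ext) (simp add: cvec_apply scaleR_fun_def sum_distrib_left mult.assoc)
lemma cvec_sum: "cvec M k (\<lambda>i. \<Sum>a\<in>A. \<xi> a i) p = (\<Sum>a\<in>A. cvec M k (\<xi> a) p)"
  by (induction A rule: infinite_finite_induct) (auto simp: cvec_zero cvec_add)
lemma cvec_cong: "(\<And>i. i < mdim M \<Longrightarrow> \<xi> i = \<eta> i) \<Longrightarrow> cvec M k \<xi> p = cvec M k \<eta> p"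
  by (simp add: cvec_def)

lemma cvec_unit: "j < mdim M \<Longrightarrow> cvec M k (\<lambda>i. if i = j then 1 else 0) p = coord_vector M k j p"
proof -
  assume j: "j < mdim M"
  have "(\<Sum>i<mdim M. (if i = j then 1 else 0) *\<^sub>R coord_vector M k i p) = (\<Sum>i<mdim M. if i = j then coord_vector M k i p else 0)"
    by (intro sum.cong) auto
  then show ?thesis using j by (simp add: cvec_def)
qed

locale smanifold =
  fixes M :: "'a manifold"
  assumes M: "smooth_manifold M"
begin

abbreviation "N \<equiv> mdim M"
abbreviation "X \<equiv> mtop M"

lemma chart: "k \<in> atlas M \<Longrightarrow> is_chart N X k"
  using M unfolding smooth_manifold_def by blast

lemma transition: "k \<in> atlas M \<Longrightarrow> k' \<in> atlas M \<Longrightarrow> i < N \<Longrightarrow>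
    Cinf_on N (snd k ` (fst k \<inter> fst k')) (\<lambda>x. snd k' (chart_inv k x) i)"
  using M unfolding smooth_manifold_def smooth_transition_def by blast

lemma atlasI: "is_chart N X k \<Longrightarrow> (\<And>k'. k' \<in> atlas M \<Longrightarrow> smooth_transition N k k' \<and> smooth_transition N k' k) \<Longrightarrow> k \<in> atlas M"
  using M unfolding smooth_manifold_def by blast

lemma chart_ex: "p \<in> topspace X \<Longrightarrow> \<exists>k\<in>atlas M. p \<in> fst k"
  using M unfolding smooth_manifold_def by blast

lemma dom_open: "k \<in> atlas M \<Longrightarrow> openin X (fst k)" using chart unfolding is_chart_def by blast
lemma dom_sub: "k \<in> atlas M \<Longrightarrow> fst k \<subseteq> topspace X" using dom_open openin_subset by blast
lemma img_open: "k \<in> atlas M \<Longrightarrow> eopen N (snd k ` fst k)" using chart unfolding is_chart_def by blast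
lemma img_eucl: "k \<in> atlas M \<Longrightarrow> p \<in> fst k \<Longrightarrow> snd k p \<in> eucl N" using open_sub_eucl[OF img_open] by blast
lemma open_image: "k \<in> atlas M \<Longrightarrow> openin X U \<Longrightarrow> eopen N (snd k ` (fst k \<inter> U))"
  by (rule chart_open_image[OF chart])
lemma open_image2: "k \<in> atlas M \<Longrightarrow> k' \<in> atlas M \<Longrightarrow> eopen N (snd k ` (fst k \<inter> fst k'))"
  by (rule open_image[OF _ dom_open])
lemma inv1: "k \<in> atlas M \<Longrightarrow> p \<in> fst k \<Longrightarrow> chart_inv k (snd k p) = p" by (rule chart_inv_snd[OF chart])

lemma snd_inj: "k \<in> atlas M \<Longrightarrow> p \<in> fst k \<Longrightarrow> q \<in> fst k \<Longrightarrow> snd k p = snd k q \<Longrightarrow> p = q"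
  using is_chart_inj[OF chart] by (meson inj_onD)

text \<open>One chart around each point suffices, since passing to any other chart composes with a
  smooth transition.\<close>

lemma smooth_fun_onI:
  assumes W: "openin X W"
    and loc: "\<And>p. p \<in> W \<Longrightarrow> \<exists>k\<in>atlas M. p \<in> fst k \<and> (\<exists>V. eopen N V \<and> snd k p \<in> V \<and> Cinf_on N V (f \<circ> chart_inv k))"
  shows "smooth_fun_on M W f"
  unfolding smooth_fun_on_def
proof
  fix c assume c: "c \<in> atlas M"
  show "Cinf_on N (snd c ` (fst c \<inter> W)) (f \<circ> chart_inv c)"
  proof (rule Cinf_local[OF open_image[OF c W]])
    fix x assume "x \<in> snd c ` (fst c \<inter> W)"
    then obtain p where p: "p \<in> fst c" "p \<in> W" "x = snd c p" by blast
    obtain k V where k: "k \<in> atlas M" "p \<in> fst k" and V: "eopen N V" "snd k p \<in> V" "Cinf_on N V (f \<circ> chart_inv k)"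
      using loc[OF p(2)] by blast
    define U where "U = {q\<in>fst k. snd k q \<in> V}"
    have U: "openin X U" unfolding U_def by (rule chart_open_vimage[OF chart[OF k(1)] V(1)])
    define V' where "V' = snd c ` (fst c \<inter> U)"
    have V': "eopen N V'" unfolding V'_def by (rule open_image[OF c U])
    have sub: "V' \<subseteq> snd c ` (fst c \<inter> fst k)" by (auto simp: V'_def U_def)
    have "Cinf_on N V' (\<lambda>y. (f \<circ> chart_inv k) (snd k (chart_inv c y)))"
    proof (rule Cinf_comp[OF V' V(1) V(3)])
      show "Cinf_on N V' (\<lambda>y. snd k (chart_inv c y) j)" if "j < N" for j
        by (rule Cinf_subset[OF transition[OF c k(1) that] sub])
      show "snd k (chart_inv c y) \<in> V" if "y \<in> V'" for y
        using that inv1[OF c] by (auto simp: V'_def U_def)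
    qed
    then have "Cinf_on N V' (f \<circ> chart_inv c)"
      by (rule Cinf_cong[OF V']) (use inv1[OF c] inv1[OF k(1)] in \<open>auto simp: V'_def U_def\<close>)
    moreover have "x \<in> V'" using p k V by (auto simp: V'_def U_def)
    ultimately show "\<exists>V. eopen N V \<and> x \<in> V \<and> Cinf_on N V (f \<circ> chart_inv c)" using V' by blast
  qed
qed

lemma CinfI:
  assumes "\<And>p. p \<in> topspace X \<Longrightarrow> \<exists>k\<in>atlas M. p \<in> fst k \<and> (\<exists>V. eopen N V \<and> snd k p \<in> V \<and> Cinf_on N V (f \<circ> chart_inv k))"
  shows "f \<in> Cinf M"
  unfolding Cinf_def using smooth_fun_onI[OF openin_topspace assms] by simp

lemma CinfD: "f \<in> Cinf M \<Longrightarrow> k \<in> atlas M \<Longrightarrow> Cinf_on N (snd k ` fst k) (f \<circ> chart_inv k)"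
  unfolding Cinf_def smooth_fun_on_def using dom_sub by (fastforce simp: inf.absorb1)

lemma CinfI2: "(\<And>k. k \<in> atlas M \<Longrightarrow> Cinf_on N (snd k ` fst k) (f \<circ> chart_inv k)) \<Longrightarrow> f \<in> Cinf M"
  unfolding Cinf_def smooth_fun_on_def using dom_sub by (simp add: inf.absorb1)

lemma coordinate_smooth: assumes k: "k \<in> atlas M" shows "smooth_fun_on M (fst k) (\<lambda>q. snd k q i)"
proof (rule smooth_fun_onI[OF dom_open[OF k]])
  fix p assume p: "p \<in> fst k"
  have "Cinf_on N (snd k ` fst k) (\<lambda>y. y i)" by (rule Cinf_coord[OF img_open[OF k]])
  then have "Cinf_on N (snd k ` fst k) ((\<lambda>q. snd k q i) \<circ> chart_inv k)"
    by (rule Cinf_cong[OF img_open[OF k]]) (simp add: snd_chart_inv)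
  then show "\<exists>k'\<in>atlas M. p \<in> fst k' \<and> (\<exists>V. eopen N V \<and> snd k' p \<in> V \<and> Cinf_on N V ((\<lambda>q. snd k q i) \<circ> chart_inv k'))"
    using k p img_open[OF k] by blast
qed

text \<open>The closed set \<open>K\<close> inside \<open>W\<close> is recorded because off
  \<open>K\<close> a product with \<open>\<beta>\<close> is zero on an open set; this lets fields
  and functions given on \<open>W\<close> be extended by 0.\<close>

definition bump :: "'a \<Rightarrow> 'a set \<Rightarrow> ('a \<Rightarrow> real) \<Rightarrow> 'a set \<Rightarrow> bool"
  where "bump p W \<beta> U \<longleftrightarrow> \<beta> \<in> Cinf M \<and> openin X U \<and> p \<in> U \<and> U \<subseteq> W \<and> (\<forall>q\<in>U. \<beta> q = 1) \<and>
    (\<exists>K. closedin X K \<and> K \<subseteq> W \<and> (\<forall>q. q \<notin> K \<longrightarrow> \<beta> q = 0))"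

lemma bump_ex:
  assumes W: "openin X W" "p \<in> W" shows "\<exists>\<beta> U. bump p W \<beta> U"
proof -
  obtain k where k: "k \<in> atlas M" "p \<in> fst k" using chart_ex openin_subset[OF W(1)] W(2) by blast
  obtain e0 where e0: "e0 > 0" "cbx N (snd k p) e0 \<subseteq> snd k ` (fst k \<inter> W)"
    using open_image[OF k(1) W(1)] k W(2) unfolding openin_eucl_iff by blast
  \<comment> \<open>Half the radius, so that the closed cube \<open>Kc\<close> still lies in the
    open cube of radius \<open>e0\<close>.\<close>
  define e where "e = e0 / 2"
  have e: "e > 0" "e < e0" using e0 by (auto simp: e_def)
  obtain \<beta> e' where chi: "e' > 0" "Cinf_on N (eucl N) \<beta>" "\<And>z. z \<in> cbx N (snd k p) e' \<Longrightarrow> \<beta> z = 1"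
    "\<And>z. z \<in> eucl N \<Longrightarrow> z \<notin> cbx N (snd k p) e \<Longrightarrow> \<beta> z = 0"
    using eucl_bump[OF img_eucl[OF k] e(1)] by metis
  define Kc where "Kc = {z\<in>eucl N. \<forall>i<N. \<bar>z i - snd k p i\<bar> \<le> e}"
  have KcW: "Kc \<subseteq> snd k ` (fst k \<inter> W)" using e e0 by (force simp: Kc_def cbx_def)
  define K where "K = {q\<in>fst k. snd k q \<in> Kc}"
  have "compactin X K" unfolding K_def
    by (rule chart_compact[OF chart[OF k(1)]]) (use KcW compactin_closed_box in \<open>auto simp: Kc_def\<close>)
  then have Kcl: "closedin X K" using M unfolding smooth_manifold_def by (metis compactin_imp_closedin)
  have inW: "q \<in> W" if q: "q \<in> fst k" "snd k q \<in> snd k ` (fst k \<inter> W)" for q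
  proof -
    obtain r where r: "r \<in> fst k" "r \<in> W" "snd k r = snd k q" using q(2) by (auto simp: image_iff)
    then have "r = q" using snd_inj[OF k(1) r(1) q(1)] by blast
    then show ?thesis using r(2) by simp
  qed
  have KW: "K \<subseteq> W" using KcW inW by (auto simp: K_def)
  define \<psi> where "\<psi> q = (if q \<in> fst k then \<beta> (snd k q) else 0)" for q
  have outK: "\<psi> q = 0" if "q \<notin> K" for q
    using that chi(4)[of "snd k q"] img_eucl[OF k(1)] by (force simp: \<psi>_def K_def Kc_def cbx_def)
  have sm: "\<psi> \<in> Cinf M"
  proof (rule CinfI)
    fix q assume q: "q \<in> topspace X"
    show "\<exists>k'\<in>atlas M. q \<in> fst k' \<and> (\<exists>V. eopen N V \<and> snd k' q \<in> V \<and> Cinf_on N V (\<psi> \<circ> chart_inv k'))"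
    proof (cases "q \<in> fst k")
      case True
      have "Cinf_on N (snd k ` fst k) \<beta>" using Cinf_subset[OF chi(2) open_sub_eucl[OF img_open[OF k(1)]]] .
      then have "Cinf_on N (snd k ` fst k) (\<psi> \<circ> chart_inv k)"
        by (rule Cinf_cong[OF img_open[OF k(1)]]) (simp add: \<psi>_def snd_chart_inv chart_inv_in)
      then show ?thesis using True k(1) img_open[OF k(1)] by blast
    next
      case False
      then have qK: "q \<in> topspace X - K" using q by (auto simp: K_def)
      obtain k' where k': "k' \<in> atlas M" "q \<in> fst k'" using chart_ex[OF q] by blast
      have op: "eopen N (snd k' ` (fst k' \<inter> (topspace X - K)))"
        by (rule open_image[OF k'(1)]) (use Kcl in auto)
      have "Cinf_on N (snd k' ` (fst k' \<inter> (topspace X - K))) (\<psi> \<circ> chart_inv k')"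
        by (rule Cinf_cong[OF op Cinf_const[OF op, of 0]]) (use inv1[OF k'(1)] outK in auto)
      then show ?thesis using k' qK op by blast
    qed
  qed
  define U where "U = {q\<in>fst k. snd k q \<in> cbx N (snd k p) (min e e')}"
  have "openin X U" unfolding U_def by (rule chart_open_vimage[OF chart[OF k(1)] open_cbx])
  moreover have "p \<in> U" using k img_eucl[OF k] e chi(1) by (auto simp: U_def intro!: cbx_self)
  moreover have "U \<subseteq> K" by (auto simp: U_def K_def Kc_def cbx_def intro: less_imp_le)
  moreover have "\<psi> q = 1" if "q \<in> U" for q using that chi(3)[of "snd k q"] by (auto simp: U_def \<psi>_def cbx_def)
  ultimately have "bump p W \<psi> U" unfolding bump_def using sm Kcl KW outK by blast
  then show ?thesis by blast
qed

text \<open>\<open>W\<close> and the complement of the closed set \<open>K\<close> cover the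
  manifold; \<open>g\<close> is a product of smooth functions on the first and zero on the
  second.\<close>

lemma cutoff_smooth:
  assumes b: "bump p W \<beta> U" and W: "openin X W" and f: "smooth_fun_on M W f" and z: "\<And>q. \<beta> q = 0 \<Longrightarrow> g q = 0" "\<And>q. q \<in> W \<Longrightarrow> g q = \<beta> q * f q"
  shows "g \<in> Cinf M"
proof (rule CinfI)
  fix q assume q: "q \<in> topspace X"
  obtain k where k: "k \<in> atlas M" "q \<in> fst k" using chart_ex[OF q] by blast
  show "\<exists>k'\<in>atlas M. q \<in> fst k' \<and> (\<exists>V. eopen N V \<and> snd k' q \<in> V \<and> Cinf_on N V (g \<circ> chart_inv k'))"
  proof (cases "q \<in> W")
    case True
    let ?V = "snd k ` (fst k \<inter> W)"
    have op: "eopen N ?V" by (rule open_image[OF k(1) W])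
    have "Cinf_on N ?V (\<lambda>y. (\<beta> \<circ> chart_inv k) y * (f \<circ> chart_inv k) y)"
    proof (rule Cinf_mult[OF op])
      have "\<beta> \<in> Cinf M" using b by (simp add: bump_def)
      then show "Cinf_on N ?V (\<beta> \<circ> chart_inv k)" using Cinf_subset[OF CinfD[OF _ k(1)], of \<beta> ?V] by blast
      show "Cinf_on N ?V (f \<circ> chart_inv k)" using f k(1) unfolding smooth_fun_on_def by blast
    qed
    then have "Cinf_on N ?V (g \<circ> chart_inv k)"
      by (rule Cinf_cong[OF op]) (use inv1[OF k(1)] z in auto)
    then show ?thesis using k op True by blast
  next
    case False
    obtain K where K: "closedin X K" "K \<subseteq> W" "\<And>q. q \<notin> K \<Longrightarrow> \<beta> q = 0" using b by (auto simp: bump_def)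
    let ?V = "snd k ` (fst k \<inter> (topspace X - K))"
    have op: "eopen N ?V" by (rule open_image[OF k(1)]) (use K in auto)
    have "Cinf_on N ?V (g \<circ> chart_inv k)"
      by (rule Cinf_cong[OF op Cinf_const[OF op, of 0]]) (use inv1[OF k(1)] K z in auto)
    moreover have "q \<in> fst k \<inter> (topspace X - K)" using k q False K by blast
    ultimately show ?thesis using k op by blast
  qed
qed

text \<open>Tangent vectors act on globally smooth functions, so chart coordinates become usable as
  test functions only after a cut-off. Applied to them, \<open>cvec\<close> yields its
  components.\<close>

lemma coordinate_function:
  assumes k: "k \<in> atlas M" "p \<in> fst k"
  shows "\<exists>\<phi>\<in>Cinf M. \<exists>U. openin X U \<and> p \<in> U \<and> U \<subseteq> fst k \<and> (\<forall>q\<in>U. \<forall>i<N. coord_vector M k i q \<phi> = (if i = j then 1 else 0))"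
proof -
  obtain \<beta> U where b: "bump p (fst k) \<beta> U" using bump_ex[OF dom_open[OF k(1)] k(2)] by blast
  define \<phi> where "\<phi> q = \<beta> q * snd k q j" for q
  have \<phi>: "\<phi> \<in> Cinf M"
    by (rule cutoff_smooth[OF b dom_open[OF k(1)] coordinate_smooth[OF k(1), of j]]) (auto simp: \<phi>_def)
  have U: "openin X U" "p \<in> U" "U \<subseteq> fst k" "\<And>q. q \<in> U \<Longrightarrow> \<beta> q = 1" using b by (auto simp: bump_def)
  have "coord_vector M k i q \<phi> = (if i = j then 1 else 0)" if q: "q \<in> U" and i: "i < N" for i q
  proof -
    have op: "eopen N (snd k ` (fst k \<inter> U))" by (rule open_image[OF k(1) U(1)])
    have "partial_deriv i (\<phi> \<circ> chart_inv k) (snd k q) = partial_deriv i (\<lambda>y. y j) (snd k q)"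
    proof (rule partial_deriv_cong[OF op])
      fix y assume "y \<in> snd k ` (fst k \<inter> U)"
      then show "(\<phi> \<circ> chart_inv k) y = y j" using inv1[OF k(1)] U(4) by (auto simp: \<phi>_def)
    qed (use q U i in auto)
    then show ?thesis using \<phi> by (simp add: coord_vector_def partial_deriv_coord)
  qed
  then show ?thesis using \<phi> U by blast
qed

lemma cvec_inj:
  assumes k: "k \<in> atlas M" "p \<in> fst k" and eq: "cvec M k \<xi> p = cvec M k \<eta> p" and j: "j < N"
  shows "\<xi> j = \<eta> j"
proof -
  obtain \<phi> where \<phi>: "\<forall>i<N. coord_vector M k i p \<phi> = (if i = j then 1 else 0)" using coordinate_function[OF k, of j] by blast
  have "cvec M k \<zeta> p \<phi> = \<zeta> j" for \<zeta>
  proof -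
    have "cvec M k \<zeta> p \<phi> = (\<Sum>i<N. if i = j then \<zeta> j else 0)" unfolding cvec_def tv_sum
      by (intro sum.cong) (use \<phi> in auto)
    then show ?thesis using j by simp
  qed
  then show ?thesis using eq by metis
qed

lemma coord_change:
  assumes k: "k \<in> atlas M" "p \<in> fst k" and k': "k' \<in> atlas M" "p \<in> fst k'" and i: "i < N"
  shows "coord_vector M k i p = cvec M k' (\<lambda>j. partial_deriv i (\<lambda>y. snd k' (chart_inv k y) j) (snd k p)) p"
proof (rule ext)
  fix f
  show "coord_vector M k i p f = cvec M k' (\<lambda>j. partial_deriv i (\<lambda>y. snd k' (chart_inv k y) j) (snd k p)) p f"
  proof (cases "f \<in> Cinf M")
    case True
    let ?V = "snd k ` (fst k \<inter> fst k')"
    have op: "eopen N ?V" by (rule open_image2[OF k(1) k'(1)])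
    have p: "snd k p \<in> ?V" using k k' by blast
    have "partial_deriv i (f \<circ> chart_inv k) (snd k p) = partial_deriv i (\<lambda>y. (f \<circ> chart_inv k') (snd k' (chart_inv k y))) (snd k p)"
      by (rule partial_deriv_cong[OF op _ p i]) (use inv1[OF k(1)] inv1[OF k'(1)] in auto)
    also have "\<dots> = (\<Sum>j<N. partial_deriv j (f \<circ> chart_inv k') (snd k' (chart_inv k (snd k p))) * partial_deriv i (\<lambda>y. snd k' (chart_inv k y) j) (snd k p))"
    proof (rule Cinf_chain[OF op img_open[OF k'(1)] CinfD[OF True k'(1)] _ _ p i])
      show "Cinf_on N ?V (\<lambda>y. snd k' (chart_inv k y) j)" if "j < N" for j by (rule transition[OF k(1) k'(1) that])
      show "snd k' (chart_inv k y) \<in> snd k' ` fst k'" if "y \<in> ?V" for y using that inv1[OF k(1)] by auto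
    qed
    finally show ?thesis using True inv1[OF k] by (simp add: coord_vector_def cvec_apply mult.commute)
  qed (simp add: coord_vector_def cvec_apply)
qed

lemma cvec_change:
  assumes k: "k \<in> atlas M" "p \<in> fst k" and k': "k' \<in> atlas M" "p \<in> fst k'"
  shows "\<exists>\<eta>. cvec M k \<xi> p = cvec M k' \<eta> p"
proof -
  have "cvec M k \<xi> p = (\<Sum>i<N. cvec M k' (\<lambda>j. \<xi> i * partial_deriv i (\<lambda>y. snd k' (chart_inv k y) j) (snd k p)) p)"
    unfolding cvec_def[of M k] using coord_change[OF assms] by (intro sum.cong refl) (simp add: cvec_scale)
  then show ?thesis unfolding cvec_sum[symmetric] by blast
qed

lemma cvec_zero_fun:
  assumes k: "k \<in> atlas M" "p \<in> fst k" and g: "\<And>q. q \<in> topspace X \<Longrightarrow> g q = 0" shows "cvec M k \<xi> p g = 0"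
proof -
  have "partial_deriv i (g \<circ> chart_inv k) (snd k p) = partial_deriv i (\<lambda>y. 0) (snd k p)" if "i < N" for i
    by (rule partial_deriv_cong[OF img_open[OF k(1)]]) (use k that g inv1[OF k(1)] dom_sub[OF k(1)] in auto)
  then show ?thesis by (simp add: cvec_apply partial_deriv_const)
qed

lemma cvec_tangent: assumes k: "k \<in> atlas M" "p \<in> fst k" shows "cvec M k \<xi> p \<in> tangent_space M p"
proof -
  have z: "snd k p \<in> snd k ` fst k" using k by blast
  have cl: "(\<lambda>x. f x + g x) \<in> Cinf M" "(\<lambda>x. f x * g x) \<in> Cinf M" if "f \<in> Cinf M" "g \<in> Cinf M" for f g
  proof -
    have "Cinf_on N (snd c ` fst c) ((\<lambda>x. f x + g x) \<circ> chart_inv c)" "Cinf_on N (snd c ` fst c) ((\<lambda>x. f x * g x) \<circ> chart_inv c)" if "c \<in> atlas M" for c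
      using Cinf_add[OF img_open[OF that] CinfD[OF \<open>f \<in> Cinf M\<close> that] CinfD[OF \<open>g \<in> Cinf M\<close> that]]
        Cinf_mult[OF img_open[OF that] CinfD[OF \<open>f \<in> Cinf M\<close> that] CinfD[OF \<open>g \<in> Cinf M\<close> that]] by (simp_all add: comp_def)
    then show "(\<lambda>x. f x + g x) \<in> Cinf M" "(\<lambda>x. f x * g x) \<in> Cinf M"
      by (auto intro!: CinfI2)
  qed
  have cst: "(\<lambda>x. a) \<in> Cinf M" for a
    using Cinf_const[OF img_open] by (intro CinfI2) (simp add: comp_def)
  have pd: "partial_deriv i ((\<lambda>x. f x + g x) \<circ> chart_inv k) (snd k p) = partial_deriv i (f \<circ> chart_inv k) (snd k p) + partial_deriv i (g \<circ> chart_inv k) (snd k p)"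
    "partial_deriv i ((\<lambda>x. f x * g x) \<circ> chart_inv k) (snd k p) = f p * partial_deriv i (g \<circ> chart_inv k) (snd k p) + g p * partial_deriv i (f \<circ> chart_inv k) (snd k p)"
    if "f \<in> Cinf M" "g \<in> Cinf M" "i < N" for f g i
    using partial_deriv_add[OF CinfD[OF that(1) k(1)] CinfD[OF that(2) k(1)] z that(3)]
      partial_deriv_mult[OF CinfD[OF that(1) k(1)] CinfD[OF that(2) k(1)] z that(3)] inv1[OF k]
    by (simp_all add: comp_def)
  show ?thesis unfolding tangent_space_def
  proof (intro CollectI conjI ballI allI impI)
    fix f g assume fg: "f \<in> Cinf M" "g \<in> Cinf M"
    show "cvec M k \<xi> p (\<lambda>x. f x + g x) = cvec M k \<xi> p f + cvec M k \<xi> p g"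
      using fg cl[OF fg] pd(1)[OF fg] by (simp add: cvec_apply sum.distrib algebra_simps)
    show "cvec M k \<xi> p (\<lambda>x. f x * g x) = f p * cvec M k \<xi> p g + g p * cvec M k \<xi> p f"
      using fg cl[OF fg] pd(2)[OF fg] by (simp add: cvec_apply sum.distrib sum_distrib_left algebra_simps)
  next
    fix f and a :: real assume f: "f \<in> Cinf M"
    have "partial_deriv i ((\<lambda>x. a) \<circ> chart_inv k) (snd k p) = 0" for i by (simp add: comp_def partial_deriv_const)
    then show "cvec M k \<xi> p (\<lambda>x. a * f x) = a * cvec M k \<xi> p f"
      using f cl(2)[OF cst f] pd(2)[OF cst f] by (simp add: cvec_apply sum_distrib_left algebra_simps)
  qed (simp add: cvec_apply)
qed


section \<open>Vector fields in coordinates\<close>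

text \<open>A field with smooth coordinates in every chart. That every smooth field is of this kind would need
  Hadamard's lemma, but the fields tangent to the plane field under study are so by assumption.\<close>

definition gfield :: "('a \<Rightarrow> 'a tvector) \<Rightarrow> bool"
  where "gfield Z \<longleftrightarrow> (\<forall>k\<in>atlas M. \<exists>\<xi>. (\<forall>i<N. Cinf_on N (snd k ` fst k) (\<xi> i)) \<and>
    (\<forall>q\<in>fst k. Z q = cvec M k (\<lambda>i. \<xi> i (snd k q)) q))"

lemma cvec_comp_smooth:
  assumes k: "k \<in> atlas M" and U: "openin X U" "U \<subseteq> fst k"
    and \<xi>: "\<And>i. i < N \<Longrightarrow> Cinf_on N (snd k ` U) (\<xi> i)" and Z: "\<And>q. q \<in> U \<Longrightarrow> Z q = cvec M k (\<lambda>i. \<xi> i (snd k q)) q"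
    and f: "f \<in> Cinf M"
  shows "y \<in> snd k ` U \<Longrightarrow> Z (chart_inv k y) f = dirD N \<xi> (f \<circ> chart_inv k) y"
    and "Cinf_on N (snd k ` U) (\<lambda>y. Z (chart_inv k y) f)"
proof -
  have op: "eopen N (snd k ` U)" using open_image[OF k U(1)] U(2) by (simp add: inf.absorb2)
  have eq: "Z (chart_inv k y) f = dirD N \<xi> (f \<circ> chart_inv k) y" if y: "y \<in> snd k ` U" for y
  proof -
    obtain q where q: "q \<in> U" "y = snd k q" using y by blast
    have "chart_inv k y = q" using inv1[OF k, of q] q U(2) by auto
    then show ?thesis using Z[OF q(1)] f q by (simp add: cvec_apply dirD_def)
  qed
  have "Cinf_on N (snd k ` U) (dirD N \<xi> (f \<circ> chart_inv k))" unfolding dirD_def[abs_def]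
  proof (intro Cinf_sum[OF op] Cinf_mult[OF op])
    fix i assume i: "i \<in> {..<N}"
    then show "Cinf_on N (snd k ` U) (\<xi> i)" using \<xi> by simp
    show "Cinf_on N (snd k ` U) (partial_deriv i (f \<circ> chart_inv k))"
      using Cinf_subset[OF Cinf_partial[OF CinfD[OF f k], of i]] i U(2) by (meson image_mono lessThan_iff)
  qed
  then show "Cinf_on N (snd k ` U) (\<lambda>y. Z (chart_inv k y) f)"
    by (rule Cinf_cong[OF op]) (use eq in auto)
  show "y \<in> snd k ` U \<Longrightarrow> Z (chart_inv k y) f = dirD N \<xi> (f \<circ> chart_inv k) y" by (rule eq)
qed

lemma gfield_apply_smooth: assumes "gfield Z" "f \<in> Cinf M" shows "(\<lambda>q. Z q f) \<in> Cinf M"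
proof (rule CinfI2)
  fix k assume k: "k \<in> atlas M"
  obtain \<xi> where "\<forall>i<N. Cinf_on N (snd k ` fst k) (\<xi> i)" "\<forall>q\<in>fst k. Z q = cvec M k (\<lambda>i. \<xi> i (snd k q)) q"
    using assms(1) k unfolding gfield_def by blast
  then show "Cinf_on N (snd k ` fst k) ((\<lambda>q. Z q f) \<circ> chart_inv k)"
    using cvec_comp_smooth(2)[OF k dom_open[OF k] subset_refl, of \<xi> Z f] assms(2) by (simp add: comp_def)
qed

lemma gfield_tangent: assumes "gfield Z" "p \<in> topspace X" shows "Z p \<in> tangent_space M p"
proof -
  obtain k where k: "k \<in> atlas M" "p \<in> fst k" using chart_ex[OF assms(2)] by blast
  then show ?thesis using assms(1) cvec_tangent[OF k] unfolding gfield_def by metis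
qed

lemma gfield_non_smooth: assumes "gfield Z" "p \<in> topspace X" "f \<notin> Cinf M" shows "Z p f = 0"
  using gfield_tangent[OF assms(1,2)] assms(3) by (simp add: tangent_space_def)

text \<open>The terms with second derivatives of \<open>f\<close> are symmetric in both fields and
  cancel in the commutator; what remains is \<open>cbracket\<close> of the components.\<close>

lemma bracket_coords:
  assumes k: "k \<in> atlas M" and U: "openin X U" "U \<subseteq> fst k" and g: "gfield Z" "gfield Z'"
    and \<xi>: "\<And>i. i < N \<Longrightarrow> Cinf_on N (snd k ` U) (\<xi> i)" "\<And>q. q \<in> U \<Longrightarrow> Z q = cvec M k (\<lambda>i. \<xi> i (snd k q)) q"
    and \<eta>: "\<And>i. i < N \<Longrightarrow> Cinf_on N (snd k ` U) (\<eta> i)" "\<And>q. q \<in> U \<Longrightarrow> Z' q = cvec M k (\<lambda>i. \<eta> i (snd k q)) q"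
    and q: "q \<in> U"
  shows "lie_bracket Z Z' q = cvec M k (\<lambda>i. cbracket N \<xi> \<eta> i (snd k q)) q"
proof (rule ext)
  fix f
  have qk: "q \<in> fst k" using q U by blast
  have op: "eopen N (snd k ` U)" using open_image[OF k U(1)] U(2) by (simp add: inf.absorb2)
  show "lie_bracket Z Z' q f = cvec M k (\<lambda>i. cbracket N \<xi> \<eta> i (snd k q)) q f"
  proof (cases "f \<in> Cinf M")
    case False
    \<comment> \<open>Where \<open>f\<close> is not smooth, \<open>\<lambda>r. Z' r f\<close> is
      known to vanish at points of the manifold, which is what \<open>cvec_zero_fun\<close> asks
      for; elsewhere its values are arbitrary.\<close>
    have "Z q (\<lambda>r. Z' r f) = 0" "Z' q (\<lambda>r. Z r f) = 0"
      using cvec_zero_fun[OF k qk] gfield_non_smooth[OF g(1) _ False] gfield_non_smooth[OF g(2) _ False] \<xi>(2)[OF q] \<eta>(2)[OF q] by auto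
    then show ?thesis using False by (simp add: lie_bracket_def cvec_apply)
  next
    case True
    define F where "F = f \<circ> chart_inv k"
    define z where "z = snd k q"
    have z: "z \<in> snd k ` U" using q by (simp add: z_def)
    have F: "Cinf_on N (snd k ` U) F" unfolding F_def
      using Cinf_subset[OF CinfD[OF True k]] U(2) by (meson image_mono)
    have dF: "Cinf_on N (snd k ` U) (partial_deriv i F)" if "i < N" for i by (rule Cinf_partial[OF F that])
    have half: "A q (\<lambda>r. B r f) = (\<Sum>j\<in>{..<N}. dirD N \<alpha> (\<beta> j) z * partial_deriv j F z + \<beta> j z * dirD N \<alpha> (partial_deriv j F) z)"
      if "gfield B" and a: "A q = cvec M k (\<lambda>i. \<alpha> i (snd k q)) q"
        and b: "\<And>i. i < N \<Longrightarrow> Cinf_on N (snd k ` U) (\<beta> i)" "\<And>q. q \<in> U \<Longrightarrow> B q = cvec M k (\<lambda>i. \<beta> i (snd k q)) q"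
      for A B and \<alpha> \<beta> :: vfield
    proof -
      have "A q (\<lambda>r. B r f) = dirD N \<alpha> ((\<lambda>r. B r f) \<circ> chart_inv k) z"
        using a gfield_apply_smooth[OF that(1) True] by (simp add: cvec_apply dirD_def z_def)
      also have "\<dots> = dirD N \<alpha> (\<lambda>y. \<Sum>j\<in>{..<N}. \<beta> j y * partial_deriv j F y) z"
        by (rule dirD_cong[OF op _ z refl]) (use cvec_comp_smooth(1)[OF k U b True] in \<open>simp add: dirD_def F_def\<close>)
      also have "\<dots> = (\<Sum>j\<in>{..<N}. dirD N \<alpha> (\<beta> j) z * partial_deriv j F z + \<beta> j z * dirD N \<alpha> (partial_deriv j F) z)"
        by (rule dirD_sum_mult[OF _ _ z op]) (use b(1) dF in auto)
      finally show ?thesis .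
    qed
    have "(\<Sum>j<N. \<eta> j z * dirD N \<xi> (partial_deriv j F) z) = (\<Sum>j<N. \<Sum>i<N. \<eta> j z * (\<xi> i z * partial_deriv i (partial_deriv j F) z))"
      by (simp add: dirD_def sum_distrib_left)
    also have "\<dots> = (\<Sum>i<N. \<Sum>j<N. \<eta> j z * (\<xi> i z * partial_deriv i (partial_deriv j F) z))" by (rule sum.swap)
    also have "\<dots> = (\<Sum>i<N. \<Sum>j<N. \<xi> i z * (\<eta> j z * partial_deriv j (partial_deriv i F) z))"
      by (intro sum.cong refl) (use Cinf_symmetric[OF op F z] in \<open>simp add: mult.left_commute\<close>)
    also have "\<dots> = (\<Sum>j<N. \<xi> j z * dirD N \<eta> (partial_deriv j F) z)"
      by (simp add: dirD_def sum_distrib_left)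
    finally have sym: "(\<Sum>j<N. \<eta> j z * dirD N \<xi> (partial_deriv j F) z) = (\<Sum>j<N. \<xi> j z * dirD N \<eta> (partial_deriv j F) z)" .
    have h1: "Z q (\<lambda>r. Z' r f) = (\<Sum>j\<in>{..<N}. dirD N \<xi> (\<eta> j) z * partial_deriv j F z + \<eta> j z * dirD N \<xi> (partial_deriv j F) z)"
      by (rule half[where A=Z and B=Z' and \<alpha>=\<xi> and \<beta>=\<eta>, OF g(2) \<xi>(2)[OF q] \<eta>])
    have h2: "Z' q (\<lambda>r. Z r f) = (\<Sum>j\<in>{..<N}. dirD N \<eta> (\<xi> j) z * partial_deriv j F z + \<xi> j z * dirD N \<eta> (partial_deriv j F) z)"
      by (rule half[where A=Z' and B=Z and \<alpha>=\<eta> and \<beta>=\<xi>, OF g(1) \<eta>(2)[OF q] \<xi>])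
    have "lie_bracket Z Z' q f = (\<Sum>j<N. (dirD N \<xi> (\<eta> j) z - dirD N \<eta> (\<xi> j) z) * partial_deriv j F z)"
      unfolding lie_bracket_def h1 h2
      using sym by (simp add: sum.distrib sum_subtractf left_diff_distrib)
    then show ?thesis using True by (simp add: cvec_apply cbracket_dirD F_def z_def)
  qed
qed

lemma gfield_bracket: assumes g: "gfield Z" "gfield Z'" shows "gfield (lie_bracket Z Z')"
  unfolding gfield_def
proof
  fix k assume k: "k \<in> atlas M"
  obtain \<xi> where \<xi>: "\<And>i. i < N \<Longrightarrow> Cinf_on N (snd k ` fst k) (\<xi> i)" "\<And>q. q \<in> fst k \<Longrightarrow> Z q = cvec M k (\<lambda>i. \<xi> i (snd k q)) q"
    using g(1) k unfolding gfield_def by blast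
  obtain \<eta> where \<eta>: "\<And>i. i < N \<Longrightarrow> Cinf_on N (snd k ` fst k) (\<eta> i)" "\<And>q. q \<in> fst k \<Longrightarrow> Z' q = cvec M k (\<lambda>i. \<eta> i (snd k q)) q"
    using g(2) k unfolding gfield_def by blast
  note op = img_open[OF k]
  have "Cinf_on N (snd k ` fst k) (cbracket N \<xi> \<eta> i)" if i: "i < N" for i
    unfolding cbracket_def[abs_def]
    by (intro Cinf_sum[OF op] Cinf_diff[OF op] Cinf_mult[OF op] Cinf_partial \<xi>(1) \<eta>(1)) (use i in auto)
  then show "\<exists>\<xi>. (\<forall>i<N. Cinf_on N (snd k ` fst k) (\<xi> i)) \<and> (\<forall>q\<in>fst k. lie_bracket Z Z' q = cvec M k (\<lambda>i. \<xi> i (snd k q)) q)"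
    using bracket_coords[OF k dom_open[OF k] subset_refl g \<xi> \<eta>] by (intro exI[of _ "cbracket N \<xi> \<eta>"]) auto
qed

lemma gfield_lie:
  assumes "\<And>Z. Z \<in> T \<Longrightarrow> gfield Z" shows "Z \<in> lie_subalgebra_generated T \<Longrightarrow> gfield Z"
proof (induction rule: lie_subalgebra_generated.induct)
  case (generator X) then show ?case using assms by simp
next
  case zero
  show ?case unfolding gfield_def
    by (intro ballI exI[of _ "\<lambda>i z. 0"]) (simp add: cvec_zero Cinf_const[OF img_open])
next
  case (add Z Z')
  show ?case unfolding gfield_def
  proof
    fix k assume k: "k \<in> atlas M"
    obtain \<xi> where 1: "\<forall>i<N. Cinf_on N (snd k ` fst k) (\<xi> i)" "\<forall>q\<in>fst k. Z q = cvec M k (\<lambda>i. \<xi> i (snd k q)) q"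
      using add.IH(1) k unfolding gfield_def by blast
    obtain \<eta> where 2: "\<forall>i<N. Cinf_on N (snd k ` fst k) (\<eta> i)" "\<forall>q\<in>fst k. Z' q = cvec M k (\<lambda>i. \<eta> i (snd k q)) q"
      using add.IH(2) k unfolding gfield_def by blast
    from 1 2 show "\<exists>\<xi>. (\<forall>i<N. Cinf_on N (snd k ` fst k) (\<xi> i)) \<and> (\<forall>q\<in>fst k. (Z + Z') q = cvec M k (\<lambda>i. \<xi> i (snd k q)) q)"
      by (intro exI[of _ "\<lambda>i z. \<xi> i z + \<eta> i z"]) (simp add: cvec_add Cinf_add[OF img_open[OF k]])
  qed
next
  case (scale Z a)
  show ?case unfolding gfield_def
  proof
    fix k assume k: "k \<in> atlas M"
    obtain \<xi> where "\<forall>i<N. Cinf_on N (snd k ` fst k) (\<xi> i)" "\<forall>q\<in>fst k. Z q = cvec M k (\<lambda>i. \<xi> i (snd k q)) q"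
      using scale.IH k unfolding gfield_def by blast
    then show "\<exists>\<xi>. (\<forall>i<N. Cinf_on N (snd k ` fst k) (\<xi> i)) \<and> (\<forall>q\<in>fst k. (a *\<^sub>R Z) q = cvec M k (\<lambda>i. \<xi> i (snd k q)) q)"
      by (intro exI[of _ "\<lambda>i z. a * \<xi> i z"])
         (simp add: cvec_scale scaleR_fun_def[of a Z] Cinf_mult[OF img_open[OF k] Cinf_const[OF img_open[OF k]]])
  qed
next
  case (bracket Z Z') then show ?case using gfield_bracket by blast
qed

text \<open>Components in a chart are recovered by applying \<open>Z\<close> to cut-off coordinate
  functions, so they inherit smoothness from \<open>Z\<close>. That components exist at each point
  in one chart carries over to all charts by \<open>cvec_change\<close>.\<close>

lemma gfieldI:
  assumes s: "smooth_vector_field_on M (topspace X) Z"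
    and c: "\<And>p. p \<in> topspace X \<Longrightarrow> \<exists>k\<in>atlas M. p \<in> fst k \<and> (\<exists>\<xi>. Z p = cvec M k \<xi> p)"
  shows "gfield Z"
  unfolding gfield_def
proof
  fix k assume k: "k \<in> atlas M"
  have "\<exists>\<xi>. Z q = cvec M k \<xi> q" if q: "q \<in> fst k" for q
  proof -
    obtain k' \<xi> where k': "k' \<in> atlas M" "q \<in> fst k'" "Z q = cvec M k' \<xi> q" using c dom_sub[OF k] q by blast
    then show ?thesis using cvec_change[OF k'(1,2) k q, of \<xi>] by simp
  qed
  then obtain x where x: "\<And>q. q \<in> fst k \<Longrightarrow> Z q = cvec M k (x q) q" by metis
  have "Cinf_on N (snd k ` fst k) (\<lambda>y. x (chart_inv k y) j)" if j: "j < N" for j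
  proof (rule Cinf_local[OF img_open[OF k]])
    fix y assume "y \<in> snd k ` fst k"
    then obtain p where p: "p \<in> fst k" "y = snd k p" by blast
    obtain \<phi> U where \<phi>: "\<phi> \<in> Cinf M" "openin X U" "p \<in> U" "U \<subseteq> fst k" "\<And>q i. q \<in> U \<Longrightarrow> i < N \<Longrightarrow> coord_vector M k i q \<phi> = (if i = j then 1 else 0)"
      using coordinate_function[OF k p(1), of j] by blast
    have op: "eopen N (snd k ` (fst k \<inter> U))" by (rule open_image[OF k \<phi>(2)])
    have "(\<lambda>q. Z q \<phi>) \<in> Cinf M" using s \<phi>(1) by (simp add: smooth_vector_field_on_def Cinf_def)
    then have "Cinf_on N (snd k ` (fst k \<inter> U)) ((\<lambda>q. Z q \<phi>) \<circ> chart_inv k)"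
      by (rule Cinf_subset[OF CinfD[OF _ k]]) auto
    then have "Cinf_on N (snd k ` (fst k \<inter> U)) (\<lambda>y. x (chart_inv k y) j)"
    proof (rule Cinf_cong[OF op])
      fix y assume "y \<in> snd k ` (fst k \<inter> U)"
      then obtain q where q: "q \<in> U" "q \<in> fst k" "chart_inv k y = q" using inv1[OF k] by auto
      have "Z q \<phi> = (\<Sum>i<N. if i = j then x q j else 0)"
        unfolding x[OF q(2)] cvec_def tv_sum by (intro sum.cong) (use \<phi>(5)[OF q(1)] in auto)
      then show "((\<lambda>q. Z q \<phi>) \<circ> chart_inv k) y = x (chart_inv k y) j" using j q by simp
    qed
    then show "\<exists>V. eopen N V \<and> y \<in> V \<and> Cinf_on N V (\<lambda>y. x (chart_inv k y) j)"
      using op p \<phi>(3) by blast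
  qed
  then show "\<exists>\<xi>. (\<forall>i<N. Cinf_on N (snd k ` fst k) (\<xi> i)) \<and> (\<forall>q\<in>fst k. Z q = cvec M k (\<lambda>i. \<xi> i (snd k q)) q)"
    using x inv1[OF k] by (intro exI[of _ "\<lambda>i y. x (chart_inv k y) i"]) auto
qed

section \<open>Charts from diffeomorphisms, slices\<close>

text \<open>The atlas is maximal, so a chart belongs to it once the transitions from and to every
  member are smooth; here these factor through \<open>k\<close>.\<close>

lemma chart_compose:
  assumes k: "k \<in> atlas M" and D: "eopen N D" "D \<subseteq> snd k ` fst k" and D': "eopen N D'"
    and \<Psi>: "\<And>z. z \<in> D \<Longrightarrow> \<Psi> z \<in> D' \<and> \<Phi> (\<Psi> z) = z" "\<And>i. i < N \<Longrightarrow> Cinf_on N D (\<lambda>z. \<Psi> z i)"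
    and \<Phi>: "\<And>w. w \<in> D' \<Longrightarrow> \<Phi> w \<in> D \<and> \<Psi> (\<Phi> w) = w" "\<And>i. i < N \<Longrightarrow> Cinf_on N D' (\<lambda>w. \<Phi> w i)"
  defines "\<kappa> \<equiv> ({q\<in>fst k. snd k q \<in> D}, \<lambda>q. \<Psi> (snd k q))"
  shows "\<kappa> \<in> atlas M" and "snd \<kappa> ` fst \<kappa> = D'" and "\<And>w. w \<in> D' \<Longrightarrow> chart_inv \<kappa> w = chart_inv k (\<Phi> w)"
proof -
  have ok: "openin X (fst \<kappa>)" unfolding \<kappa>_def fst_conv by (rule chart_open_vimage[OF chart[OF k] D(1)])
  have inv_in: "chart_inv k (\<Phi> w) \<in> fst \<kappa>" "snd \<kappa> (chart_inv k (\<Phi> w)) = w" if "w \<in> D'" for w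
  proof -
    have "\<Phi> w \<in> snd k ` fst k" using \<Phi>(1)[OF that] D by blast
    then show "chart_inv k (\<Phi> w) \<in> fst \<kappa>" "snd \<kappa> (chart_inv k (\<Phi> w)) = w"
      using \<Phi>(1)[OF that] by (simp_all add: \<kappa>_def chart_inv_in snd_chart_inv)
  qed
  have im: "snd \<kappa> ` fst \<kappa> = D'"
  proof (intro equalityI subsetI)
    fix w assume "w \<in> D'" then show "w \<in> snd \<kappa> ` fst \<kappa>" using inv_in by (metis imageI)
  qed (use \<Psi>(1) in \<open>auto simp: \<kappa>_def\<close>)
  then show "snd \<kappa> ` fst \<kappa> = D'" .
  have inj: "inj_on (snd \<kappa>) (fst \<kappa>)"
  proof (rule inj_onI)
    fix p q assume "p \<in> fst \<kappa>" "q \<in> fst \<kappa>" and e: "snd \<kappa> p = snd \<kappa> q"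
    then have pq: "p \<in> fst k" "snd k p \<in> D" "q \<in> fst k" "snd k q \<in> D" by (auto simp: \<kappa>_def)
    have "snd k p = snd k q" using e \<Psi>(1)[OF pq(2)] \<Psi>(1)[OF pq(4)] unfolding \<kappa>_def snd_conv by metis
    then show "p = q" by (rule snd_inj[OF k pq(1,3)])
  qed
  have ts: "topspace (subtopology X (fst \<kappa>)) = fst \<kappa>" using openin_subset[OF ok] by (simp add: inf.absorb2)
  have tsE: "topspace (subtopology (Euclidean_space N) D') = D'" using openin_subset[OF D'] by (simp add: inf.absorb2)
  have eD: "\<Psi> z \<in> eucl N" if "z \<in> D" for z using \<Psi>(1)[OF that] open_sub_eucl[OF D'] by blast
  have eD': "\<Phi> z \<in> eucl N" if "z \<in> D'" for z using \<Phi>(1)[OF that] open_sub_eucl[OF D(1)] by blast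
  have "homeomorphic_map (subtopology X (fst \<kappa>)) (subtopology (Euclidean_space N) D') (snd \<kappa>)"
  proof (rule bijective_open_imp_homeomorphic_map)
    show "continuous_map (subtopology X (fst \<kappa>)) (subtopology (Euclidean_space N) D') (snd \<kappa>)"
      unfolding continuous_map_def ts tsE
    proof (intro conjI allI impI)
      show "snd \<kappa> \<in> fst \<kappa> \<rightarrow> D'" using im by auto
      fix U assume "openin (subtopology (Euclidean_space N) D') U"
      then have U: "eopen N U" using D' by (simp add: openin_open_subtopology)
      have "eopen N {z\<in>D. \<Psi> z \<in> U}" by (rule open_vimage_eucl[OF D(1) U eD \<Psi>(2)])
      then have "openin X {q\<in>fst k. snd k q \<in> {z\<in>D. \<Psi> z \<in> U}}" by (rule chart_open_vimage[OF chart[OF k]])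
      moreover have "{q\<in>fst k. snd k q \<in> {z\<in>D. \<Psi> z \<in> U}} = {x \<in> fst \<kappa>. snd \<kappa> x \<in> U}" by (auto simp: \<kappa>_def)
      ultimately show "openin (subtopology X (fst \<kappa>)) {x \<in> fst \<kappa>. snd \<kappa> x \<in> U}"
        using ok by (auto simp: openin_open_subtopology)
    qed
    show "open_map (subtopology X (fst \<kappa>)) (subtopology (Euclidean_space N) D') (snd \<kappa>)"
      unfolding open_map_def
    proof (intro allI impI)
      fix U assume "openin (subtopology X (fst \<kappa>)) U"
      then have U: "openin X U" "U \<subseteq> fst \<kappa>" using ok by (auto simp: openin_open_subtopology)
      have "eopen N {w\<in>D'. \<Phi> w \<in> snd k ` (fst k \<inter> U)}"
        by (rule open_vimage_eucl[OF D' open_image[OF k U(1)] eD' \<Phi>(2)])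
      moreover have "{w\<in>D'. \<Phi> w \<in> snd k ` (fst k \<inter> U)} = snd \<kappa> ` U"
      proof (intro equalityI subsetI)
        fix w assume "w \<in> {w\<in>D'. \<Phi> w \<in> snd k ` (fst k \<inter> U)}"
        then obtain p where "w \<in> D'" "p \<in> U" "\<Phi> w = snd k p" by blast
        then show "w \<in> snd \<kappa> ` U" using \<Phi>(1)[of w] by (intro image_eqI[of _ _ p]) (auto simp: \<kappa>_def)
      next
        fix w assume "w \<in> snd \<kappa> ` U"
        then obtain p where p: "p \<in> U" "w = \<Psi> (snd k p)" by (auto simp: \<kappa>_def)
        then have "p \<in> fst k" "snd k p \<in> D" using U(2) by (auto simp: \<kappa>_def)
        then show "w \<in> {w\<in>D'. \<Phi> w \<in> snd k ` (fst k \<inter> U)}" using \<Psi>(1)[of "snd k p"] p by auto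
      qed
      ultimately show "openin (subtopology (Euclidean_space N) D') (snd \<kappa> ` U)"
        using D' by (auto simp: openin_open_subtopology)
    qed
  qed (use im inj ts tsE in auto)
  then have ch: "is_chart N X \<kappa>" unfolding is_chart_def using ok im D' by simp
  show ci: "chart_inv \<kappa> w = chart_inv k (\<Phi> w)" if "w \<in> D'" for w
    using chart_inv_snd[OF ch inv_in(1)[OF that]] inv_in(2)[OF that] by simp
  show "\<kappa> \<in> atlas M"
  proof (rule atlasI[OF ch], intro conjI)
    fix c assume c: "c \<in> atlas M"
    show "smooth_transition N \<kappa> c" unfolding smooth_transition_def
    proof (intro allI impI)
      fix i assume i: "i < N"
      let ?V = "snd \<kappa> ` (fst \<kappa> \<inter> fst c)"
      have op: "eopen N ?V" by (rule chart_open_image[OF ch dom_open[OF c]])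
      have V: "?V \<subseteq> D'" using im by blast
      have "Cinf_on N ?V (\<lambda>w. snd c (chart_inv k (\<Phi> w)) i)"
      proof (rule Cinf_comp[OF op open_image2[OF k c] transition[OF k c i]])
        show "Cinf_on N ?V (\<lambda>w. \<Phi> w j)" if "j < N" for j by (rule Cinf_subset[OF \<Phi>(2)[OF that] V])
        fix w assume "w \<in> ?V"
        then obtain p where p: "p \<in> fst \<kappa>" "p \<in> fst c" "w = snd \<kappa> p" by blast
        then have "\<Phi> w = snd k p" "p \<in> fst k" using \<Psi>(1)[of "snd k p"] by (auto simp: \<kappa>_def)
        then show "\<Phi> w \<in> snd k ` (fst k \<inter> fst c)" using p by blast
      qed
      then show "Cinf_on N ?V (\<lambda>w. snd c (chart_inv \<kappa> w) i)"
        by (rule Cinf_cong[OF op]) (use ci V in auto)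
    qed
    show "smooth_transition N c \<kappa>" unfolding smooth_transition_def
    proof (intro allI impI)
      fix i assume i: "i < N"
      let ?V = "snd c ` (fst c \<inter> fst \<kappa>)"
      have op: "eopen N ?V" by (rule open_image[OF c ok])
      have "Cinf_on N ?V (\<lambda>w. \<Psi> (snd k (chart_inv c w)) i)"
      proof (rule Cinf_comp[OF op D(1) \<Psi>(2)[OF i]])
        show "Cinf_on N ?V (\<lambda>w. snd k (chart_inv c w) j)" if "j < N" for j
          by (rule Cinf_subset[OF transition[OF c k that]]) (auto simp: \<kappa>_def)
        show "snd k (chart_inv c w) \<in> D" if "w \<in> ?V" for w
          using that inv1[OF c] by (auto simp: \<kappa>_def)
      qed
      then show "Cinf_on N ?V (\<lambda>w. snd \<kappa> (chart_inv c w) i)" by (simp add: \<kappa>_def)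
    qed
  qed
qed

lemma chart_restrict:
  assumes k: "k \<in> atlas M" and U: "openin X U" shows "(fst k \<inter> U, snd k) \<in> atlas M"
proof -
  let ?D = "snd k ` (fst k \<inter> U)"
  have op: "eopen N ?D" by (rule open_image[OF k U])
  have "({q\<in>fst k. snd k q \<in> ?D}, \<lambda>q. (\<lambda>z. z) (snd k q)) \<in> atlas M"
    by (rule chart_compose(1)[OF k op _ op, where \<Phi>="\<lambda>z. z"]) (auto intro: Cinf_coord[OF op])
  moreover have "{q\<in>fst k. snd k q \<in> ?D} = fst k \<inter> U"
  proof (intro equalityI subsetI)
    fix q assume "q \<in> {q\<in>fst k. snd k q \<in> ?D}"
    then obtain r where "q \<in> fst k" "r \<in> fst k" "r \<in> U" "snd k q = snd k r" by blast
    then show "q \<in> fst k \<inter> U" using snd_inj[OF k, of q r] by blast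
  qed auto
  ultimately show ?thesis by simp
qed

text \<open>The transition between two slice charts maps points of \<open>eucl d\<close> near
  \<open>snd c p\<close> into \<open>eucl d\<close>, so its components from \<open>d\<close> on have
  zero derivatives in the first \<open>d\<close> directions. Used both ways, this makes the tangent
  space of a submanifold independent of the slice chart.\<close>

lemma slice_span_subset:
  assumes d: "d \<le> N" and c: "slice_chart M d L c" "p \<in> fst c" and c': "slice_chart M d L c'" "p \<in> fst c'" and p: "p \<in> L"
  shows "span ((\<lambda>i. coord_vector M c i p) ` {..<d}) \<subseteq> span ((\<lambda>i. coord_vector M c' i p) ` {..<d})"
proof (rule span_minimal[OF _ subspace_span], rule image_subsetI)
  fix i assume "i \<in> {..<d}"
  then have i: "i < d" "i < N" using d by auto
  have at: "c \<in> atlas M" "c' \<in> atlas M" using c c' by (auto simp: slice_chart_def)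
  have sl: "snd c ` (fst c \<inter> L) = snd c ` fst c \<inter> eucl d" "snd c' ` (fst c' \<inter> L) = snd c' ` fst c' \<inter> eucl d"
    using c c' by (auto simp: slice_chart_def)
  have pd: "snd c p \<in> eucl d" using sl(1) c(2) p by blast
  have op: "eopen N (snd c ` (fst c \<inter> fst c'))" by (rule open_image2[OF at])
  have z: "partial_deriv i (\<lambda>y. snd c' (chart_inv c y) j) (snd c p) = 0" if j: "j \<ge> d" for j
  proof (rule partial_deriv_eqI)
    have "\<forall>\<^sub>F t in nhds (snd c p i). (snd c p)(i := t) \<in> snd c ` (fst c \<inter> fst c')"
      by (rule eventually_upd[OF op _ i(2)]) (use c c' in auto)
    then have ev: "\<forall>\<^sub>F t in nhds (snd c p i). snd c' (chart_inv c ((snd c p)(i := t))) j = 0"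
    proof eventually_elim
      case (elim t)
      have "(snd c p)(i := t) \<in> eucl d" using pd i by (auto simp: eucl_iff)
      then have "(snd c p)(i := t) \<in> snd c ` (fst c \<inter> L)" using elim sl(1) by blast
      then obtain r where r: "r \<in> fst c" "r \<in> L" "(snd c p)(i := t) = snd c r" by blast
      obtain r' where r': "r' \<in> fst c" "r' \<in> fst c'" "(snd c p)(i := t) = snd c r'" using elim by blast
      have "r = r'" by (rule snd_inj[OF at(1) r(1) r'(1)]) (use r(3) r'(3) in metis)
      then have rc: "r \<in> fst c'" using r'(2) by simp
      then have "snd c' r \<in> eucl d" using sl(2) r(2) by blast
      then show ?case using r(3) inv1[OF at(1) r(1)] j by (simp add: eucl_iff)
    qed
    have "((\<lambda>t. 0) has_real_derivative 0) (at (snd c p i))" by simp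
    then show "((\<lambda>t. snd c' (chart_inv c ((snd c p)(i := t))) j) has_real_derivative 0) (at (snd c p i))"
      using DERIV_cong_ev[OF refl ev refl] by simp
  qed
  have "coord_vector M c i p = (\<Sum>j<N. partial_deriv i (\<lambda>y. snd c' (chart_inv c y) j) (snd c p) *\<^sub>R coord_vector M c' j p)"
    using coord_change[OF at(1) c(2) at(2) c'(2) i(2)] by (simp add: cvec_def)
  also have "\<dots> = (\<Sum>j<d. partial_deriv i (\<lambda>y. snd c' (chart_inv c y) j) (snd c p) *\<^sub>R coord_vector M c' j p)"
    by (rule sum.mono_neutral_right) (use d z in auto)
  finally show "coord_vector M c i p \<in> span ((\<lambda>i. coord_vector M c' i p) ` {..<d})"
    by (auto intro!: span_sum span_scale intro: span_base)
qed

end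

section \<open>Leaves\<close>

text \<open>The surrounding space need not be finite-dimensional, so dimensions are compared through
  \<open>independent_span_bound\<close>: a strictly larger span would contain
  \<open>dim P + 1\<close> independent vectors inside the span of \<open>card T \<le> dim P\<close>
  ones.\<close>

lemma span_eq_by_dim:
  fixes P :: "('b :: real_vector) set"
  assumes P: "P = span S0" "finite S0" and T: "P \<subseteq> span T" "finite T" "card T \<le> dim P"
  shows "span T = P"
proof (rule ccontr)
  assume "span T \<noteq> P"
  then obtain v where v: "v \<in> span T" "v \<notin> P" using T(1) by blast
  obtain B where B: "B \<subseteq> P" "independent B" "P \<subseteq> span B" "card B = dim P" using basis_exists[of P] by blast
  have fB: "finite B" using independent_span_bound[OF P(2) B(2)] B(1) P(1) by blast
  have "span B \<subseteq> P" using B(1) P(1) by (metis span_mono span_span)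
  then have vB: "v \<notin> span B" using v(2) by blast
  then have "independent (insert v B)" using B(2) by (simp add: independent_insert)
  moreover have "insert v B \<subseteq> span T" using v(1) B(1) T(1) by blast
  ultimately have "card (insert v B) \<le> card T" using independent_span_bound[OF T(2)] by blast
  moreover have "v \<notin> B" using vB span_base by blast
  ultimately show False using fB T(3) B(4) by simp
qed

text \<open>Completes the graph coordinates \<open>\<sigma>\<close> to a permutation of all
  coordinates, so that a slice chart can list them first.\<close>

lemma extend_to_bij:
  assumes inj: "inj_on \<sigma> {..<d}" and n: "\<And>i. i < d \<Longrightarrow> \<sigma> i < (n::nat)"
  shows "\<exists>\<pi>. bij_betw \<pi> {..<n} {..<n} \<and> (\<forall>i<d. \<pi> i = \<sigma> i) \<and> d \<le> n"
proof -
  have sub: "\<sigma> ` {..<d} \<subseteq> {..<n}" using n by auto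
  have cd: "card (\<sigma> ` {..<d}) = d" using inj by (simp add: card_image)
  then have dn: "d \<le> n" using card_mono[OF _ sub] by simp
  have "card {d..<n} = card ({..<n} - \<sigma> ` {..<d})" using sub cd by (simp add: card_Diff_subset)
  then obtain r where r: "bij_betw r {d..<n} ({..<n} - \<sigma> ` {..<d})"
    using finite_same_card_bij[of "{d..<n}" "{..<n} - \<sigma> ` {..<d}"] by auto
  have "bij_betw (\<lambda>i. if i \<in> {..<d} then \<sigma> i else r i) ({..<d} \<union> {d..<n}) (\<sigma> ` {..<d} \<union> ({..<n} - \<sigma> ` {..<d}))"
    by (rule bij_betw_disjoint_Un) (use inj r in \<open>auto simp: bij_betw_def\<close>)
  moreover have "{..<d} \<union> {d..<n} = {..<n}" using dn by auto
  moreover have "\<sigma> ` {..<d} \<union> ({..<n} - \<sigma> ` {..<d}) = {..<n}" using sub by auto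
  ultimately show ?thesis using dn by (intro exI[of _ "\<lambda>i. if i \<in> {..<d} then \<sigma> i else r i"]) auto
qed

context smanifold
begin

text \<open>\<open>F\<close> is a graph over the coordinates \<open>\<sigma>\<close>; \<open>\<kappa>\<close> straightens its image \<open>L\<close> by subtracting the graph.\<close>

lemma graph_slice:
  assumes k: "k \<in> atlas M" and B: "eopen N B" "B \<subseteq> snd k ` fst k" and r: "\<rho> > 0"
    and sg: "inj_on \<sigma> {..<d}" "\<And>i. i < d \<Longrightarrow> \<sigma> i < N"
    and F: "\<And>j. j < N \<Longrightarrow> Cinf_on d (cbx d 0 \<rho>) (\<lambda>v. F v j)" "\<And>v. v \<in> cbx d 0 \<rho> \<Longrightarrow> F v \<in> B"
      "\<And>v i. v \<in> cbx d 0 \<rho> \<Longrightarrow> i < d \<Longrightarrow> F v (\<sigma> i) = z0 (\<sigma> i) + v i"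
    and z0: "F 0 = z0"
  shows "\<exists>\<kappa> L. slice_chart M d L \<kappa> \<and> L \<subseteq> fst \<kappa> \<and> fst \<kappa> \<subseteq> fst k \<and> d \<le> N \<and> chart_inv k z0 \<in> L \<and>
    (\<forall>q\<in>L. \<exists>v\<in>cbx d 0 \<rho>. snd k q = F v \<and> (\<forall>i<d. coord_vector M \<kappa> i q = cvec M k (\<lambda>j. partial_deriv i (\<lambda>v. F v j) v) q))"
proof -
  obtain \<pi> where pi: "bij_betw \<pi> {..<N} {..<N}" "\<And>i. i < d \<Longrightarrow> \<pi> i = \<sigma> i" and dN: "d \<le> N"
    using extend_to_bij[OF sg] by blast
  define \<pi>' where "\<pi>' = inv_into {..<N} \<pi>"
  have pi': "\<pi>' (\<pi> i) = i" "\<pi> i < N" if "i < N" for i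
    using pi(1) that by (auto simp: \<pi>'_def bij_betw_def)
  have pi'2: "\<pi> (\<pi>' j) = j" "\<pi>' j < N" if "j < N" for j
    using pi(1) that bij_betw_inv_into_right[OF pi(1), of j] bij_betwE[OF bij_betw_inv_into[OF pi(1)]] by (auto simp: \<pi>'_def)
  let ?Q = "cbx d 0 \<rho>"
  have Qo: "eopen d ?Q" by (rule open_cbx)
  have BE: "B \<subseteq> eucl N" by (rule open_sub_eucl[OF B(1)])
  define vv where "vv z = (\<lambda>i. if i < d then z (\<sigma> i) - z0 (\<sigma> i) else 0)" for z :: "nat \<Rightarrow> real"
  define D where "D = {z\<in>B. vv z \<in> ?Q}"
  have vvC: "Cinf_on N B (\<lambda>z. vv z i)" for i
    unfolding vv_def using Cinf_diff[OF B(1) Cinf_coord[OF B(1)] Cinf_const[OF B(1)]] Cinf_const[OF B(1)] by (cases "i < d") auto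
  have D: "eopen N D" unfolding D_def
    by (rule open_vimage_eucl[OF B(1) Qo _ vvC]) (simp add: vv_def eucl_iff)
  have DB: "D \<subseteq> B" by (auto simp: D_def)
  \<comment> \<open>\<open>\<Psi>\<close> puts the coordinates \<open>\<sigma>\<close> first,
    relative to \<open>z0\<close>, and replaces the others by their height over the graph of
    \<open>F\<close>; \<open>\<Phi>\<close> adds the graph back. On the slice, where the heights are
    0, \<open>\<Phi>\<close> is \<open>F\<close>.\<close>
  define \<Psi> where "\<Psi> z = (\<lambda>i. if i < d then z (\<sigma> i) - z0 (\<sigma> i) else if i < N then z (\<pi> i) - F (vv z) (\<pi> i) else 0)" for z
  define \<Phi> where "\<Phi> w = (\<lambda>j. if j < N then F (trunc d w) j + (if \<pi>' j < d then 0 else w (\<pi>' j)) else 0)" for w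
  define D1 where "D1 = {w\<in>eucl N. trunc d w \<in> ?Q}"
  have eo: "eopen N (eucl N)" by simp
  have trC: "Cinf_on N W (\<lambda>w. trunc d w i)" if "eopen N W" for W i
    using Cinf_coord[OF that, of i] Cinf_const[OF that, of 0] by (cases "i < d") (auto simp: trunc_def)
  have D1: "eopen N D1" unfolding D1_def by (rule open_vimage_eucl[OF eo Qo trunc_eucl trC[OF eo]])
  have FtC: "Cinf_on N D1 (\<lambda>w. F (trunc d w) j)" if "j < N" for j
    by (rule Cinf_comp[OF D1 Qo F(1)[OF that] trC[OF D1]]) (auto simp: D1_def)
  have \<Phi>C1: "Cinf_on N D1 (\<lambda>w. \<Phi> w j)" if j: "j < N" for j
  proof -
    have "Cinf_on N D1 (\<lambda>w. if \<pi>' j < d then 0 else w (\<pi>' j))"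
      using Cinf_coord[OF D1] Cinf_const[OF D1] by (cases "\<pi>' j < d") auto
    from Cinf_add[OF D1 FtC[OF j] this] show ?thesis using j by (simp add: \<Phi>_def)
  qed
  have \<Phi>e: "\<Phi> w \<in> eucl N" for w by (simp add: \<Phi>_def eucl_iff)
  define D' where "D' = {w\<in>D1. \<Phi> w \<in> B}"
  have D': "eopen N D'" unfolding D'_def by (rule open_vimage_eucl[OF D1 B(1) \<Phi>e \<Phi>C1])
  have \<Phi>s: "\<Phi> w (\<sigma> i) = z0 (\<sigma> i) + w i" if "w \<in> D1" "i < d" for w i
  proof -
    have "\<pi>' (\<sigma> i) = i" using pi'(1)[of i] pi(2)[OF that(2)] that(2) dN by simp
    then show ?thesis using that sg(2)[OF that(2)] F(3)[of "trunc d w" i] by (simp add: \<Phi>_def D1_def trunc_def)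
  qed
  have v\<Phi>: "vv (\<Phi> w) = trunc d w" if "w \<in> D1" for w
    using \<Phi>s[OF that] by (auto simp: vv_def trunc_def)
  have t\<Psi>: "trunc d (\<Psi> z) = vv z" for z by (auto simp: trunc_def \<Psi>_def vv_def)
  have \<Psi>e: "\<Psi> z \<in> eucl N" for z using dN by (auto simp: \<Psi>_def eucl_iff)
  have \<Phi>\<Psi>: "\<Phi> (\<Psi> z) = z" if z: "z \<in> D" for z
  proof (rule eucl_ext[OF \<Phi>e])
    show "z \<in> eucl N" using z DB BE by blast
    fix j assume j: "j < N"
    obtain i where i: "i < N" "j = \<pi> i" "\<pi>' j = i" using pi'2[OF j] by metis
    show "\<Phi> (\<Psi> z) j = z j"
    proof (cases "i < d")
      case True
      then have "F (vv z) j = z0 j + vv z i" using F(3)[of "vv z" i] z pi(2)[OF True] i by (simp add: D_def)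
      then show ?thesis using True j i pi(2)[OF True] by (simp add: \<Phi>_def t\<Psi> vv_def)
    next
      case False then show ?thesis using j i by (simp add: \<Phi>_def t\<Psi>) (simp add: \<Psi>_def)
    qed
  qed
  have \<Psi>1: "\<Psi> z \<in> D' \<and> \<Phi> (\<Psi> z) = z" if z: "z \<in> D" for z
    using \<Phi>\<Psi>[OF z] z \<Psi>e DB by (auto simp: D'_def D1_def t\<Psi> D_def)
  have \<Psi>2: "Cinf_on N D (\<lambda>z. \<Psi> z i)" if i: "i < N" for i
  proof (cases "i < d")
    case True
    have "Cinf_on N D (\<lambda>z. z (\<sigma> i) - z0 (\<sigma> i))" by (intro Cinf_diff[OF D] Cinf_coord[OF D] Cinf_const[OF D])
    then show ?thesis using True by (simp add: \<Psi>_def)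
  next
    case False
    have "Cinf_on N D (\<lambda>z. F (vv z) (\<pi> i))"
      by (rule Cinf_comp[OF D Qo F(1)[OF pi'(2)[OF i]] Cinf_subset[OF vvC DB]]) (simp add: D_def)
    then have "Cinf_on N D (\<lambda>z. z (\<pi> i) - F (vv z) (\<pi> i))" by (rule Cinf_diff[OF D Cinf_coord[OF D]])
    then show ?thesis using False i by (simp add: \<Psi>_def)
  qed
  have \<Phi>1: "\<Phi> w \<in> D \<and> \<Psi> (\<Phi> w) = w" if w: "w \<in> D'" for w
  proof
    have w1: "w \<in> D1" using w by (simp add: D'_def)
    show "\<Phi> w \<in> D" using w v\<Phi>[OF w1] by (simp add: D_def D'_def D1_def)
    show "\<Psi> (\<Phi> w) = w"
    proof (rule eucl_ext[OF \<Psi>e])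
      show "w \<in> eucl N" using w1 by (simp add: D1_def)
      fix i assume i: "i < N"
      show "\<Psi> (\<Phi> w) i = w i"
      proof (cases "i < d")
        case True then show ?thesis using \<Phi>s[OF w1 True] by (simp add: \<Psi>_def)
      next
        case False then show ?thesis using i pi' by (simp add: \<Psi>_def v\<Phi>[OF w1]) (simp add: \<Phi>_def)
      qed
    qed
  qed
  have \<Phi>2: "Cinf_on N D' (\<lambda>w. \<Phi> w i)" if "i < N" for i
    by (rule Cinf_subset[OF \<Phi>C1[OF that]]) (auto simp: D'_def)
  define \<kappa> where "\<kappa> = ({q\<in>fst k. snd k q \<in> D}, \<lambda>q. \<Psi> (snd k q))"
  have Dk: "D \<subseteq> snd k ` fst k" using DB B(2) by blast
  note cc = chart_compose[OF k D Dk D' \<Psi>1 \<Psi>2 \<Phi>1 \<Phi>2, folded \<kappa>_def]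
  define L where "L = {q\<in>fst \<kappa>. snd \<kappa> q \<in> eucl d}"
  have sl: "slice_chart M d L \<kappa>" unfolding slice_chart_def using cc(1) by (auto simp: L_def)
  have z0Q: "(0 :: nat \<Rightarrow> real) \<in> ?Q" using r by (intro cbx_self) (simp_all add: eucl_iff)
  have z0B: "z0 \<in> B" using F(2)[OF z0Q] z0 by simp
  have vz0: "vv z0 = 0" by (auto simp: vv_def)
  have z0D: "z0 \<in> D" using z0B vz0 z0Q by (simp add: D_def)
  have "\<Psi> z0 i = 0" for i
    unfolding \<Psi>_def vz0 z0 using vz0 by (simp add: vv_def)
  then have "\<Psi> z0 = 0" by (auto simp: fun_eq_iff)
  then have pL: "chart_inv k z0 \<in> L"
    using z0D Dk by (auto simp: L_def \<kappa>_def snd_chart_inv chart_inv_in eucl_iff)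
  have Lq: "\<exists>v\<in>?Q. snd k q = F v \<and> (\<forall>i<d. coord_vector M \<kappa> i q = cvec M k (\<lambda>j. partial_deriv i (\<lambda>v. F v j) v) q)"
    if q: "q \<in> L" for q
  proof -
    define w where "w = snd \<kappa> q"
    have q': "q \<in> fst \<kappa>" "q \<in> fst k" "w \<in> eucl d" using q by (auto simp: L_def \<kappa>_def w_def)
    have wD': "w \<in> D'" using cc(2) q'(1) by (auto simp: w_def)
    then have w1: "w \<in> D1" by (simp add: D'_def)
    have tw: "trunc d w = w" by (rule trunc_id[OF q'(3)])
    have wQ: "w \<in> ?Q" using w1 tw by (simp add: D1_def)
    have snq: "snd k q = \<Phi> w" using \<Psi>1[of "snd k q"] q'(1) by (simp add: \<kappa>_def w_def)
    have "\<Phi> w = F w"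
    proof (rule eucl_ext[OF \<Phi>e])
      show "F w \<in> eucl N" using F(2)[OF wQ] BE by blast
      show "\<Phi> w j = F w j" if "j < N" for j using that q'(3) by (simp add: \<Phi>_def tw eucl_iff)
    qed
    moreover have "coord_vector M \<kappa> i q = cvec M k (\<lambda>j. partial_deriv i (\<lambda>v. F v j) w) q" if i: "i < d" for i
    proof -
      have iN: "i < N" using i dN by simp
      have "partial_deriv i (\<lambda>y. snd k (chart_inv \<kappa> y) j) w = partial_deriv i (\<lambda>v. F v j) w" if j: "j < N" for j
      proof -
        have "partial_deriv i (\<lambda>y. snd k (chart_inv \<kappa> y) j) w = partial_deriv i (\<lambda>y. \<Phi> y j) w"
        proof (rule partial_deriv_cong[OF D' _ wD' iN])
          fix y assume y: "y \<in> D'"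
          then have "\<Phi> y \<in> snd k ` fst k" using \<Phi>1 Dk by blast
          then show "snd k (chart_inv \<kappa> y) j = \<Phi> y j" using cc(3)[of y] y snd_chart_inv[of "\<Phi> y" k] by simp
        qed
        also have "\<dots> = partial_deriv i (\<lambda>v. F v j) w"
        proof (rule partial_deriv_eqI)
          have "\<Phi> (w(i := t)) j = F (w(i := t)) j + (if \<pi>' j < d then 0 else w (\<pi>' j))" for t
          proof -
            have "trunc d (w(i := t)) = w(i := t)" using i q'(3) by (intro trunc_id) (auto simp: eucl_iff)
            then show ?thesis using j i by (auto simp: \<Phi>_def)
          qed
          then have eq: "(\<lambda>t. \<Phi> (w(i := t)) j) = (\<lambda>t. F (w(i := t)) j + (if \<pi>' j < d then 0 else w (\<pi>' j)))" by blast
          show "((\<lambda>t. \<Phi> (w(i := t)) j) has_real_derivative partial_deriv i (\<lambda>v. F v j) w) (at (w i))"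
            unfolding eq using DERIV_add[OF Cinf_has[OF F(1)[OF j] wQ i] DERIV_const] by simp
        qed
        finally show ?thesis .
      qed
      then have "cvec M k (\<lambda>j. partial_deriv i (\<lambda>y. snd k (chart_inv \<kappa> y) j) w) q = cvec M k (\<lambda>j. partial_deriv i (\<lambda>v. F v j) w) q"
        by (rule cvec_cong)
      then show ?thesis using coord_change[OF cc(1) q'(1) k q'(2) iN] unfolding w_def by (rule trans[rotated])
    qed
    ultimately show ?thesis using wQ snq by (intro bexI[of _ w]) auto
  qed
  have "L \<subseteq> fst \<kappa>" "fst \<kappa> \<subseteq> fst k" by (auto simp: L_def \<kappa>_def)
  then show ?thesis using sl dN pL Lq by (intro exI[of _ \<kappa>] exI[of _ L]) blast
qed

lemma tangent_scale: "v \<in> tangent_space M p \<Longrightarrow> a *\<^sub>R v \<in> tangent_space M p"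
  by (simp add: tangent_space_def scaleR_fun_def algebra_simps)

end

text \<open>The condition \<open>coords\<close> comes from spanning fields that are given in
  coordinates. It makes the tangent fields of \<open>P\<close>, and with them all iterated brackets,
  members of \<open>gfield\<close>.\<close>

locale plane_field = smanifold +
  fixes d :: nat and P
  assumes pf: "smooth_plane_field M d P"
    and coords: "\<And>p. p \<in> topspace (mtop M) \<Longrightarrow> \<exists>k\<in>atlas M. p \<in> fst k \<and> (\<forall>v\<in>P p. \<exists>\<xi>. v = cvec M k \<xi> p)"
begin

abbreviation "G \<equiv> lie_subalgebra_generated (tangent_fields M P)"

lemma frame: "p \<in> topspace X \<Longrightarrow> \<exists>v. P p = span (v ` {..<d}) \<and> dim (P p) = d"
proof -
  assume "p \<in> topspace X"
  then obtain W Z where W: "p \<in> W" "\<forall>q\<in>W. P q = span ((\<lambda>i. Z i q) ` {..<d}) \<and> dim (P q) = d"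
    using pf unfolding smooth_plane_field_def by metis
  then show ?thesis using bspec[OF W(2,1)] by (intro exI[of _ "\<lambda>i. Z i p"])
qed

lemma P_dim: "p \<in> topspace X \<Longrightarrow> dim (P p) = d" using frame by blast

lemma P_subspace: "p \<in> topspace X \<Longrightarrow> subspace (P p)" using frame by (metis subspace_span)

lemma P_coords: assumes k: "k \<in> atlas M" "p \<in> fst k" and v: "v \<in> P p" shows "\<exists>\<xi>. v = cvec M k \<xi> p"
proof -
  obtain k' \<xi> where "k' \<in> atlas M" "p \<in> fst k'" "v = cvec M k' \<xi> p" using coords dom_sub[OF k(1)] k(2) v by blast
  then show ?thesis using cvec_change[of k' p k \<xi>] k by simp
qed

lemma P_span_eq: assumes p: "p \<in> topspace X" and T: "P p \<subseteq> span T" "finite T" "card T \<le> d" shows "span T = P p"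
proof -
  obtain v where v: "P p = span (v ` {..<d})" "dim (P p) = d" using frame[OF p] by blast
  show ?thesis by (rule span_eq_by_dim[OF v(1) _ T(1,2)]) (use v T in auto)
qed

lemma gfield_tangent_field: "Z \<in> tangent_fields M P \<Longrightarrow> gfield Z"
  by (rule gfieldI) (use coords in \<open>auto simp: tangent_fields_def, blast\<close>)

lemma gfield_G: "Z \<in> G \<Longrightarrow> gfield Z" by (rule gfield_lie[OF gfield_tangent_field])

text \<open>The Lie algebra in question is generated by fields on the whole manifold. A bump factor
  keeps the values in the subspaces \<open>P q\<close> and leaves the germ at \<open>p\<close>
  unchanged.\<close>

lemma extend_field:
  assumes W: "openin X W" "p \<in> W" and Z: "smooth_vector_field_on M W Z" "\<And>q. q \<in> W \<Longrightarrow> Z q \<in> P q"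
  shows "\<exists>Z'\<in>tangent_fields M P. \<exists>U. openin X U \<and> p \<in> U \<and> U \<subseteq> W \<and> (\<forall>q\<in>U. Z' q = Z q)"
proof -
  obtain \<beta> U where b: "bump p W \<beta> U" using bump_ex[OF W] by blast
  define Z' where "Z' q = (if q \<in> W then \<beta> q *\<^sub>R Z q else 0)" for q
  have ts: "Z' q \<in> tangent_space M q" if "q \<in> topspace X" for q
  proof (cases "q \<in> W")
    case True
    then have "Z q \<in> tangent_space M q" using Z(1) by (simp add: smooth_vector_field_on_def)
    then show ?thesis using tangent_scale True by (simp add: Z'_def)
  qed (simp add: Z'_def tangent_space_def)
  have "smooth_fun_on M (topspace X) (\<lambda>q. Z' q f)" if f: "f \<in> Cinf M" for f
  proof -
    have "smooth_fun_on M W (\<lambda>q. Z q f)" using Z(1) f by (simp add: smooth_vector_field_on_def)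
    then have "(\<lambda>q. Z' q f) \<in> Cinf M"
      by (rule cutoff_smooth[OF b W(1)]) (auto simp: Z'_def scaleR_fun_def)
    then show ?thesis by (simp add: Cinf_def)
  qed
  then have "smooth_vector_field_on M (topspace X) Z'" using ts by (simp add: smooth_vector_field_on_def)
  moreover have "Z' q \<in> P q" if "q \<in> topspace X" for q
    using Z(2)[of q] P_subspace[OF that] by (auto simp: Z'_def subspace_0 subspace_scale)
  ultimately have "Z' \<in> tangent_fields M P" by (simp add: tangent_fields_def)
  moreover have "\<forall>q\<in>U. Z' q = Z q" using b by (auto simp: Z'_def bump_def)
  ultimately show ?thesis using b by (auto simp: bump_def)
qed

text \<open>A local frame of \<open>P\<close> extends to global tangent fields by
  \<open>extend_field\<close>, so this inclusion holds at every point; infinitesimal integrability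
  is about the opposite one.\<close>

lemma P_sub_G: assumes p: "p \<in> topspace X" shows "P p \<subseteq> {Z p |Z. Z \<in> G}"
proof -
  have sub: "subspace {Z p |Z. Z \<in> G}"
    unfolding subspace_def
  proof (intro conjI ballI allI)
    show "0 \<in> {Z p |Z. Z \<in> G}" using lie_subalgebra_generated.zero[of "tangent_fields M P"] by (auto intro!: exI[of _ 0])
    fix x assume "x \<in> {Z p |Z. Z \<in> G}"
    then obtain Z where Z: "Z \<in> G" "x = Z p" by blast
    show "c *\<^sub>R x \<in> {Z p |Z. Z \<in> G}" for c
      using lie_subalgebra_generated.scale[OF Z(1), of c] Z(2) by (auto simp: scaleR_fun_def[of c Z] intro!: exI[of _ "c *\<^sub>R Z"])
    fix y assume "y \<in> {Z p |Z. Z \<in> G}"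
    then obtain Z' where Z': "Z' \<in> G" "y = Z' p" by blast
    show "x + y \<in> {Z p |Z. Z \<in> G}"
      using lie_subalgebra_generated.add[OF Z(1) Z'(1)] Z(2) Z'(2) by (auto intro!: exI[of _ "Z + Z'"])
  qed
  obtain W Z where W: "openin X W" "p \<in> W" and Z: "\<forall>i<d. smooth_vector_field_on M W (Z i)"
    "\<forall>q\<in>W. P q = span ((\<lambda>i. Z i q) ` {..<d}) \<and> dim (P q) = d"
    using pf p unfolding smooth_plane_field_def by metis
  have "Z i p \<in> {Z p |Z. Z \<in> G}" if i: "i < d" for i
  proof -
    have "\<And>q. q \<in> W \<Longrightarrow> Z i q \<in> P q" using Z(2) i by (auto intro!: span_base)
    then have "\<exists>Z'\<in>tangent_fields M P. \<exists>U. openin X U \<and> p \<in> U \<and> U \<subseteq> W \<and> (\<forall>q\<in>U. Z' q = Z i q)"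
      using extend_field[OF W] Z(1) i by simp
    then obtain Z' where Z': "Z' \<in> tangent_fields M P" "Z' p = Z i p" by metis
    then show ?thesis using lie_subalgebra_generated.generator[OF Z'(1)] by (intro CollectI exI[of _ Z'] conjI) (rule Z'(2)[symmetric])
  qed
  then have "span ((\<lambda>i. Z i p) ` {..<d}) \<subseteq> {Z p |Z. Z \<in> G}" by (intro span_minimal sub) auto
  then show ?thesis using Z(2) W(2) by simp
qed

text \<open>Brackets of fields tangent to a leaf are tangent to it.\<close>

lemma leaf_in_domain: assumes L: "leaf M d P L" and p: "p \<in> L" shows "p \<in> inf_integrability_domain M P"
proof -
  have dN: "d \<le> N" using L by (simp add: leaf_def submanifold_def)
  obtain c where c: "slice_chart M d L c" "p \<in> fst c" using L p by (auto simp: leaf_def submanifold_def)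
  have at: "c \<in> atlas M" and sl: "snd c ` (fst c \<inter> L) = snd c ` fst c \<inter> eucl d" using c by (auto simp: slice_chart_def)
  define T where "T q = span ((\<lambda>i. coord_vector M c i q) ` {..<d})" for q
  have TP: "T q = P q" if "q \<in> fst c" "q \<in> L" for q using L[unfolded leaf_def] c(1) that unfolding T_def by metis
  have Tz: "\<xi> i = 0" if q: "q \<in> fst c" and x: "cvec M c \<xi> q \<in> T q" and i: "d \<le> i" "i < N" for \<xi> i q
  proof -
    have "T q \<subseteq> {cvec M c \<eta> q |\<eta>. \<forall>i\<ge>d. \<eta> i = 0}"
      unfolding T_def
    proof (rule span_minimal)
      show "(\<lambda>i. coord_vector M c i q) ` {..<d} \<subseteq> {cvec M c \<eta> q |\<eta>. \<forall>i\<ge>d. \<eta> i = 0}"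
      proof (rule image_subsetI)
        fix j assume j: "j \<in> {..<d}"
        then show "coord_vector M c j q \<in> {cvec M c \<eta> q |\<eta>. \<forall>i\<ge>d. \<eta> i = 0}"
          using cvec_unit[of j M c q] dN by (intro CollectI exI[of _ "\<lambda>i. if i = j then 1 else 0"]) auto
      qed
      show "subspace {cvec M c \<eta> q |\<eta>. \<forall>i\<ge>d. \<eta> i = 0}"
        unfolding subspace_def
      proof (intro conjI ballI allI)
        show "0 \<in> {cvec M c \<eta> q |\<eta>. \<forall>i\<ge>d. \<eta> i = 0}" using cvec_zero[of M c q] by (intro CollectI exI[of _ "\<lambda>i. 0"]) auto
        fix x assume "x \<in> {cvec M c \<eta> q |\<eta>. \<forall>i\<ge>d. \<eta> i = 0}"
        then obtain \<eta> where \<eta>: "x = cvec M c \<eta> q" "\<forall>i\<ge>d. \<eta> i = 0" by blast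
        show "a *\<^sub>R x \<in> {cvec M c \<eta> q |\<eta>. \<forall>i\<ge>d. \<eta> i = 0}" for a
          using \<eta> by (intro CollectI exI[of _ "\<lambda>i. a * \<eta> i"]) (simp add: cvec_scale)
        fix y assume "y \<in> {cvec M c \<eta> q |\<eta>. \<forall>i\<ge>d. \<eta> i = 0}"
        then obtain \<zeta> where "y = cvec M c \<zeta> q" "\<forall>i\<ge>d. \<zeta> i = 0" by blast
        then show "x + y \<in> {cvec M c \<eta> q |\<eta>. \<forall>i\<ge>d. \<eta> i = 0}"
          using \<eta> by (intro CollectI exI[of _ "\<lambda>i. \<eta> i + \<zeta> i"]) (simp add: cvec_add)
      qed
    qed
    then obtain \<eta> where "cvec M c \<xi> q = cvec M c \<eta> q" "\<forall>i\<ge>d. \<eta> i = 0" using x by blast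
    then show ?thesis using cvec_inj[OF at q _ i(2)] i(1) by metis
  qed
  have "\<forall>q\<in>fst c \<inter> L. Z q \<in> T q" if "Z \<in> G" for Z
    using that
  proof (induction rule: lie_subalgebra_generated.induct)
    case (generator Z)
    then show ?case using TP dom_sub[OF at] by (auto simp: tangent_fields_def)
  next
    case zero
    have "(0 :: 'a \<Rightarrow> 'a tvector) q = 0" for q by (rule ext) simp
    then show ?case using span_zero unfolding T_def by metis
  next
    case (add Z Z')
    have "(Z + Z') q = Z q + Z' q" for q by (rule ext) simp
    then show ?case using add.IH span_add unfolding T_def by metis
  next
    case (scale Z a) then show ?case by (auto simp: T_def scaleR_fun_def[of a Z] intro: span_scale)
  next
    case (bracket Z Z')
    have g: "gfield Z" "gfield Z'" using bracket.hyps gfield_G by auto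
    obtain \<xi> where \<xi>: "\<And>i. i < N \<Longrightarrow> Cinf_on N (snd c ` fst c) (\<xi> i)" "\<And>q. q \<in> fst c \<Longrightarrow> Z q = cvec M c (\<lambda>i. \<xi> i (snd c q)) q"
      using g(1) at unfolding gfield_def by blast
    obtain \<eta> where \<eta>: "\<And>i. i < N \<Longrightarrow> Cinf_on N (snd c ` fst c) (\<eta> i)" "\<And>q. q \<in> fst c \<Longrightarrow> Z' q = cvec M c (\<lambda>i. \<eta> i (snd c q)) q"
      using g(2) at unfolding gfield_def by blast
    have van: "\<zeta> i y = 0" if "\<forall>q\<in>fst c \<inter> L. B q \<in> T q" "\<And>q. q \<in> fst c \<Longrightarrow> B q = cvec M c (\<lambda>i. \<zeta> i (snd c q)) q"
        "d \<le> i" "i < N" and y: "y \<in> snd c ` fst c \<inter> eucl d" for B \<zeta> i y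
    proof -
      have "y \<in> snd c ` (fst c \<inter> L)" using y sl by simp
      then obtain q where q: "q \<in> fst c" "q \<in> L" "y = snd c q" by blast
      have "cvec M c (\<lambda>i. \<zeta> i (snd c q)) q \<in> T q" using that(1,2) q by (metis IntI)
      then show ?thesis using Tz[OF q(1) _ that(3,4)] q(3) by simp
    qed
    have pz: "partial_deriv l (\<zeta> i) y = 0" if "\<And>y. y \<in> snd c ` fst c \<inter> eucl d \<Longrightarrow> \<zeta> i y = 0" "l < d" "y \<in> snd c ` fst c \<inter> eucl d" for \<zeta> :: vfield and i l y
    proof (rule partial_deriv_eqI)
      have "\<forall>\<^sub>F t in nhds (y l). y(l := t) \<in> snd c ` fst c"
        by (rule eventually_upd[OF img_open[OF at]]) (use that dN in auto)
      then have ev: "\<forall>\<^sub>F t in nhds (y l). \<zeta> i (y(l := t)) = 0"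
        by eventually_elim (use that in \<open>auto simp: eucl_iff\<close>)
      have "((\<lambda>t. 0) has_real_derivative 0) (at (y l))" by simp
      then show "((\<lambda>t. \<zeta> i (y(l := t))) has_real_derivative 0) (at (y l))"
        using DERIV_cong_ev[OF refl ev refl] by simp
    qed
    show ?case
    proof
      fix q assume q: "q \<in> fst c \<inter> L"
      define y where "y = snd c q"
      have y: "y \<in> snd c ` fst c \<inter> eucl d" using q sl by (auto simp: y_def)
      have vx: "\<xi> i y = 0" "\<eta> i y = 0" if "d \<le> i" "i < N" "y \<in> snd c ` fst c \<inter> eucl d" for i y
        using van[OF bracket.IH(1) \<xi>(2) that] van[OF bracket.IH(2) \<eta>(2) that] by auto
      \<comment> \<open>In each summand either \<open>l < d\<close>, and the derivatives run along
        the slice, where component \<open>i\<close> of both fields vanishes; or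
        \<open>l \<ge> d\<close>, and the factors \<open>\<xi> l\<close> and \<open>\<eta> l\<close>
        vanish themselves.\<close>
      have "cbracket N \<xi> \<eta> i y = 0" if i: "d \<le> i" "i < N" for i
        unfolding cbracket_def
      proof (rule sum.neutral, rule ballI)
        fix l assume l: "l \<in> {..<N}"
        show "\<xi> l y * partial_deriv l (\<eta> i) y - \<eta> l y * partial_deriv l (\<xi> i) y = 0"
        proof (cases "l < d")
          case True then show ?thesis using pz[of \<eta> i l y] pz[of \<xi> i l y] vx[OF i] y by simp
        next
          case False then show ?thesis using vx[of l y] l y by simp
        qed
      qed
      then have "cvec M c (\<lambda>i. cbracket N \<xi> \<eta> i y) q = (\<Sum>i<d. cbracket N \<xi> \<eta> i y *\<^sub>R coord_vector M c i q)"
        unfolding cvec_def by (intro sum.mono_neutral_right) (use dN in auto)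
      also have "\<dots> \<in> T q" unfolding T_def by (intro span_sum span_scale span_base) auto
      finally show "lie_bracket Z Z' q \<in> T q"
        using bracket_coords[OF at dom_open[OF at] subset_refl g \<xi> \<eta>, of q] q by (simp add: y_def)
    qed
  qed
  then have "{Z p |Z. Z \<in> G} \<subseteq> P p" using TP[OF c(2) p] c(2) p by blast
  moreover have "p \<in> topspace X" using dom_sub[OF at] c(2) by blast
  ultimately show ?thesis using P_sub_G unfolding inf_integrability_domain_def by blast
qed

text \<open>Tangent spaces of Hermann's surface contain \<open>P\<close>, since they contain the
  \<open>Y a\<close> and these span \<open>P\<close>. At \<open>p\<close> the \<open>Y a\<close> lie
  in \<open>P p\<close>, so there the tangent space is \<open>P p\<close> and the dimension of the
  surface is \<open>d\<close>; the containment is then an equality at every other point by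
  dimension.\<close>

lemma leaf_through:
  assumes k: "k \<in> atlas M" "p \<in> fst k" and inv: "involutive N B A Y" and B: "B \<subseteq> snd k ` fst k" "snd k p \<in> B"
    and PY: "\<And>q. q \<in> fst k \<Longrightarrow> snd k q \<in> B \<Longrightarrow> P q \<subseteq> span ((\<lambda>a. cvec M k (\<lambda>i. Y a i (snd k q)) q) ` A)"
    and YP: "\<And>a. a \<in> A \<Longrightarrow> cvec M k (\<lambda>i. Y a i (snd k p)) p \<in> P p"
  shows "p \<in> integrability_domain M d P"
proof -
  interpret I: involutive N B A Y by (rule inv)
  define z0 where "z0 = snd k p"
  obtain d' \<sigma> \<rho> F x where F: "\<rho> > 0" "F 0 = z0" "inj_on \<sigma> {..<d'}" "\<And>i. i < d' \<Longrightarrow> \<sigma> i < N"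
    "\<And>j. j < N \<Longrightarrow> Cinf_on d' (cbx d' 0 \<rho>) (\<lambda>v. F v j)" "\<And>v. v \<in> cbx d' 0 \<rho> \<Longrightarrow> F v \<in> B"
    "\<And>v i. v \<in> cbx d' 0 \<rho> \<Longrightarrow> i < d' \<Longrightarrow> F v (\<sigma> i) = z0 (\<sigma> i) + v i"
    and dF: "\<And>v i j. v \<in> cbx d' 0 \<rho> \<Longrightarrow> i < d' \<Longrightarrow> j < N \<Longrightarrow> partial_deriv i (\<lambda>v. F v j) v = (\<Sum>a\<in>A. x i a v * Y a j (F v))"
    and YF: "\<And>v a j. v \<in> cbx d' 0 \<rho> \<Longrightarrow> a \<in> A \<Longrightarrow> j < N \<Longrightarrow> Y a j (F v) = (\<Sum>i<d'. Y a (\<sigma> i) (F v) * partial_deriv i (\<lambda>v. F v j) v)"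
  proof -
    have "z0 \<in> B" using B(2) by (simp add: z0_def)
    from I.integral_surface[OF this] show thesis
    proof (elim exE conjE, goal_cases)
      case (1 d \<sigma> \<rho> F x)
      show thesis by (rule that[of \<rho> F \<sigma> d x]) (use 1 in blast)+
    qed
  qed
  define bv where "bv q v i = cvec M k (\<lambda>j. partial_deriv i (\<lambda>v. F v j) v) q" for q v i
  have Pb: "P q \<subseteq> span (bv q v ` {..<d'})" if q: "q \<in> fst k" and v: "v \<in> cbx d' 0 \<rho>" "snd k q = F v" for q v
  proof -
    have "cvec M k (\<lambda>i. Y a i (snd k q)) q \<in> span (bv q v ` {..<d'})" if a: "a \<in> A" for a
    proof -
      have "cvec M k (\<lambda>j. Y a j (snd k q)) q = cvec M k (\<lambda>j. \<Sum>i<d'. Y a (\<sigma> i) (F v) * partial_deriv i (\<lambda>v. F v j) v) q"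
        by (rule cvec_cong) (use YF[OF v(1) a] v(2) in simp)
      also have "\<dots> = (\<Sum>i<d'. Y a (\<sigma> i) (F v) *\<^sub>R bv q v i)" by (simp add: cvec_sum cvec_scale bv_def)
      also have "\<dots> \<in> span (bv q v ` {..<d'})" by (intro span_sum span_scale span_base) auto
      finally show ?thesis .
    qed
    then have "span ((\<lambda>a. cvec M k (\<lambda>i. Y a i (snd k q)) q) ` A) \<subseteq> span (bv q v ` {..<d'})" by (intro span_minimal) auto
    then show ?thesis using PY[OF q] F(6)[OF v(1)] v(2) by auto
  qed
  have z0Q: "(0 :: nat \<Rightarrow> real) \<in> cbx d' 0 \<rho>" using F(1) by (intro cbx_self) (simp_all add: eucl_iff)
  have pt: "p \<in> topspace X" using dom_sub[OF k(1)] k(2) by blast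
  have dij: "partial_deriv i (\<lambda>v. F v (\<sigma> j)) v = (if i = j then 1 else 0)" if v: "v \<in> cbx d' 0 \<rho>" and ij: "i < d'" "j < d'" for v i j
  proof -
    have "partial_deriv i (\<lambda>v. F v (\<sigma> j)) v = partial_deriv i (\<lambda>v. z0 (\<sigma> j) + v j) v"
      by (rule partial_deriv_cong[OF open_cbx _ v ij(1)]) (use F(7) ij in auto)
    also have "\<dots> = partial_deriv i (\<lambda>v. z0 (\<sigma> j)) v + partial_deriv i (\<lambda>v. v j) v"
      by (rule partial_deriv_add[OF Cinf_const[OF open_cbx] Cinf_coord[OF open_cbx] v ij(1)])
    finally show ?thesis by (simp add: partial_deriv_const partial_deriv_coord)
  qed
    \<comment> \<open>By \<open>dij\<close> the tangent vectors \<open>bv p 0 i\<close> have unit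
      vectors as their \<open>\<sigma>\<close> components.\<close>
    have lin: "u i = 0" if z: "(\<Sum>i<d'. u i *\<^sub>R bv p 0 i) = 0" and i: "i < d'" for u i
    proof -
      have "cvec M k (\<lambda>j. \<Sum>i<d'. u i * partial_deriv i (\<lambda>v. F v j) 0) p = cvec M k (\<lambda>j. 0) p"
        using z by (simp add: cvec_sum cvec_scale bv_def cvec_zero)
      from cvec_inj[OF k this F(4)[OF i]]
      have "(\<Sum>l<d'. u l * partial_deriv l (\<lambda>v. F v (\<sigma> i)) 0) = 0" .
      moreover have "(\<Sum>l<d'. u l * partial_deriv l (\<lambda>v. F v (\<sigma> i)) 0) = (\<Sum>l<d'. if l = i then u i else 0)"
        by (intro sum.cong) (use dij[OF z0Q _ i] in auto)
      ultimately show ?thesis using i by simp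
    qed
  have bv_inj: "inj_on (bv p 0) {..<d'}"
    proof (rule inj_onI, rule ccontr)
      fix i j assume ij: "i \<in> {..<d'}" "j \<in> {..<d'}" "bv p 0 i = bv p 0 j" "i \<noteq> j"
      have "(\<Sum>l<d'. (if l = i then 1 else if l = j then -1 else 0) *\<^sub>R bv p 0 l) = (\<Sum>l<d'. (if l = i then bv p 0 i else 0) + (if l = j then - bv p 0 j else 0))"
        by (intro sum.cong) (use ij in auto)
      also have "\<dots> = bv p 0 i + - bv p 0 j" using ij(1,2) by (simp add: sum.distrib)
      finally have "(\<Sum>l<d'. (if l = i then 1 else if l = j then -1 else 0) *\<^sub>R bv p 0 l) = 0" using ij(3) by simp
      from lin[OF this, of i] show False using ij(1) by simp
  qed
  have bv_indep: "independent (bv p 0 ` {..<d'})"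
  proof -
    have fin: "finite (bv p 0 ` {..<d'})" by blast
    have sc: "u y = 0" if s: "(\<Sum>y\<in>bv p 0 ` {..<d'}. u y *\<^sub>R y) = 0" and y: "y \<in> bv p 0 ` {..<d'}" for u y
    proof -
      obtain i where i: "i < d'" "y = bv p 0 i" using y by blast
      have "(\<Sum>i<d'. u (bv p 0 i) *\<^sub>R bv p 0 i) = 0" using s unfolding sum.reindex[OF bv_inj] comp_def .
      then have "u (bv p 0 i) = 0" by (rule lin[OF _ i(1)])
      then show ?thesis unfolding i(2) .
    qed
    show ?thesis by (rule independent_if_scalars_zero[OF fin]) (fact sc)
  qed
  have bP: "bv p 0 i \<in> P p" if i: "i < d'" for i
  proof -
    have "bv p 0 i = cvec M k (\<lambda>j. \<Sum>a\<in>A. x i a 0 * Y a j z0) p"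
      unfolding bv_def by (rule cvec_cong) (use dF[OF z0Q i] F(2) in simp)
    also have "\<dots> = (\<Sum>a\<in>A. x i a 0 *\<^sub>R cvec M k (\<lambda>j. Y a j z0) p)" by (simp add: cvec_sum cvec_scale)
    also have "\<dots> \<in> P p" using YP P_subspace[OF pt] by (intro subspace_sum subspace_scale) (auto simp: z0_def)
    finally show ?thesis .
  qed
  have "span (bv p 0 ` {..<d'}) = P p"
  proof
    show "span (bv p 0 ` {..<d'}) \<subseteq> P p" using bP by (intro span_minimal P_subspace[OF pt]) auto
    show "P p \<subseteq> span (bv p 0 ` {..<d'})" by (rule Pb[OF k(2) z0Q]) (simp add: F(2) z0_def)
  qed
  then have "dim (P p) = card (bv p 0 ` {..<d'})" using dim_span_eq_card_independent[OF bv_indep] by simp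
  then have dd: "d' = d" using P_dim[OF pt] bv_inj by (simp add: card_image)
  obtain \<kappa> L where K: "slice_chart M d L \<kappa>" "L \<subseteq> fst \<kappa>" "fst \<kappa> \<subseteq> fst k" "d \<le> N" "chart_inv k z0 \<in> L"
    "\<And>q. q \<in> L \<Longrightarrow> \<exists>v\<in>cbx d 0 \<rho>. snd k q = F v \<and> (\<forall>i<d. coord_vector M \<kappa> i q = cvec M k (\<lambda>j. partial_deriv i (\<lambda>v. F v j) v) q)"
  proof -
    note F' = F[unfolded dd]
    have "\<exists>\<kappa> L. slice_chart M d L \<kappa> \<and> L \<subseteq> fst \<kappa> \<and> fst \<kappa> \<subseteq> fst k \<and> d \<le> N \<and> chart_inv k z0 \<in> L \<and>
      (\<forall>q\<in>L. \<exists>v\<in>cbx d 0 \<rho>. snd k q = F v \<and> (\<forall>i<d. coord_vector M \<kappa> i q = cvec M k (\<lambda>j. partial_deriv i (\<lambda>v. F v j) v) q))"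
      by (rule graph_slice[OF k(1) I.B B(1)]) (fact F')+
    then show thesis
    proof (elim exE conjE, goal_cases)
      case (1 \<kappa> L)
      show thesis by (rule that[of L \<kappa>]) (use 1 in blast)+
    qed
  qed
  have "leaf M d P L" unfolding leaf_def
  proof (intro conjI ballI allI impI)
    show "submanifold M d L" unfolding submanifold_def using K(1,2,4) by blast
    fix q c assume q: "q \<in> L" and c: "slice_chart M d L c \<and> q \<in> fst c"
    have qk: "q \<in> fst \<kappa>" "q \<in> fst k" "q \<in> topspace X" using q K dom_sub[OF k(1)] by auto
    have "span ((\<lambda>i. coord_vector M c i q) ` {..<d}) = span ((\<lambda>i. coord_vector M \<kappa> i q) ` {..<d})"
      using slice_span_subset[OF K(4) K(1) qk(1) _ _ q, of c] slice_span_subset[OF K(4) _ _ K(1) qk(1) q, of c] c by blast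
    also have "\<dots> = P q"
    proof (rule P_span_eq[OF qk(3)])
      obtain v where v: "v \<in> cbx d 0 \<rho>" "snd k q = F v" "\<And>i. i < d \<Longrightarrow> coord_vector M \<kappa> i q = bv q v i"
        using K(6)[OF q] unfolding bv_def by blast
      have "(\<lambda>i. coord_vector M \<kappa> i q) ` {..<d} = bv q v ` {..<d}" using v(3) by (intro image_cong) auto
      then show "P q \<subseteq> span ((\<lambda>i. coord_vector M \<kappa> i q) ` {..<d})" using Pb[OF qk(2), of v] v(1,2) dd by simp
      show "card ((\<lambda>i. coord_vector M \<kappa> i q) ` {..<d}) \<le> d" using card_image_le[of "{..<d}"] by (metis card_lessThan finite_lessThan)
    qed simp
    finally show "span ((\<lambda>i. coord_vector M c i q) ` {..<d}) = P q" .
  qed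
  moreover have "chart_inv k z0 = p" using inv1[OF k] by (simp add: z0_def)
  ultimately show ?thesis using K(5) unfolding integrability_domain_def by auto
qed

end

section \<open>Generic finiteness over the base\<close>

text \<open>The preimage of \<open>W\<close> under the bundle projection, in the coordinates of a
  trivialization with fibre dimension \<open>q\<close>.\<close>

definition tube :: "nat \<Rightarrow> nat \<Rightarrow> (nat \<Rightarrow> real) set \<Rightarrow> (nat \<Rightarrow> real) set"
  where "tube n q W = {z \<in> eucl (n + q). trunc n z \<in> W}"

lemma Cinf_trunc:
  assumes "eopen r B" shows "Cinf_on r B (\<lambda>z. trunc n z i)"
  using Cinf_coord[OF assms, of i] Cinf_const[OF assms, of 0] by (cases "i < n") (auto simp: trunc_def)

lemma tube_open:
  assumes "eopen n W" shows "eopen (n + q) (tube n q W)"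
  unfolding tube_def by (rule open_vimage_eucl[OF _ assms trunc_eucl Cinf_trunc]) simp_all

lemma tube_mono: "V \<subseteq> W \<Longrightarrow> tube n q V \<subseteq> tube n q W" by (auto simp: tube_def)

lemma trunc_upd: "trunc n (z(j := t)) = (if j < n then (trunc n z)(j := t) else trunc n z)"
  by (auto simp: trunc_def fun_eq_iff)

lemma FP_Cinf:
  assumes W: "eopen n W"
  shows "f \<in> FP n q W \<Longrightarrow> Cinf_on (n + q) (tube n q W) f"
proof (induction rule: FP.induct)
  note T = tube_open[OF W, of q]
  { case (coef a)
    then show ?case by (rule Cinf_comp[OF T W _ Cinf_trunc[OF T]]) (simp add: tube_def) }
  { case (var j) show ?case by (rule Cinf_coord[OF T]) }
  { case (add f g) then show ?case by (intro Cinf_add[OF T]) }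
  { case (mult f g) then show ?case by (intro Cinf_mult[OF T]) }
qed

lemma FP_partial:
  assumes W: "eopen n W" and i: "i < n + q"
  shows "f \<in> FP n q W \<Longrightarrow> \<exists>g\<in>FP n q W. \<forall>z\<in>tube n q W. partial_deriv i f z = g z"
proof (induction rule: FP.induct)
  case (coef a)
  show ?case
  proof (cases "i < n")
    case True
    then have "partial_deriv i (\<lambda>z. a (trunc n z)) z = partial_deriv i a (trunc n z)" for z
      unfolding partial_deriv_def by (simp add: trunc_upd) (simp add: trunc_def)
    then show ?thesis using FP.coef[OF Cinf_partial[OF coef True], of q] by auto
  next
    case False
    then have "partial_deriv i (\<lambda>z. a (trunc n z)) z = 0" for z
      unfolding partial_deriv_def by (simp add: trunc_upd)
    then show ?thesis using FP_const[OF W, of 0 q] by auto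
  qed
next
  case (var j)
  show ?case using FP_const[OF W] by (auto simp: partial_deriv_coord)
next
  case (add f g)
  then obtain f' g' where "f' \<in> FP n q W" "g' \<in> FP n q W" "\<forall>z\<in>tube n q W. partial_deriv i f z = f' z" "\<forall>z\<in>tube n q W. partial_deriv i g z = g' z"
    by blast
  then show ?case using partial_deriv_add[OF FP_Cinf[OF W add.hyps(1)] FP_Cinf[OF W add.hyps(2)] _ i]
    by (intro bexI[of _ "\<lambda>z. f' z + g' z"] FP.add) auto
next
  case (mult f g)
  then obtain f' g' where "f' \<in> FP n q W" "g' \<in> FP n q W" "\<forall>z\<in>tube n q W. partial_deriv i f z = f' z" "\<forall>z\<in>tube n q W. partial_deriv i g z = g' z"
    by blast
  then show ?case using partial_deriv_mult[OF FP_Cinf[OF W mult.hyps(1)] FP_Cinf[OF W mult.hyps(2)] _ i] mult.hyps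
    by (intro bexI[of _ "\<lambda>z. f' z * g z + g' z * f z"] FP.add FP.mult) auto
qed

text \<open>Along a fibre variable the coefficients are constant, so only the polynomial dependence
  is left. This serves the limit that removes the auxiliary variables in
  \<open>generic_module\<close>.\<close>

lemma FP_fibre_continuous:
  assumes "n \<le> j" shows "f \<in> FP n q W \<Longrightarrow> isCont (\<lambda>t. f (z(j := t))) s"
proof (induction rule: FP.induct)
  case (coef a)
  have "(\<lambda>t. a (trunc n (z(j := t)))) = (\<lambda>t. a (trunc n z))" using assms by (simp add: trunc_upd del: fun_upd_apply)
  then show ?case by (simp del: fun_upd_apply)
next
  case (var l) show ?case by (cases "n + l = j") auto
qed (auto simp del: fun_upd_apply)

text \<open>Neither the degree nor the set of exponents need be uniform over \<open>B\<close>; they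
  may change with the neighbourhood, as for fiberwise algebraic objects.\<close>

definition locFP :: "nat \<Rightarrow> nat \<Rightarrow> (nat \<Rightarrow> real) set \<Rightarrow> ((nat \<Rightarrow> real) \<Rightarrow> real) \<Rightarrow> bool"
  where "locFP n q B f \<longleftrightarrow> (\<forall>x\<in>B. \<exists>W\<subseteq>B. eopen n W \<and> x \<in> W \<and> (\<exists>g\<in>FP n q W. \<forall>z\<in>tube n q W. f z = g z))"

lemma locFP_finite:
  assumes B: "eopen n B" "x \<in> B"
  shows "finite F \<Longrightarrow> (\<And>f. f \<in> F \<Longrightarrow> locFP n q B f) \<Longrightarrow>
    \<exists>W\<subseteq>B. eopen n W \<and> x \<in> W \<and> (\<forall>f\<in>F. \<exists>g\<in>FP n q W. \<forall>z\<in>tube n q W. f z = g z)"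
proof (induction F rule: finite_induct)
  case empty show ?case using B by blast
next
  case (insert f F)
  obtain W where W: "W \<subseteq> B" "eopen n W" "x \<in> W" "\<forall>f\<in>F. \<exists>g\<in>FP n q W. \<forall>z\<in>tube n q W. f z = g z"
    using insert.IH insert.prems by blast
  have "locFP n q B f" using insert.prems by simp
  then obtain V g where V: "V \<subseteq> B" "eopen n V" "x \<in> V" "g \<in> FP n q V" "\<forall>z\<in>tube n q V. f z = g z"
    using B(2) unfolding locFP_def by blast
  show ?case
  proof (intro exI[of _ "W \<inter> V"] conjI ballI)
    show "eopen n (W \<inter> V)" using W V by blast
    fix h assume h: "h \<in> insert f F"
    have t: "tube n q (W \<inter> V) \<subseteq> tube n q W" "tube n q (W \<inter> V) \<subseteq> tube n q V" by (simp_all add: tube_mono)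
    show "\<exists>g\<in>FP n q (W \<inter> V). \<forall>z\<in>tube n q (W \<inter> V). h z = g z"
    proof (cases "h = f")
      case True then show ?thesis using V(4,5) t FP_subset[of g n q V "W \<inter> V"] by blast
    next
      case False
      then obtain g' where "g' \<in> FP n q W" "\<forall>z\<in>tube n q W. h z = g' z" using h W(4) by blast
      then show ?thesis using t FP_subset[of g' n q W "W \<inter> V"] by blast
    qed
  qed (use W V in auto)
qed

lemma locFP_Cinf:
  assumes B: "eopen n B" and f: "locFP n q B f" shows "Cinf_on (n + q) (tube n q B) f"
proof (rule Cinf_local[OF tube_open[OF B]])
  fix z assume z: "z \<in> tube n q B"
  then have "trunc n z \<in> B" by (simp add: tube_def)
  then obtain W g where W: "W \<subseteq> B" "eopen n W" "trunc n z \<in> W" "g \<in> FP n q W" "\<forall>z\<in>tube n q W. f z = g z"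
    using f unfolding locFP_def by blast
  have "Cinf_on (n + q) (tube n q W) f" by (rule Cinf_cong[OF tube_open[OF W(2)] FP_Cinf[OF W(2,4)]]) (use W(5) in simp)
  then show "\<exists>V. eopen (n + q) V \<and> z \<in> V \<and> Cinf_on (n + q) V f"
    using tube_open[OF W(2), of q] W(3) z by (intro exI[of _ "tube n q W"]) (auto simp: tube_def)
qed

lemma locFP_partial:
  assumes i: "i < n + q" and f: "locFP n q B f" shows "locFP n q B (partial_deriv i f)"
  unfolding locFP_def
proof
  fix x assume "x \<in> B"
  then obtain W g where W: "W \<subseteq> B" "eopen n W" "x \<in> W" "g \<in> FP n q W" "\<forall>z\<in>tube n q W. f z = g z"
    using f unfolding locFP_def by blast
  obtain g' where g': "g' \<in> FP n q W" "\<forall>z\<in>tube n q W. partial_deriv i g z = g' z" using FP_partial[OF W(2) i W(4)] by blast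
  have "partial_deriv i f z = g' z" if z: "z \<in> tube n q W" for z
    using partial_deriv_cong[OF tube_open[OF W(2)] _ z i, of f g] W(5) g'(2) z by simp
  then show "\<exists>W\<subseteq>B. eopen n W \<and> x \<in> W \<and> (\<exists>g\<in>FP n q W. \<forall>z\<in>tube n q W. partial_deriv i f z = g z)"
    using W g'(1) by (intro exI[of _ W]) blast
qed

lemma locFP_cbracket:
  assumes B: "eopen n B"
    and V: "\<And>i. i < n + q \<Longrightarrow> locFP n q B (V i)" and U: "\<And>i. i < n + q \<Longrightarrow> locFP n q B (U i)" and k: "k < n + q"
  shows "locFP n q B (cbracket (n + q) V U k)"
  unfolding locFP_def
proof
  fix x assume x: "x \<in> B"
  define F where "F = V ` {..<n + q} \<union> U ` {..<n + q} \<union> (\<lambda>l. partial_deriv l (U k)) ` {..<n + q} \<union> (\<lambda>l. partial_deriv l (V k)) ` {..<n + q}"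
  have "finite F" by (simp add: F_def)
  moreover have "locFP n q B f" if "f \<in> F" for f using that V U k locFP_partial by (auto simp: F_def)
  ultimately have "\<exists>W\<subseteq>B. eopen n W \<and> x \<in> W \<and> (\<forall>f\<in>F. \<exists>g\<in>FP n q W. \<forall>z\<in>tube n q W. f z = g z)"
    by (rule locFP_finite[OF B x])
  then obtain W where W: "W \<subseteq> B" "eopen n W" "x \<in> W" "\<And>f. f \<in> F \<Longrightarrow> \<exists>g\<in>FP n q W. \<forall>z\<in>tube n q W. f z = g z"
    by blast
  obtain r where r: "\<And>f. f \<in> F \<Longrightarrow> r f \<in> FP n q W" "\<And>f z. f \<in> F \<Longrightarrow> z \<in> tube n q W \<Longrightarrow> f z = r f z" using W(4) by metis
  have mem: "V l \<in> F" "U l \<in> F" "partial_deriv l (U k) \<in> F" "partial_deriv l (V k) \<in> F" if "l < n + q" for l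
    using that by (auto simp: F_def)
  define g where "g = (\<lambda>z. \<Sum>l<n + q. r (V l) z * r (partial_deriv l (U k)) z - r (U l) z * r (partial_deriv l (V k)) z)"
  have "g \<in> FP n q W" unfolding g_def by (intro FP_sum FP_diff FP.mult W(2) r(1) mem) auto
  moreover have "cbracket (n + q) V U k z = g z" if z: "z \<in> tube n q W" for z
    unfolding cbracket_def g_def by (intro sum.cong refl arg_cong2[where f="(-)"] arg_cong2[where f="(*)"] r(2) mem z) auto
  ultimately show "\<exists>W\<subseteq>B. eopen n W \<and> x \<in> W \<and> (\<exists>g\<in>FP n q W. \<forall>z\<in>tube n q W. cbracket (n + q) V U k z = g z)"
    using W(1-3) by blast
qed

lemma FP_trunc: "f \<in> FP n q W \<Longrightarrow> f (trunc (n + q) z) = f z"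
  by (erule FP_dep) (simp add: trunc_def)

lemma trunc_tube: "trunc n z \<in> W \<Longrightarrow> trunc (n + q) z \<in> tube n q W"
  by (simp add: tube_def trunc_trunc)

text \<open>Over a suitable smaller base every member of \<open>F\<close> lies, near each base
  point, in the ideal of one finite part of \<open>F\<close>.\<close>

lemma generic_zero_set:
  assumes B: "eopen n B" "B \<noteq> {}" and F: "\<And>f. f \<in> F \<Longrightarrow> locFP n q B f"
  shows "\<exists>W F0. W \<subseteq> B \<and> eopen n W \<and> W \<noteq> {} \<and> finite F0 \<and> F0 \<subseteq> F \<and>
    (\<forall>z\<in>tube n q W. (\<forall>f\<in>F0. f z = 0) \<longrightarrow> (\<forall>f\<in>F. f z = 0))"
proof -
  \<comment> \<open>Ideal membership is tested at every \<open>z\<close> with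
    \<open>trunc n z\<close> in the base set, whatever its coordinates from \<open>n + q\<close> on;
    composing with \<open>trunc (n + q)\<close> moves such points into the tube, where
    \<open>f\<close> is known.\<close>
  define T where "T f = (\<lambda>z. f (trunc (n + q) z))" for f :: "(nat \<Rightarrow> real) \<Rightarrow> real"
  have loc: "\<exists>V. eopen n V \<and> x \<in> V \<and> h \<in> pols n q V" if h: "h \<in> T ` F" and x: "x \<in> B" for h x
  proof -
    obtain f where f: "f \<in> F" "h = T f" using h by blast
    obtain W g where W: "W \<subseteq> B" "eopen n W" "x \<in> W" "g \<in> FP n q W" "\<forall>z\<in>tube n q W. f z = g z"
      using F[OF f(1)] x unfolding locFP_def by blast
    have "h \<in> pols n q W"
      by (rule pols_cong[OF FP_pols[OF W(2,4)]]) (use W(5) trunc_tube[of n _ W q] FP_trunc[OF W(4)] f(2) in \<open>simp add: T_def\<close>)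
    then show ?thesis using W by blast
  qed
  obtain W F0 where W: "W \<subseteq> B" "eopen n W" "W \<noteq> {}" "finite F0" "F0 \<subseteq> T ` F"
    "\<forall>f\<in>T ` F. \<forall>x\<in>W. \<exists>V\<subseteq>W. eopen n V \<and> x \<in> V \<and> f \<in> ideal_on n q F0 V"
  proof -
    have "\<exists>W F0. W \<subseteq> B \<and> eopen n W \<and> W \<noteq> {} \<and> finite F0 \<and> F0 \<subseteq> T ` F \<and>
      (\<forall>f\<in>T ` F. \<forall>x\<in>W. \<exists>V\<subseteq>W. eopen n V \<and> x \<in> V \<and> f \<in> ideal_on n q F0 V)"
      by (rule generically_noetherian[OF B loc])
    then show thesis
    proof (elim exE conjE, goal_cases)
      case (1 W F0)
      show thesis by (rule that[OF 1(1,2,3,4,5,6)])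
    qed
  qed
  obtain F1 where F1: "F1 \<subseteq> F" "finite F1" "F0 = T ` F1" using finite_subset_image[OF W(4,5)] by blast
  have "f z = 0" if z: "z \<in> tube n q W" and h: "\<forall>f\<in>F1. f z = 0" and f: "f \<in> F" for z f
  proof -
    have zt: "trunc n z \<in> W" "trunc (n + q) z = z" using z trunc_id by (auto simp: tube_def)
    obtain V where V: "trunc n z \<in> V" "T f \<in> ideal_on n q F0 V" using W(6) f zt(1) by blast
    then obtain G c where "G \<subseteq> F0" "T f z = (\<Sum>g\<in>G. c g z * g z)" unfolding ideal_on_def by blast
    moreover have "g z = 0" if "g \<in> F0" for g using that h zt(2) by (auto simp: F1 T_def)
    ultimately have "T f z = 0" using sum.neutral[of G "\<lambda>g. c g z * g z"] by (metis mult_zero_right subsetD)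
    then show ?thesis using zt(2) by (simp add: T_def)
  qed
  then show ?thesis using W F1(1,2) by (intro exI[of _ W] exI[of _ F1]) blast
qed

text \<open>Vector fields are reduced to functions by an extra variable for each component: \<open>R\<close> becomes the
  linear form \<open>\<Sum>i. R i * e i\<close>. The coefficients of the field are recovered by letting \<open>e\<close> tend to \<open>0\<close>.\<close>

lemma generic_module:
  fixes L :: "vfield set"
  assumes B: "eopen n B" "B \<noteq> {}" and L: "\<And>R i. R \<in> L \<Longrightarrow> i < n + q \<Longrightarrow> locFP n q B (R i)"
  shows "\<exists>W F0. W \<subseteq> B \<and> eopen n W \<and> W \<noteq> {} \<and> finite F0 \<and> F0 \<subseteq> L \<and>
    (\<forall>R\<in>L. \<forall>x\<in>W. \<exists>V\<subseteq>W. eopen n V \<and> x \<in> V \<and> in_span (n + q) (tube n q V) F0 (\<lambda>R. R) R)"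
proof -
  let ?N = "n + q"
  let ?q = "q + ?N"
  define lin where "lin R = (\<lambda>z. \<Sum>i<?N. R i (trunc ?N z) * z (?N + i))" for R :: vfield
  have loc: "\<exists>V. eopen n V \<and> x \<in> V \<and> h \<in> pols n ?q V" if h: "h \<in> lin ` L" and x: "x \<in> B" for h x
  proof -
    obtain R where R: "R \<in> L" "h = lin R" using h by blast
    have "\<exists>W\<subseteq>B. eopen n W \<and> x \<in> W \<and> (\<forall>f\<in>R ` {..<?N}. \<exists>g\<in>FP n q W. \<forall>z\<in>tube n q W. f z = g z)"
      by (rule locFP_finite[OF B(1) x]) (use L[OF R(1)] in auto)
    then obtain W where W: "W \<subseteq> B" "eopen n W" "x \<in> W" "\<And>i. i < ?N \<Longrightarrow> \<exists>g\<in>FP n q W. \<forall>z\<in>tube n q W. R i z = g z"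
      by blast
    obtain r where r: "\<And>i. i < ?N \<Longrightarrow> r i \<in> FP n q W" "\<And>i z. i < ?N \<Longrightarrow> z \<in> tube n q W \<Longrightarrow> R i z = r i z" using W(4) by metis
    have "(\<lambda>z. \<Sum>i<?N. r i z * z (n + (q + i))) \<in> FP n ?q W"
      by (intro FP_sum[OF W(2)] FP.mult FP.var FP_mono[OF r(1)]) auto
    then have "h \<in> pols n ?q W"
    proof (rule pols_cong[OF FP_pols[OF W(2)]])
      fix z assume z: "trunc n z \<in> W"
      show "h z = (\<Sum>i<?N. r i z * z (n + (q + i)))"
        unfolding R(2) lin_def by (intro sum.cong) (use r(2)[OF _ trunc_tube[OF z]] FP_trunc[OF r(1)] in \<open>auto simp: add.assoc\<close>)
    qed
    then show ?thesis using W by blast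
  qed
  obtain W F1 where W: "W \<subseteq> B" "eopen n W" "W \<noteq> {}" "finite F1" "F1 \<subseteq> lin ` L"
    "\<forall>f\<in>lin ` L. \<forall>x\<in>W. \<exists>V\<subseteq>W. eopen n V \<and> x \<in> V \<and> f \<in> ideal_on n ?q F1 V"
  proof -
    have "\<exists>W F0. W \<subseteq> B \<and> eopen n W \<and> W \<noteq> {} \<and> finite F0 \<and> F0 \<subseteq> lin ` L \<and>
      (\<forall>f\<in>lin ` L. \<forall>x\<in>W. \<exists>V\<subseteq>W. eopen n V \<and> x \<in> V \<and> f \<in> ideal_on n ?q F0 V)"
      by (rule generically_noetherian[OF B loc])
    then show thesis
    proof (elim exE conjE, goal_cases)
      case (1 W F0)
      show thesis by (rule that[OF 1(1,2,3,4,5,6)])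
    qed
  qed
  \<comment> \<open>One field is kept for each linear form in \<open>F1\<close>, so that sums over
    forms can be rewritten as sums over fields.\<close>
  obtain F0 where F0: "F0 \<subseteq> L" "F1 = lin ` F0" "inj_on lin F0"
    using W(5) subset_image_inj[of F1 lin L] by blast
  have f0: "finite F0" using W(4) F0 finite_imageD by metis
  have "\<exists>V\<subseteq>W. eopen n V \<and> x \<in> V \<and> in_span ?N (tube n q V) F0 (\<lambda>R. R) R" if R: "R \<in> L" and x: "x \<in> W" for R x
  proof -
    obtain V where V: "V \<subseteq> W" "eopen n V" "x \<in> V" "lin R \<in> ideal_on n ?q F1 V" using W(6) R x by blast
    then obtain G c where G: "finite G" "G \<subseteq> F1" "\<And>g. g \<in> G \<Longrightarrow> c g \<in> FP n ?q V" "\<And>z. trunc n z \<in> V \<Longrightarrow> lin R z = (\<Sum>g\<in>G. c g z * g z)"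
      unfolding ideal_on_def by blast
    define \<phi> where "\<phi> S = (if lin S \<in> G then c (lin S) else (\<lambda>z. 0))" for S
    have \<phi>F: "\<phi> S \<in> FP n ?q V" for S using G(3) FP_const[OF V(2)] by (simp add: \<phi>_def)
    have lR: "lin R z = (\<Sum>S\<in>F0. \<phi> S z * lin S z)" if "trunc n z \<in> V" for z
    proof -
      have "lin R z = (\<Sum>g\<in>F1. (if g \<in> G then c g z else 0) * g z)"
        unfolding G(4)[OF that] by (rule sum.mono_neutral_cong_left) (use W(4) G(2) in auto)
      also have "\<dots> = (\<Sum>S\<in>F0. (if lin S \<in> G then c (lin S) z else 0) * lin S z)" unfolding F0(2) sum.reindex[OF F0(3)] by simp
      also have "\<dots> = (\<Sum>S\<in>F0. \<phi> S z * lin S z)" by (intro sum.cong) (auto simp: \<phi>_def)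
      finally show ?thesis .
    qed
    have "R i z = (\<Sum>S\<in>F0. \<phi> S z * S i z)" if z: "z \<in> tube n q V" and i: "i < ?N" for i z
    proof -
      have ze: "z \<in> eucl ?N" "trunc n z \<in> V" using z by (auto simp: tube_def)
      \<comment> \<open>If only the \<open>i\<close>-th auxiliary variable is nonzero, with value
        \<open>t\<close>, the linear form becomes \<open>t\<close> times the \<open>i\<close>-th
        component; an identity between such forms can be divided by \<open>t\<close>.\<close>
      have li: "lin S (z(?N + i := t)) = t * S i z" for S t
      proof -
        have tr: "trunc ?N (z(?N + i := t)) = z" using trunc_id[OF ze(1)] by (simp add: trunc_upd)
        have "lin S (z(?N + i := t)) = (\<Sum>j<?N. if j = i then t * S i z else 0)"
          unfolding lin_def tr by (intro sum.cong) (use ze(1) in \<open>auto simp: eucl_iff\<close>)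
        then show ?thesis using i by simp
      qed
      define b where "b t = (\<Sum>S\<in>F0. \<phi> S (z(?N + i := t)) * S i z)" for t
      have "trunc n (z(?N + i := t)) \<in> V" for t using ze(2) by (simp add: trunc_upd)
      from lR[OF this] have "t * R i z = t * b t" for t by (simp add: li b_def sum_distrib_left mult.left_commute)
      then have bt: "b t = R i z" if "t \<noteq> 0" for t using that by (metis mult_left_cancel)
      have "isCont b 0" unfolding b_def by (intro continuous_intros FP_fibre_continuous[OF _ \<phi>F]) simp
      then have "(b \<longlongrightarrow> b 0) (at 0)" by (simp add: isCont_def)
      moreover have "(b \<longlongrightarrow> R i z) (at 0)"
        by (rule tendsto_eventually) (use bt in \<open>auto simp: eventually_at_filter\<close>)
      ultimately have "b 0 = R i z" by (rule LIM_unique)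
      moreover have "z(?N + i := 0) = z" using ze(1) by (auto simp: eucl_iff fun_eq_iff)
      ultimately show ?thesis by (simp add: b_def)
    qed
    moreover have "Cinf_on ?N (tube n q V) (\<phi> S)" for S
    proof -
      have "Cinf_on (n + ?q) (tube n ?q V) (\<phi> S)" by (rule FP_Cinf[OF V(2) \<phi>F])
      then have "Cinf_on ?N (tube n q V) (\<lambda>z. \<phi> S ((\<lambda>z. z) z))"
        by (rule Cinf_comp[OF tube_open[OF V(2)] tube_open[OF V(2)]]) (use Cinf_coord[OF tube_open[OF V(2)]] in \<open>auto simp: tube_def eucl_iff\<close>)
      then show ?thesis by simp
    qed
    ultimately have "in_span ?N (tube n q V) F0 (\<lambda>R. R) R" unfolding in_span_def by blast
    then show ?thesis using V(1-3) by blast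
  qed
  then show ?thesis using W F0(1) f0 by (intro exI[of _ W] exI[of _ F0]) blast
qed

text \<open>A family has rank at most \<open>d\<close> iff it factors through \<open>d\<close> vectors; the vectors and the coefficients
  become auxiliary variables, which quantifier elimination then removes together with the fibre variables.\<close>

lemma generic_fibres:
  fixes d K r :: nat
  assumes W: "eopen n W" "W \<noteq> {}" and G: "finite G1" "G1 \<subseteq> FP n q W" "finite G2" "G2 \<subseteq> FP n q W"
    and y: "\<And>a i. a < K \<Longrightarrow> i < r \<Longrightarrow> y a i \<in> FP n q W"
  defines "T z \<equiv> (\<forall>g\<in>G1. g z = 0) \<and> (\<exists>g\<in>G2. g z \<noteq> 0) \<and>
     (\<exists>v u. \<forall>a<K. \<forall>i<r. y a i z = (\<Sum>j<d. (u a j :: real) * v j i))"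
  shows "\<exists>V\<subseteq>W. eopen n V \<and> V \<noteq> {} \<and>
    (\<forall>z\<in>tube n q V. T z \<longrightarrow> (\<forall>x\<in>V. \<exists>z'\<in>tube n q V. trunc n z' = x \<and> T z'))"
proof -
  let ?N = "n + q"
  \<comment> \<open>Pairs are coded by even numbers for the coefficients \<open>u\<close> and by odd
    ones for the vectors \<open>v\<close>, so the two families of auxiliary variables never share a
    coordinate; \<open>Q\<close> exceeds all codes in use.\<close>
  define cu where "cu a j = 2 * prod_encode (a, j)" for a j
  define cv where "cv j i = Suc (2 * prod_encode (j, i))" for j i
  define Q where "Q = Suc (Max (insert 0 ((\<lambda>(a, j). cu a j) ` ({..<K} \<times> {..<d}) \<union> (\<lambda>(j, i). cv j i) ` ({..<d} \<times> {..<r}))))"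
  have cQ: "cu a j < Q" if "a < K" "j < d" for a j
    unfolding Q_def less_Suc_eq_le by (rule Max_ge) (use that in force)+
  have vQ: "cv j i < Q" if "j < d" "i < r" for j i
    unfolding Q_def less_Suc_eq_le by (rule Max_ge) (use that in force)+
  define eq where "eq a i = (\<lambda>z. y a i z - (\<Sum>j<d. z (n + (q + cu a j)) * z (n + (q + cv j i))))" for a i
  define Sys where "Sys = G1 \<union> G2 \<union> (\<lambda>(a, i). eq a i) ` ({..<K} \<times> {..<r})"
  have eqF: "eq a i \<in> FP n (q + Q) W" if "a < K" "i < r" for a i
    unfolding eq_def by (intro FP_diff FP_sum FP.mult FP.var W(1) FP_mono[OF y[OF that]]) (use cQ vQ that in auto)
  have "finite Sys" using G by (simp add: Sys_def)
  moreover have "Sys \<subseteq> FP n (q + Q) W" using G(2,4) eqF FP_mono[of _ n q W "q + Q"] by (auto simp: Sys_def)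
  ultimately obtain V where V: "V \<subseteq> W" "eopen n V" "V \<noteq> {}"
    and sg: "\<And>z w. trunc n z \<in> V \<Longrightarrow> trunc n w \<in> V \<Longrightarrow> \<exists>w'. trunc n w' = trunc n w \<and> same_signs Sys z w'"
    using generic_signs[OF W] by metis
  have "\<exists>z'\<in>tube n q V. trunc n z' = x \<and> T z'" if z: "z \<in> tube n q V" and Tz: "T z" and x: "x \<in> V" for z x
  proof -
    obtain v u where vu: "\<And>a i. a < K \<Longrightarrow> i < r \<Longrightarrow> y a i z = (\<Sum>j<d. u a j * v j i)" using Tz unfolding T_def by blast
    obtain g0 where g0: "g0 \<in> G2" "g0 z \<noteq> 0" using Tz unfolding T_def by blast
    \<comment> \<open>Below \<open>n + q\<close> this is \<open>z\<close>; beyond, the given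
      \<open>u\<close> and \<open>v\<close> are stored at the places that \<open>cu\<close> and
      \<open>cv\<close> assign to them, told apart by parity.\<close>
    define zz where "zz l = (if l < ?N then z l else if even (l - ?N) then case_prod u (prod_decode ((l - ?N) div 2)) else case_prod v (prod_decode ((l - ?N) div 2)))" for l
    have zu: "zz (n + (q + cu a j)) = u a j" for a j by (simp add: zz_def cu_def)
    have zv: "zz (n + (q + cv j i)) = v j i" for j i by (simp add: zz_def cv_def)
    have zf: "f zz = f z" if "f \<in> FP n q W" for f by (rule FP_dep[OF that]) (simp add: zz_def)
    have tz: "trunc n zz = trunc n z" by (rule trunc_cong) (simp add: zz_def)
    have "trunc n z \<in> V" using z by (simp add: tube_def)
    moreover have tx: "trunc n x = x" using x open_sub_eucl[OF V(2)] trunc_id by blast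
    ultimately obtain w where w: "trunc n w = x" "same_signs Sys zz w" using sg[of zz x] tz x by auto
    have s0: "f w = 0 \<longleftrightarrow> f zz = 0" if "f \<in> Sys" for f using w(2) that unfolding same_signs_def by (metis sgn_eq_0_iff)
    define z' where "z' = trunc ?N w"
    have wf: "f z' = f w" if "f \<in> FP n q W" for f unfolding z'_def by (rule FP_trunc[OF that])
    have "z' \<in> tube n q V" "trunc n z' = x" using w(1) x by (auto simp: tube_def z'_def trunc_trunc)
    moreover have "g z' = 0" if "g \<in> G1" for g
    proof -
      have "g \<in> FP n q W" "g \<in> Sys" "g z = 0" using that G(2) Tz by (auto simp: Sys_def T_def)
      then show ?thesis using wf zf s0 by metis
    qed
    moreover have "g0 z' \<noteq> 0"
    proof -
      have "g0 \<in> FP n q W" "g0 \<in> Sys" using g0 G(4) by (auto simp: Sys_def)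
      then show ?thesis using wf zf s0 g0(2) by metis
    qed
    moreover have "y a i z' = (\<Sum>j<d. w (n + (q + cu a j)) * w (n + (q + cv j i)))" if ai: "a < K" "i < r" for a i
    proof -
      have "eq a i zz = 0" unfolding eq_def zu zv zf[OF y[OF ai]] using vu[OF ai] by simp
      moreover have "eq a i \<in> Sys" using ai by (auto simp: Sys_def)
      ultimately have "eq a i w = 0" using s0 by blast
      then show ?thesis using wf[OF y[OF ai]] by (simp add: eq_def)
    qed
    ultimately show ?thesis unfolding T_def using g0(1)
      by (intro bexI[of _ z'] conjI exI[of _ "\<lambda>j i. w (n + (q + cv j i))"] exI[of _ "\<lambda>a j. w (n + (q + cu a j))"]) auto
  qed
  then show ?thesis using V by (intro exI[of _ V]) blast
qed

section \<open>Vector bundles\<close>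

text \<open>Coefficients are indexed by \<open>j < d\<close> and not by vectors, because the
  \<open>v j\<close> need not be distinct.\<close>

lemma span_lessThan:
  assumes "x \<in> span (v ` {..<d::nat})" shows "\<exists>u. x = (\<Sum>j<d. u j *\<^sub>R (v j :: 'b :: real_vector))"
proof -
  let ?T = "range (\<lambda>u. \<Sum>j<d. u j *\<^sub>R v j)"
  have "subspace ?T"
    unfolding subspace_def
  proof (intro conjI ballI allI)
    have "0 = (\<Sum>j<d. 0 *\<^sub>R v j)" by simp
    then show "0 \<in> ?T" by (rule range_eqI[where x="\<lambda>j. 0"])
    fix x assume "x \<in> ?T"
    then obtain u where u: "x = (\<Sum>j<d. u j *\<^sub>R v j)" by blast
    have "c *\<^sub>R x = (\<Sum>j<d. (c * u j) *\<^sub>R v j)" for c by (simp add: u scaleR_sum_right)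
    then show "c *\<^sub>R x \<in> ?T" for c by (rule range_eqI[where x="\<lambda>j. c * u j"])
    fix y assume "y \<in> ?T"
    then obtain w where w: "y = (\<Sum>j<d. w j *\<^sub>R v j)" by blast
    have "x + y = (\<Sum>j<d. (u j + w j) *\<^sub>R v j)" by (simp add: u w scaleR_add_left sum.distrib)
    then show "x + y \<in> ?T" by (rule range_eqI[where x="\<lambda>j. u j + w j"])
  qed
  moreover have "v ` {..<d} \<subseteq> ?T"
  proof (rule image_subsetI)
    fix j assume j: "j \<in> {..<d}"
    have "(\<Sum>i<d. (if i = j then 1 else 0) *\<^sub>R v i) = (\<Sum>i<d. if i = j then v i else 0)" by (intro sum.cong) auto
    then have "v j = (\<Sum>i<d. (if i = j then 1 else 0) *\<^sub>R v i)" using j by simp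
    then show "v j \<in> ?T" by (rule range_eqI[where x="\<lambda>i. if i = j then 1 else 0"])
  qed
  ultimately show ?thesis using span_minimal[of "v ` {..<d}" ?T] assms by blast
qed

lemma finite_common_nbhd:
  assumes W: "eopen n W" "x \<in> W"
    and anti: "\<And>f V V'. Q f V \<Longrightarrow> V' \<subseteq> V \<Longrightarrow> eopen n V' \<Longrightarrow> Q f V'"
  shows "finite F \<Longrightarrow> (\<And>f. f \<in> F \<Longrightarrow> \<exists>V\<subseteq>W. eopen n V \<and> x \<in> V \<and> Q f V) \<Longrightarrow>
    \<exists>V\<subseteq>W. eopen n V \<and> x \<in> V \<and> (\<forall>f\<in>F. Q f V)"
proof (induction F rule: finite_induct)
  case empty show ?case using W by blast
next
  case (insert f F)
  obtain V where V: "V \<subseteq> W" "eopen n V" "x \<in> V" "\<forall>f\<in>F. Q f V" using insert.IH insert.prems by blast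
  obtain U where U: "U \<subseteq> W" "eopen n U" "x \<in> U" "Q f U" using insert.prems by blast
  have o: "eopen n (V \<inter> U)" using V U by blast
  have "Q g (V \<inter> U)" if "g \<in> insert f F" for g using that V(4) U(4) anti[OF _ _ o, of g] by blast
  then show ?case using o V U by (intro exI[of _ "V \<inter> U"]) blast
qed

lemma locFP_subset:
  assumes f: "locFP n q B f" and V: "eopen n V" "V \<subseteq> B" shows "locFP n q V f"
  unfolding locFP_def
proof
  fix x assume x: "x \<in> V"
  then have "x \<in> B" using V(2) by blast
  then obtain W g where W: "eopen n W" "x \<in> W" "g \<in> FP n q W" "\<forall>z\<in>tube n q W. f z = g z"
    using f unfolding locFP_def by blast
  have "g \<in> FP n q (W \<inter> V)" "\<forall>z\<in>tube n q (W \<inter> V). f z = g z"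
    using FP_subset[OF W(3), of "W \<inter> V"] W(4) tube_mono[of "W \<inter> V" W n q] by auto
  then show "\<exists>W\<subseteq>V. eopen n W \<and> x \<in> W \<and> (\<exists>g\<in>FP n q W. \<forall>z\<in>tube n q W. f z = g z)"
    using W(1,2) V(1) x by (intro exI[of _ "W \<inter> V"]) blast
qed

lemma join_trunc: "join n (trunc n z) (\<lambda>j. z (n + j)) = z"
  by (auto simp: join_def trunc_def)

lemma trunc_join: "x \<in> eucl n \<Longrightarrow> trunc n (join n x u) = x"
  by (auto simp: join_def trunc_def eucl_iff)

lemma join_eucl: "u \<in> eucl q \<Longrightarrow> join n x u \<in> eucl (n + q)"
  by (auto simp: join_def eucl_iff)

lemma tube_eq:
  assumes "W \<subseteq> eucl n" shows "tube n q W = {join n x u |x u. x \<in> W \<and> u \<in> eucl q}"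
proof (intro equalityI subsetI)
  fix z assume z: "z \<in> tube n q W"
  have "trunc n z \<in> W" "(\<lambda>j. z (n + j)) \<in> eucl q" using z by (auto simp: tube_def eucl_iff)
  then show "z \<in> {join n x u |x u. x \<in> W \<and> u \<in> eucl q}" using join_trunc[of n z, symmetric] by blast
next
  fix z assume "z \<in> {join n x u |x u. x \<in> W \<and> u \<in> eucl q}"
  then obtain x u where "z = join n x u" "x \<in> W" "u \<in> eucl q" by blast
  then show "z \<in> tube n q W" using trunc_join[of x n u] join_eucl[of u q n x] assms by (auto simp: tube_def)
qed

lemma fibre_polynomial_FP:
  assumes W: "eopen n W" and g: "fibre_polynomial n m W g"
  shows "\<exists>f\<in>FP n m W. \<forall>z\<in>tube n m W. g z = f z"
proof -
  obtain K :: "(nat \<Rightarrow> nat) set" and a where a: "\<And>\<alpha>. \<alpha> \<in> K \<Longrightarrow> Cinf_on n W (a \<alpha>)"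
    "\<And>x u. x \<in> W \<Longrightarrow> u \<in> eucl m \<Longrightarrow> g (join n x u) = (\<Sum>\<alpha>\<in>K. a \<alpha> x * (\<Prod>j<m. u j ^ \<alpha> j))"
    using g unfolding fibre_polynomial_def by blast
  define f where "f = (\<lambda>z. \<Sum>\<alpha>\<in>K. a \<alpha> (trunc n z) * (\<Prod>j<m. z (n + j) ^ \<alpha> j))"
  have "f \<in> FP n m W" unfolding f_def
    by (intro FP_sum[OF W] FP.mult FP_prod[OF W] FP_power[OF W] FP.var FP.coef a(1)) auto
  moreover have "g z = f z" if z: "z \<in> tube n m W" for z
  proof -
    have "trunc n z \<in> W" "(\<lambda>j. z (n + j)) \<in> eucl m" using z by (auto simp: tube_def eucl_iff)
    from a(2)[OF this] show ?thesis unfolding join_trunc f_def .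
  qed
  ultimately show ?thesis by blast
qed

context smanifold
begin

lemma chart_inv_restrict:
  assumes k: "k \<in> atlas M" "k' \<in> atlas M" "fst k' \<subseteq> fst k" "snd k' = snd k" and z: "z \<in> snd k' ` fst k'"
  shows "chart_inv k' z = chart_inv k z"
proof -
  obtain p where p: "p \<in> fst k'" "z = snd k' p" using z by blast
  have "chart_inv k' z = p" unfolding p(2) by (rule inv1[OF k(2) p(1)])
  moreover have "chart_inv k z = p" unfolding p(2) k(4) by (rule inv1[OF k(1)]) (use p(1) k(3) in blast)
  ultimately show ?thesis by simp
qed

lemma cvec_restrict:
  assumes k: "k \<in> atlas M" "k' \<in> atlas M" "fst k' \<subseteq> fst k" "snd k' = snd k" and p: "p \<in> fst k'"
  shows "cvec M k' \<xi> p = cvec M k \<xi> p"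
proof (rule ext)
  fix f
  have "partial_deriv i (f \<circ> chart_inv k') (snd k p) = partial_deriv i (f \<circ> chart_inv k) (snd k p)" if "i < N" for i
    by (rule partial_deriv_cong[OF img_open[OF k(2)] _ _ that]) (use chart_inv_restrict[OF k] p k(4) in auto)
  then show "cvec M k' \<xi> p f = cvec M k \<xi> p f" unfolding cvec_apply k(4) by simp
qed

lemma cvec_subspace: "subspace {cvec M k \<xi> p |\<xi>. True}"
  unfolding subspace_def
proof (intro conjI ballI allI)
  show "0 \<in> {cvec M k \<xi> p |\<xi>. True}" using cvec_zero[of M k p] by (intro CollectI exI[of _ "\<lambda>i. 0"]) simp
  fix x assume "x \<in> {cvec M k \<xi> p |\<xi>. True}"
  then obtain \<xi> where x: "x = cvec M k \<xi> p" by blast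
  show "a *\<^sub>R x \<in> {cvec M k \<xi> p |\<xi>. True}" for a
    unfolding x by (intro CollectI exI[of _ "\<lambda>i. a * \<xi> i"]) (simp add: cvec_scale)
  fix y assume "y \<in> {cvec M k \<xi> p |\<xi>. True}"
  then obtain \<eta> where y: "y = cvec M k \<eta> p" by blast
  show "x + y \<in> {cvec M k \<xi> p |\<xi>. True}"
    unfolding x y by (intro CollectI exI[of _ "\<lambda>i. \<xi> i + \<eta> i"]) (simp add: cvec_add)
qed

end

text \<open>The vectors span at least the \<open>d\<close>-dimensional \<open>P p\<close>, so they
  all lie in it exactly if their rank is at most \<open>d\<close>. The factorization on the right
  expresses this by polynomial equations in the components, without reference to
  \<open>P\<close>.\<close>

lemma (in plane_field) rank_iff:
  fixes K :: nat
  assumes k: "k \<in> atlas M" "p \<in> fst k" and PY: "P p \<subseteq> span ((\<lambda>a. cvec M k (y a) p) ` {..<K})"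
  shows "(\<forall>a<K. cvec M k (y a) p \<in> P p) \<longleftrightarrow> (\<exists>v u. \<forall>a<K. \<forall>i<N. y a i = (\<Sum>j<d. u a j * v j i))"
proof
  have pt: "p \<in> topspace X" using dom_sub[OF k(1)] k(2) by blast
  { assume Y: "\<forall>a<K. cvec M k (y a) p \<in> P p"
    obtain v where v: "P p = span (v ` {..<d})" using frame[OF pt] by blast
    have "\<exists>\<xi>. v j = cvec M k \<xi> p" if "j < d" for j
      by (rule P_coords[OF k]) (use that in \<open>auto simp: v intro: span_base\<close>)
    then obtain w where w: "\<And>j. j < d \<Longrightarrow> v j = cvec M k (w j) p" by metis
    have "\<exists>u. \<forall>i<N. y a i = (\<Sum>j<d. u j * w j i)" if a: "a < K" for a
    proof -
      have "cvec M k (y a) p \<in> span (v ` {..<d})" using Y a v by simp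
      then obtain u where "cvec M k (y a) p = (\<Sum>j<d. u j *\<^sub>R v j)" using span_lessThan by blast
      also have "\<dots> = (\<Sum>j<d. cvec M k (\<lambda>i. u j * w j i) p)" by (intro sum.cong) (simp_all add: w cvec_scale)
      also have "\<dots> = cvec M k (\<lambda>i. \<Sum>j<d. u j * w j i) p" by (simp add: cvec_sum)
      finally have e: "cvec M k (y a) p = cvec M k (\<lambda>i. \<Sum>j<d. u j * w j i) p" .
      show ?thesis using cvec_inj[OF k e] by blast
    qed
    then obtain u where "\<And>a. a < K \<Longrightarrow> \<forall>i<N. y a i = (\<Sum>j<d. u a j * w j i)" by metis
    then show "\<exists>v u. \<forall>a<K. \<forall>i<N. y a i = (\<Sum>j<d. u a j * v j i)" by blast }
  { assume "\<exists>v u. \<forall>a<K. \<forall>i<N. y a i = (\<Sum>j<d. u a j * v j i)"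
    then obtain v u where vu: "\<And>a i. a < K \<Longrightarrow> i < N \<Longrightarrow> y a i = (\<Sum>j<d. u a j * v j i)" by blast
    let ?T = "(\<lambda>j. cvec M k (v j) p) ` {..<d}"
    have Y: "cvec M k (y a) p \<in> span ?T" if a: "a < K" for a
    proof -
      have "cvec M k (y a) p = cvec M k (\<lambda>i. \<Sum>j<d. u a j * v j i) p" by (rule cvec_cong) (use vu[OF a] in simp)
      also have "\<dots> = (\<Sum>j<d. u a j *\<^sub>R cvec M k (v j) p)" by (simp add: cvec_sum cvec_scale)
      also have "\<dots> \<in> span ?T" by (intro span_sum span_scale span_base) auto
      finally show ?thesis .
    qed
    then have "span ((\<lambda>a. cvec M k (y a) p) ` {..<K}) \<subseteq> span ?T" by (intro span_minimal) auto
    then have PT: "P p \<subseteq> span ?T" using PY by blast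
    have "card ?T \<le> d" using card_image_le[of "{..<d}"] by (metis card_lessThan finite_lessThan)
    then have "span ?T = P p" using P_span_eq[OF pt PT] by blast
    then show "\<forall>a<K. cvec M k (y a) p \<in> P p" using Y by blast }
qed

section \<open>Local trivializations in coordinates\<close>

locale vector_bundle =
  fixes E :: "('e, 'b) vbundle"
  assumes vb: "smooth_vector_bundle E"
begin

abbreviation "M \<equiv> total_space E"
abbreviation "Q \<equiv> base_space E"
abbreviation "n \<equiv> mdim (base_space E)"
abbreviation "m \<equiv> fibre_dim E"

sublocale tot: smanifold M by standard (use vb in \<open>simp add: smooth_vector_bundle_def\<close>)
sublocale bas: smanifold Q by standard (use vb in \<open>simp add: smooth_vector_bundle_def\<close>)

lemma dim_tot: "mdim M = n + m" using vb by (simp add: smooth_vector_bundle_def)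

lemma proj_base: "p \<in> topspace (mtop M) \<Longrightarrow> proj E p \<in> topspace (mtop Q)"
  using vb by (auto simp: smooth_vector_bundle_def)

lemma triv_ex: "b \<in> topspace (mtop Q) \<Longrightarrow> \<exists>c \<tau>. b \<in> fst c \<and> local_trivialization E c \<tau>"
  using vb by (auto simp: smooth_vector_bundle_def)

lemma fst_triv [simp]: "fst (trivial_chart E c \<tau>) = over E (fst c)" by (simp add: trivial_chart_def)

lemma snd_triv: "snd (trivial_chart E c \<tau>) p = join n (snd c (proj E p)) (\<tau> p)" by (simp add: trivial_chart_def)

context
  fixes c \<tau> assumes t: "local_trivialization E c \<tau>"
begin

lemma triv_base: "c \<in> atlas Q" using t by (simp add: local_trivialization_def)
lemma triv_atlas: "trivial_chart E c \<tau> \<in> atlas M" using t by (simp add: local_trivialization_def)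
lemma triv_base_open: "eopen n (snd c ` fst c)" by (rule bas.img_open[OF triv_base])

lemma triv_img: "snd (trivial_chart E c \<tau>) ` over E (fst c) = tube n m (snd c ` fst c)"
  using t unfolding tube_eq[OF open_sub_eucl[OF triv_base_open]] by (simp add: local_trivialization_def)

lemma triv_trunc: "p \<in> over E (fst c) \<Longrightarrow> trunc n (snd (trivial_chart E c \<tau>) p) = snd c (proj E p)"
  unfolding snd_triv by (rule trunc_join[OF bas.img_eucl[OF triv_base]]) (simp add: over_def)

lemma triv_tube:
  assumes p: "p \<in> over E (fst c)" and W: "W \<subseteq> snd c ` fst c"
  shows "snd (trivial_chart E c \<tau>) p \<in> tube n m W \<longleftrightarrow> snd c (proj E p) \<in> W"
  using triv_trunc[OF p] tot.img_eucl[OF triv_atlas, of p] p by (simp add: tube_def dim_tot)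

lemma triv_over:
  assumes U: "U \<subseteq> fst c"
  shows "over E U = {p \<in> over E (fst c). snd (trivial_chart E c \<tau>) p \<in> tube n m (snd c ` U)}"
proof (intro equalityI subsetI CollectI conjI)
  fix p assume p: "p \<in> over E U"
  then show pc: "p \<in> over E (fst c)" using U by (auto simp: over_def)
  show "snd (trivial_chart E c \<tau>) p \<in> tube n m (snd c ` U)"
    using triv_tube[OF pc, of "snd c ` U"] U p by (auto simp: over_def)
next
  fix p assume p: "p \<in> {p \<in> over E (fst c). snd (trivial_chart E c \<tau>) p \<in> tube n m (snd c ` U)}"
  then have "snd c (proj E p) \<in> snd c ` U" using triv_tube[of p "snd c ` U"] U by blast
  then obtain b where b: "b \<in> U" "snd c (proj E p) = snd c b" by blast
  have "proj E p = b" by (rule bas.snd_inj[OF triv_base _ _ b(2)]) (use p U b(1) in \<open>auto simp: over_def\<close>)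
  then show "p \<in> over E U" using p b(1) by (simp add: over_def)
qed

lemma triv_img_over:
  assumes U: "U \<subseteq> fst c"
  shows "snd (trivial_chart E c \<tau>) ` over E U = tube n m (snd c ` U)"
proof -
  have "tube n m (snd c ` U) \<subseteq> snd (trivial_chart E c \<tau>) ` over E (fst c)"
    unfolding triv_img by (rule tube_mono) (use U in blast)
  then show ?thesis unfolding triv_over[OF U] by blast
qed

lemma triv_over_open:
  assumes U: "openin (mtop Q) U" "U \<subseteq> fst c" shows "openin (mtop M) (over E U)"
proof -
  have "eopen n (snd c ` U)" using bas.open_image[OF triv_base U(1)] U(2) by (simp add: inf.absorb2)
  from chart_open_vimage[OF tot.chart[OF triv_atlas] tube_open[OF this, of m, folded dim_tot]]
  show ?thesis unfolding triv_over[OF U(2)] by simp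
qed

text \<open>Algebraic objects are described only in trivializations over small base sets.
  Restricting a given one to such a set keeps its coordinate map, so the description can be read in
  the given coordinates.\<close>

lemma triv_restrict:
  assumes U: "openin (mtop Q) U" shows "local_trivialization E (fst c \<inter> U, snd c) \<tau>"
proof -
  have o: "openin (mtop Q) (fst c \<inter> U)" using bas.dom_open[OF triv_base] U by blast
  have tr: "trivial_chart E (fst c \<inter> U, snd c) \<tau> = (fst (trivial_chart E c \<tau>) \<inter> over E (fst c \<inter> U), snd (trivial_chart E c \<tau>))"
    by (auto simp: trivial_chart_def over_def)
  have "trivial_chart E (fst c \<inter> U, snd c) \<tau> \<in> atlas M"
    unfolding tr by (rule tot.chart_restrict[OF triv_atlas triv_over_open[OF o]]) simp
  moreover have "(fst c \<inter> U, snd c) \<in> atlas Q" by (rule bas.chart_restrict[OF triv_base U])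
  moreover have "snd (trivial_chart E (fst c \<inter> U, snd c) \<tau>) ` over E (fst c \<inter> U) = {join n x u |x u. x \<in> snd c ` (fst c \<inter> U) \<and> u \<in> eucl m}"
  proof -
    have "snd c ` (fst c \<inter> U) \<subseteq> eucl n" using open_sub_eucl[OF triv_base_open] by blast
    from tube_eq[OF this, of m] show ?thesis unfolding tr using triv_img_over[of "fst c \<inter> U"] by simp
  qed
  moreover have "over E (fst c \<inter> U) \<subseteq> over E (fst c)" by (auto simp: over_def)
  ultimately show ?thesis using t unfolding local_trivialization_def by (simp add: subset_iff)
qed

lemma triv_sub:
  assumes U: "openin (mtop Q) U"
  defines "k \<equiv> trivial_chart E c \<tau>" and "k' \<equiv> trivial_chart E (fst c \<inter> U, snd c) \<tau>"
  shows "k' \<in> atlas M" "fst k' \<subseteq> fst k" "snd k' = snd k"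
  using triv_restrict[OF U] by (auto simp: local_trivialization_def k_def k'_def trivial_chart_def over_def)

lemma algebraic_fun_locFP:
  assumes f: "fiberwise_algebraic_fun_on E (topspace (mtop Q)) f"
  shows "locFP n m (snd c ` fst c) (\<lambda>z. f (chart_inv (trivial_chart E c \<tau>) z))"
  unfolding locFP_def
proof
  fix x assume "x \<in> snd c ` fst c"
  then obtain b where b: "b \<in> fst c" "x = snd c b" by blast
  then have "b \<in> topspace (mtop Q)" using bas.dom_sub[OF triv_base] by blast
  from bspec[OF f[unfolded fiberwise_algebraic_fun_on_def] this] obtain V where V: "openin (mtop Q) V" "b \<in> V"
    "\<forall>c \<tau>. local_trivialization E c \<tau> \<and> fst c \<subseteq> V \<longrightarrow> fibre_polynomial n m (snd c ` fst c) (f \<circ> chart_inv (trivial_chart E c \<tau>))"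
    by (elim exE conjE) (rule that)
  let ?c = "(fst c \<inter> V, snd c)" let ?W = "snd c ` (fst c \<inter> V)"
  have t': "local_trivialization E ?c \<tau>" by (rule triv_restrict[OF V(1)])
  have Wo: "eopen n ?W" by (rule bas.open_image[OF triv_base V(1)])
  have "fibre_polynomial n m ?W (f \<circ> chart_inv (trivial_chart E ?c \<tau>))" using V(3) t' by simp
  then obtain g where g: "g \<in> FP n m ?W" "\<And>z. z \<in> tube n m ?W \<Longrightarrow> f (chart_inv (trivial_chart E ?c \<tau>) z) = g z"
    using fibre_polynomial_FP[OF Wo] by force
  have "f (chart_inv (trivial_chart E c \<tau>) z) = g z" if z: "z \<in> tube n m ?W" for z
  proof -
    have "z \<in> snd (trivial_chart E ?c \<tau>) ` fst (trivial_chart E ?c \<tau>)"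
      using z triv_img_over[of "fst c \<inter> V"] triv_sub(3)[OF V(1)] by simp
    then show ?thesis using g(2)[OF z] tot.chart_inv_restrict[OF triv_atlas triv_sub[OF V(1)]] by simp
  qed
  then show "\<exists>W\<subseteq>snd c ` fst c. eopen n W \<and> x \<in> W \<and> (\<exists>g\<in>FP n m W. \<forall>z\<in>tube n m W. f (chart_inv (trivial_chart E c \<tau>) z) = g z)"
    using Wo g(1) b V(2) by (intro exI[of _ ?W]) blast
qed

text \<open>Near each base point the field has fibre polynomial components; by uniqueness of
  components (\<open>cvec_inj\<close>) these local families fit together to one family
  \<open>R\<close> over the whole chart.\<close>

lemma algebraic_field_locFP:
  assumes Z: "fiberwise_algebraic_field_on E V Z" and V: "fst c \<subseteq> V"
  defines "k \<equiv> trivial_chart E c \<tau>"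
  shows "\<exists>R. (\<forall>i<mdim M. locFP n m (snd c ` fst c) (R i)) \<and> (\<forall>p\<in>over E (fst c). Z p = cvec M k (\<lambda>i. R i (snd k p)) p)"
proof -
  have k: "k \<in> atlas M" "fst k = over E (fst c)" using triv_atlas by (simp_all add: k_def)
  have loc: "\<exists>U R. openin (mtop Q) U \<and> b \<in> U \<and> (\<forall>i<mdim M. R i \<in> FP n m (snd c ` (fst c \<inter> U))) \<and>
      (\<forall>p\<in>over E (fst c \<inter> U). Z p = cvec M k (\<lambda>i. R i (snd k p)) p)" if b: "b \<in> fst c" for b
  proof -
    have "b \<in> V" using b V by blast
    from bspec[OF Z[unfolded fiberwise_algebraic_field_on_def] this] obtain U where U: "openin (mtop Q) U" "b \<in> U"
      "\<forall>c \<tau>. local_trivialization E c \<tau> \<and> fst c \<subseteq> U \<longrightarrow> (\<exists>R. (\<forall>i<mdim M. fibre_polynomial n m (snd c ` fst c) (R i)) \<and>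
         (\<forall>p\<in>over E (fst c). Z p = (\<Sum>i<mdim M. R i (snd (trivial_chart E c \<tau>) p) *\<^sub>R coord_vector M (trivial_chart E c \<tau>) i p)))"
      by (elim exE conjE) (rule that)
    let ?c = "(fst c \<inter> U, snd c)" let ?k = "trivial_chart E ?c \<tau>" let ?W = "snd c ` (fst c \<inter> U)"
    have Wo: "eopen n ?W" by (rule bas.open_image[OF triv_base U(1)])
    obtain R where R: "\<And>i. i < mdim M \<Longrightarrow> fibre_polynomial n m ?W (R i)"
      "\<And>p. p \<in> over E (fst c \<inter> U) \<Longrightarrow> Z p = cvec M ?k (\<lambda>i. R i (snd ?k p)) p"
    proof -
      have "fst ?c \<subseteq> U" by simp
      from U(3)[rule_format, OF conjI[OF triv_restrict[OF U(1)] this]] obtain R where "\<forall>i<mdim M. fibre_polynomial n m (snd ?c ` fst ?c) (R i)"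
        "\<forall>p\<in>over E (fst ?c). Z p = (\<Sum>i<mdim M. R i (snd ?k p) *\<^sub>R coord_vector M ?k i p)" by (elim exE conjE) (rule that)
      then show thesis by (intro that[of R]) (simp_all add: cvec_def)
    qed
    obtain r where r: "\<And>i. i < mdim M \<Longrightarrow> r i \<in> FP n m ?W" "\<And>i z. i < mdim M \<Longrightarrow> z \<in> tube n m ?W \<Longrightarrow> R i z = r i z"
      using fibre_polynomial_FP[OF Wo R(1)] by metis
    note s = triv_sub[OF U(1), folded k_def]
    have "Z p = cvec M k (\<lambda>i. r i (snd k p)) p" if p: "p \<in> over E (fst c \<inter> U)" for p
    proof -
      have "snd k p \<in> tube n m ?W" using triv_img_over[of "fst c \<inter> U"] p by (auto simp: k_def)
      then have "cvec M ?k (\<lambda>i. R i (snd ?k p)) p = cvec M ?k (\<lambda>i. r i (snd k p)) p" unfolding s(3) by (intro cvec_cong r(2))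
      also have "\<dots> = cvec M k (\<lambda>i. r i (snd k p)) p" by (rule tot.cvec_restrict[OF k(1) s]) (use p in simp)
      finally show ?thesis using R(2)[OF p] by simp
    qed
    then show ?thesis using U(1,2) r(1) by (intro exI[of _ U] exI[of _ r]) blast
  qed
  have "\<exists>\<xi>. Z p = cvec M k \<xi> p" if p: "p \<in> over E (fst c)" for p
  proof -
    have "proj E p \<in> fst c" using p by (simp add: over_def)
    from loc[OF this] obtain U R where "proj E p \<in> U" "\<forall>p\<in>over E (fst c \<inter> U). Z p = cvec M k (\<lambda>i. R i (snd k p)) p" by blast
    moreover then have "p \<in> over E (fst c \<inter> U)" using p by (simp add: over_def)
    ultimately show ?thesis by blast
  qed
  then obtain \<xi> where \<xi>: "\<And>p. p \<in> over E (fst c) \<Longrightarrow> Z p = cvec M k (\<xi> p) p" by metis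
  define R where "R i z = \<xi> (chart_inv k z) i" for i z
  have inv: "chart_inv k (snd k p) = p" if "p \<in> over E (fst c)" for p using tot.inv1[OF k(1)] that k(2) by simp
  have "locFP n m (snd c ` fst c) (R i)" if i: "i < mdim M" for i
    unfolding locFP_def
  proof
    fix x assume "x \<in> snd c ` fst c"
    then obtain b where b: "b \<in> fst c" "x = snd c b" by blast
    obtain U r where U: "openin (mtop Q) U" "b \<in> U" "\<And>i. i < mdim M \<Longrightarrow> r i \<in> FP n m (snd c ` (fst c \<inter> U))"
      "\<And>p. p \<in> over E (fst c \<inter> U) \<Longrightarrow> Z p = cvec M k (\<lambda>i. r i (snd k p)) p" using loc[OF b(1)] by blast
    let ?W = "snd c ` (fst c \<inter> U)"
    have "R i z = r i z" if z: "z \<in> tube n m ?W" for z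
    proof -
      have "z \<in> snd k ` over E (fst c \<inter> U)" using triv_img_over[of "fst c \<inter> U"] z by (simp add: k_def)
      then obtain p where p: "p \<in> over E (fst c \<inter> U)" "z = snd k p" by blast
      have pc: "p \<in> over E (fst c)" using p(1) by (simp add: over_def)
      have e: "cvec M k (\<xi> p) p = cvec M k (\<lambda>i. r i (snd k p)) p" using \<xi>[OF pc] U(4)[OF p(1)] by simp
      have "p \<in> fst k" using pc k(2) by simp
      from tot.cvec_inj[OF k(1) this e i] show ?thesis unfolding R_def p(2) inv[OF pc] .
    qed
    then show "\<exists>W\<subseteq>snd c ` fst c. eopen n W \<and> x \<in> W \<and> (\<exists>g\<in>FP n m W. \<forall>z\<in>tube n m W. R i z = g z)"
      using bas.open_image[OF triv_base U(1)] U(2,3) b i by (intro exI[of _ ?W]) blast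
  qed
  moreover have "Z p = cvec M k (\<lambda>i. R i (snd k p)) p" if "p \<in> over E (fst c)" for p
    unfolding R_def inv[OF that] by (rule \<xi>[OF that])
  ultimately show ?thesis by blast
qed

end

end

lemma in_span_subset: "in_span r B A Y Z \<Longrightarrow> B' \<subseteq> B \<Longrightarrow> in_span r B' A Y Z"
  using Cinf_subset unfolding in_span_def by (meson subsetD)

section \<open>Plane fields spanned by fibrewise algebraic fields\<close>

locale algebraic_plane_field = vector_bundle E for E :: "('e, 'b) vbundle" +
  fixes d :: nat and P
  assumes alg: "fiberwise_algebraic_plane_field E d P"
begin

lemma spanning:
  assumes "b \<in> topspace (mtop Q)"
  shows "\<exists>V. openin (mtop Q) V \<and> b \<in> V \<and>
    (\<forall>p\<in>over E V. P p = span {Z p |Z. fiberwise_algebraic_field_on E V Z \<and> (\<forall>q\<in>over E V. Z q \<in> P q)})"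
  using alg assms unfolding fiberwise_algebraic_plane_field_def by (elim conjE) (rule bspec)

text \<open>The spanning fields have components in a trivialization restricted to \<open>V\<close>,
  and the vectors with components form a subspace; this yields the condition
  \<open>coords\<close>.\<close>

sublocale pl: plane_field M d P
proof
  show "smooth_plane_field M d P" using alg by (simp add: fiberwise_algebraic_plane_field_def)
  fix p assume p: "p \<in> topspace (mtop M)"
  from spanning[OF proj_base[OF p]] obtain V where V: "openin (mtop Q) V" "proj E p \<in> V"
    "\<forall>p\<in>over E V. P p = span {Z p |Z. fiberwise_algebraic_field_on E V Z \<and> (\<forall>q\<in>over E V. Z q \<in> P q)}"
    by (elim exE conjE) (rule that)
  obtain c \<tau> where c: "proj E p \<in> fst c" "local_trivialization E c \<tau>" using triv_ex[OF proj_base[OF p]] by blast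
  let ?c = "(fst c \<inter> V, snd c)" let ?k = "trivial_chart E ?c \<tau>"
  have t: "local_trivialization E ?c \<tau>" by (rule triv_restrict[OF c(2) V(1)])
  have po: "p \<in> over E (fst ?c)" "p \<in> over E V" using p c(1) V(2) by (auto simp: over_def)
  have "Z p \<in> {cvec M ?k \<xi> p |\<xi>. True}" if "fiberwise_algebraic_field_on E V Z" for Z
  proof -
    have "fst ?c \<subseteq> V" by simp
    from algebraic_field_locFP[OF t that this] show ?thesis using po(1) by blast
  qed
  then have "P p \<subseteq> {cvec M ?k \<xi> p |\<xi>. True}"
    unfolding bspec[OF V(3) po(2)] by (intro span_minimal tot.cvec_subspace) blast
  then show "\<exists>k\<in>atlas M. p \<in> fst k \<and> (\<forall>v\<in>P p. \<exists>\<xi>. v = cvec M k \<xi> p)"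
    using triv_atlas[OF t] po(1) by (intro bexI[of _ ?k]) auto
qed

end

text \<open>\<open>V\<close> comes from the definition of an algebraic plane field, the
  trivialization from the bundle; both can be had together because trivializations restrict to
  smaller base sets.\<close>

locale algebraic_chart = algebraic_plane_field +
  fixes c \<tau> V
  assumes t: "local_trivialization E c \<tau>" and cV: "fst c \<subseteq> V"
    and PV: "\<And>p. p \<in> over E V \<Longrightarrow> P p = span {Z p |Z. fiberwise_algebraic_field_on E V Z \<and> (\<forall>q\<in>over E V. Z q \<in> P q)}"
begin

abbreviation "k \<equiv> trivial_chart E c \<tau>"
abbreviation "B \<equiv> snd c ` fst c"

definition value_at :: "vfield \<Rightarrow> 'a \<Rightarrow> 'a tvector"
  where "value_at R p = cvec M k (\<lambda>i. R i (snd k p)) p"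

text \<open>Generators may be any local fields in \<open>P\<close> with fibre polynomial components,
  and the set is closed under brackets; linear combinations enter only later, through
  \<open>in_span\<close>.\<close>

inductive_set algebraic_brackets :: "vfield set"
  where
    gen: "(\<And>i. i < mdim M \<Longrightarrow> locFP n m B (R i)) \<Longrightarrow> (\<And>p. p \<in> over E (fst c) \<Longrightarrow> value_at R p \<in> P p) \<Longrightarrow> R \<in> algebraic_brackets"
  | br: "R \<in> algebraic_brackets \<Longrightarrow> R' \<in> algebraic_brackets \<Longrightarrow> cbracket (mdim M) R R' \<in> algebraic_brackets"

lemma B_open: "eopen n B" by (rule triv_base_open[OF t])
lemma k_atlas: "k \<in> atlas M" by (rule triv_atlas[OF t])
lemma img: "snd k ` over E (fst c) = tube n m B" by (rule triv_img[OF t])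

lemma brackets_locFP: "R \<in> algebraic_brackets \<Longrightarrow> i < mdim M \<Longrightarrow> locFP n m B (R i)"
proof (induction arbitrary: i rule: algebraic_brackets.induct)
  case (br R R')
  then show ?case using locFP_cbracket[OF B_open, of m R R' i] by (simp add: dim_tot)
qed

lemma brackets_Cinf:
  assumes "R \<in> algebraic_brackets" "i < mdim M" shows "Cinf_on (mdim M) (tube n m B) (R i)"
  using locFP_Cinf[OF B_open brackets_locFP[OF assms]] by (simp add: dim_tot)

text \<open>The fields here exist over the chart only, while infinitesimal integrability refers to
  global ones. A global field with the same germ at \<open>p\<close> is enough, because brackets
  depend only on germs.\<close>

lemma brackets_in_G:
  "R \<in> algebraic_brackets \<Longrightarrow> p \<in> over E (fst c) \<Longrightarrow>
    \<exists>Z\<in>lie_subalgebra_generated (tangent_fields M P). \<exists>U. openin (mtop M) U \<and> p \<in> U \<and> U \<subseteq> over E (fst c) \<and> (\<forall>q\<in>U. Z q = value_at R q)"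
proof (induction rule: algebraic_brackets.induct)
  case (gen R)
  have R: "R \<in> algebraic_brackets" by (rule algebraic_brackets.gen) (use gen in auto)
  have o: "openin (mtop M) (over E (fst c))" using tot.dom_open[OF k_atlas] by simp
  have sv: "smooth_vector_field_on M (over E (fst c)) (value_at R)"
    unfolding smooth_vector_field_on_def
  proof (intro conjI ballI)
    show "value_at R q \<in> tangent_space M q" if "q \<in> over E (fst c)" for q
      unfolding value_at_def by (rule tot.cvec_tangent[OF k_atlas]) (use that in simp)
    fix f assume f: "f \<in> Cinf M"
    have C: "Cinf_on (mdim M) (tube n m B) (\<lambda>y. value_at R (chart_inv k y) f)"
      using tot.cvec_comp_smooth(2)[OF k_atlas o _ _ _ f, of R "value_at R"] brackets_Cinf[OF R] by (simp add: img value_at_def)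
    show "smooth_fun_on M (over E (fst c)) (\<lambda>q. value_at R q f)"
    proof (rule tot.smooth_fun_onI[OF o])
      fix q assume q: "q \<in> over E (fst c)"
      then have "snd k q \<in> tube n m B" using img by blast
      moreover have "eopen (mdim M) (tube n m B)" using tube_open[OF B_open] by (simp add: dim_tot)
      ultimately show "\<exists>k\<in>atlas M. q \<in> fst k \<and> (\<exists>V. eopen (mdim M) V \<and> snd k q \<in> V \<and> Cinf_on (mdim M) V ((\<lambda>q. value_at R q f) \<circ> chart_inv k))"
        using C q k_atlas by (intro bexI[of _ k] conjI exI[of _ "tube n m B"]) (auto simp: comp_def)
    qed
  qed
  have "\<exists>Z'\<in>tangent_fields M P. \<exists>U. openin (mtop M) U \<and> p \<in> U \<and> U \<subseteq> over E (fst c) \<and> (\<forall>q\<in>U. Z' q = value_at R q)"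
    by (rule pl.extend_field[OF o gen.prems sv gen.hyps(2)])
  then show ?case using lie_subalgebra_generated.generator by (elim bexE) (rule bexI)
next
  case (br R R')
  from br.IH(1)[OF br.prems] obtain Z U where Z: "Z \<in> lie_subalgebra_generated (tangent_fields M P)"
    "openin (mtop M) U" "p \<in> U" "U \<subseteq> over E (fst c)" "\<forall>q\<in>U. Z q = value_at R q" by (elim bexE exE conjE) (rule that)
  from br.IH(2)[OF br.prems] obtain Z' U' where Z': "Z' \<in> lie_subalgebra_generated (tangent_fields M P)"
    "openin (mtop M) U'" "p \<in> U'" "U' \<subseteq> over E (fst c)" "\<forall>q\<in>U'. Z' q = value_at R' q" by (elim bexE exE conjE) (rule that)
  have o: "openin (mtop M) (U \<inter> U')" "U \<inter> U' \<subseteq> fst k" using Z(2,4) Z'(2) by auto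
  have sub: "snd k ` (U \<inter> U') \<subseteq> tube n m B" using img o(2) by auto
  have "lie_bracket Z Z' q = value_at (cbracket (mdim M) R R') q" if q: "q \<in> U \<inter> U'" for q
    unfolding value_at_def
    by (rule tot.bracket_coords[OF k_atlas o pl.gfield_G[OF Z(1)] pl.gfield_G[OF Z'(1)] Cinf_subset[OF brackets_Cinf[OF br.hyps(1)] sub] _
        Cinf_subset[OF brackets_Cinf[OF br.hyps(2)] sub] _ q]) (use Z(5) Z'(5) in \<open>simp_all add: value_at_def\<close>)
  then show ?case using lie_subalgebra_generated.bracket[OF Z(1) Z'(1)] o Z(3) Z'(3)
    by (intro bexI[of _ "lie_bracket Z Z'"] exI[of _ "U \<inter> U'"]) auto
qed

lemma P_sub_brackets:
  assumes p: "p \<in> over E (fst c)" shows "P p \<subseteq> span ((\<lambda>R. value_at R p) ` algebraic_brackets)"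
proof -
  have pV: "over E (fst c) \<subseteq> over E V" using cV by (auto simp: over_def)
  have "Z p \<in> (\<lambda>R. value_at R p) ` algebraic_brackets"
    if Z: "fiberwise_algebraic_field_on E V Z" "\<forall>q\<in>over E V. Z q \<in> P q" for Z
  proof -
    obtain R where R: "\<And>i. i < mdim M \<Longrightarrow> locFP n m B (R i)" "\<And>q. q \<in> over E (fst c) \<Longrightarrow> Z q = value_at R q"
      using algebraic_field_locFP[OF t Z(1) cV] unfolding value_at_def by blast
    have "value_at R q \<in> P q" if "q \<in> over E (fst c)" for q using R(2)[OF that] Z(2) pV that by (metis subsetD)
    then have "R \<in> algebraic_brackets" using R(1) by (intro algebraic_brackets.gen)
    then show ?thesis using R(2)[OF p] by blast
  qed
  then have "{Z p |Z. fiberwise_algebraic_field_on E V Z \<and> (\<forall>q\<in>over E V. Z q \<in> P q)} \<subseteq> (\<lambda>R. value_at R p) ` algebraic_brackets" by blast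
  moreover have "p \<in> over E V" using p pV by blast
  ultimately show ?thesis unfolding PV[OF \<open>p \<in> over E V\<close>] by (intro span_mono)
qed

text \<open>The three conditions imply one another in a circle: an integral leaf makes
  \<open>p\<close> infinitesimally integrable, this puts the values of all brackets into
  \<open>P p\<close>, and then the surface through \<open>p\<close> is a leaf. The finite
  \<open>A\<close> turns the middle condition into finitely many memberships.\<close>

lemma generated_domain:
  assumes W: "W \<subseteq> B" "eopen n W" and A: "finite A" "A \<subseteq> algebraic_brackets"
    and gen: "\<forall>R\<in>algebraic_brackets. \<forall>x\<in>W. \<exists>V\<subseteq>W. eopen n V \<and> x \<in> V \<and> in_span (n + m) (tube n m V) A (\<lambda>R. R) R"
    and p: "p \<in> over E (fst c)" "snd c (proj E p) \<in> W"
  shows "P p \<subseteq> span ((\<lambda>R. value_at R p) ` A)"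
    and "p \<in> integrability_domain M d P \<longleftrightarrow> (\<forall>R\<in>A. value_at R p \<in> P p)"
    and "p \<in> inf_integrability_domain M P \<longleftrightarrow> (\<forall>R\<in>A. value_at R p \<in> P p)"
proof -
  have pk: "p \<in> fst k" and pt: "p \<in> topspace (mtop M)" using p by (auto simp: over_def)
  have PA: "P q \<subseteq> span ((\<lambda>R. value_at R q) ` A)" if q: "q \<in> over E (fst c)" "snd c (proj E q) \<in> W" for q
  proof -
    have "value_at R q \<in> span ((\<lambda>R. value_at R q) ` A)" if R: "R \<in> algebraic_brackets" for R
    proof -
      obtain U where U: "U \<subseteq> W" "snd c (proj E q) \<in> U" "in_span (n + m) (tube n m U) A (\<lambda>R. R) R" using gen R q(2) by blast
      have "snd k q \<in> tube n m U" using triv_tube[OF t q(1), of U] U(1,2) W(1) by simp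
      then obtain \<phi> where "\<And>i. i < mdim M \<Longrightarrow> R i (snd k q) = (\<Sum>S\<in>A. \<phi> S (snd k q) * S i (snd k q))"
        using U(3) unfolding in_span_def dim_tot by blast
      then have "value_at R q = cvec M k (\<lambda>i. \<Sum>S\<in>A. \<phi> S (snd k q) * S i (snd k q)) q" unfolding value_at_def by (rule cvec_cong)
      also have "\<dots> = (\<Sum>S\<in>A. \<phi> S (snd k q) *\<^sub>R value_at S q)" by (simp add: cvec_sum cvec_scale value_at_def)
      also have "\<dots> \<in> span ((\<lambda>R. value_at R q) ` A)" by (intro span_sum span_scale span_base) auto
      finally show ?thesis .
    qed
    then have "span ((\<lambda>R. value_at R q) ` algebraic_brackets) \<subseteq> span ((\<lambda>R. value_at R q) ` A)" by (intro span_minimal) auto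
    then show ?thesis using P_sub_brackets[OF q(1)] by blast
  qed
  show "P p \<subseteq> span ((\<lambda>R. value_at R p) ` A)" by (rule PA[OF p])
  have inf: "\<forall>R\<in>A. value_at R p \<in> P p" if "p \<in> inf_integrability_domain M P"
  proof
    fix R assume "R \<in> A"
    then have "\<exists>Z\<in>lie_subalgebra_generated (tangent_fields M P). \<exists>U. openin (mtop M) U \<and> p \<in> U \<and> U \<subseteq> over E (fst c) \<and> (\<forall>q\<in>U. Z q = value_at R q)"
      using brackets_in_G[OF _ p(1)] A(2) by blast
    then obtain Z where Z: "Z \<in> lie_subalgebra_generated (tangent_fields M P)" "value_at R p = Z p" by metis
    have "{Z p |Z. Z \<in> lie_subalgebra_generated (tangent_fields M P)} = P p" using that by (simp add: inf_integrability_domain_def)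
    then show "value_at R p \<in> P p" using Z by blast
  qed
  have dom: "p \<in> integrability_domain M d P" if Y: "\<forall>R\<in>A. value_at R p \<in> P p"
  proof -
    \<comment> \<open>Brackets of members of \<open>A\<close> are in its span only near the base
      point of \<open>p\<close>, each pair on a neighbourhood of its own. Their finite intersection
      is the set over which \<open>A\<close> is involutive.\<close>
    have "\<exists>U\<subseteq>W. eopen n U \<and> snd c (proj E p) \<in> U \<and>
        (\<forall>f\<in>A \<times> A. in_span (n + m) (tube n m U) A (\<lambda>R. R) (cbracket (mdim M) (fst f) (snd f)))"
    proof (rule finite_common_nbhd[OF W(2) p(2)])
      show "in_span (n + m) (tube n m V') A (\<lambda>R. R) (cbracket (mdim M) (fst f) (snd f))"
        if "in_span (n + m) (tube n m V) A (\<lambda>R. R) (cbracket (mdim M) (fst f) (snd f))" "V' \<subseteq> V" for f :: "vfield \<times> vfield" and V V'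
        by (rule in_span_subset[OF that(1) tube_mono[OF that(2)]])
      show "\<exists>U\<subseteq>W. eopen n U \<and> snd c (proj E p) \<in> U \<and> in_span (n + m) (tube n m U) A (\<lambda>R. R) (cbracket (mdim M) (fst f) (snd f))"
        if "f \<in> A \<times> A" for f
      proof -
        have "cbracket (mdim M) (fst f) (snd f) \<in> algebraic_brackets" using that A(2) by (intro algebraic_brackets.br) auto
        from bspec[OF bspec[OF gen this] p(2)] show ?thesis .
      qed
    qed (use A(1) in simp)
    then obtain U where U: "U \<subseteq> W" "eopen n U" "snd c (proj E p) \<in> U"
      "\<forall>f\<in>A \<times> A. in_span (n + m) (tube n m U) A (\<lambda>R. R) (cbracket (mdim M) (fst f) (snd f))" by (elim exE conjE) (rule that)
    have UB: "tube n m U \<subseteq> tube n m B" using U(1) W(1) by (intro tube_mono) auto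
    have I: "involutive (mdim M) (tube n m U) A (\<lambda>R. R)"
    proof
      show "eopen (mdim M) (tube n m U)" using tube_open[OF U(2)] by (simp add: dim_tot)
      show "finite A" by (rule A(1))
      show "Cinf_on (mdim M) (tube n m U) (R i)" if "R \<in> A" "i < mdim M" for R i
        by (rule Cinf_subset[OF brackets_Cinf UB]) (use that A(2) in auto)
      show "in_span (mdim M) (tube n m U) A (\<lambda>R. R) (cbracket (mdim M) R R')" if "R \<in> A" "R' \<in> A" for R R'
        using bspec[OF U(4), of "(R, R')"] that by (simp add: dim_tot)
    qed
    show ?thesis
    proof (rule pl.leaf_through[OF k_atlas pk I])
      show "tube n m U \<subseteq> snd k ` fst k" using UB img by simp
      show "snd k p \<in> tube n m U" using triv_tube[OF t p(1), of U] U(1,3) W(1) by simp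
      show "P q \<subseteq> span ((\<lambda>R. cvec M k (\<lambda>i. R i (snd k q)) q) ` A)" if "q \<in> fst k" "snd k q \<in> tube n m U" for q
      proof -
        have q: "q \<in> over E (fst c)" using that(1) by simp
        then have "snd c (proj E q) \<in> W" using triv_tube[OF t q, of U] that(2) U(1) W(1) by auto
        from PA[OF q this] show ?thesis unfolding value_at_def .
      qed
      show "cvec M k (\<lambda>i. R i (snd k p)) p \<in> P p" if "R \<in> A" for R using Y that by (simp add: value_at_def)
    qed
  qed
  have "p \<in> inf_integrability_domain M P" if "p \<in> integrability_domain M d P"
    using that pl.leaf_in_domain unfolding integrability_domain_def by blast
  then show "p \<in> integrability_domain M d P \<longleftrightarrow> (\<forall>R\<in>A. value_at R p \<in> P p)"
    "p \<in> inf_integrability_domain M P \<longleftrightarrow> (\<forall>R\<in>A. value_at R p \<in> P p)" using inf dom by blast+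
qed

lemma generic_zero_set_chart:
  assumes W: "W \<subseteq> B" "eopen n W" "W \<noteq> {}"
    and F: "\<forall>f\<in>F. fiberwise_algebraic_fun_on E (topspace (mtop Q)) f"
  shows "\<exists>W' F0. W' \<subseteq> W \<and> eopen n W' \<and> W' \<noteq> {} \<and> finite F0 \<and> F0 \<subseteq> F \<and>
    (\<forall>z\<in>tube n m W'. (\<forall>f\<in>F0. f (chart_inv k z) = 0) \<longrightarrow> (\<forall>f\<in>F. f (chart_inv k z) = 0))"
proof -
  define T where "T f = (\<lambda>z. f (chart_inv k z) :: real)" for f
  have "locFP n m W h" if h: "h \<in> T ` F" for h
  proof -
    obtain f where f: "f \<in> F" "h = T f" using h by blast
    show ?thesis using locFP_subset[OF algebraic_fun_locFP[OF t bspec[OF F f(1)]] W(2,1)] f(2) by (simp add: T_def)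
  qed
  then have "\<exists>W' F0. W' \<subseteq> W \<and> eopen n W' \<and> W' \<noteq> {} \<and> finite F0 \<and> F0 \<subseteq> T ` F \<and>
    (\<forall>z\<in>tube n m W'. (\<forall>f\<in>F0. f z = 0) \<longrightarrow> (\<forall>f\<in>T ` F. f z = 0))"
    by (rule generic_zero_set[OF W(2,3)])
  then obtain W' F0 where W': "W' \<subseteq> W" "eopen n W'" "W' \<noteq> {}" "finite F0" "F0 \<subseteq> T ` F"
    "\<forall>z\<in>tube n m W'. (\<forall>f\<in>F0. f z = 0) \<longrightarrow> (\<forall>f\<in>T ` F. f z = 0)" by (elim exE conjE) (rule that)
  obtain F1 where F1: "F1 \<subseteq> F" "finite F1" "F0 = T ` F1" using finite_subset_image[OF W'(4,5)] by blast
  have "\<forall>z\<in>tube n m W'. (\<forall>f\<in>F1. f (chart_inv k z) = 0) \<longrightarrow> (\<forall>f\<in>F. f (chart_inv k z) = 0)"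
    using W'(6) unfolding F1(3) by (simp add: T_def)
  then show ?thesis using W'(1-3) F1(1,2) by (intro exI[of _ W'] exI[of _ F1] conjI)
qed

text \<open>Over a small enough base set, everything is described by finitely many fibre polynomials, so that
  quantifier elimination applies to the integrability points in \<open>S\<close>.\<close>

lemma good_open_set:
  assumes S: "fiberwise_constructible E S" and ne: "fst c \<noteq> {}"
  defines "D \<equiv> integrability_domain M d P" and "D' \<equiv> inf_integrability_domain M P"
  shows "\<exists>U\<subseteq>fst c. openin (mtop Q) U \<and> U \<noteq> {} \<and> D \<inter> S \<inter> over E U = D' \<inter> S \<inter> over E U \<and>
    (U \<inter> proj E ` (D \<inter> S \<inter> over E U) = {} \<or> U \<subseteq> proj E ` (D \<inter> S \<inter> over E U))"
proof -
  obtain S1 S2 where S12: "fiberwise_algebraic_set E S1" "fiberwise_algebraic_set E S2" "S = S1 - S2"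
    using S unfolding fiberwise_constructible_def by blast
  obtain F1 where F1: "\<forall>f\<in>F1. fiberwise_algebraic_fun_on E (topspace (mtop Q)) f" "S1 = {p \<in> topspace (mtop M). \<forall>f\<in>F1. f p = 0}"
    using S12(1) unfolding fiberwise_algebraic_set_def by blast
  obtain F2 where F2: "\<forall>f\<in>F2. fiberwise_algebraic_fun_on E (topspace (mtop Q)) f" "S2 = {p \<in> topspace (mtop M). \<forall>f\<in>F2. f p = 0}"
    using S12(2) unfolding fiberwise_algebraic_set_def by blast
  have Bne: "B \<noteq> {}" using ne by simp
  have "\<exists>W A. W \<subseteq> B \<and> eopen n W \<and> W \<noteq> {} \<and> finite A \<and> A \<subseteq> algebraic_brackets \<and>
    (\<forall>R\<in>algebraic_brackets. \<forall>x\<in>W. \<exists>V\<subseteq>W. eopen n V \<and> x \<in> V \<and> in_span (n + m) (tube n m V) A (\<lambda>R. R) R)"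
    by (rule generic_module[OF B_open Bne]) (simp add: brackets_locFP dim_tot)
  then obtain W1 A where W1: "W1 \<subseteq> B" "eopen n W1" "W1 \<noteq> {}" "finite A" "A \<subseteq> algebraic_brackets"
    "\<forall>R\<in>algebraic_brackets. \<forall>x\<in>W1. \<exists>V\<subseteq>W1. eopen n V \<and> x \<in> V \<and> in_span (n + m) (tube n m V) A (\<lambda>R. R) R"
    by (elim exE conjE) (rule that)
  from generic_zero_set_chart[OF W1(1-3) F1(1)]
  obtain W2 H1 where W2: "W2 \<subseteq> W1" "eopen n W2" "W2 \<noteq> {}" "finite H1" "H1 \<subseteq> F1"
    "\<forall>z\<in>tube n m W2. (\<forall>f\<in>H1. f (chart_inv k z) = 0) \<longrightarrow> (\<forall>f\<in>F1. f (chart_inv k z) = 0)"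
    by (elim exE conjE) (rule that)
  have "W2 \<subseteq> B" using W1(1) W2(1) by blast
  from generic_zero_set_chart[OF this W2(2,3) F2(1)]
  obtain W3 H2 where W3: "W3 \<subseteq> W2" "eopen n W3" "W3 \<noteq> {}" "finite H2" "H2 \<subseteq> F2"
    "\<forall>z\<in>tube n m W3. (\<forall>f\<in>H2. f (chart_inv k z) = 0) \<longrightarrow> (\<forall>f\<in>F2. f (chart_inv k z) = 0)"
    by (elim exE conjE) (rule that)
  have W3B: "W3 \<subseteq> B" using W1(1) W2(1) W3(1) by blast
  obtain x where x: "x \<in> W3" using W3(3) by blast
  define h where "h f = (\<lambda>z. f (chart_inv k z) :: real)" for f
  \<comment> \<open>The finitely many functions that decide integrability and membership in
    \<open>S\<close>. They are replaced by fibre polynomials near one point \<open>x\<close> only,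
    which is enough because any nonempty open set will do.\<close>
  define F where "F = h ` H1 \<union> h ` H2 \<union> (\<lambda>(R, i). R i) ` (A \<times> {..<mdim M})"
  have loc: "locFP n m W3 f" if f: "f \<in> F" for f
  proof -
    have "locFP n m B (h g)" if "g \<in> H1 \<union> H2" for g
      unfolding h_def by (rule algebraic_fun_locFP[OF t]) (use that F1(1) F2(1) W2(5) W3(5) in blast)
    then have "locFP n m B f" using f W1(5) brackets_locFP by (auto simp: F_def)
    then show ?thesis by (rule locFP_subset[OF _ W3(2) W3B])
  qed
  have "finite F" using W1(4) W2(4) W3(4) by (simp add: F_def)
  then have "\<exists>W\<subseteq>W3. eopen n W \<and> x \<in> W \<and> (\<forall>f\<in>F. \<exists>g\<in>FP n m W. \<forall>z\<in>tube n m W. f z = g z)"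
    by (rule locFP_finite[OF W3(2) x _ loc])
  then obtain W where W: "W \<subseteq> W3" "eopen n W" "x \<in> W" "\<forall>f\<in>F. \<exists>g\<in>FP n m W. \<forall>z\<in>tube n m W. f z = g z"
    by (elim exE conjE) (rule that)
  \<comment> \<open>\<open>r f\<close> is a fibre polynomial on the whole space, while the
    coordinate expression \<open>f\<close> agrees with it on the tube over \<open>W\<close>;
    \<open>generic_fibres\<close> has to be applied to \<open>r f\<close>.\<close>
  obtain r where r: "\<And>f. f \<in> F \<Longrightarrow> r f \<in> FP n m W" "\<And>f z. f \<in> F \<Longrightarrow> z \<in> tube n m W \<Longrightarrow> r f z = f z" using W(4) by metis
  obtain K :: nat and e where e: "bij_betw e {..<K} A" using ex_bij_betw_nat_finite[OF W1(4)] by (auto simp: atLeast0LessThan)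
  have eA: "e a \<in> A" if "a < K" for a using e that by (auto simp: bij_betw_def)
  have AF: "e a i \<in> F" if "a < K" "i < mdim M" for a i using eA[OF that(1)] that(2) by (auto simp: F_def)
  define T where "T z \<longleftrightarrow> (\<forall>g\<in>(\<lambda>f. r (h f)) ` H1. g z = 0) \<and> (\<exists>g\<in>(\<lambda>f. r (h f)) ` H2. g z \<noteq> 0) \<and>
     (\<exists>v u. \<forall>a<K. \<forall>i<mdim M. r (e a i) z = (\<Sum>j<d. (u a j :: real) * v j i))" for z
  have HF: "h f \<in> F" if "f \<in> H1 \<union> H2" for f using that by (auto simp: F_def)
  have Wne: "W \<noteq> {}" using W(3) by blast
  have "\<exists>V\<subseteq>W. eopen n V \<and> V \<noteq> {} \<and> (\<forall>z\<in>tube n m V. T z \<longrightarrow> (\<forall>x\<in>V. \<exists>z'\<in>tube n m V. trunc n z' = x \<and> T z'))"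
    unfolding T_def
    by (rule generic_fibres[OF W(2) Wne]) (use W2(4) W3(4) HF r(1) AF in auto)
  then obtain V where V: "V \<subseteq> W" "eopen n V" "V \<noteq> {}"
    "\<forall>z\<in>tube n m V. T z \<longrightarrow> (\<forall>x\<in>V. \<exists>z'\<in>tube n m V. trunc n z' = x \<and> T z')" by (elim exE conjE) (rule that)
  have VB: "V \<subseteq> B" "V \<subseteq> W1" using V(1) W(1) W3B W2(1) W3(1) by auto
  define U where "U = {b \<in> fst c. snd c b \<in> V}"
  have Uo: "openin (mtop Q) U" unfolding U_def by (rule chart_open_vimage[OF bas.chart[OF triv_base[OF t]] V(2)])
  have Uc: "U \<subseteq> fst c" by (auto simp: U_def)
  have UV: "snd c ` U = V" using VB(1) by (auto simp: U_def)
  have pU: "p \<in> over E (fst c)" "snd c (proj E p) \<in> V" "snd k p \<in> tube n m V" if "p \<in> over E U" for p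
  proof -
    show "p \<in> over E (fst c)" "snd c (proj E p) \<in> V" using that by (auto simp: over_def U_def)
    then show "snd k p \<in> tube n m V" using triv_tube[OF t _ VB(1)] by blast
  qed
  have DD: "p \<in> D \<longleftrightarrow> (\<forall>R\<in>A. value_at R p \<in> P p)" "p \<in> D' \<longleftrightarrow> (\<forall>R\<in>A. value_at R p \<in> P p)" if p: "p \<in> over E U" for p
  proof -
    have "snd c (proj E p) \<in> W1" using pU(2)[OF p] VB(2) by blast
    note g = generated_domain[OF W1(1,2,4,5,6) pU(1)[OF p] this]
    show "p \<in> D \<longleftrightarrow> (\<forall>R\<in>A. value_at R p \<in> P p)" unfolding D_def by (rule g(2))
    show "p \<in> D' \<longleftrightarrow> (\<forall>R\<in>A. value_at R p \<in> P p)" unfolding D'_def by (rule g(3))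
  qed
  have DS: "p \<in> D \<inter> S \<longleftrightarrow> T (snd k p)" if p: "p \<in> over E U" for p
  proof -
    have pc: "p \<in> over E (fst c)" and pt: "p \<in> topspace (mtop M)" using p pU(1) by (auto simp: over_def)
    have pk: "p \<in> fst k" using pc by simp
    have z: "snd k p \<in> tube n m W" "snd k p \<in> tube n m W3" "snd k p \<in> tube n m W2"
      using pU(3)[OF p] V(1) W(1) W3(1) tube_mono by (meson subsetD)+
    have inv: "chart_inv k (snd k p) = p" by (rule tot.inv1[OF k_atlas pk])
    have h0: "r (h f) (snd k p) = f p" if "f \<in> H1 \<union> H2" for f using r(2)[OF HF[OF that] z(1)] inv by (simp add: h_def)
    have s1: "p \<in> S1 \<longleftrightarrow> (\<forall>f\<in>H1. f p = 0)" using bspec[OF W2(6) z(3)] W2(5) pt inv by (auto simp: F1(2))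
    have s2: "p \<in> S2 \<longleftrightarrow> (\<forall>f\<in>H2. f p = 0)" using bspec[OF W3(6) z(2)] W3(5) pt inv by (auto simp: F2(2))
    have "snd c (proj E p) \<in> W1" using pU(2)[OF p] VB(2) by blast
    then have "P p \<subseteq> span ((\<lambda>R. value_at R p) ` A)" by (rule generated_domain(1)[OF W1(1,2,4,5,6) pc])
    moreover have "(\<lambda>R. value_at R p) ` A = (\<lambda>a. cvec M k (\<lambda>i. e a i (snd k p)) p) ` {..<K}"
      unfolding bij_betw_imp_surj_on[OF e, symmetric] by (simp add: image_image value_at_def)
    ultimately have PA: "P p \<subseteq> span ((\<lambda>a. cvec M k (\<lambda>i. e a i (snd k p)) p) ` {..<K})" by simp
    have "p \<in> D \<longleftrightarrow> (\<forall>a<K. cvec M k (\<lambda>i. e a i (snd k p)) p \<in> P p)"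
      unfolding DD(1)[OF p] using e by (auto simp: value_at_def bij_betw_def)
    also have "\<dots> \<longleftrightarrow> (\<exists>v u. \<forall>a<K. \<forall>i<mdim M. e a i (snd k p) = (\<Sum>j<d. u a j * v j i))"
      by (rule pl.rank_iff[OF k_atlas pk PA])
    also have "\<dots> \<longleftrightarrow> (\<exists>v u. \<forall>a<K. \<forall>i<mdim M. r (e a i) (snd k p) = (\<Sum>j<d. u a j * v j i))"
      using r(2)[OF AF z(1)] by simp
    finally show ?thesis using s1 s2 h0 unfolding T_def S12(3) by auto
  qed
  have "D \<inter> S \<inter> over E U = D' \<inter> S \<inter> over E U" using DD by blast
  moreover have "U \<subseteq> proj E ` (D \<inter> S \<inter> over E U)" if nonempty: "U \<inter> proj E ` (D \<inter> S \<inter> over E U) \<noteq> {}"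
  proof
    fix b assume b: "b \<in> U"
    obtain p where p: "p \<in> D \<inter> S" "p \<in> over E U" using nonempty by blast
    have Tp: "T (snd k p)" using DS[OF p(2)] p(1) by blast
    have "snd c b \<in> V" using b by (simp add: U_def)
    then obtain z where z: "z \<in> tube n m V" "trunc n z = snd c b" "T z" using V(4) pU(3)[OF p(2)] Tp by blast
    have "z \<in> snd k ` over E U" unfolding triv_img_over[OF t Uc] UV by (rule z(1))
    then obtain q where q: "q \<in> over E U" "z = snd k q" by blast
    have "snd c (proj E q) = snd c b" using triv_trunc[OF t pU(1)[OF q(1)]] q(2) z(2) by simp
    moreover have "proj E q \<in> fst c" "b \<in> fst c" using pU(1)[OF q(1)] b Uc by (auto simp: over_def)
    ultimately have "proj E q = b" using bas.snd_inj[OF triv_base[OF t]] by blast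
    moreover have "q \<in> D \<inter> S" using DS[OF q(1)] z(3) q(2) by blast
    ultimately show "b \<in> proj E ` (D \<inter> S \<inter> over E U)" using q(1) by blast
  qed
  moreover have "U \<noteq> {}" using UV V(3) by blast
  ultimately show ?thesis using Uo Uc by (intro exI[of _ U]) blast
qed

end

theorem theorem1p6:
  fixes E :: "('e, 'b) vbundle" and P :: "'e \<Rightarrow> 'e tvector set" and d :: nat and S :: "'e set"
  assumes "smooth_vector_bundle E"
    and "fiberwise_algebraic_plane_field E d P"
    and "fiberwise_constructible E S"
  shows "\<exists>U. openin (mtop (base_space E)) U \<and>
           mtop (base_space E) closure_of U = topspace (mtop (base_space E)) \<and>
           integrability_domain (total_space E) d P \<inter> S \<inter> over E U
             = inf_integrability_domain (total_space E) P \<inter> S \<inter> over E U \<and>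
           closedin (subtopology (mtop (base_space E)) U)
             (proj E ` (integrability_domain (total_space E) d P \<inter> S \<inter> over E U))"
proof -
  interpret algebraic_plane_field E d P by standard (use assms in auto)
  define D where "D = integrability_domain M d P \<inter> S"
  define D' where "D' = inf_integrability_domain M P \<inter> S"
  \<comment> \<open>Goodness asks that the set lie inside or outside the projection altogether. All
    good sets are united, so that openness, density and closedness can be read off from single good
    sets.\<close>
  define good where "good G \<longleftrightarrow> openin (mtop Q) G \<and> D \<inter> over E G = D' \<inter> over E G \<and>
    (G \<inter> proj E ` (D \<inter> over E G) = {} \<or> G \<subseteq> proj E ` (D \<inter> over E G))" for G
  define U where "U = \<Union>{G. good G}"
  have Uo: "openin (mtop Q) U" unfolding U_def by (rule openin_Union) (simp add: good_def)
  have dense: "\<exists>G. good G \<and> G \<noteq> {} \<and> G \<subseteq> O1" if O1: "openin (mtop Q) O1" "b \<in> O1" for O1 b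
  proof -
    have b: "b \<in> topspace (mtop Q)" using O1 openin_subset by blast
    from spanning[OF b] obtain V where V: "openin (mtop Q) V" "b \<in> V"
      "\<forall>p\<in>over E V. P p = span {Z p |Z. fiberwise_algebraic_field_on E V Z \<and> (\<forall>q\<in>over E V. Z q \<in> P q)}"
      by (elim exE conjE) (rule that)
    obtain c \<tau> where c: "b \<in> fst c" "local_trivialization E c \<tau>" using triv_ex[OF b] by blast
    have VO: "openin (mtop Q) (V \<inter> O1)" using V(1) O1(1) by blast
    \<comment> \<open>The trivialization is restricted to \<open>O1\<close> as well, so that the set
      found by \<open>good_open_set\<close> lies in the given open set.\<close>
    let ?c = "(fst c \<inter> (V \<inter> O1), snd c)"
    interpret algebraic_chart E d P ?c \<tau> V
      by standard (use triv_restrict[OF c(2) VO] bspec[OF V(3)] in auto)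
    have "fst ?c \<noteq> {}" using c(1) V(2) O1(2) by auto
    from good_open_set[OF assms(3) this] obtain G where G: "G \<subseteq> fst ?c" "openin (mtop Q) G" "G \<noteq> {}"
      "integrability_domain M d P \<inter> S \<inter> over E G = inf_integrability_domain M P \<inter> S \<inter> over E G"
      "G \<inter> proj E ` (integrability_domain M d P \<inter> S \<inter> over E G) = {} \<or> G \<subseteq> proj E ` (integrability_domain M d P \<inter> S \<inter> over E G)"
      by (elim exE conjE) (rule that)
    have "good G" unfolding good_def D_def D'_def using G(2,4,5) by blast
    then show ?thesis using G(1,3) by (intro exI[of _ G]) auto
  qed
  have cl: "mtop Q closure_of U = topspace (mtop Q)"
  proof (rule subset_antisym[OF closure_of_subset_topspace], rule subsetI)
    fix b assume b: "b \<in> topspace (mtop Q)"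
    show "b \<in> mtop Q closure_of U"
      unfolding in_closure_of
    proof (intro conjI b allI impI)
      fix O1 assume "b \<in> O1 \<and> openin (mtop Q) O1"
      then obtain G where "good G" "G \<noteq> {}" "G \<subseteq> O1" using dense by blast
      then show "\<exists>y. y \<in> U \<and> y \<in> O1" unfolding U_def by blast
    qed
  qed
  have ov: "p \<in> over E U \<longleftrightarrow> (\<exists>G. good G \<and> p \<in> over E G)" for p by (auto simp: over_def U_def)
  have eq: "D \<inter> over E U = D' \<inter> over E U"
  proof -
    have "p \<in> D \<longleftrightarrow> p \<in> D'" if "p \<in> over E G" "good G" for p G using that unfolding good_def by blast
    then show ?thesis using ov by blast
  qed
  have "closedin (subtopology (mtop Q) U) (proj E ` (D \<inter> over E U))"
    unfolding closedin_def
  proof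
    let ?I = "proj E ` (D \<inter> over E U)"
    have tU: "topspace (subtopology (mtop Q) U) = U" using openin_subset[OF Uo] by auto
    show "?I \<subseteq> topspace (subtopology (mtop Q) U)" unfolding tU by (auto simp: over_def)
    \<comment> \<open>On a good set the projection is everything or nothing, so its complement in
      \<open>U\<close> is the union of the good sets of the second kind, an open set.\<close>
    let ?C = "\<Union>{G. good G \<and> G \<inter> proj E ` (D \<inter> over E G) = {}}"
    have "U - ?I = ?C"
    proof (intro equalityI subsetI)
      fix b assume b: "b \<in> U - ?I"
      then obtain G where G: "good G" "b \<in> G" by (auto simp: U_def)
      have "b \<notin> proj E ` (D \<inter> over E G)" using b ov G(1) by blast
      then show "b \<in> ?C" using G unfolding good_def by blast
    next
      fix b assume "b \<in> ?C"
      then obtain G where G: "good G" "b \<in> G" "G \<inter> proj E ` (D \<inter> over E G) = {}" by blast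
      have "b \<notin> ?I"
      proof
        assume "b \<in> ?I"
        then obtain p where p: "p \<in> D" "b = proj E p" "p \<in> over E U" by blast
        then have "p \<in> over E G" using G(2) by (simp add: over_def)
        then show False using p(1,2) G(2,3) by blast
      qed
      then show "b \<in> U - ?I" using G(1,2) by (auto simp: U_def)
    qed
    moreover have "openin (mtop Q) ?C" by (rule openin_Union) (auto simp: good_def)
    ultimately show "openin (subtopology (mtop Q) U) (topspace (subtopology (mtop Q) U) - ?I)"
      unfolding tU openin_open_subtopology[OF Uo] by auto
  qed
  then show ?thesis using Uo cl eq unfolding D_def D'_def by (intro exI[of _ U]) blast
qed

end
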